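(* Let $p,q\ge1$ and let $(x,y,h)$ be a standard triple in $\mathfrak{so}(p,q,\mathbb R)$ with associated multiplicity spaces $(W_r,\phi_r)$, $r\ge0$. Put $n_r=\dim W_r$, and for even $r$ let $(p_r,q_r)$ be the signature of the non-degenerate symmetric form $\phi_r$. (For odd $r$, $\phi_r$ is symplectic, so $n_r$ is even.) Then $x$ and $-x$ belong to different $\mathrm{SO}^+(p,q,\mathbb R)$-orbits if and only if $$\sum_{k\ge0}\Big(n_{8k+4}+n_{8k+2}+\frac{n_{4k+1}}2\Big)\equiv1\mod 2$$ and at least one of the following two conditions holds: $$q_{4k}=p_{4k+2}=0\quad\text{for all }k\in\mathbb N,\qquad\text{or}\qquad p_{4k}=q_{4k+2}=0\quad\text{for all }k\in\mathbb N .$$ When $x$ and $-x$ are $\mathrm{SO}^+(p,q,\mathbb R)$-conjugate, the nilpotent orbit of $x$ admits no Gibbs states.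
   Context: $\mathbb N=\{0,1,2,\dots\}$. $\mathrm O(p,q,\mathbb R)$ is the group of isometries of a symmetric bilinear form $B$ of signature $(p,q)$ on $\mathbb R^{p+q}$, $\mathrm{SO}^+(p,q,\mathbb R)$ is its identity component, and $\mathfrak{so}(p,q,\mathbb R)$ its Lie algebra. Adjoint (nilpotent) orbits are orbits under $\mathrm{SO}^+(p,q,\mathbb R)$. Standard triple: elements $(x,y,h)$ of a Lie algebra, with $x\ne0$, such that $[h,x]=2x$, $[h,y]=-2y$, $[x,y]=h$. With $X=\begin{pmatrix}0&1\\0&0\end{pmatrix}$, $Y=\begin{pmatrix}0&0\\1&0\end{pmatrix}$, $H=\begin{pmatrix}1&0\\0&-1\end{pmatrix}$, it defines an embedding of $\mathfrak{sl}(2,\mathbb R)$ by $X\mapsto x$, $Y\mapsto y$, $H\mapsto h$. For $r\ge0$, $V_r$ is the irreducible real $\mathfrak{sl}(2,\mathbb R)$-module of dimension $r+1$, with weight spaces $V_r(k)=\ker(H-k)$, and $B_r$ is a fixed nonzero invariant bilinear form on it (unique up to scale; symmetric if $r$ is even, symplectic if $r$ is odd), normalized so that for $r=2m$ it has signature $(m+1,m)$ (equivalently, it is positive on $V_r(0)$), and for $r$ odd $B_r(v,X\cdot v)\ge0$ for all $v\in V_r(-1)$. Multiplicity spaces: via the standard triple, $\mathbb R^{p+q}$ is an $\mathfrak{sl}(2,\mathbb R)$-module with invariant form $B$, and there is an isometric isomorphism of $\mathfrak{sl}(2,\mathbb R)$-modules $(\mathbb R^{p+q},B)\simeq\bigoplus_r(V_r\otimes_{\mathbb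 R}W_r,\;B_r\otimes\phi_r)$ with $\mathfrak{sl}(2,\mathbb R)$ acting trivially on $W_r$; the isometry classes of the $(W_r,\phi_r)$ are well defined. Gibbs states: for a real semisimple Lie algebra $\mathfrak g$ with Killing form $\kappa$, an adjoint orbit $\mathcal O$ carries the symplectic form $\omega_{\mathcal O}|_y([X,y],[Y,y])=\kappa(y,[X,Y])$ and the Liouville form $\lambda_{\mathcal O}=\omega_{\mathcal O}^{\dim\mathcal O/2}$. For $\beta\in\mathfrak g^*$ put $Z(\beta)=\int_{\mathcal O}e^{-\langle\beta,y\rangle}|\lambda_{\mathcal O}|(y)\in(0,+\infty]$. $\mathcal O$ admits a Gibbs state (the probability distribution $Z(\beta)^{-1}e^{-\langle\beta,y\rangle}|\lambda_{\mathcal O}|(y)$) if $Z(\beta)<\infty$ for some $\beta$. *)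

theory Defs
  imports "HOL-Analysis.Analysis" "HOL-Combinatorics.Permutations" "HOL-Library.Groups_Big_Fun"
    "HOL-Analysis.Finite_Function_Topology"
begin

section \<open>Bilinear forms on subspaces\<close>

definition bilinear_form_on :: "'a::real_vector set \<Rightarrow> ('a \<Rightarrow> 'a \<Rightarrow> real) \<Rightarrow> bool" where
  "bilinear_form_on V f \<longleftrightarrow>
     (\<forall>u\<in>V. \<forall>v\<in>V. \<forall>w\<in>V. f (u + v) w = f u w + f v w \<and> f w (u + v) = f w u + f w v) \<and>
     (\<forall>u\<in>V. \<forall>v\<in>V. \<forall>c. f (c *\<^sub>R u) v = c * f u v \<and> f u (c *\<^sub>R v) = c * f u v)"

text \<open>The form is symmetric and non-degenerate, of signature \<open>(p, q)\<close>: an orthogonal basis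
  consists of \<open>p\<close> positive and \<open>q\<close> negative vectors.\<close>

definition has_signature ::
  "'a::real_vector set \<Rightarrow> ('a \<Rightarrow> 'a \<Rightarrow> real) \<Rightarrow> nat \<Rightarrow> nat \<Rightarrow> bool" where
  "has_signature V f p q \<longleftrightarrow>
     subspace V \<and> bilinear_form_on V f \<and> (\<forall>u\<in>V. \<forall>v\<in>V. f u v = f v u) \<and>
     (\<exists>P N. finite P \<and> finite N \<and> card P = p \<and> card N = q \<and> P \<inter> N = {} \<and>
        independent (P \<union> N) \<and> span (P \<union> N) = V \<and>
        pairwise (\<lambda>u v. f u v = 0) (P \<union> N) \<and>
        (\<forall>v\<in>P. f v v > 0) \<and> (\<forall>v\<in>N. f v v < 0))"


section \<open>The isometry group of a form, its Lie algebra and adjoint orbits\<close>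

definition O_group :: "(real^'n \<Rightarrow> real^'n \<Rightarrow> real) \<Rightarrow> (real^'n^'n) set" where
  "O_group B = {g. invertible g \<and> (\<forall>v w. B (g *v v) (g *v w) = B v w)}"

definition SO_plus :: "(real^'n \<Rightarrow> real^'n \<Rightarrow> real) \<Rightarrow> (real^'n^'n) set" where
  "SO_plus B = connected_component_set (O_group B) (mat 1)"

definition so_algebra :: "(real^'n \<Rightarrow> real^'n \<Rightarrow> real) \<Rightarrow> (real^'n^'n) set" where
  "so_algebra B = {a. \<forall>v w. B (a *v v) w + B v (a *v w) = 0}"

definition bracket :: "real^'n^'n \<Rightarrow> real^'n^'n \<Rightarrow> real^'n^'n" where
  "bracket a b = a ** b - b ** a"

definition adjoint_orbit :: "(real^'n \<Rightarrow> real^'n \<Rightarrow> real) \<Rightarrow> real^'n^'n \<Rightarrow> (real^'n^'n) set" where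
  "adjoint_orbit B x = {g ** x ** matrix_inv g | g. g \<in> SO_plus B}"

definition standard_triple ::
  "(real^'n \<Rightarrow> real^'n \<Rightarrow> real) \<Rightarrow> real^'n^'n \<Rightarrow> real^'n^'n \<Rightarrow> real^'n^'n \<Rightarrow> bool" where
  "standard_triple B x y h \<longleftrightarrow>
     x \<in> so_algebra B \<and> y \<in> so_algebra B \<and> h \<in> so_algebra B \<and> x \<noteq> 0 \<and>
     bracket h x = 2 *\<^sub>R x \<and> bracket h y = - 2 *\<^sub>R y \<and> bracket x y = h"


section \<open>The irreducible modules of sl(2)\<close>

text \<open>\<open>V_mod r\<close> is the module of binary forms of degree \<open>r\<close> in \<open>s\<close>, \<open>t\<close>, where
  \<open>X = s d/dt\<close>, \<open>Y = t d/ds\<close> and \<open>H = s d/ds - t d/dt\<close>; the monomial \<open>s^(r-i) t^i\<close> is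
  represented by \<open>Poly_Mapping.single i 1\<close>, for \<open>i \<le> r\<close>, and has weight \<open>r - 2 i\<close>.\<close>

type_synonym bform = "nat \<Rightarrow>\<^sub>0 real"

definition V_mod :: "nat \<Rightarrow> bform set" where
  "V_mod r = {f. Poly_Mapping.keys f \<subseteq> {..r}}"

definition V_X :: "bform \<Rightarrow> bform" where
  "V_X f = (\<Sum>i\<in>Poly_Mapping.keys f.
     Poly_Mapping.single (i - 1) (real i * Poly_Mapping.lookup f i))"

definition V_Y :: "nat \<Rightarrow> bform \<Rightarrow> bform" where
  "V_Y r f = (\<Sum>i\<in>Poly_Mapping.keys f.
     Poly_Mapping.single (i + 1) ((real r - real i) * Poly_Mapping.lookup f i))"

definition V_H :: "nat \<Rightarrow> bform \<Rightarrow> bform" where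
  "V_H r f = (\<Sum>i\<in>Poly_Mapping.keys f.
     Poly_Mapping.single i ((real r - 2 * real i) * Poly_Mapping.lookup f i))"

lemma lookup_V_X: "Poly_Mapping.lookup (V_X f) i = real (i + 1) * Poly_Mapping.lookup f (i + 1)"
proof -
  have "Poly_Mapping.lookup (V_X f) i =
      (\<Sum>j\<in>Poly_Mapping.keys f. if j = i + 1 then real j * Poly_Mapping.lookup f j else 0)"
    unfolding V_X_def lookup_sum
    by (rule sum.cong) (auto simp: lookup_single when_def)
  also have "\<dots> = real (i + 1) * Poly_Mapping.lookup f (i + 1)"
    by (subst sum.delta) (auto simp: in_keys_iff)
  finally show ?thesis .
qed

lemma lookup_V_Y:
  "Poly_Mapping.lookup (V_Y r f) i =
     (if i = 0 then 0 else (real r - real (i - 1)) * Poly_Mapping.lookup f (i - 1))"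
proof -
  have "Poly_Mapping.lookup (V_Y r f) i =
      (\<Sum>j\<in>Poly_Mapping.keys f.
        if j = i - 1 then (if i = 0 then 0 else (real r - real j) * Poly_Mapping.lookup f j) else 0)"
    unfolding V_Y_def lookup_sum
    by (rule sum.cong) (auto simp: lookup_single when_def)
  also have "\<dots> = (if i = 0 then 0 else (real r - real (i - 1)) * Poly_Mapping.lookup f (i - 1))"
    by (subst sum.delta) (auto simp: in_keys_iff)
  finally show ?thesis .
qed

lemma lookup_V_H:
  "Poly_Mapping.lookup (V_H r f) i = (real r - 2 * real i) * Poly_Mapping.lookup f i"
proof -
  have "Poly_Mapping.lookup (V_H r f) i =
      (\<Sum>j\<in>Poly_Mapping.keys f.
        if j = i then (real r - 2 * real j) * Poly_Mapping.lookup f j else 0)"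
    unfolding V_H_def lookup_sum
    by (rule sum.cong) (auto simp: lookup_single when_def)
  also have "\<dots> = (real r - 2 * real i) * Poly_Mapping.lookup f i"
    by (subst sum.delta) (auto simp: in_keys_iff)
  finally show ?thesis .
qed

lemmas lookup_V = lookup_V_X lookup_V_Y lookup_V_H

lemma in_V_mod_iff: "f \<in> V_mod r \<longleftrightarrow> (\<forall>i>r. Poly_Mapping.lookup f i = 0)"
  unfolding V_mod_def by (auto simp: in_keys_iff subset_iff not_le[symmetric])

lemma lookup_scaleR_bform:
  "Poly_Mapping.lookup (c *\<^sub>R f) i = c * Poly_Mapping.lookup (f :: bform) i"
proof -
  have "finite {i. c * Poly_Mapping.lookup f i \<noteq> 0}"
    by (rule finite_subset[of _ "Poly_Mapping.keys f"]) (auto simp: in_keys_iff)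
  then show ?thesis by (simp add: scaleR_poly_mapping_def lookup_Abs_poly_mapping)
qed

lemma subspace_V_mod: "subspace (V_mod r)"
  by (rule subspaceI) (auto simp: in_V_mod_iff lookup_add lookup_scaleR_bform)

lemma linear_V_X: "linear V_X" and linear_V_Y: "linear (V_Y r)" and linear_V_H: "linear (V_H r)"
  by (rule linearI; rule poly_mapping_eqI;
      simp add: lookup_V lookup_add lookup_scaleR_bform algebra_simps)+

lemma V_mod_closed:
  assumes "f \<in> V_mod r"
  shows "V_X f \<in> V_mod r" "V_Y r f \<in> V_mod r" "V_H r f \<in> V_mod r"
proof -
  show "V_X f \<in> V_mod r" "V_H r f \<in> V_mod r"
    using assms by (auto simp: in_V_mod_iff lookup_V)
  have "Poly_Mapping.lookup (V_Y r f) i = 0" if "i > r" for i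
  proof (cases "i = r + 1")
    case False
    then have "i - 1 > r" using that by simp
    then show ?thesis using assms by (simp add: in_V_mod_iff lookup_V)
  qed (simp add: lookup_V)
  then show "V_Y r f \<in> V_mod r" by (simp add: in_V_mod_iff)
qed

lemma V_brackets:
  "V_H r (V_X f) - V_X (V_H r f) = 2 *\<^sub>R V_X f"
  "V_H r (V_Y r f) - V_Y r (V_H r f) = - 2 *\<^sub>R V_Y r f"
  "V_X (V_Y r f) - V_Y r (V_X f) = V_H r f"
  by (rule poly_mapping_eqI;
      auto simp: lookup_V lookup_minus lookup_scaleR_bform algebra_simps of_nat_diff)+

lemma V_mod_irreducible:
  assumes S: "subspace S" "S \<subseteq> V_mod r" "S \<noteq> {0}"
    and inv: "\<And>f. f \<in> S \<Longrightarrow> V_X f \<in> S" "\<And>f. f \<in> S \<Longrightarrow> V_Y r f \<in> S"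
  shows "S = V_mod r"
proof -
  let ?e = "\<lambda>i. Poly_Mapping.single i (1::real)"
  obtain f where f: "f \<in> S" "f \<noteq> 0"
    using S(1,3) subspace_0 by blast
  have XS: "(V_X ^^ k) f \<in> S" for k
    by (induction k) (auto intro: inv f)
  have Xk: "\<exists>c>0. Poly_Mapping.lookup ((V_X ^^ k) f) i = c * Poly_Mapping.lookup f (i + k)" for k i
  proof (induction k arbitrary: i)
    case 0
    show ?case by (rule exI[of _ 1]) simp
  next
    case (Suc k)
    from Suc[of "i + 1"] obtain c where "c > 0"
      "Poly_Mapping.lookup ((V_X ^^ k) f) (i + 1) = c * Poly_Mapping.lookup f (i + 1 + k)" by auto
    then show ?case
      by (intro exI[of _ "real (i + 1) * c"]) (auto simp: lookup_V)
  qed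
  define k where "k = Max (Poly_Mapping.keys f)"
  have k: "k \<in> Poly_Mapping.keys f" "\<And>i. i > k \<Longrightarrow> Poly_Mapping.lookup f i = 0"
  proof -
    show "k \<in> Poly_Mapping.keys f" using f(2) by (simp add: k_def)
    show "Poly_Mapping.lookup f i = 0" if "i > k" for i
    proof (rule ccontr)
      assume "Poly_Mapping.lookup f i \<noteq> 0"
      then have "i \<le> k" by (simp add: k_def in_keys_iff)
      then show False using that by simp
    qed
  qed
  obtain c where c: "c > 0" "Poly_Mapping.lookup ((V_X ^^ k) f) 0 = c * Poly_Mapping.lookup f k"
    using Xk[of k 0] by auto
  define a where "a = c * Poly_Mapping.lookup f k"
  have a: "a \<noteq> 0" using c k(1) by (simp add: a_def in_keys_iff)
  have "(V_X ^^ k) f = a *\<^sub>R ?e 0"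
  proof (rule poly_mapping_eqI)
    fix i
    show "Poly_Mapping.lookup ((V_X ^^ k) f) i = Poly_Mapping.lookup (a *\<^sub>R ?e 0) i"
    proof (cases "i = 0")
      case True
      then show ?thesis using c by (simp add: lookup_scaleR_bform a_def)
    next
      case False
      obtain d where "Poly_Mapping.lookup ((V_X ^^ k) f) i = d * Poly_Mapping.lookup f (i + k)"
        using Xk[of k i] by auto
      then show ?thesis using False k(2)[of "i + k"]
        by (simp add: lookup_scaleR_bform lookup_one when_def)
    qed
  qed
  then have "inverse a *\<^sub>R (a *\<^sub>R ?e 0) \<in> S"
    using XS[of k] S(1) subspace_scale by metis
  then have e0: "?e 0 \<in> S" using a by simp
  have e: "?e i \<in> S" if "i \<le> r" for i
    using that
  proof (induction i)
    case (Suc i)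
    have "V_Y r (?e i) = (real r - real i) *\<^sub>R ?e (Suc i)"
      by (rule poly_mapping_eqI)
         (auto simp: lookup_V lookup_scaleR_bform lookup_single when_def)
    then have "inverse (real r - real i) *\<^sub>R ((real r - real i) *\<^sub>R ?e (Suc i)) \<in> S"
      using Suc inv(2) S(1) subspace_scale by (metis Suc_leD)
    then show ?case using Suc.prems by simp
  qed (rule e0)
  have "g \<in> S" if "g \<in> V_mod r" for g
  proof -
    have "g = (\<Sum>i\<in>Poly_Mapping.keys g. Poly_Mapping.lookup g i *\<^sub>R ?e i)"
    proof (rule poly_mapping_eqI)
      fix j
      have "Poly_Mapping.lookup (\<Sum>i\<in>Poly_Mapping.keys g. Poly_Mapping.lookup g i *\<^sub>R ?e i) j =
          (\<Sum>i\<in>Poly_Mapping.keys g. if i = j then Poly_Mapping.lookup g i else 0)"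
        unfolding lookup_sum
        by (rule sum.cong) (auto simp: lookup_scaleR_bform lookup_single when_def)
      then show "Poly_Mapping.lookup g j =
          Poly_Mapping.lookup (\<Sum>i\<in>Poly_Mapping.keys g. Poly_Mapping.lookup g i *\<^sub>R ?e i) j"
        by (subst (asm) sum.delta) (auto simp: in_keys_iff)
    qed
    also have "\<dots> \<in> S"
      using that S(1) e by (intro subspace_sum subspace_scale) (auto simp: V_mod_def)
    finally show ?thesis .
  qed
  then show ?thesis using S(2) by blast
qed

definition normalized_invariant_form :: "nat \<Rightarrow> (bform \<Rightarrow> bform \<Rightarrow> real) \<Rightarrow> bool" where
  "normalized_invariant_form r b \<longleftrightarrow>
     bilinear_form_on (V_mod r) b \<and>
     (\<exists>u\<in>V_mod r. \<exists>v\<in>V_mod r. b u v \<noteq> 0) \<and>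
     (\<forall>u\<in>V_mod r. \<forall>v\<in>V_mod r.
        b (V_X u) v + b u (V_X v) = 0 \<and>
        b (V_Y r u) v + b u (V_Y r v) = 0 \<and>
        b (V_H r u) v + b u (V_H r v) = 0) \<and>
     (even r \<longrightarrow> has_signature (V_mod r) b (r div 2 + 1) (r div 2)) \<and>
     (odd r \<longrightarrow> (\<forall>v\<in>V_mod r. V_H r v = - v \<longrightarrow> b v (V_X v) \<ge> 0))"


section \<open>Multiplicity spaces\<close>

text \<open>An isometric isomorphism of modules from the direct sum of the \<open>V_mod r \<otimes> W r\<close> onto
  \<open>real^'n\<close> is given by its restrictions to the summands, that is by bilinear maps
  \<open>T r\<close> on \<open>V_mod r \<times> W r\<close>. It is bijective iff the elementary tensors of basis vectors are
  mapped bijectively onto a basis.\<close>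

definition multiplicity_iso ::
  "(real^'n \<Rightarrow> real^'n \<Rightarrow> real) \<Rightarrow> real^'n^'n \<Rightarrow> real^'n^'n \<Rightarrow> real^'n^'n \<Rightarrow>
   (nat \<Rightarrow> bform \<Rightarrow> bform \<Rightarrow> real) \<Rightarrow>
   (nat \<Rightarrow> 'w::real_vector set) \<Rightarrow> (nat \<Rightarrow> 'w \<Rightarrow> 'w \<Rightarrow> real) \<Rightarrow>
   (nat \<Rightarrow> bform \<Rightarrow> 'w \<Rightarrow> real^'n) \<Rightarrow> bool" where
  "multiplicity_iso B x y h b W \<phi> T \<longleftrightarrow>
     \<comment> \<open>bilinearity\<close>
     (\<forall>r. \<forall>v\<in>V_mod r. \<forall>v'\<in>V_mod r. \<forall>w\<in>W r. \<forall>w'\<in>W r. \<forall>c.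
        T r (v + v') w = T r v w + T r v' w \<and> T r (c *\<^sub>R v) w = c *\<^sub>R T r v w \<and>
        T r v (w + w') = T r v w + T r v w' \<and> T r v (c *\<^sub>R w) = c *\<^sub>R T r v w) \<and>
     \<comment> \<open>bijectivity\<close>
     (\<exists>E F. (\<forall>r. independent (E r) \<and> span (E r) = V_mod r) \<and>
            (\<forall>r. independent (F r) \<and> span (F r) = W r) \<and>
            inj_on (\<lambda>(r, e, f). T r e f) (SIGMA r:UNIV. E r \<times> F r) \<and>
            independent ((\<lambda>(r, e, f). T r e f) ` (SIGMA r:UNIV. E r \<times> F r)) \<and>
            span ((\<lambda>(r, e, f). T r e f) ` (SIGMA r:UNIV. E r \<times> F r)) = UNIV) \<and>
     \<comment> \<open>equivariance, with trivial action on the second factor\<close>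
     (\<forall>r. \<forall>v\<in>V_mod r. \<forall>w\<in>W r.
        x *v T r v w = T r (V_X v) w \<and>
        y *v T r v w = T r (V_Y r v) w \<and>
        h *v T r v w = T r (V_H r v) w) \<and>
     \<comment> \<open>isometry\<close>
     (\<forall>r s. \<forall>v\<in>V_mod r. \<forall>w\<in>W r. \<forall>v'\<in>V_mod s. \<forall>w'\<in>W s.
        B (T r v w) (T s v' w') = (if r = s then b r v v' * \<phi> r w w' else 0))"

definition multiplicity_spaces ::
  "(real^'n \<Rightarrow> real^'n \<Rightarrow> real) \<Rightarrow> real^'n^'n \<Rightarrow> real^'n^'n \<Rightarrow> real^'n^'n \<Rightarrow>
   (nat \<Rightarrow> bform \<Rightarrow> bform \<Rightarrow> real) \<Rightarrow>
   (nat \<Rightarrow> 'w::real_vector set) \<Rightarrow> (nat \<Rightarrow> 'w \<Rightarrow> 'w \<Rightarrow> real) \<Rightarrow> bool" where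
  "multiplicity_spaces B x y h b W \<phi> \<longleftrightarrow>
     (\<forall>r. subspace (W r) \<and> bilinear_form_on (W r) (\<phi> r)) \<and>
     (\<exists>T. multiplicity_iso B x y h b W \<phi> T)"


section \<open>The Liouville measure of an adjoint orbit\<close>

definition trace_on :: "'a::real_vector set \<Rightarrow> ('a \<Rightarrow> 'a) \<Rightarrow> real" where
  "trace_on V f = (let E = (SOME E. independent E \<and> span E = V)
                   in \<Sum>e\<in>E. representation E (f e) e)"

definition killing_form ::
  "(real^'n \<Rightarrow> real^'n \<Rightarrow> real) \<Rightarrow> real^'n^'n \<Rightarrow> real^'n^'n \<Rightarrow> real" where
  "killing_form B a c = trace_on (so_algebra B) (\<lambda>z. bracket a (bracket c z))"

text \<open>The symplectic form at the point \<open>y\<close> of an orbit; the value does not depend on the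
  choice of \<open>a\<close> and \<open>c\<close> because the Killing form is invariant.\<close>

definition orbit_form ::
  "(real^'n \<Rightarrow> real^'n \<Rightarrow> real) \<Rightarrow> real^'n^'n \<Rightarrow> real^'n^'n \<Rightarrow> real^'n^'n \<Rightarrow> real" where
  "orbit_form B y u v = (THE k. \<exists>a\<in>so_algebra B. \<exists>c\<in>so_algebra B.
     u = bracket a y \<and> v = bracket c y \<and> k = killing_form B y (bracket a c))"

text \<open>The value of the \<open>d\<close>-th exterior power of a 2-form on the vectors
  \<open>v 0, \<dots>, v (2 d - 1)\<close>.\<close>

definition wedge_power :: "nat \<Rightarrow> ('a \<Rightarrow> 'a \<Rightarrow> real) \<Rightarrow> (nat \<Rightarrow> 'a) \<Rightarrow> real" where
  "wedge_power d \<omega> v =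
     (\<Sum>\<sigma> | \<sigma> permutes {..<2 * d}. of_int (sign \<sigma>) *
        (\<Prod>i<d. \<omega> (v (\<sigma> (2 * i))) (v (\<sigma> (2 * i + 1)))))
       / 2 ^ d"

definition tangent_space ::
  "(real^'n \<Rightarrow> real^'n \<Rightarrow> real) \<Rightarrow> real^'n^'n \<Rightarrow> (real^'n^'n) set" where
  "tangent_space B y = {bracket a y | a. a \<in> so_algebra B}"

text \<open>A \<open>C\<^sup>1\<close> parametrization of an open part of the orbit \<open>Q\<close>, defined on an open subset \<open>U\<close> of
  \<open>\<real>\<^sup>m\<close>; points of \<open>\<real>\<^sup>m\<close> are functions that are \<open>undefined\<close> outside \<open>{..<m}\<close>, and \<open>D i\<close> is the
  \<open>i\<close>-th partial derivative. As the partial derivatives form a basis of the tangent space, \<open>m\<close>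
  is the dimension of the orbit.\<close>

definition orbit_chart ::
  "(real^'n \<Rightarrow> real^'n \<Rightarrow> real) \<Rightarrow> (real^'n^'n) set \<Rightarrow> nat \<Rightarrow> (nat \<Rightarrow> real) set \<Rightarrow>
   ((nat \<Rightarrow> real) \<Rightarrow> real^'n^'n) \<Rightarrow> (nat \<Rightarrow> (nat \<Rightarrow> real) \<Rightarrow> real^'n^'n) \<Rightarrow> bool" where
  "orbit_chart B Q m U \<psi> D \<longleftrightarrow>
     openin (product_topology (\<lambda>_. euclideanreal) {..<m}) U \<and>
     inj_on \<psi> U \<and> \<psi> ` U \<subseteq> Q \<and>
     (\<forall>i<m. continuous_map (subtopology (product_topology (\<lambda>_. euclideanreal) {..<m}) U)
               euclidean (D i)) \<and>
     (\<forall>u\<in>U. (\<forall>i<m. ((\<lambda>t. \<psi> (u(i := t))) has_vector_derivative D i u) (at (u i))) \<and>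
            inj_on (\<lambda>i. D i u) {..<m} \<and>
            independent ((\<lambda>i. D i u) ` {..<m}) \<and>
            span ((\<lambda>i. D i u) ` {..<m}) = tangent_space B (\<psi> u))"

text \<open>\<open>\<mu>\<close> is the measure on the orbit \<open>Q\<close> given by the density \<open>|\<lambda>|\<close>, where
  \<open>\<lambda> = \<omega>\<^sup>m\<^sup>/\<^sup>2\<close>: in every chart it is the pullback of \<open>\<lambda>\<close>, in absolute value, times
  Lebesgue measure.\<close>

definition liouville_measure ::
  "(real^'n \<Rightarrow> real^'n \<Rightarrow> real) \<Rightarrow> (real^'n^'n) set \<Rightarrow> (real^'n^'n) measure \<Rightarrow> bool" where
  "liouville_measure B Q \<mu> \<longleftrightarrow>
     space \<mu> = Q \<and> sets \<mu> = sets (restrict_space borel Q) \<and>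
     (\<forall>m U \<psi> D. orbit_chart B Q m U \<psi> D \<longrightarrow>
        (\<forall>A\<in>sets \<mu>. A \<subseteq> \<psi> ` U \<longrightarrow>
           emeasure \<mu> A =
             (\<integral>\<^sup>+u. ennreal \<bar>wedge_power (m div 2) (orbit_form B (\<psi> u)) (\<lambda>i. D i u)\<bar>
                    * indicator {u \<in> U. \<psi> u \<in> A} u \<partial>Pi\<^sub>M {..<m} (\<lambda>_. lborel))))"


section \<open>Gibbs states\<close>

definition partition_function ::
  "(real^'n^'n) measure \<Rightarrow> (real^'n^'n \<Rightarrow> real) \<Rightarrow> ennreal" where
  "partition_function \<mu> \<beta> = (\<integral>\<^sup>+y. ennreal (exp (- \<beta> y)) \<partial>\<mu>)"

text \<open>Elements of the dual of \<open>so_algebra B\<close> are represented by linear forms on the whole matrix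
  space; only their restriction matters.\<close>

definition admits_gibbs_state ::
  "(real^'n \<Rightarrow> real^'n \<Rightarrow> real) \<Rightarrow> (real^'n^'n) set \<Rightarrow> bool" where
  "admits_gibbs_state B Q \<longleftrightarrow>
     (\<exists>\<mu> \<beta>. liouville_measure B Q \<mu> \<and> linear \<beta> \<and> partition_function \<mu> \<beta> < \<infinity>)"

end

theory Submission
  imports Defs
begin

text \<open>The element \<open>- x\<close> lies in the orbit of \<open>x\<close> iff some \<open>g\<close> in the identity component satisfies
  \<open>g x = - x g\<close>. In a basis \<open>v (r, i, j)\<close> adapted to the decomposition into the \<open>V_r \<otimes> W_r\<close>, such a \<open>g\<close>
  is block triangular for the filtration by kernels and images of powers of \<open>x\<close>, and its diagonal
  block at \<open>(r, i)\<close> is \<open>(-1)^i D_r\<close>, where \<open>D_r\<close> is an isometry (\<open>r\<close> even) or an anti-isometry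
  (\<open>r\<close> odd, hence \<open>det D_r = (-1)^(n_r/2)\<close>) of \<open>W_r\<close>.

  Under either of the two sign conditions the vectors with \<open>2 i < r\<close>, together with the middle ones
  with \<open>r/2\<close> odd, span a subspace on which \<open>\<plusminus>B\<close> is semidefinite and which has a definite complement.
  Hence the compression of \<open>g\<close> to this subspace has positive determinant, and the product of the block
  determinants computes its sign as \<open>(-1)\<close> to the sum in the theorem. If both sign conditions fail
  or the sum is even, a diagonal anticommuting isometry can be chosen as a product of an even number of
  reflections in positive and an even number of reflections in negative vectors.

  If \<open>x\<close> and \<open>- x\<close> are conjugate, the orbit is invariant under multiplication by all \<open>t \<noteq> 0\<close>. Take a
  compact patch of the orbit on which a given linear form \<open>\<beta>\<close> has constant sign. Its multiple by \<open>t\<close>, with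
  the sign of \<open>t\<close> such that \<open>\<beta> \<le> 0\<close> there, has Liouville measure proportional to \<open>\<bar>t\<bar>^d\<close>, where
  \<open>2 d\<close> is the dimension of the orbit, and contributes at least this much to \<open>Z(\<beta>)\<close>.\<close>

section \<open>Determinants over finite index sets\<close>

text \<open>The component of an isometry \<open>g\<close> in \<open>O(p,q)\<close> is read off from
  the signs of its compressions to a maximal positive and a maximal negative definite subspace. An
  isometry anticommuting with \<open>x\<close> has no reason to preserve a definite subspace; the
  way out is a semidefinite one that all of them preserve, which the filtration by powers of
  \<open>x\<close> provides when the middle weight spaces have coherent signs. If neither sign
  condition holds, flipping a diagonal isometry on one chain \<open>v (r, _, j)\<close> corrects
  either of the two parities independently of the other.

  The period 8 is that of the product of \<open>(-1)^i\<close> over the low indices \<open>i\<close>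
  of \<open>V_r\<close>. Their number is even for even \<open>r\<close>, so \<open>det D_r\<close>
  drops out there; for odd \<open>r\<close> it is odd exactly when \<open>r\<close> is 1 mod 4,
  which produces \<open>n_(4k+1)/2\<close>. The reflections in the construction are counted by the
  same products, so one computation of signs serves both directions.

  For the Gibbs states one chart around \<open>x\<close> and its multiples suffice. The density
  gains \<open>t^d\<close> and not \<open>t^(2d)\<close>: at \<open>t y\<close> the vectors
  \<open>t [a,y]\<close> belong to the same \<open>a\<close>, so only the base point contributes a
  factor to each value of the form.\<close>

text \<open>The Leibniz determinant, for index sets that are not types.\<close>

definition ldet :: "'a set \<Rightarrow> ('a \<Rightarrow> 'a \<Rightarrow> real) \<Rightarrow> real" where
  "ldet S M = (\<Sum>\<sigma> | \<sigma> permutes S. of_int (sign \<sigma>) * (\<Prod>a\<in>S. M a (\<sigma> a)))"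

lemma ldet_cong:
  assumes "\<And>a b. a \<in> S \<Longrightarrow> b \<in> S \<Longrightarrow> M a b = M' a b"
  shows "ldet S M = ldet S M'"
  unfolding ldet_def by (rule sum.cong) (auto intro!: prod.cong simp: permutes_in_image assms)

lemma ldet_empty [simp]: "ldet {} M = 1"
  by (simp add: ldet_def)

lemma det_eq_ldet: "det A = ldet UNIV (\<lambda>a b. A $ a $ b)"
  by (simp add: det_def ldet_def)

lemma ldet_reindex:
  assumes f: "bij_betw f S T" and S: "finite S"
  shows "ldet T M = ldet S (\<lambda>a b. M (f a) (f b))"
proof -
  have inj: "inj_on f S" and T: "T = f ` S" using f by (auto simp: bij_betw_def)
  have "bij_betw (map_permutation S f) {\<sigma>. \<sigma> permutes S} {\<sigma>. \<sigma> permutes T}"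
  proof -
    have "bij_betw (\<lambda>\<pi> x. if x \<in> T then f (\<pi> (inv_into S f x)) else x) {\<sigma>. \<sigma> permutes S} {\<sigma>. \<sigma> permutes T}"
      by (rule bij_betw_permutations[OF f])
    moreover have "map_permutation S f = (\<lambda>\<pi> x. if x \<in> T then f (\<pi> (inv_into S f x)) else x)"
      by (auto simp: fun_eq_iff map_permutation_def restrict_id_def T)
    ultimately show ?thesis by simp
  qed
  then have "ldet T M = (\<Sum>\<sigma> | \<sigma> permutes S. of_int (sign (map_permutation S f \<sigma>)) *
      (\<Prod>b\<in>T. M b (map_permutation S f \<sigma> b)))"
    unfolding ldet_def by (rule sum.reindex_bij_betw[symmetric])
  also have "\<dots> = ldet S (\<lambda>a b. M (f a) (f b))"
    unfolding ldet_def
  proof (rule sum.cong[OF refl])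
    fix \<sigma> assume s: "\<sigma> \<in> {\<sigma>. \<sigma> permutes S}"
    have "(\<Prod>b\<in>T. M b (map_permutation S f \<sigma> b)) = (\<Prod>a\<in>S. M (f a) (f (\<sigma> a)))"
      unfolding T using inj
      by (subst prod.reindex) (auto intro!: prod.cong simp: map_permutation_apply)
    then show "of_int (sign (map_permutation S f \<sigma>)) * (\<Prod>b\<in>T. M b (map_permutation S f \<sigma> b)) =
        of_int (sign \<sigma>) * (\<Prod>a\<in>S. M (f a) (f (\<sigma> a)))"
      using s S inj by (simp add: sign_map_permutation)
  qed
  finally show ?thesis .
qed

text \<open>A term with a nonzero product comes from a permutation mapping \<open>S\<close> to
  itself; finiteness then makes it preserve \<open>T\<close> as well, so it splits uniquely into a
  permutation of \<open>S\<close> and one of \<open>T\<close>, whose signs multiply.\<close>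

lemma ldet_block_triangular:
  assumes fin: "finite S" "finite T" and disj: "S \<inter> T = {}"
    and zero: "\<And>a b. a \<in> S \<Longrightarrow> b \<in> T \<Longrightarrow> M a b = 0"
  shows "ldet (S \<union> T) M = ldet S M * ldet T M"
proof -
  let ?P = "{\<sigma>. \<sigma> permutes S \<union> T}" and ?P' = "{\<sigma>. \<sigma> permutes S \<union> T \<and> \<sigma> ` S \<subseteq> S}"
  let ?f = "\<lambda>\<sigma>. of_int (sign \<sigma>) * (\<Prod>a\<in>S\<union>T. M a (\<sigma> a)) :: real"
  have "ldet (S \<union> T) M = sum ?f ?P'"
    unfolding ldet_def
  proof (rule sum.mono_neutral_right)
    show "finite ?P" using fin by (simp add: finite_permutations)
    show "\<forall>\<sigma>\<in>?P - ?P'. ?f \<sigma> = 0"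
    proof
      fix \<sigma> assume s: "\<sigma> \<in> ?P - ?P'"
      then obtain a where "a \<in> S" "\<sigma> a \<notin> S" by auto
      moreover have "\<sigma> a \<in> S \<union> T" using s \<open>a \<in> S\<close> permutes_in_image[of \<sigma> "S \<union> T" a] by blast
      ultimately have "M a (\<sigma> a) = 0" using zero by auto
      then show "?f \<sigma> = 0" using \<open>a \<in> S\<close> fin by (auto intro!: bexI[of _ a])
    qed
  qed auto
  also have "\<dots> = (\<Sum>(p, q)\<in>{p. p permutes S} \<times> {q. q permutes T}. ?f (p \<circ> q))"
  proof (rule sum.reindex_bij_witness[of _ "\<lambda>(p, q). p \<circ> q"
        "\<lambda>\<sigma>. (restrict_id \<sigma> S, restrict_id \<sigma> T)"])
    fix \<sigma> assume s: "\<sigma> \<in> ?P'"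
    then have sp: "\<sigma> permutes S \<union> T" and sS: "\<sigma> ` S = S"
      using endo_inj_surj[of S \<sigma>] fin by (auto simp: permutes_inj_on)
    have "\<sigma> ` (S \<union> T) = S \<union> T" using sp by (rule permutes_image)
    then have sT: "\<sigma> ` T = T"
    proof -
      have "\<sigma> ` T = \<sigma> ` ((S \<union> T) - S)" using disj by (metis Diff_cancel Int_commute Un_Diff Diff_triv Un_empty_left)
      also have "\<dots> = \<sigma> ` (S \<union> T) - \<sigma> ` S"
        using sp by (intro image_set_diff) (auto simp: permutes_inj)
      finally show ?thesis using permutes_image[OF sp] sS disj by auto
    qed
    have bS: "bij_betw \<sigma> S S" "bij_betw \<sigma> T T"
      using sS sT permutes_inj_on[OF sp] by (auto simp: bij_betw_def)
    have "restrict_id \<sigma> S \<circ> restrict_id \<sigma> T = \<sigma>"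
    proof
      fix a show "(restrict_id \<sigma> S \<circ> restrict_id \<sigma> T) a = \<sigma> a"
        using sS sT disj permutes_not_in[OF sp, of a]
        by (cases "a \<in> T"; cases "a \<in> S") (auto simp: restrict_id_def)
    qed
    then show "(case (restrict_id \<sigma> S, restrict_id \<sigma> T) of (p, q) \<Rightarrow> p \<circ> q) = \<sigma>"
      and "(case (restrict_id \<sigma> S, restrict_id \<sigma> T) of (p, q) \<Rightarrow> ?f (p \<circ> q)) = ?f \<sigma>"
      by (simp_all only: prod.case)
    show "(restrict_id \<sigma> S, restrict_id \<sigma> T) \<in> {p. p permutes S} \<times> {q. q permutes T}"
      using bS by (simp add: permutes_restrict_id)
  next
    fix pq assume "pq \<in> {p. p permutes S} \<times> {q. q permutes T}"
    then obtain p q where pq: "pq = (p, q)" "p permutes S" "q permutes T" by auto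
    have "p \<circ> q permutes S \<union> T"
      using pq permutes_subset[of p S "S \<union> T"] permutes_subset[of q T "S \<union> T"]
      by (auto intro: permutes_compose)
    moreover have "q a = a" if "a \<in> S" for a using permutes_not_in[OF pq(3), of a] that disj by auto
    ultimately show "(case pq of (p, q) \<Rightarrow> p \<circ> q) \<in> ?P'"
      using pq by (auto simp: permutes_in_image)
    have "restrict_id (p \<circ> q) S = p" "restrict_id (p \<circ> q) T = q"
      using pq disj \<open>\<And>a. a \<in> S \<Longrightarrow> q a = a\<close> permutes_in_image[of q T]
      by (auto simp: fun_eq_iff restrict_id_def permutes_not_in) (metis disjoint_iff permutes_not_in)+
    then show "(restrict_id (case pq of (p, q) \<Rightarrow> p \<circ> q) S, restrict_id (case pq of (p, q) \<Rightarrow> p \<circ> q) T) = pq"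
      using pq by simp
  qed
  also have "\<dots> = (\<Sum>(p, q)\<in>{p. p permutes S} \<times> {q. q permutes T}.
       (of_int (sign p) * (\<Prod>a\<in>S. M a (p a))) * (of_int (sign q) * (\<Prod>a\<in>T. M a (q a))))"
  proof (rule sum.cong[OF refl], clarify)
    fix p q assume pq: "p permutes S" "q permutes T"
    have 1: "(\<Prod>a\<in>S. M a ((p \<circ> q) a)) = (\<Prod>a\<in>S. M a (p a))"
      using pq disj by (intro prod.cong refl) (metis comp_apply disjoint_iff permutes_not_in)
    have 2: "(\<Prod>a\<in>T. M a ((p \<circ> q) a)) = (\<Prod>a\<in>T. M a (q a))"
    proof (intro prod.cong refl)
      fix a assume "a \<in> T"
      then have "q a \<in> T" using pq by (simp add: permutes_in_image)
      then have "q a \<notin> S" using disj by auto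
      then show "M a ((p \<circ> q) a) = M a (q a)" using pq by (simp add: permutes_not_in)
    qed
    have "sign (p \<circ> q) = sign p * sign q"
      using pq fin by (intro sign_compose permutes_imp_permutation)
    then show "?f (p \<circ> q) = (of_int (sign p) * (\<Prod>a\<in>S. M a (p a))) * (of_int (sign q) * (\<Prod>a\<in>T. M a (q a)))"
      using 1 2 by (subst prod.union_disjoint[OF fin disj]) simp
  qed
  also have "\<dots> = ldet S M * ldet T M"
    unfolding ldet_def sum_product sum.cartesian_product by simp
  finally show ?thesis .
qed

text \<open>The blocks are adjoined by increasing key, so each new block plays the role of
  \<open>T\<close> in \<open>ldet_block_triangular\<close>: all entries from the earlier blocks into
  it vanish.\<close>

lemma ldet_key_triangular:
  fixes key :: "'a \<Rightarrow> 'k::linorder"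
  assumes "finite S"
    and zero: "\<And>a b. a \<in> S \<Longrightarrow> b \<in> S \<Longrightarrow> key a < key b \<Longrightarrow> M a b = 0"
  shows "ldet S M = (\<Prod>k\<in>key ` S. ldet {a\<in>S. key a = k} M)"
proof -
  have "finite K \<Longrightarrow> K \<subseteq> key ` S \<Longrightarrow>
      ldet {a\<in>S. key a \<in> K} M = (\<Prod>k\<in>K. ldet {a\<in>S. key a = k} M)" for K
  proof (induction rule: finite_linorder_max_induct)
    case (insert m K)
    have "{a\<in>S. key a \<in> insert m K} = {a\<in>S. key a \<in> K} \<union> {a\<in>S. key a = m}" by auto
    moreover have "ldet ({a\<in>S. key a \<in> K} \<union> {a\<in>S. key a = m}) M =
        ldet {a\<in>S. key a \<in> K} M * ldet {a\<in>S. key a = m} M"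
      using insert.hyps assms by (intro ldet_block_triangular) auto
    moreover have "m \<notin> K" using insert.hyps by auto
    ultimately show ?case using insert by simp
  qed simp
  from this[of "key ` S"] show ?thesis
    using assms(1) by (simp add: Collect_conj_eq) (metis (no_types, lifting) Int_absorb2 image_eqI mem_Collect_eq subsetI)
qed

lemma ldet_scale:
  assumes "finite S"
  shows "ldet S (\<lambda>a b. c * M a b) = c ^ card S * ldet S M"
  unfolding ldet_def by (simp add: prod.distrib sum_distrib_left mult.left_commute)

lemma ldet_zero_column:
  assumes "finite S" "k \<in> S" "\<And>a. a \<in> S \<Longrightarrow> M a k = 0"
  shows "ldet S M = 0"
  unfolding ldet_def
proof (rule sum.neutral, clarify)
  fix \<sigma> assume s: "\<sigma> permutes S"
  then obtain a where "a \<in> S" "\<sigma> a = k" using permutes_image[OF s] assms(2) by force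
  then show "of_int (sign \<sigma>) * (\<Prod>a\<in>S. M a (\<sigma> a)) = (0::real)"
    using assms by (auto intro!: bexI[of _ a])
qed

text \<open>The coefficient in the multilinear expansion of a congruence. A repeated column makes
  the terms cancel under composition with the transposition of its two positions; an injective
  selection is a permutation and only contributes its sign.\<close>

lemma ldet_select_columns:
  assumes S: "finite S" and g: "g \<in> S \<rightarrow>\<^sub>E S"
  shows "(\<Sum>\<sigma> | \<sigma> permutes S. of_int (sign \<sigma>) * (\<Prod>a\<in>S. M (\<sigma> a) (g a))) =
     (if inj_on g S then of_int (sign (restrict_id g S)) * ldet S M else 0)"
proof (cases "inj_on g S")
  case True
  then have bij: "bij_betw g S S"
    using g S endo_inj_surj[OF S _ True] by (auto simp: bij_betw_def PiE_def Pi_def image_subset_iff)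
  define \<tau> where "\<tau> = restrict_id g S"
  have t: "\<tau> permutes S" unfolding \<tau>_def using bij by (rule permutes_restrict_id)
  have "(\<Sum>\<sigma> | \<sigma> permutes S. of_int (sign \<sigma>) * (\<Prod>a\<in>S. M (\<sigma> a) (g a))) =
      (\<Sum>\<sigma> | \<sigma> permutes S. of_int (sign (inv \<sigma>)) * (\<Prod>a\<in>S. M (inv \<sigma> a) (\<tau> a)))"
    by (subst sum_permutations_inverse) (auto intro!: sum.cong prod.cong simp: \<tau>_def)
  also have "\<dots> = (\<Sum>\<sigma> | \<sigma> permutes S. of_int (sign \<sigma>) * (\<Prod>a\<in>S. M a (\<tau> (\<sigma> a))))"
  proof (rule sum.cong[OF refl], clarify)
    fix \<sigma> assume s: "\<sigma> permutes S"
    have "(\<Prod>a\<in>S. M (inv \<sigma> a) (\<tau> a)) = (\<Prod>a\<in>S. M (inv \<sigma> (\<sigma> a)) (\<tau> (\<sigma> a)))"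
      using prod.permute[OF s, of "\<lambda>a. M (inv \<sigma> a) (\<tau> a)"] by (simp add: comp_def)
    then show "of_int (sign (inv \<sigma>)) * (\<Prod>a\<in>S. M (inv \<sigma> a) (\<tau> a)) =
        of_int (sign \<sigma>) * (\<Prod>a\<in>S. M a (\<tau> (\<sigma> a)))"
      using s S by (simp add: sign_inverse permutes_imp_permutation permutes_inverses)
  qed
  also have "\<dots> = (\<Sum>\<sigma> | \<sigma> permutes S. of_int (sign \<tau> * sign (\<tau> \<circ> \<sigma>)) * (\<Prod>a\<in>S. M a ((\<tau> \<circ> \<sigma>) a)))"
  proof (rule sum.cong[OF refl], clarify)
    fix \<sigma> assume s: "\<sigma> permutes S"
    have "sign \<tau> * sign (\<tau> \<circ> \<sigma>) = sign \<sigma>"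
      using s t S by (simp add: sign_compose permutes_imp_permutation)
    then show "of_int (sign \<sigma>) * (\<Prod>a\<in>S. M a (\<tau> (\<sigma> a))) =
      of_int (sign \<tau> * sign (\<tau> \<circ> \<sigma>)) * (\<Prod>a\<in>S. M a ((\<tau> \<circ> \<sigma>) a))" by simp
  qed
  also have "\<dots> = (\<Sum>\<sigma> | \<sigma> permutes S. of_int (sign \<tau> * sign \<sigma>) * (\<Prod>a\<in>S. M a (\<sigma> a)))"
    using setum_permutations_compose_left[OF t, of "\<lambda>\<sigma>. of_int (sign \<tau> * sign \<sigma>) * (\<Prod>a\<in>S. M a (\<sigma> a))"]
    by simp
  also have "\<dots> = of_int (sign \<tau>) * ldet S M"
    by (simp add: ldet_def sum_distrib_left mult.assoc)
  finally show ?thesis using True by (simp add: \<tau>_def)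
next
  case False
  then obtain a b where ab: "a \<in> S" "b \<in> S" "a \<noteq> b" "g a = g b" by (auto simp: inj_on_def)
  let ?t = "Transposition.transpose a b"
  have t: "?t permutes S" using ab by (intro permutes_swap_id)
  let ?F = "\<lambda>\<sigma>. of_int (sign \<sigma>) * (\<Prod>a\<in>S. M (\<sigma> a) (g a)) :: real"
  have "sum ?F {\<sigma>. \<sigma> permutes S} = (\<Sum>\<sigma> | \<sigma> permutes S. ?F (\<sigma> \<circ> ?t))"
    by (rule sum_permutations_compose_right[OF t])
  also have "\<dots> = (\<Sum>\<sigma> | \<sigma> permutes S. - ?F \<sigma>)"
  proof (rule sum.cong[OF refl], clarify)
    fix \<sigma> assume s: "\<sigma> permutes S"
    have "sign (\<sigma> \<circ> ?t) = - sign \<sigma>"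
      using s t S ab by (simp add: sign_compose permutes_imp_permutation[OF S] sign_swap_id)
    moreover have "(\<Prod>c\<in>S. M (\<sigma> c) (g c)) = (\<Prod>c\<in>S. M ((\<sigma> \<circ> ?t) c) (g c))"
    proof -
      have "(\<Prod>c\<in>S. M (\<sigma> c) (g c)) = (\<Prod>c\<in>S. M (\<sigma> (?t c)) (g (?t c)))"
        using prod.permute[OF t, of "\<lambda>c. M (\<sigma> c) (g c)"] by (simp add: comp_def)
      also have "\<dots> = (\<Prod>c\<in>S. M ((\<sigma> \<circ> ?t) c) (g c))"
        using ab by (intro prod.cong) (auto simp: Transposition.transpose_def)
      finally show ?thesis .
    qed
    ultimately show "?F (\<sigma> \<circ> ?t) = - ?F \<sigma>" by simp
  qed
  also have "\<dots> = - sum ?F {\<sigma>. \<sigma> permutes S}" by (simp add: sum_negf)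
  finally show ?thesis using False by simp
qed

section \<open>Exterior powers of a 2-form\<close>

lemma wedge_power_gram: "wedge_power d \<omega> v = wedge_power d (\<lambda>a b. \<omega> (v a) (v b)) id"
  by (simp add: wedge_power_def)

lemma permutes_lessThan_double:
  assumes "\<sigma> permutes {..<2 * d}" "i < d"
  shows "\<sigma> (2 * i) < 2 * d" "\<sigma> (Suc (2 * i)) < 2 * d"
  using assms permutes_in_image[OF assms(1), of "2*i"] permutes_in_image[OF assms(1), of "Suc (2*i)"] by auto

lemma wedge_power_cong:
  assumes "\<And>a b. a < 2 * d \<Longrightarrow> b < 2 * d \<Longrightarrow> \<Omega> a b = \<Omega>' a b"
  shows "wedge_power d \<Omega> id = wedge_power d \<Omega>' id"
  unfolding wedge_power_def
  by (rule arg_cong[where f = "\<lambda>x. x / 2 ^ d"], rule sum.cong)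
     (auto intro!: prod.cong assms simp: permutes_lessThan_double)

lemma prod_pairs: "(\<Prod>a<2 * d. f a) = (\<Prod>i<d. f (2 * i) * f (2 * i + 1))"
  for f :: "nat \<Rightarrow> 'a::comm_monoid_mult"
  by (induction d) (simp_all add: mult.assoc)

text \<open>The two indices chosen in the factor \<open>i\<close> are stored at positions
  \<open>2 * i\<close> and \<open>2 * i + 1\<close>, which turns the expansion into a sum over
  selections of columns as in \<open>ldet_select_columns\<close>.\<close>

lemma prod_double_sum_PiE:
  fixes H :: "nat \<Rightarrow> nat \<Rightarrow> nat \<Rightarrow> real"
  assumes "finite K"
  shows "(\<Prod>i<d. \<Sum>k\<in>K. \<Sum>l\<in>K. H i k l) =
     (\<Sum>g\<in>{..<2 * d} \<rightarrow>\<^sub>E K. \<Prod>i<d. H i (g (2 * i)) (g (2 * i + 1)))"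
proof -
  have "(\<Prod>i<d. \<Sum>k\<in>K. \<Sum>l\<in>K. H i k l) = (\<Prod>i<d. \<Sum>kl\<in>K \<times> K. H i (fst kl) (snd kl))"
    by (simp add: sum.cartesian_product case_prod_beta)
  also have "\<dots> = (\<Sum>f\<in>{..<d} \<rightarrow>\<^sub>E K \<times> K. \<Prod>i<d. H i (fst (f i)) (snd (f i)))"
    using assms by (intro prod_sum_PiE) auto
  also have "\<dots> = (\<Sum>g\<in>{..<2 * d} \<rightarrow>\<^sub>E K. \<Prod>i<d. H i (g (2 * i)) (g (2 * i + 1)))"
  proof (rule sum.reindex_bij_witness[of _ "\<lambda>g. \<lambda>i\<in>{..<d}. (g (2 * i), g (2 * i + 1))"
        "\<lambda>f. \<lambda>a\<in>{..<2 * d}. (if even a then fst (f (a div 2)) else snd (f (a div 2)))"])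
    fix f assume f: "f \<in> {..<d} \<rightarrow>\<^sub>E K \<times> K"
    then show "(\<lambda>i\<in>{..<d}. ((\<lambda>a\<in>{..<2 * d}. if even a then fst (f (a div 2)) else snd (f (a div 2))) (2 * i),
          (\<lambda>a\<in>{..<2 * d}. if even a then fst (f (a div 2)) else snd (f (a div 2))) (2 * i + 1))) = f"
      by (auto simp: fun_eq_iff PiE_def extensional_def)
    show "(\<lambda>a\<in>{..<2 * d}. if even a then fst (f (a div 2)) else snd (f (a div 2))) \<in> {..<2 * d} \<rightarrow>\<^sub>E K"
    proof -
      have "f (a div 2) \<in> K \<times> K" if "a < 2 * d" for a using f that by (auto simp: PiE_def Pi_def)
      then show ?thesis by (auto simp: mem_Times_iff)
    qed
    show "(\<Prod>i<d. H i ((\<lambda>a\<in>{..<2 * d}. if even a then fst (f (a div 2)) else snd (f (a div 2))) (2 * i))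
         ((\<lambda>a\<in>{..<2 * d}. if even a then fst (f (a div 2)) else snd (f (a div 2))) (2 * i + 1))) =
       (\<Prod>i<d. H i (fst (f i)) (snd (f i)))"
      by (rule prod.cong) auto
  next
    fix g assume g: "g \<in> {..<2 * d} \<rightarrow>\<^sub>E K"
    show "(\<lambda>i\<in>{..<d}. (g (2 * i), g (2 * i + 1))) \<in> {..<d} \<rightarrow>\<^sub>E K \<times> K"
      using g by (auto simp: PiE_def Pi_def)
    show "(\<lambda>a\<in>{..<2 * d}. if even a then fst ((\<lambda>i\<in>{..<d}. (g (2 * i), g (2 * i + 1))) (a div 2))
        else snd ((\<lambda>i\<in>{..<d}. (g (2 * i), g (2 * i + 1))) (a div 2))) = g"
    proof
      fix a :: nat
      have "2 * (a div 2) + 1 = a" if "odd a" using that by (rule odd_two_times_div_two_succ)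
      then show "(\<lambda>a\<in>{..<2 * d}. if even a then fst ((\<lambda>i\<in>{..<d}. (g (2 * i), g (2 * i + 1))) (a div 2))
        else snd ((\<lambda>i\<in>{..<d}. (g (2 * i), g (2 * i + 1))) (a div 2))) a = g a"
        using g by (auto simp: PiE_def extensional_def)
    qed
  qed
  finally show ?thesis .
qed

text \<open>For skew \<open>\<Omega>\<close> the value \<open>wedge_power d \<Omega> id\<close> is
  \<open>d!\<close> times the Pfaffian, and this is the rule Pf(M \<Omega> M^t) = det M Pf \<Omega>.
  It detects the determinant itself and not only its square.\<close>

lemma wedge_power_congruence:
  assumes "\<And>a b. a < 2 * d \<Longrightarrow> b < 2 * d \<Longrightarrow>
      \<Omega>' a b = (\<Sum>k<2 * d. \<Sum>l<2 * d. M a k * M b l * \<Omega> k l)"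
  shows "wedge_power d \<Omega>' id = ldet {..<2 * d} M * wedge_power d \<Omega> id"
proof -
  let ?K = "{..<2 * d}"
  let ?w = "\<lambda>g. \<Prod>i<d. \<Omega> (g (2 * i)) (g (2 * i + 1))"
  have "(\<Sum>\<sigma> | \<sigma> permutes ?K. of_int (sign \<sigma>) * (\<Prod>i<d. \<Omega>' (\<sigma> (2 * i)) (\<sigma> (2 * i + 1)))) =
      (\<Sum>\<sigma> | \<sigma> permutes ?K. \<Sum>g\<in>?K \<rightarrow>\<^sub>E ?K. of_int (sign \<sigma>) * (\<Prod>a\<in>?K. M (\<sigma> a) (g a)) * ?w g)"
  proof (rule sum.cong[OF refl], clarify)
    fix \<sigma> assume s: "\<sigma> permutes ?K"
    have "(\<Prod>i<d. \<Omega>' (\<sigma> (2 * i)) (\<sigma> (2 * i + 1))) =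
        (\<Prod>i<d. \<Sum>k\<in>?K. \<Sum>l\<in>?K. M (\<sigma> (2 * i)) k * M (\<sigma> (2 * i + 1)) l * \<Omega> k l)"
      by (rule prod.cong) (simp_all add: assms permutes_lessThan_double[OF s])
    also have "\<dots> = (\<Sum>g\<in>?K \<rightarrow>\<^sub>E ?K. \<Prod>i<d. M (\<sigma> (2 * i)) (g (2 * i)) * M (\<sigma> (2 * i + 1)) (g (2 * i + 1)) *
         \<Omega> (g (2 * i)) (g (2 * i + 1)))"
      by (rule prod_double_sum_PiE) simp
    also have "\<dots> = (\<Sum>g\<in>?K \<rightarrow>\<^sub>E ?K. (\<Prod>a\<in>?K. M (\<sigma> a) (g a)) * ?w g)"
      by (simp only: prod_pairs prod.distrib)
    finally show "of_int (sign \<sigma>) * (\<Prod>i<d. \<Omega>' (\<sigma> (2 * i)) (\<sigma> (2 * i + 1))) =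
       (\<Sum>g\<in>?K \<rightarrow>\<^sub>E ?K. of_int (sign \<sigma>) * (\<Prod>a\<in>?K. M (\<sigma> a) (g a)) * ?w g)"
      by (simp add: sum_distrib_left mult.assoc)
  qed
  also have "\<dots> = (\<Sum>g\<in>?K \<rightarrow>\<^sub>E ?K. (\<Sum>\<sigma> | \<sigma> permutes ?K. of_int (sign \<sigma>) * (\<Prod>a\<in>?K. M (\<sigma> a) (g a))) * ?w g)"
    by (subst sum.swap) (simp add: sum_distrib_right)
  also have "\<dots> = (\<Sum>g\<in>?K \<rightarrow>\<^sub>E ?K. if inj_on g ?K then ldet ?K M * of_int (sign (restrict_id g ?K)) * ?w g else 0)"
    by (rule sum.cong[OF refl]) (subst ldet_select_columns, auto)
  also have "\<dots> = (\<Sum>g\<in>{g \<in> ?K \<rightarrow>\<^sub>E ?K. inj_on g ?K}. ldet ?K M * of_int (sign (restrict_id g ?K)) * ?w g)"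
    by (rule sum.mono_neutral_cong_right) (auto intro!: finite_PiE)
  also have "\<dots> = (\<Sum>\<sigma> | \<sigma> permutes ?K. ldet ?K M * of_int (sign \<sigma>) * ?w \<sigma>)"
  proof (rule sum.reindex_bij_witness[of _ "\<lambda>\<sigma>. restrict \<sigma> ?K" "\<lambda>g. restrict_id g ?K"])
    fix g assume "g \<in> {g \<in> ?K \<rightarrow>\<^sub>E ?K. inj_on g ?K}"
    then have g: "g \<in> ?K \<rightarrow>\<^sub>E ?K" "inj_on g ?K" by auto
    show "restrict (restrict_id g ?K) ?K = g"
      using g by (auto simp: fun_eq_iff PiE_def extensional_def restrict_id_def)
    have "bij_betw g ?K ?K"
      using g endo_inj_surj[of ?K g] by (auto simp: bij_betw_def PiE_def Pi_def image_subset_iff)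
    then show "restrict_id g ?K \<in> {\<sigma>. \<sigma> permutes ?K}" by (simp add: permutes_restrict_id)
    show "ldet ?K M * of_int (sign (restrict_id g ?K)) * ?w (restrict_id g ?K) =
        ldet ?K M * of_int (sign (restrict_id g ?K)) * ?w g"
      by (rule arg_cong[where f = "\<lambda>x. _ * x"], rule prod.cong) (auto simp: restrict_id_def)
  next
    fix \<sigma> assume "\<sigma> \<in> {\<sigma>. \<sigma> permutes ?K}"
    then have s: "\<sigma> permutes ?K" by simp
    show "restrict_id (restrict \<sigma> ?K) ?K = \<sigma>"
      using permutes_not_in[OF s] by (fastforce simp: fun_eq_iff restrict_id_def)
    show "restrict \<sigma> ?K \<in> {g \<in> ?K \<rightarrow>\<^sub>E ?K. inj_on g ?K}"
      using s permutes_in_image[OF s] permutes_inj[OF s]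
      by (auto simp: PiE_def Pi_def inj_on_def)
  qed
  finally show ?thesis
    unfolding wedge_power_def by (simp add: sum_distrib_left mult.assoc)
qed

text \<open>A relation between the rows and columns of the Gram matrix is inserted into one of the vectors.\<close>

lemma wedge_power_degenerate:
  assumes k: "k < 2 * d" "c k \<noteq> 0"
    and row: "\<And>b. b < 2 * d \<Longrightarrow> (\<Sum>a<2 * d. c a * \<Omega> a b) = 0"
    and col: "\<And>a. a < 2 * d \<Longrightarrow> (\<Sum>b<2 * d. c b * \<Omega> a b) = 0"
  shows "wedge_power d \<Omega> id = 0"
proof -
  let ?K = "{..<2 * d}"
  \<comment> \<open>Row \<open>k\<close> of the identity is corrected so that column
    \<open>k\<close> vanishes. By the relation \<open>c\<close> the congruence with \<open>e\<close>
    leaves \<open>\<Omega>\<close> unchanged, so the power equals 0 times itself.\<close>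
  define e where "e a l = (if a = l then 1 else 0) - (if a = k then c l / c k else 0)" for a l
  have R: "(\<Sum>l\<in>?K. e b l * \<Omega> a l) = \<Omega> a b" if "a \<in> ?K" "b \<in> ?K" for a b
  proof -
    have "(\<Sum>l\<in>?K. e b l * \<Omega> a l) = (\<Sum>l\<in>?K. (if b = l then \<Omega> a l else 0) - (if b = k then 1 else 0) / c k * (c l * \<Omega> a l))"
      by (rule sum.cong) (auto simp: e_def left_diff_distrib)
    also have "\<dots> = \<Omega> a b"
      using that col by (simp add: sum_subtractf flip: sum_distrib_left del: times_divide_eq_left times_divide_eq_right)
    finally show ?thesis .
  qed
  have L: "(\<Sum>l\<in>?K. e a l * \<Omega> l b) = \<Omega> a b" if "a \<in> ?K" "b \<in> ?K" for a b
  proof -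
    have "(\<Sum>l\<in>?K. e a l * \<Omega> l b) = (\<Sum>l\<in>?K. (if a = l then \<Omega> l b else 0) - (if a = k then 1 else 0) / c k * (c l * \<Omega> l b))"
      by (rule sum.cong) (auto simp: e_def left_diff_distrib)
    also have "\<dots> = \<Omega> a b"
      using that row by (simp add: sum_subtractf flip: sum_distrib_left del: times_divide_eq_left times_divide_eq_right)
    finally show ?thesis .
  qed
  have "\<Omega> a b = (\<Sum>i\<in>?K. \<Sum>l\<in>?K. e a i * e b l * \<Omega> i l)" if "a < 2 * d" "b < 2 * d" for a b
  proof -
    have "(\<Sum>i\<in>?K. \<Sum>l\<in>?K. e a i * e b l * \<Omega> i l) = (\<Sum>i\<in>?K. e a i * (\<Sum>l\<in>?K. e b l * \<Omega> i l))"
      by (simp add: sum_distrib_left mult.assoc)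
    then show ?thesis using that R L by simp
  qed
  then have "wedge_power d \<Omega> id = ldet ?K e * wedge_power d \<Omega> id" by (rule wedge_power_congruence)
  moreover have "ldet ?K e = 0"
    by (rule ldet_zero_column[of _ k]) (use k in \<open>auto simp: e_def\<close>)
  ultimately show ?thesis by simp
qed

text \<open>Consecutive indices form hyperbolic pairs, the same pairing of positions that
  \<open>wedge_power\<close> uses.\<close>

definition std_symp :: "nat \<Rightarrow> nat \<Rightarrow> real" where
  "std_symp a b = (if even a \<and> b = a + 1 then 1 else if odd a \<and> a = b + 1 then -1 else 0)"

text \<open>Exchanging two pairs exchanges their even members and their odd members: two
  transpositions, hence even.\<close>

lemma sign_double_permutation:
  fixes d :: nat
  assumes "\<rho> permutes {..<d}"
  shows "sign (\<lambda>a. 2 * \<rho> (a div 2) + a mod 2) = 1 \<and> (\<lambda>a. 2 * \<rho> (a div 2) + a mod 2) permutes {..<2 * d}"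
  using finite_lessThan[of d] assms
proof (induction rule: permutes_rev_induct)
  case id
  have "(\<lambda>a. 2 * id (a div 2) + a mod 2) = (id :: nat \<Rightarrow> nat)" by (auto simp: fun_eq_iff)
  then show ?case by (simp add: permutes_id)
next
  case (swap a b \<rho>)
  let ?D = "\<lambda>a. 2 * \<rho> (a div 2) + a mod 2"
  let ?s = "Transposition.transpose (2 * a) (2 * b)" and ?t = "Transposition.transpose (2 * a + 1) (2 * b + 1)"
  have eq: "(\<lambda>c. 2 * (\<rho> \<circ> Transposition.transpose a b) (c div 2) + c mod 2) = ?D \<circ> (?s \<circ> ?t)"
  proof
    fix c :: nat
    define m where "m = c div 2"
    show "2 * (\<rho> \<circ> Transposition.transpose a b) (c div 2) + c mod 2 = (?D \<circ> (?s \<circ> ?t)) c"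
    proof (cases "even c")
      case True
      then have c: "c = 2 * m" by (simp add: m_def)
      have "?t c = c" unfolding c Transposition.transpose_def by presburger
      moreover have "?s c = 2 * Transposition.transpose a b m" unfolding c Transposition.transpose_def by simp
      ultimately show ?thesis by (simp add: c)
    next
      case False
      then have c: "c = 2 * m + 1" by (simp add: m_def)
      have t: "?t c = 2 * Transposition.transpose a b m + 1" unfolding c Transposition.transpose_def by simp
      have "?s (2 * Transposition.transpose a b m + 1) = 2 * Transposition.transpose a b m + 1"
        unfolding Transposition.transpose_def[of "2 * a"] by presburger
      then have "?s (?t c) = 2 * Transposition.transpose a b m + 1" unfolding t .
      then show ?thesis by (simp add: c)
    qed
  qed
  have st: "?s permutes {..<2*d}" "?t permutes {..<2*d}"
    using swap by (auto intro!: permutes_swap_id)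
  have D: "?D permutes {..<2*d}" "sign ?D = 1" using swap by auto
  have "sign (?D \<circ> (?s \<circ> ?t)) = sign ?D * (sign ?s * sign ?t)"
    using st D by (simp add: sign_compose permutes_imp_permutation[OF finite_lessThan] permutation_compose)
  moreover have "sign ?s * sign ?t = 1" by (simp add: sign_swap_id)
  ultimately show ?case unfolding eq using st D by (auto intro!: permutes_compose)
qed

text \<open>A nonvanishing term comes from a permutation of the pairs followed by swaps inside some
  pairs. A permutation of pairs is even, and each swap changes both the sign of the permutation
  and that of the product.\<close>

lemma std_symp_term_pos:
  assumes "\<sigma> permutes {..<2 * d}" "(\<Prod>i<d. std_symp (\<sigma> (2 * i)) (\<sigma> (2 * i + 1))) \<noteq> 0"
  shows "of_int (sign \<sigma>) * (\<Prod>i<d. std_symp (\<sigma> (2 * i)) (\<sigma> (2 * i + 1))) = 1"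
  using assms
proof (induction "card {i. i < d \<and> odd (\<sigma> (2 * i))}" arbitrary: \<sigma>)
  case 0
  have "{i. i < d \<and> odd (\<sigma> (2 * i))} = {}" using "0.hyps" by simp
  then have ev: "even (\<sigma> (2 * i))" if "i < d" for i using that by blast
  have nz: "std_symp (\<sigma> (2 * i)) (\<sigma> (2 * i + 1)) \<noteq> 0" if "i < d" for i
    using "0.prems"(2) that by simp
  have s1: "\<sigma> (2 * i + 1) = \<sigma> (2 * i) + 1" if "i < d" for i
    using nz[OF that] ev[OF that] by (auto simp: std_symp_def split: if_splits)
  define \<rho> where "\<rho> i = (if i < d then \<sigma> (2 * i) div 2 else i)" for i
  have "\<sigma> = (\<lambda>a. 2 * \<rho> (a div 2) + a mod 2)"
  proof
    fix a show "\<sigma> a = 2 * \<rho> (a div 2) + a mod 2"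
    proof (cases "a < 2 * d")
      case True
      define m where "m = a div 2"
      have m: "m < d" using True by (simp add: m_def less_mult_imp_div_less mult.commute)
      then have 2: "2 * \<rho> m = \<sigma> (2 * m)" using ev[OF m] by (simp add: \<rho>_def)
      show ?thesis
      proof (cases "even a")
        case True
        then have "a = 2 * m" by (simp add: m_def)
        with 2 show ?thesis by simp
      next
        case False
        then have "a = 2 * m + 1" by (simp add: m_def)
        with 2 s1[OF m] show ?thesis by simp
      qed
    next
      case False
      then have "\<not> a div 2 < d" by presburger
      then show ?thesis using permutes_not_in[OF "0.prems"(1), of a] False by (simp add: \<rho>_def)
    qed
  qed
  moreover have "\<rho> permutes {..<d}"
  proof (rule bij_imp_permutes)
    have "\<rho> ` {..<d} \<subseteq> {..<d}"
      using permutes_lessThan_double(1)[OF "0.prems"(1)] by (auto simp: \<rho>_def less_mult_imp_div_less mult.commute)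
    moreover have "inj_on \<rho> {..<d}"
    proof (rule inj_onI)
      fix i j assume "i \<in> {..<d}" "j \<in> {..<d}" "\<rho> i = \<rho> j"
      then have "2 * (\<sigma> (2 * i) div 2) = 2 * (\<sigma> (2 * j) div 2)" "i < d" "j < d" by (simp_all add: \<rho>_def)
      then have "\<sigma> (2 * i) = \<sigma> (2 * j)" using ev[of i] ev[of j] by simp
      then show "i = j" using injD[OF permutes_inj[OF "0.prems"(1)], of "2 * i" "2 * j"] by simp
    qed
    ultimately show "bij_betw \<rho> {..<d} {..<d}" by (simp add: bij_betw_def endo_inj_surj)
  qed (auto simp: \<rho>_def)
  ultimately have "sign \<sigma> = 1" using sign_double_permutation[of \<rho> d] by simp
  moreover have "std_symp (\<sigma> (2 * i)) (\<sigma> (2 * i + 1)) = 1" if "i < d" for i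
    using ev[OF that] s1[OF that] by (simp add: std_symp_def)
  then have "(\<Prod>i<d. std_symp (\<sigma> (2 * i)) (\<sigma> (2 * i + 1))) = 1" by (intro prod.neutral) simp
  ultimately show ?case by simp
next
  case (Suc m)
  let ?A = "\<lambda>\<sigma>. {i. i < d \<and> odd (\<sigma> (2 * i))}"
  \<comment> \<open>An inverted pair. Swapping its two members lowers the number of odd values at
    even positions, on which the induction runs, by one.\<close>
  obtain j where j: "j < d" "odd (\<sigma> (2 * j))" 
  proof -
    have "?A \<sigma> \<noteq> {}" using Suc.hyps(2) by (metis card.empty nat.distinct(1))
    then show thesis using that by blast
  qed
  let ?t = "Transposition.transpose (2 * j) (2 * j + 1)"
  define \<tau> where "\<tau> = \<sigma> \<circ> ?t"
  have t: "?t permutes {..<2*d}" using j by (intro permutes_swap_id) auto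
  have tp: "\<tau> permutes {..<2*d}" unfolding \<tau>_def using t Suc.prems(1) by (rule permutes_compose)
  have oth: "\<tau> (2 * i) = \<sigma> (2 * i)" "\<tau> (2 * i + 1) = \<sigma> (2 * i + 1)" if "i \<noteq> j" for i
    using that double_not_eq_Suc_double[of i j] double_not_eq_Suc_double[of j i] Suc_double_not_eq_double[of i j]
    by (simp_all add: \<tau>_def Transposition.transpose_def)
  have at: "\<tau> (2 * j) = \<sigma> (2 * j + 1)" "\<tau> (2 * j + 1) = \<sigma> (2 * j)" by (auto simp: \<tau>_def)
  have nz: "std_symp (\<sigma> (2 * j)) (\<sigma> (2 * j + 1)) \<noteq> 0"
    using Suc.prems(2) j by simp
  then have ev: "even (\<sigma> (2 * j + 1))" using j by (auto simp: std_symp_def split: if_splits)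
  have A: "?A \<sigma> = insert j (?A \<tau>)" "j \<notin> ?A \<tau>" 
  proof -
    have "i \<in> ?A \<sigma> \<longleftrightarrow> i = j \<or> i \<in> ?A \<tau>" for i
      using j ev at(1) oth(1)[of i] by (cases "i = j") simp_all
    then show "?A \<sigma> = insert j (?A \<tau>)" by blast
    show "j \<notin> ?A \<tau>" using ev at(1) by simp
  qed
  have m: "m = card (?A \<tau>)" using Suc.hyps(2) A by simp
  have skew: "std_symp (\<tau> (2 * j)) (\<tau> (2 * j + 1)) = - std_symp (\<sigma> (2 * j)) (\<sigma> (2 * j + 1))"
    unfolding at using j ev by (simp add: std_symp_def)
  have P: "(\<Prod>i<d. std_symp (\<tau> (2 * i)) (\<tau> (2 * i + 1))) = - (\<Prod>i<d. std_symp (\<sigma> (2 * i)) (\<sigma> (2 * i + 1)))"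
  proof -
    have "(\<Prod>i<d. std_symp (\<tau> (2 * i)) (\<tau> (2 * i + 1))) =
        std_symp (\<tau> (2 * j)) (\<tau> (2 * j + 1)) * (\<Prod>i\<in>{..<d} - {j}. std_symp (\<tau> (2 * i)) (\<tau> (2 * i + 1)))"
      using j by (intro prod.remove) auto
    also have "(\<Prod>i\<in>{..<d} - {j}. std_symp (\<tau> (2 * i)) (\<tau> (2 * i + 1))) =
        (\<Prod>i\<in>{..<d} - {j}. std_symp (\<sigma> (2 * i)) (\<sigma> (2 * i + 1)))"
      by (rule prod.cong) (auto simp: oth simp del: One_nat_def add_Suc_right)
    also have "std_symp (\<tau> (2 * j)) (\<tau> (2 * j + 1)) * \<dots> = - (std_symp (\<sigma> (2 * j)) (\<sigma> (2 * j + 1)) * \<dots>)"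
      by (simp only: skew minus_mult_left)
    also have "std_symp (\<sigma> (2 * j)) (\<sigma> (2 * j + 1)) * (\<Prod>i\<in>{..<d} - {j}. std_symp (\<sigma> (2 * i)) (\<sigma> (2 * i + 1))) =
        (\<Prod>i<d. std_symp (\<sigma> (2 * i)) (\<sigma> (2 * i + 1)))"
      using j by (intro prod.remove[symmetric]) auto
    finally show ?thesis .
  qed
  have sg: "sign \<tau> = - sign \<sigma>"
    unfolding \<tau>_def using t Suc.prems(1)
    by (simp add: sign_compose permutes_imp_permutation[OF finite_lessThan] sign_swap_id)
  have "(\<Prod>i<d. std_symp (\<tau> (2 * i)) (\<tau> (2 * i + 1))) \<noteq> 0"
    unfolding P using Suc.prems(2) by (simp only: neg_equal_0_iff_equal not_False_eq_True)
  then have "of_int (sign \<tau>) * (\<Prod>i<d. std_symp (\<tau> (2 * i)) (\<tau> (2 * i + 1))) = 1"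
    by (rule Suc.hyps(1)[OF m tp])
  then show ?case unfolding P sg by simp
qed

text \<open>No cancellation occurs: by \<open>std_symp_term_pos\<close> every nonzero term equals 1,
  and the identity gives such a term.\<close>

lemma wedge_power_std_symp: "wedge_power d std_symp id > 0"
proof -
  let ?f = "\<lambda>\<sigma>. of_int (sign \<sigma>) * (\<Prod>i<d. std_symp (\<sigma> (2 * i)) (\<sigma> (2 * i + 1)))"
  have "0 < sum ?f {\<sigma>. \<sigma> permutes {..<2 * d}}"
  proof (rule sum_pos2[of _ id])
    show "finite {\<sigma>. \<sigma> permutes {..<2 * d}}" by (simp add: finite_permutations)
    show "0 < ?f id" by (simp add: std_symp_def)
    show "0 \<le> ?f \<sigma>" if "\<sigma> \<in> {\<sigma>. \<sigma> permutes {..<2 * d}}" for \<sigma>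
      using std_symp_term_pos[of \<sigma> d] that
      apply (cases "(\<Prod>i<d. std_symp (\<sigma> (2 * i)) (\<sigma> (2 * i + 1))) = 0")
       apply (simp del: prod_zero_iff One_nat_def add_Suc_right)
      apply (drule meta_mp) apply simp apply (drule meta_mp) apply assumption
      by linarith
  qed (simp add: permutes_id)
  then show ?thesis by (simp add: wedge_power_def)
qed

text \<open>Taking determinants in the hypothesis would only give the square. The Pfaffians of
  \<open>std_symp\<close> and of its negative differ by \<open>(-1) ^ d\<close>, and comparing them
  gives the determinant itself. This is the source of n_r/2 in the criterion.\<close>

lemma ldet_antisymplectic:
  assumes "\<And>a b. a < 2 * d \<Longrightarrow> b < 2 * d \<Longrightarrow>
      (\<Sum>k<2 * d. \<Sum>l<2 * d. M a k * M b l * std_symp k l) = - std_symp a b"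
  shows "ldet {..<2 * d} M = (-1) ^ d"
proof -
  have "wedge_power d (\<lambda>a b. - std_symp a b) id = ldet {..<2 * d} M * wedge_power d std_symp id"
    using assms by (intro wedge_power_congruence) simp
  moreover have "wedge_power d (\<lambda>a b. - std_symp a b) id = (-1) ^ d * wedge_power d std_symp id"
    by (simp add: wedge_power_def prod_uminus sum_distrib_left mult.left_commute[of _ "(-1) ^ d"])
  ultimately show ?thesis using wedge_power_std_symp[of d] by simp
qed

section \<open>The identity component of the isometry group\<close>

lemma bounded_bilinear_matrix_mult: "bounded_bilinear ((**) :: real^'n^'n \<Rightarrow> _)"
  unfolding bilinear_conv_bounded_bilinear[symmetric] bilinear_def
  by (intro conjI allI linearI)
    (simp_all add: matrix_matrix_mult_def vec_eq_iff sum.distrib sum_distrib_left distrib_left distrib_right mult_ac)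

lemmas matrix_mult_simps =
  bounded_bilinear.add_left[OF bounded_bilinear_matrix_mult]
  bounded_bilinear.add_right[OF bounded_bilinear_matrix_mult]
  bounded_bilinear.diff_left[OF bounded_bilinear_matrix_mult]
  bounded_bilinear.diff_right[OF bounded_bilinear_matrix_mult]
  bounded_bilinear.minus_left[OF bounded_bilinear_matrix_mult]
  bounded_bilinear.minus_right[OF bounded_bilinear_matrix_mult]
  bounded_bilinear.scaleR_left[OF bounded_bilinear_matrix_mult]
  bounded_bilinear.scaleR_right[OF bounded_bilinear_matrix_mult]
  bounded_bilinear.zero_left[OF bounded_bilinear_matrix_mult]
  bounded_bilinear.zero_right[OF bounded_bilinear_matrix_mult]

lemma matrix_inv_inverses:
  fixes g :: "real^'n^'n"
  assumes "invertible g"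
  shows "g ** matrix_inv g = mat 1" "matrix_inv g ** g = mat 1"
  using someI_ex[OF assms[unfolded invertible_def]] by (auto simp: matrix_inv_def)

lemma invertible_mat_1: "invertible (mat 1 :: real^'n^'n)"
  unfolding invertible_def by (rule exI[of _ "mat 1"]) simp

lemma mat_1_O_group: "mat 1 \<in> O_group B"
  by (simp add: O_group_def invertible_mat_1)

lemma O_group_mult:
  assumes "g \<in> O_group B" "k \<in> O_group B"
  shows "g ** k \<in> O_group B"
  using assms by (auto simp: O_group_def invertible_mult matrix_vector_mul_assoc[symmetric])

lemma mat_1_SO_plus: "mat 1 \<in> SO_plus B"
  unfolding SO_plus_def by (simp add: connected_component_refl mat_1_O_group)

lemma SO_plus_subset: "SO_plus B \<subseteq> O_group B"
  unfolding SO_plus_def by (rule connected_component_subset)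

lemma SO_plusI:
  assumes "connected S" "S \<subseteq> O_group B" "k \<in> S" "k \<in> SO_plus B" "g \<in> S"
  shows "g \<in> SO_plus B"
  using assms unfolding SO_plus_def
  by (metis connected_component_maximal connected_component_eq subsetD)

lemma SO_plus_path:
  fixes \<gamma> :: "real \<Rightarrow> real^'n^'n"
  assumes "continuous_on {0..1} \<gamma>" "\<And>t. 0 \<le> t \<Longrightarrow> t \<le> 1 \<Longrightarrow> \<gamma> t \<in> O_group B"
    and "\<gamma> 0 \<in> SO_plus B"
  shows "\<gamma> 1 \<in> SO_plus B"
proof (rule SO_plusI)
  show "connected (\<gamma> ` {0..1})" using assms(1) by (intro connected_continuous_image) auto
qed (use assms in auto)

lemma SO_plus_mult:
  fixes g k :: "real^'n^'n"
  assumes "g \<in> SO_plus B" "k \<in> SO_plus B"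
  shows "g ** k \<in> SO_plus B"
proof (rule SO_plusI)
  show "connected ((**) g ` SO_plus B)"
  proof (rule connected_continuous_image)
    show "continuous_on (SO_plus B) ((**) g)"
      by (intro linear_continuous_on bounded_bilinear.bounded_linear_right bounded_bilinear_matrix_mult)
    show "connected (SO_plus B)" unfolding SO_plus_def by (rule connected_connected_component)
  qed
  show "(**) g ` SO_plus B \<subseteq> O_group B"
    using assms SO_plus_subset by (auto intro!: O_group_mult)
  show "g \<in> (**) g ` SO_plus B" using mat_1_SO_plus[of B] by (intro image_eqI[of _ _ "mat 1"]) simp_all
qed (use assms in auto)

lemma SO_plus_invertible: "g \<in> SO_plus B \<Longrightarrow> invertible g"
  using SO_plus_subset by (auto simp: O_group_def)

lemma conj_eq_iff:
  fixes g :: "real^'n^'n"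
  assumes "invertible g"
  shows "g ** a ** matrix_inv g = c \<longleftrightarrow> g ** a = c ** g"
proof
  assume "g ** a ** matrix_inv g = c"
  then have "c ** g = g ** a ** (matrix_inv g ** g)" by (simp add: matrix_mul_assoc)
  then show "g ** a = c ** g" by (simp add: matrix_inv_inverses assms)
next
  assume "g ** a = c ** g"
  then have "g ** a ** matrix_inv g = c ** (g ** matrix_inv g)" by (simp add: matrix_mul_assoc)
  then show "g ** a ** matrix_inv g = c" by (simp add: matrix_inv_inverses assms)
qed

lemma mem_adjoint_orbit_iff:
  "c \<in> adjoint_orbit B a \<longleftrightarrow> (\<exists>g\<in>SO_plus B. g ** a = c ** g)"
  proof
  assume "c \<in> adjoint_orbit B a"
  then obtain g where "g \<in> SO_plus B" "g ** a ** matrix_inv g = c" by (auto simp: adjoint_orbit_def)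
  then show "\<exists>g\<in>SO_plus B. g ** a = c ** g" using conj_eq_iff[OF SO_plus_invertible] by blast
next
  assume "\<exists>g\<in>SO_plus B. g ** a = c ** g"
  then obtain g where "g \<in> SO_plus B" "g ** a = c ** g" by blast
  then have "g \<in> SO_plus B" "g ** a ** matrix_inv g = c" using conj_eq_iff[OF SO_plus_invertible] by blast+
  then show "c \<in> adjoint_orbit B a" by (auto simp: adjoint_orbit_def)
qed

lemma adjoint_orbit_trans:
  assumes "g \<in> SO_plus B" "g ** a = a' ** g"
  shows "adjoint_orbit B a' \<subseteq> adjoint_orbit B a"
proof
  fix c assume "c \<in> adjoint_orbit B a'"
  then obtain k where k: "k \<in> SO_plus B" "k ** a' = c ** k" by (auto simp: mem_adjoint_orbit_iff)
  have "(k ** g) ** a = c ** (k ** g)"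
    by (simp only: matrix_mul_assoc[symmetric] assms(2)) (simp only: matrix_mul_assoc k(2))
  then show "c \<in> adjoint_orbit B a"
    using SO_plus_mult[OF k(1) assms(1)] by (auto simp: mem_adjoint_orbit_iff)
qed

lemma adjoint_orbit_eq_minus_iff:
  "adjoint_orbit B x = adjoint_orbit B (- x) \<longleftrightarrow> (\<exists>g\<in>SO_plus B. g ** x = - x ** g)"
proof
  assume "adjoint_orbit B x = adjoint_orbit B (- x)"
  moreover have "- x \<in> adjoint_orbit B (- x)"
    using mat_1_SO_plus by (auto simp: mem_adjoint_orbit_iff intro!: bexI[of _ "mat 1"])
  ultimately show "\<exists>g\<in>SO_plus B. g ** x = - x ** g" by (auto simp: mem_adjoint_orbit_iff)
next
  assume "\<exists>g\<in>SO_plus B. g ** x = - x ** g"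
  then obtain g where g: "g \<in> SO_plus B" "g ** x = - x ** g" by blast
  moreover have "g ** (- x) = x ** g" using g(2) by (simp add: matrix_mult_simps)
  ultimately show "adjoint_orbit B x = adjoint_orbit B (- x)"
    using adjoint_orbit_trans[of g B x "- x"] adjoint_orbit_trans[of g B "- x" x] by blast
qed

lemma bilinear_lsum: "bilinear h \<Longrightarrow> h (sum f A) z = (\<Sum>a\<in>A. h (f a) z)"
  and bilinear_rsum: "bilinear h \<Longrightarrow> h z (sum f A) = (\<Sum>a\<in>A. h z (f a))"
  unfolding bilinear_def by (auto intro: linear_sum[of "\<lambda>x. h x z"] linear_sum[of "\<lambda>x. h z x"])

lemma bilinear_form_on_UNIV: "bilinear_form_on UNIV f \<longleftrightarrow> bilinear f"
  by (auto simp: bilinear_form_on_def bilinear_def linear_iff)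

text \<open>A semidefinite subspace \<open>N\<close> is enough: a positive definite complement \<open>P\<close> always exists, and
  for an isometry \<open>g\<close> no vector of \<open>N\<close> can be mapped into \<open>P\<close>. So the compression of \<open>g\<close> to \<open>N\<close>
  along \<open>P\<close> remains invertible on the whole identity component.\<close>

lemma SO_plus_compression_det_pos:
  fixes B :: "real^'n \<Rightarrow> real^'n \<Rightarrow> real" and Q :: "real^'n^'n"
  assumes proj: "Q ** Q = Q"
    and pos: "\<And>v. Q *v v = 0 \<Longrightarrow> v \<noteq> 0 \<Longrightarrow> B v v > 0"
    and nonpos: "\<And>v. Q *v v = v \<Longrightarrow> B v v \<le> 0"
    and B: "bilinear B"
    and g: "g \<in> SO_plus B"
  shows "det (Q ** g ** Q + (mat 1 - Q)) > 0"
proof -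
  let ?L = "\<lambda>g. Q ** g ** Q + (mat 1 - Q)"
  have nz: "det (?L k) \<noteq> 0" if k: "k \<in> O_group B" for k
  proof
    assume "det (?L k) = 0"
    then obtain v where v: "?L k *v v = 0" "v \<noteq> 0"
      using invertible_det_nz[of "?L k"] matrix_left_invertible_ker[of "?L k"] invertible_left_inverse[of "?L k"]
      by blast
    \<comment> \<open>The summand \<open>mat 1 - Q\<close> extends the compression by the identity.
      Applying \<open>Q\<close> separates the two summands, so a kernel vector \<open>v\<close> lies
      in the range of \<open>Q\<close> while \<open>k\<close> maps it into the kernel of
      \<open>Q\<close>, where \<open>B\<close> is positive.\<close>
    have QL: "Q *v (k *v (Q *v v)) + (v - Q *v v) = 0"
      using v(1) by (simp add: matrix_vector_mult_add_rdistrib matrix_vector_mult_diff_rdistrib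
          flip: matrix_vector_mul_assoc)
    have QQ: "Q *v (Q *v u) = Q *v u" for u by (simp add: matrix_vector_mul_assoc proj)
    have "Q *v (Q *v (k *v (Q *v v)) + (v - Q *v v)) = Q *v (k *v (Q *v v))"
      by (simp add: matrix_vector_right_distrib matrix_vector_mult_diff_distrib QQ)
    then have z: "Q *v (k *v (Q *v v)) = 0" using QL by simp
    then have Qv: "Q *v v = v" using QL by simp
    have "B (k *v v) (k *v v) = B v v" using k by (simp add: O_group_def)
    moreover have "k *v v \<noteq> 0" 
    proof
      assume "k *v v = 0"
      then have "(matrix_inv k ** k) *v v = 0" by (simp flip: matrix_vector_mul_assoc)
      then show False using k v(2) by (simp add: matrix_inv_inverses O_group_def)
    qed
    ultimately show False using pos[of "k *v v"] nonpos[of v] z Qv by simp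
  qed
  have lin: "linear (\<lambda>g. Q ** g ** Q)"
    by (rule linearI) (simp_all add: matrix_mult_simps)
  have "continuous_on (SO_plus B) (\<lambda>g. det (?L g))"
    unfolding det_def using lin
    by (intro continuous_intros linear_continuous_on) (auto simp: linear_linear)
  moreover have "connected (SO_plus B)" unfolding SO_plus_def by (rule connected_connected_component)
  ultimately have "is_interval ((\<lambda>g. det (?L g)) ` SO_plus B)"
    by (simp add: connected_continuous_image is_interval_connected_1)
  have "?L (mat 1) = mat 1" by (simp add: proj)
  then have "1 \<in> (\<lambda>g. det (?L g)) ` SO_plus B" using mat_1_SO_plus[of B]
    by (metis (no_types, lifting) det_I image_eqI)
  have "0 \<notin> (\<lambda>g. det (?L g)) ` SO_plus B" using nz SO_plus_subset by fastforce
  have "0 < x" if "x \<in> (\<lambda>g. det (?L g)) ` SO_plus B" for x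
  proof (rule ccontr)
    assume "\<not> 0 < x"
    then have "x \<le> 0" by simp
    have "\<And>a b c. a \<in> (\<lambda>g. det (?L g)) ` SO_plus B \<Longrightarrow> b \<in> (\<lambda>g. det (?L g)) ` SO_plus B \<Longrightarrow> a \<le> c \<Longrightarrow> c \<le> b \<Longrightarrow>
        c \<in> (\<lambda>g. det (?L g)) ` SO_plus B"
      using \<open>is_interval _\<close> unfolding is_interval_1 by blast
    from this[OF that \<open>1 \<in> _\<close> \<open>x \<le> 0\<close> zero_le_one] show False using \<open>0 \<notin> _\<close> by contradiction
  qed
  then show ?thesis using g by blast
qed

section \<open>Products of reflections\<close>

text \<open>For pairwise orthogonal \<open>u a\<close> the reflections commute and their composition
  is this single sum. A vector with \<open>B (u a) (u a) = 0\<close> drops out, since division by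
  zero gives zero.\<close>

definition refl_prod :: "(real^'n \<Rightarrow> real^'n \<Rightarrow> real) \<Rightarrow> 'i set \<Rightarrow> ('i \<Rightarrow> real^'n) \<Rightarrow> real^'n \<Rightarrow> real^'n" where
  "refl_prod B A u v = v - (\<Sum>a\<in>A. (2 * B v (u a) / B (u a) (u a)) *\<^sub>R u a)"

context
  fixes B :: "real^'n \<Rightarrow> real^'n \<Rightarrow> real"
  assumes bil: "bilinear B" and sym: "\<And>v w. B v w = B w v"
begin

lemmas B_simps = bilinear_ladd[OF bil] bilinear_radd[OF bil] bilinear_lsub[OF bil] bilinear_rsub[OF bil]
  bilinear_lmul[OF bil] bilinear_rmul[OF bil] bilinear_lneg[OF bil] bilinear_rneg[OF bil]
  bilinear_lzero[OF bil] bilinear_rzero[OF bil] bilinear_lsum[OF bil] bilinear_rsum[OF bil]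

lemma linear_refl_prod: "linear (refl_prod B A u)"
proof -
  have "linear (\<lambda>v. (2 * B v (u a) / B (u a) (u a)) *\<^sub>R u a)" for a
    by (rule linearI) (simp_all add: B_simps distrib_left add_divide_distrib scaleR_add_left)
  then show ?thesis
    unfolding refl_prod_def[abs_def] by (intro linear_compose_sub linear_ident linear_compose_sum ballI)
qed

lemma refl_prod_Un:
  assumes "finite A" "finite A'" "A \<inter> A' = {}"
    and "\<And>a b. a \<in> A \<Longrightarrow> b \<in> A' \<Longrightarrow> B (u a) (u b) = 0"
  shows "refl_prod B (A \<union> A') u v = refl_prod B A u (refl_prod B A' u v)"
proof -
  have "B (refl_prod B A' u v) (u a) = B v (u a)" if "a \<in> A" for a
    using assms(4)[OF that] by (simp add: refl_prod_def B_simps sym[of _ "u a"])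
  then show ?thesis
    using assms by (simp add: refl_prod_def[of _ "A \<union> A'"] refl_prod_def[of _ A] refl_prod_def[of _ A'] sum.union_disjoint)
qed

lemma refl_prod_isometry:
  assumes "finite A" "pairwise (\<lambda>a b. B (u a) (u b) = 0) A" "\<And>a. a \<in> A \<Longrightarrow> B (u a) (u a) \<noteq> 0"
  shows "B (refl_prod B A u v) (refl_prod B A u w) = B v w"
  using assms
proof (induction A arbitrary: v w rule: finite_induct)
  case empty
  then show ?case by (simp add: refl_prod_def)
next
  case (insert a A)
  have R: "refl_prod B (insert a A) u v = refl_prod B {a} u (refl_prod B A u v)" for v
    using refl_prod_Un[of "{a}" A u v] insert by (auto simp: pairwise_insert)
  have "B (refl_prod B {a} u v) (refl_prod B {a} u w) = B v w" for v w
  proof -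
    define s t where "s = 2 * B v (u a) / B (u a) (u a)" and "t = 2 * B w (u a) / B (u a) (u a)"
    have st: "s * B (u a) (u a) = 2 * B v (u a)" "t * B (u a) (u a) = 2 * B w (u a)"
      using insert.prems(2)[of a] by (simp_all add: s_def t_def)
    have "B (v - s *\<^sub>R u a) (w - t *\<^sub>R u a) =
        B v w - t * B v (u a) - s * B w (u a) + t * (s * B (u a) (u a))"
      by (simp add: B_simps sym[of "u a" w] algebra_simps)
    also have "\<dots> = B v w - s * B w (u a) + t * B v (u a)" unfolding st by simp
    also have "t * B v (u a) = s * B w (u a)" by (simp add: s_def t_def)
    finally show ?thesis by (simp add: refl_prod_def s_def t_def)
  qed
  moreover have "B (refl_prod B A u v) (refl_prod B A u w) = B v w" for v w
    using insert.prems by (intro insert.IH) (simp_all add: pairwise_insert)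
  ultimately show ?case unfolding R by simp
qed

lemma matrix_refl_prod_O_group:
  assumes "finite A" "pairwise (\<lambda>a b. B (u a) (u b) = 0) A" "\<And>a. a \<in> A \<Longrightarrow> B (u a) (u a) \<noteq> 0"
  shows "matrix (refl_prod B A u) \<in> O_group B"
proof -
  have "refl_prod B A u (refl_prod B A u v) = v" for v
  proof -
    have "B (refl_prod B A u v) (u a) = - B v (u a)" if "a \<in> A" for a
    proof -
      have "B (refl_prod B A u v) (u a) = B v (u a) - (\<Sum>b\<in>A. 2 * B v (u b) / B (u b) (u b) * B (u b) (u a))"
        by (simp add: refl_prod_def B_simps)
      also have "(\<Sum>b\<in>A. 2 * B v (u b) / B (u b) (u b) * B (u b) (u a)) =
          (\<Sum>b\<in>A. if b = a then 2 * B v (u a) else 0)"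
        using assms that by (intro sum.cong) (auto simp: pairwise_def)
      finally show ?thesis using assms that by simp
    qed
    then have "refl_prod B A u (refl_prod B A u v) = refl_prod B A u v - (\<Sum>a\<in>A. (- (2 * B v (u a) / B (u a) (u a))) *\<^sub>R u a)"
      by (subst refl_prod_def) (auto intro!: sum.cong)
    also have "\<dots> = v" by (simp add: refl_prod_def sum_negf)
    finally show ?thesis .
  qed
  then have "matrix (refl_prod B A u) ** matrix (refl_prod B A u) = mat 1"
    unfolding matrix_compose[OF linear_refl_prod linear_refl_prod, symmetric] by (simp add: comp_def matrix_id_mat_1[unfolded id_def])
  then have "invertible (matrix (refl_prod B A u))" unfolding invertible_def by blast
  then show ?thesis
    using refl_prod_isometry[OF assms] by (simp add: O_group_def fun_cong[OF matrix_vector_mul(2)[OF linear_refl_prod]])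
qed

text \<open>The two norms have the same sign, so \<open>B\<close> is definite on the plane of
  \<open>a\<close> and \<open>b\<close>, and the segment from \<open>b\<close> to \<open>a\<close>
  avoids isotropic vectors. Reflecting in \<open>b\<close> and then in a moving point of the segment
  joins the identity to the product.\<close>

lemma refl_pair_SO_plus:
  assumes "B a b = 0" "B a a * B b b > 0"
  shows "matrix (refl_prod B {True, False} (\<lambda>i. if i then a else b)) \<in> SO_plus B"
proof -
  define c where "c t = t *\<^sub>R a + (1 - t) *\<^sub>R b" for t :: real
  define \<gamma> where "\<gamma> t = matrix (refl_prod B {c t} id) ** matrix (refl_prod B {b} id)" for t
  have Bc: "B (c t) (c t) \<noteq> 0" for t
  proof -
    have eq: "B (c t) (c t) = t\<^sup>2 * B a a + (1 - t)\<^sup>2 * B b b"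
      using assms(1) sym[of b a] by (simp add: c_def B_simps power2_eq_square algebra_simps)
    \<comment> \<open>Multiplying by \<open>B b b\<close> reduces both possible signs to the
      positive case.\<close>
    have "B b b * B (c t) (c t) = t\<^sup>2 * (B a a * B b b) + (1 - t)\<^sup>2 * (B b b)\<^sup>2"
      unfolding eq by (simp add: power2_eq_square algebra_simps)
    moreover have "t\<^sup>2 * (B a a * B b b) + (1 - t)\<^sup>2 * (B b b)\<^sup>2 > 0"
    proof (cases "t = 0")
      case True then show ?thesis using assms(2) by auto
    next
      case False
      then have "t\<^sup>2 * (B a a * B b b) > 0" using assms(2) by simp
      then show ?thesis by (meson add_pos_nonneg mult_nonneg_nonneg zero_le_power2)
    qed
    ultimately show ?thesis by auto
  qed
  have "\<gamma> 1 \<in> SO_plus B"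
  proof (rule SO_plus_path)
    show "\<gamma> t \<in> O_group B" if "0 \<le> t" "t \<le> 1" for t
      unfolding \<gamma>_def using Bc[of t] Bc[of 0] by (intro O_group_mult matrix_refl_prod_O_group) (auto simp: c_def)
    have "\<gamma> 0 = mat 1"
    proof -
      have "refl_prod B {b} id (refl_prod B {b} id v) = v" for v
        using Bc[of 0] by (simp add: refl_prod_def B_simps c_def field_simps)
      then show ?thesis
        unfolding \<gamma>_def c_def by (simp add: comp_def matrix_id_mat_1[unfolded id_def]
          flip: matrix_compose[OF linear_refl_prod linear_refl_prod])
    qed
    then show "\<gamma> 0 \<in> SO_plus B" by (simp add: mat_1_SO_plus)
    have bb: "bounded_bilinear B" using bil by (simp add: bilinear_conv_bounded_bilinear)
    have "continuous_on {0..1} (\<lambda>t. matrix (refl_prod B {c t} id))"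
      unfolding matrix_def refl_prod_def
      using Bc by (auto intro!: continuous_on_vec_lambda continuous_intros bounded_bilinear.continuous_on[OF bb] simp: c_def)
    then show "continuous_on {0..1} \<gamma>"
      unfolding \<gamma>_def by (intro bounded_bilinear.continuous_on[OF bounded_bilinear_matrix_mult] continuous_intros)
  qed
  moreover have "\<gamma> 1 = matrix (refl_prod B {True, False} (\<lambda>i. if i then a else b))"
  proof -
    have "refl_prod B {a} id (refl_prod B {b} id v) = refl_prod B {True, False} (\<lambda>i. if i then a else b) v" for v
      using assms(1) sym[of b a] by (simp add: refl_prod_def B_simps)
    then show ?thesis
      unfolding \<gamma>_def c_def
      by (simp add: comp_def flip: matrix_compose[OF linear_refl_prod linear_refl_prod])
  qed
  ultimately show ?thesis by simp
qed

text \<open>The reflections are removed two at a time, both in positive or both in negative vectors;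
  orthogonality allows any two of them to be split off.\<close>

lemma refl_prod_SO_plus:
  assumes "finite A" "pairwise (\<lambda>a b. B (u a) (u b) = 0) A" "\<And>a. a \<in> A \<Longrightarrow> B (u a) (u a) \<noteq> 0"
    and "even (card {a\<in>A. B (u a) (u a) > 0})" "even (card {a\<in>A. B (u a) (u a) < 0})"
  shows "matrix (refl_prod B A u) \<in> SO_plus B"
  using assms
proof (induction "card A" arbitrary: A rule: less_induct)
  case less
  show ?case
  proof (cases "A = {}")
    case True
    then have "refl_prod B A u = id" by (simp add: refl_prod_def fun_eq_iff)
    then show ?thesis by (simp add: mat_1_SO_plus matrix_id_mat_1)
  next
    case False
    let ?P = "\<lambda>A. {a\<in>A. B (u a) (u a) > 0}" and ?N = "\<lambda>A. {a\<in>A. B (u a) (u a) < 0}"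
    have two: "\<exists>a b. a \<in> S \<and> b \<in> S \<and> a \<noteq> b" if "even (card S)" "S \<noteq> {}" "finite S" for S :: "'a set"
    proof -
      have "card S \<noteq> 0" "card S \<noteq> 1" using that by auto
      then have "\<not> card S \<le> Suc 0" by linarith
      then show ?thesis using card_le_Suc0_iff_eq[OF that(3)] by blast
    qed
    have "?P A \<noteq> {} \<or> ?N A \<noteq> {}" using False less.prems(3) by (force simp: not_less_iff_gr_or_eq linorder_neq_iff)
    then have "\<exists>a b. a \<in> A \<and> b \<in> A \<and> a \<noteq> b \<and> ({a, b} \<subseteq> ?P A \<or> {a, b} \<subseteq> ?N A)"
    proof (elim disjE)
      have fin: "finite (?P A)" "finite (?N A)" using less.prems(1) by auto
      show ?thesis if "?P A \<noteq> {}" using two[OF less.prems(4) that fin(1)] by blast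
      show ?thesis if "?N A \<noteq> {}" using two[OF less.prems(5) that fin(2)] by blast
    qed
    then obtain a b where ab: "a \<in> A" "b \<in> A" "a \<noteq> b"
      "{a, b} \<subseteq> ?P A \<or> {a, b} \<subseteq> ?N A" by blast
    let ?A = "A - {a, b}"
    have "matrix (refl_prod B ?A u) \<in> SO_plus B"
    proof (rule less.hyps)
      show "card ?A < card A" using ab less.prems(1) by (intro psubset_card_mono) auto
      show "pairwise (\<lambda>a b. B (u a) (u b) = 0) ?A" using less.prems(2) by (rule pairwise_subset) auto
      have ev: "even (card S) \<Longrightarrow> {a, b} \<subseteq> S \<Longrightarrow> finite S \<Longrightarrow> even (card (S - {a, b}))" for S
        using ab(3) by (subst card_Diff_subset) auto
      have eq: "?P ?A = ?P A - {a, b}" "?N ?A = ?N A - {a, b}" by auto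
      have "?N A - {a,b} = ?N A" if "{a, b} \<subseteq> ?P A" using that by auto
      moreover have "?P A - {a,b} = ?P A" if "{a, b} \<subseteq> ?N A" using that by auto
      ultimately show "even (card (?P ?A))" "even (card (?N ?A))"
        unfolding eq using ab(4) ev[of "?P A"] ev[of "?N A"] less.prems by auto
    qed (use less.prems in auto)
    moreover have "matrix (refl_prod B {True, False} (\<lambda>i. if i then u a else u b)) \<in> SO_plus B"
      using ab less.prems(2) by (intro refl_pair_SO_plus) (auto simp: pairwise_def zero_less_mult_iff)
    ultimately have S: "matrix (refl_prod B {True, False} (\<lambda>i. if i then u a else u b)) ** matrix (refl_prod B ?A u) \<in> SO_plus B"
      by (intro SO_plus_mult)
    have R: "refl_prod B A u v = refl_prod B {True, False} (\<lambda>i. if i then u a else u b) (refl_prod B ?A u v)" for v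
    proof -
      have "refl_prod B ({a, b} \<union> ?A) u v = refl_prod B {a, b} u (refl_prod B ?A u v)"
        using less.prems ab by (intro refl_prod_Un) (auto simp: pairwise_def)
      moreover have "{a, b} \<union> ?A = A" using ab by auto
      moreover have "refl_prod B {a, b} u w = refl_prod B {True, False} (\<lambda>i. if i then u a else u b) w" for w
        using ab(3) by (simp add: refl_prod_def)
      ultimately show ?thesis by simp
    qed
    have "refl_prod B A u = refl_prod B {True, False} (\<lambda>i. if i then u a else u b) \<circ> refl_prod B ?A u"
      by (rule ext, unfold comp_apply, rule R)
    then show ?thesis
      using S by (simp only: matrix_compose[OF linear_refl_prod linear_refl_prod])
  qed
qed

end

section \<open>Bases of spaces with a bilinear form\<close>

lemma bilinear_form_on_sum:
  assumes f: "bilinear_form_on V f" "subspace V" and A: "finite A" "\<And>a. a \<in> A \<Longrightarrow> u a \<in> V" "w \<in> V"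
  shows "f (\<Sum>a\<in>A. k a *\<^sub>R u a) w = (\<Sum>a\<in>A. k a * f (u a) w)"
    and "f w (\<Sum>a\<in>A. k a *\<^sub>R u a) = (\<Sum>a\<in>A. k a * f w (u a))"
proof -
  have add: "f (u + v) w = f u w + f v w" "f w (u + v) = f w u + f w v"
    and scale: "f (t *\<^sub>R u) v = t * f u v" "f u (t *\<^sub>R v) = t * f u v"
    if "u \<in> V" "v \<in> V" "w \<in> V" for u v w t
    using f(1) that unfolding bilinear_form_on_def by blast+
  have z: "f 0 w = 0" "f w 0 = 0"
    using scale[of 0 w _ 0] scale[of w 0 _ 0] A(3) subspace_0[OF f(2)] by auto
  have "f (\<Sum>a\<in>A. k a *\<^sub>R u a) w = (\<Sum>a\<in>A. k a * f (u a) w) \<and>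
        f w (\<Sum>a\<in>A. k a *\<^sub>R u a) = (\<Sum>a\<in>A. k a * f w (u a))"
    using A(1,2)
  proof (induction A rule: finite_induct)
    case empty
    then show ?case by (simp add: z)
  next
    case (insert a A)
    have "(\<Sum>a\<in>A. k a *\<^sub>R u a) \<in> V"
      using insert.prems f(2) by (intro subspace_sum subspace_scale) auto
    moreover have "k a *\<^sub>R u a \<in> V" "u a \<in> V" using insert.prems f(2) by (auto intro: subspace_scale)
    ultimately show ?case using insert A(3) by (simp add: add scale)
  qed
  then show "f (\<Sum>a\<in>A. k a *\<^sub>R u a) w = (\<Sum>a\<in>A. k a * f (u a) w)"
    and "f w (\<Sum>a\<in>A. k a *\<^sub>R u a) = (\<Sum>a\<in>A. k a * f w (u a))" by auto
qed

section \<open>Symplectic bases\<close>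

definition pair_partner :: "nat \<Rightarrow> nat" where
  "pair_partner a = (if even a then a + 1 else a - 1)"

lemma pair_partner_simps [simp]:
  "pair_partner (pair_partner a) = a" "pair_partner a < 2 * d \<longleftrightarrow> a < 2 * d" "pair_partner a \<noteq> a"
  "a \<noteq> pair_partner a"
  "even (pair_partner a) \<longleftrightarrow> odd a"
proof -
  consider m where "a = 2 * m" | m where "a = 2 * m + 1" by (metis evenE oddE)
  then show "pair_partner (pair_partner a) = a" "pair_partner a < 2 * d \<longleftrightarrow> a < 2 * d" "pair_partner a \<noteq> a"
    "a \<noteq> pair_partner a" "even (pair_partner a) \<longleftrightarrow> odd a"
    by (cases; auto simp: pair_partner_def)+
qed

lemma std_symp_eq_0: "b \<noteq> pair_partner a \<Longrightarrow> std_symp a b = 0"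
  by (auto simp: std_symp_def pair_partner_def)

lemma std_symp_partner: "std_symp a (pair_partner a) = (if even a then 1 else -1)"
  "std_symp (pair_partner a) a = (if even a then -1 else 1)"
  by (auto simp: std_symp_def pair_partner_def elim!: oddE evenE)

text \<open>Pairing with \<open>w b\<close> reads off the coefficient at the partner of
  \<open>b\<close>, up to sign. This gives independence of the family and also the projection used
  in \<open>symplectic_basis\<close>.\<close>

lemma symplectic_family_expand:
  assumes f: "bilinear_form_on V f" "subspace V"
    and w: "\<And>a. a < 2 * d \<Longrightarrow> w a \<in> V" "\<And>a b. a < 2 * d \<Longrightarrow> b < 2 * d \<Longrightarrow> f (w a) (w b) = std_symp a b"
    and b: "b < 2 * d"
  shows "f (\<Sum>a<2 * d. k a *\<^sub>R w a) (w b) = k (pair_partner b) * std_symp (pair_partner b) b"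
proof -
  have "f (\<Sum>a<2 * d. k a *\<^sub>R w a) (w b) = (\<Sum>a<2 * d. k a * f (w a) (w b))"
    using w b by (intro bilinear_form_on_sum[OF f]) auto
  also have "\<dots> = (\<Sum>a<2 * d. if a = pair_partner b then k a * std_symp a b else 0)"
  proof (rule sum.cong[OF refl])
    fix a assume a: "a \<in> {..<2 * d}"
    have "std_symp a b = 0" if "a \<noteq> pair_partner b"
      using std_symp_eq_0[of b a] that by (metis pair_partner_simps(1))
    then show "k a * f (w a) (w b) = (if a = pair_partner b then k a * std_symp a b else 0)"
      using a b w(2) by auto
  qed
  finally show ?thesis using b by simp
qed

lemma symplectic_family_independent:
  assumes f: "bilinear_form_on V f" "subspace V"
    and w: "\<And>a. a < 2 * d \<Longrightarrow> w a \<in> V" "\<And>a b. a < 2 * d \<Longrightarrow> b < 2 * d \<Longrightarrow> f (w a) (w b) = std_symp a b"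
  shows "inj_on w {..<2 * d}" "independent (w ` {..<2 * d})"
proof -
  show inj: "inj_on w {..<2 * d}"
  proof (rule inj_onI)
    fix a b assume ab: "a \<in> {..<2 * d}" "b \<in> {..<2 * d}" "w a = w b"
    have "std_symp a (pair_partner a) = std_symp b (pair_partner a)"
      using w(2)[of a "pair_partner a"] w(2)[of b "pair_partner a"] ab by simp
    then have "std_symp b (pair_partner a) \<noteq> 0" by (simp add: std_symp_partner split: if_splits)
    then show "a = b" using std_symp_eq_0 by (metis pair_partner_simps(1))
  qed
  show "independent (w ` {..<2 * d})"
  proof (rule independent_if_scalars_zero)
    fix k v assume k: "(\<Sum>v\<in>w ` {..<2 * d}. k v *\<^sub>R v) = 0" and v: "v \<in> w ` {..<2 * d}"
    obtain a where a: "a < 2 * d" "v = w a" using v by auto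
    have "0 = (\<Sum>a<2 * d. k (w a) *\<^sub>R w a)" using k inj by (simp add: sum.reindex)
    then have "f 0 (w (pair_partner a)) = k (w a) * std_symp a (pair_partner a)"
      using symplectic_family_expand[OF f, of d w "pair_partner a" "\<lambda>a. k (w a)"] w a by simp
    moreover have "f 0 (w (pair_partner a)) = 0"
      using bilinear_form_on_sum(1)[OF f, of "{}" undefined "w (pair_partner a)"] w(1) a by simp
    ultimately show "k v = 0" using a by (simp add: std_symp_partner split: if_splits)
  qed simp
qed

text \<open>A symplectic family of maximal length spans: otherwise a vector orthogonal to it starts a
  further hyperbolic pair.\<close>

lemma symplectic_basis:
  assumes f: "bilinear_form_on V f" "subspace V"
    and fin: "finite F" "V \<subseteq> span F"
    and alt: "\<And>u v. u \<in> V \<Longrightarrow> v \<in> V \<Longrightarrow> f u v = - f v u"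
    and nondeg: "\<And>u. u \<in> V \<Longrightarrow> (\<And>v. v \<in> V \<Longrightarrow> f u v = 0) \<Longrightarrow> u = 0"
  obtains d w where "inj_on w {..<2 * d}" "independent (w ` {..<2 * d})" "span (w ` {..<2 * d}) = V"
    "\<And>a b. a < 2 * d \<Longrightarrow> b < 2 * d \<Longrightarrow> f (w a) (w b) = std_symp a b"
proof -
  define Q where "Q d w \<longleftrightarrow> (\<forall>a<2 * d. w a \<in> V) \<and> (\<forall>a<2 * d. \<forall>b<2 * d. f (w a) (w b) = std_symp a b)" for d w
  have bound: "d \<le> card F" if "Q d w" for d w
  proof -
    have "card (w ` {..<2 * d}) \<le> card F"
      using that symplectic_family_independent(2)[OF f, of d w] fin
      by (intro conjunct2[OF independent_span_bound]) (auto simp: Q_def)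
    then show ?thesis using that symplectic_family_independent(1)[OF f, of d w] by (simp add: card_image Q_def)
  qed
  \<comment> \<open>The empty family starts the search and \<open>card F\<close> bounds the length,
    so a longest family exists.\<close>
  have "Q 0 (\<lambda>_. 0)" by (simp add: Q_def)
  then obtain d where d: "\<exists>w. Q d w" "\<And>d'. \<exists>w. Q d' w \<Longrightarrow> d' \<le> d"
    using bound GreatestI_nat[of "\<lambda>d. \<exists>w. Q d w" 0 "card F"] Greatest_le_nat[of "\<lambda>d. \<exists>w. Q d w" _ "card F"] by blast
  then obtain w where Q: "Q d w" by blast
  then have w: "\<And>a. a < 2 * d \<Longrightarrow> w a \<in> V" "\<And>a b. a < 2 * d \<Longrightarrow> b < 2 * d \<Longrightarrow> f (w a) (w b) = std_symp a b"
    by (auto simp: Q_def)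
  let ?S = "span (w ` {..<2 * d})"
  have SV: "?S \<subseteq> V" using w(1) f(2) by (intro span_minimal) auto
  have add: "f (u - v) w = f u w - f v w" "f w (u - v) = f w u - f w v"
    and scale: "f (t *\<^sub>R u) v = t * f u v" "f u (t *\<^sub>R v) = t * f u v"
    if "u \<in> V" "v \<in> V" "w \<in> V" for u v w t
  proof -
    have *: "f (u + v) w = f u w + f v w" "f w (u + v) = f w u + f w v"
      "f (t *\<^sub>R u) v = t * f u v" "f u (t *\<^sub>R v) = t * f u v" if "u \<in> V" "v \<in> V" "w \<in> V" for u v w t
      using f(1) that unfolding bilinear_form_on_def by blast+
    show "f (t *\<^sub>R u) v = t * f u v" "f u (t *\<^sub>R v) = t * f u v" using * that by blast+
    have "(- 1) *\<^sub>R v \<in> V" using that f(2) by (intro subspace_scale) auto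
    from *(1)[OF that(1) this that(3)] *(2)[OF that(1) this that(3)]
    show "f (u - v) w = f u w - f v w" "f w (u - v) = f w u - f w v"
      using *(3)[OF that(2,3,1), of "-1"] *(4)[OF that(3,2,1), of "-1"] by simp_all
  qed
  \<comment> \<open>Projection to the span of the family: the coefficient of \<open>w a\<close> is
    recovered by pairing with its partner, and the factor \<open>std_symp\<close> restores its
    sign.\<close>
  define pr where "pr v = (\<Sum>a<2 * d. (f v (w (pair_partner a)) * std_symp a (pair_partner a)) *\<^sub>R w a)" for v
  have prV: "pr v \<in> ?S" for v unfolding pr_def by (intro span_sum span_scale span_base) auto
  have pr_orth: "f (v - pr v) (w b) = 0" if "v \<in> V" "b < 2 * d" for v b
  proof -
    have "f (pr v) (w b) = f v (w b) * std_symp (pair_partner b) b * std_symp (pair_partner b) b"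
      unfolding pr_def using that(2) by (subst symplectic_family_expand[OF f]) (auto simp: w)
    then have "f (pr v) (w b) = f v (w b)" by (simp add: std_symp_partner)
    moreover have "f (v - pr v) (w b) = f v (w b) - f (pr v) (w b)"
      using that prV SV w by (intro add) auto
    ultimately show ?thesis by simp
  qed
  have orth_S: "f u s = 0" if "u \<in> V" "\<And>b. b < 2 * d \<Longrightarrow> f u (w b) = 0" "s \<in> ?S" for u s
  proof -
    have "w ` {..<2 * d} \<subseteq> {s \<in> V. f u s = 0}" using that w(1) by auto
    moreover have "subspace {s \<in> V. f u s = 0}"
    proof (rule subspaceI)
      show "0 \<in> {s \<in> V. f u s = 0}"
        using scale(2)[of u 0 u 0] that(1) subspace_0[OF f(2)] by simp
      show "x + y \<in> {s \<in> V. f u s = 0}" if "x \<in> {s \<in> V. f u s = 0}" "y \<in> {s \<in> V. f u s = 0}" for x y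
        using that \<open>u \<in> V\<close> f unfolding bilinear_form_on_def by (auto intro: subspace_add)
      show "c *\<^sub>R x \<in> {s \<in> V. f u s = 0}" if "x \<in> {s \<in> V. f u s = 0}" for x c
        using that \<open>u \<in> V\<close> f scale by (auto intro: subspace_scale)
    qed
    ultimately show ?thesis using that(3) span_minimal by blast
  qed
  have "V \<subseteq> ?S"
  proof (rule ccontr)
    assume "\<not> V \<subseteq> ?S"
    then obtain v where v: "v \<in> V" "v \<notin> ?S" by blast
    define e where "e = v - pr v"
    have e: "e \<in> V" "e \<noteq> 0" using v prV[of v] SV f(2) by (auto simp: e_def intro: subspace_diff)
    then obtain u where u: "u \<in> V" "f e u \<noteq> 0" using nondeg by blast
    \<comment> \<open>Normalised so that \<open>e\<close> and \<open>g\<close> are the new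
      hyperbolic pair at positions \<open>2 * d\<close> and \<open>2 * d + 1\<close>. Subtracting
      \<open>pr u\<close> does not change the pairing with \<open>e\<close>, which is orthogonal to
      the span.\<close>
    define g where "g = (1 / f e u) *\<^sub>R (u - pr u)"
    have uV: "u - pr u \<in> V" using u prV[of u] SV f(2) by (auto intro: subspace_diff)
    have g: "g \<in> V" using uV f(2) by (auto simp: g_def intro: subspace_scale)
    have eS: "f e (w b) = 0" if "b < 2 * d" for b unfolding e_def using pr_orth v that by simp
    have gS: "f g (w b) = 0" if "b < 2 * d" for b
      unfolding g_def using pr_orth[OF u(1) that] scale(1)[OF uV w(1)[OF that] u(1)] by simp
    have "f e (u - pr u) = f e u"
      using add(2)[OF u(1) _ e(1), of "pr u"] orth_S[OF e(1) eS prV] prV[of u] SV by auto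
    then have eg: "f e g = 1" unfolding g_def using scale(2)[OF e(1) uV e(1)] u(2) by simp
    define w' where "w' a = (if a < 2 * d then w a else if a = 2 * d then e else g)" for a
    have "f (w' a) (w' b) = std_symp a b" if "a < 2 * Suc d" "b < 2 * Suc d" for a b
    proof -
      have self: "f z z = 0" if "z \<in> V" for z using alt[OF that that] by simp
      have *: "a < 2 * d \<or> a = 2 * d \<or> a = 2 * d + 1" "b < 2 * d \<or> b = 2 * d \<or> b = 2 * d + 1" using that by auto
      have "2 * d \<noteq> Suc m" if "even m" for m using that by (metis dvd_triv_left even_Suc)
      then show ?thesis
        using * w(2)[of a b] eS gS alt[OF w(1) e(1)] alt[OF w(1) g] eg alt[OF e(1) g] self[OF e(1)] self[OF g]
        unfolding w'_def std_symp_def by (elim disjE) auto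
    qed
    moreover have "w' a \<in> V" if "a < 2 * Suc d" for a using that w(1) e g by (auto simp: w'_def)
    ultimately have "Q (Suc d) w'" by (simp add: Q_def)
    then show False using d(2)[of "Suc d"] by auto
  qed
  then have "?S = V" using SV by blast
  with symplectic_family_independent[OF f, of d w] w that show thesis by blast
qed

lemma orthogonal_positive_span:
  assumes f: "bilinear_form_on V f" "subspace V" and P: "finite P" "P \<subseteq> V"
    and orth: "pairwise (\<lambda>u v. f u v = 0) P" and pos: "\<And>v. v \<in> P \<Longrightarrow> f v v > 0"
    and u: "u \<in> span P" "f u u \<le> 0"
  shows "u = 0"
proof -
  obtain k where k: "u = (\<Sum>v\<in>P. k v *\<^sub>R v)" using u(1) span_finite[OF P(1)] by auto
  have fu: "f u v = k v * f v v" if "v \<in> P" for v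
  proof -
    have "f u v = (\<Sum>w\<in>P. k w * f w v)"
      unfolding k using P that by (intro bilinear_form_on_sum(1)[OF f]) auto
    also have "\<dots> = (\<Sum>w\<in>P. if w = v then k v * f v v else 0)"
      using orth that by (intro sum.cong) (auto simp: pairwise_def)
    finally show ?thesis using P(1) that by simp
  qed
  have uV: "u \<in> V" using u(1) span_minimal[OF P(2) f(2)] by auto
  have "f u u = (\<Sum>v\<in>P. k v * f u v)"
    by (subst (2) k, rule bilinear_form_on_sum(2)[OF f]) (use P uV in auto)
  also have "\<dots> = (\<Sum>v\<in>P. (k v)\<^sup>2 * f v v)" using fu by (intro sum.cong) (auto simp: power2_eq_square)
  finally have "(\<Sum>v\<in>P. (k v)\<^sup>2 * f v v) \<le> 0" using u(2) by simp
  moreover have nn: "0 \<le> (k v)\<^sup>2 * f v v" if "v \<in> P" for v using pos[OF that] by simp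
  ultimately have "(\<Sum>v\<in>P. (k v)\<^sup>2 * f v v) = 0" using sum_nonneg[of P "\<lambda>v. (k v)\<^sup>2 * f v v"] by force
  then have "\<forall>v\<in>P. (k v)\<^sup>2 * f v v = 0"
    using nn by (subst (asm) sum_nonneg_eq_0_iff[OF P(1)]) auto
  then have "\<forall>v\<in>P. k v = 0" using pos by force
  then show ?thesis by (simp add: k)
qed

text \<open>One half of the law of inertia: such a span meets the positive definite
  \<open>span P\<close> only in 0, so \<open>A\<close> and \<open>P\<close> together are still
  independent and number at most p + q.\<close>

lemma signature_nonpositive_card:
  assumes sig: "has_signature V f p q"
    and A: "finite A" "independent A" "A \<subseteq> V" "\<And>u. u \<in> span A \<Longrightarrow> f u u \<le> 0"
  shows "card A \<le> q"
proof -
  obtain P N where PN: "finite P" "finite N" "card P = p" "card N = q" "P \<inter> N = {}"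
      "independent (P \<union> N)" "span (P \<union> N) = V" "pairwise (\<lambda>u v. f u v = 0) (P \<union> N)"
      "\<And>v. v \<in> P \<Longrightarrow> f v v > 0" and f: "bilinear_form_on V f" "subspace V"
    using sig unfolding has_signature_def by blast
  have PV: "P \<subseteq> V" using PN(7) span_superset by blast
  have meet: "u = 0" if "u \<in> span A" "u \<in> span P" for u
  proof (rule orthogonal_positive_span[OF f PN(1) PV _ PN(9) that(2)])
    show "pairwise (\<lambda>u v. f u v = 0) P" using PN(8) by (rule pairwise_subset) auto
  qed (use A(4) that in auto)
  have P: "independent P" using PN(6) by (rule independent_mono) auto
  have disj: "A \<inter> P = {}"
  proof -
    have "v = 0" if "v \<in> A" "v \<in> P" for v using meet that by (auto intro: span_base)
    then show ?thesis using A(2) dependent_zero by fastforce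
  qed
  have "independent (A \<union> P)"
  proof (rule independent_if_scalars_zero)
    fix k v assume k: "(\<Sum>v\<in>A \<union> P. k v *\<^sub>R v) = 0" and v: "v \<in> A \<union> P"
    let ?a = "\<Sum>v\<in>A. k v *\<^sub>R v" and ?p = "\<Sum>v\<in>P. k v *\<^sub>R v"
    have 0: "?a + ?p = 0" using k A(1) PN(1) disj by (simp add: sum.union_disjoint)
    have "?a \<in> span A" "?p \<in> span P" by (auto intro: span_sum span_scale span_base)
    moreover have "?a = - ?p" using 0 by (simp add: add_eq_0_iff2)
    ultimately have "?a = 0" using meet[of ?a] by (auto intro: span_neg)
    then have "?p = 0" using 0 by simp
    show "k v = 0"
      using v independentD[OF A(2) A(1) subset_refl \<open>?a = 0\<close>] independentD[OF P PN(1) subset_refl \<open>?p = 0\<close>] by blast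
  qed (use A(1) PN(1) in auto)
  moreover have "A \<union> P \<subseteq> span (P \<union> N)" using A(3) PV PN(7) by auto
  ultimately have "card (A \<union> P) \<le> card (P \<union> N)"
    using independent_span_bound[of "P \<union> N" "A \<union> P"] PN by auto
  then show ?thesis using A(1) PN disj by (simp add: card_Un_disjoint)
qed

section \<open>Bases adapted to the multiplicity spaces\<close>

definition bmono :: "nat \<Rightarrow> bform" where
  "bmono i = Poly_Mapping.single i 1"

lemma lookup_bmono: "Poly_Mapping.lookup (bmono i) j = (if i = j then 1 else 0)"
  by (simp add: bmono_def lookup_single when_def)

lemma V_X_bmono: "V_X (bmono i) = real i *\<^sub>R bmono (i - 1)"
  by (rule poly_mapping_eqI) (auto simp: lookup_V lookup_scaleR_bform lookup_bmono)

lemma V_H_bmono: "V_H r (bmono i) = (real r - 2 * real i) *\<^sub>R bmono i"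
  by (rule poly_mapping_eqI) (auto simp: lookup_V lookup_scaleR_bform lookup_bmono)

lemma bmono_in_V_mod: "bmono i \<in> V_mod r \<longleftrightarrow> i \<le> r"
  by (auto simp: in_V_mod_iff lookup_bmono)

lemma inj_bmono: "inj_on bmono A"
  by (rule inj_onI) (metis lookup_bmono one_neq_zero)

lemma independent_bmono: "independent (bmono ` {..r})"
proof (rule independent_if_scalars_zero)
  fix k u assume k: "(\<Sum>u\<in>bmono ` {..r}. k u *\<^sub>R u) = 0" and u: "u \<in> bmono ` {..r}"
  obtain i where i: "i \<le> r" "u = bmono i" using u by auto
  have "0 = Poly_Mapping.lookup (\<Sum>j\<le>r. k (bmono j) *\<^sub>R bmono j) i"
    using k by (simp add: sum.reindex inj_bmono)
  also have "\<dots> = (\<Sum>j\<le>r. if j = i then k (bmono j) else 0)"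
    unfolding lookup_sum by (rule sum.cong) (auto simp: lookup_scaleR_bform lookup_bmono)
  finally show "k u = 0" using i by simp
qed simp

lemma span_bmono: "span (bmono ` {..r}) = V_mod r"
proof
  show "span (bmono ` {..r}) \<subseteq> V_mod r"
    by (rule span_minimal[OF _ subspace_V_mod]) (auto simp: bmono_in_V_mod)
  show "V_mod r \<subseteq> span (bmono ` {..r})"
  proof
    fix g assume g: "g \<in> V_mod r"
    have "g = (\<Sum>i\<le>r. Poly_Mapping.lookup g i *\<^sub>R bmono i)"
    proof (rule poly_mapping_eqI)
      fix j
      have "Poly_Mapping.lookup (\<Sum>i\<le>r. Poly_Mapping.lookup g i *\<^sub>R bmono i) j =
          (\<Sum>i\<le>r. if i = j then Poly_Mapping.lookup g i else 0)"
        unfolding lookup_sum by (rule sum.cong) (auto simp: lookup_scaleR_bform lookup_bmono)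
      then show "Poly_Mapping.lookup g j = Poly_Mapping.lookup (\<Sum>i\<le>r. Poly_Mapping.lookup g i *\<^sub>R bmono i) j"
        using g by (auto simp: in_V_mod_iff)
    qed
    also have "\<dots> \<in> span (bmono ` {..r})" by (intro span_sum span_scale span_base) auto
    finally show "g \<in> span (bmono ` {..r})" .
  qed
qed

text \<open>Invariance under \<open>V_H\<close> makes monomials orthogonal unless their weights
  cancel; invariance under \<open>V_X\<close> relates consecutive \<open>c i\<close>, with solution
  (-1)^i c 0 / (r choose i). The sign in the middle comes from the signature: for
  \<open>c (r div 2) < 0\<close> the first r/2 + 1 monomials would span a subspace without positive
  vectors, one dimension too large.\<close>

lemma normalized_invariant_form_bmono:
  assumes "normalized_invariant_form r b"
  obtains c where "\<And>i k. i \<le> r \<Longrightarrow> k \<le> r \<Longrightarrow> b (bmono i) (bmono k) = (if i + k = r then c i else 0)"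
    "\<And>i. i \<le> r \<Longrightarrow> c i \<noteq> 0" "odd r \<Longrightarrow> c r = - c 0" "even r \<Longrightarrow> c (r div 2) > 0"
proof -
  define c where "c i = b (bmono i) (bmono (r - i))" for i
  have f: "bilinear_form_on (V_mod r) b" and nz: "\<exists>u\<in>V_mod r. \<exists>v\<in>V_mod r. b u v \<noteq> 0"
    and inv: "\<And>u v. u \<in> V_mod r \<Longrightarrow> v \<in> V_mod r \<Longrightarrow> b (V_X u) v + b u (V_X v) = 0"
      "\<And>u v. u \<in> V_mod r \<Longrightarrow> v \<in> V_mod r \<Longrightarrow> b (V_H r u) v + b u (V_H r v) = 0"
    and sig: "even r \<Longrightarrow> has_signature (V_mod r) b (r div 2 + 1) (r div 2)"
    using assms unfolding normalized_invariant_form_def by blast+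
  have scale: "b (t *\<^sub>R u) v = t * b u v" "b u (t *\<^sub>R v) = t * b u v" if "u \<in> V_mod r" "v \<in> V_mod r" for u v t
    using f that unfolding bilinear_form_on_def by blast+
  have c: "b (bmono i) (bmono k) = (if i + k = r then c i else 0)" if "i \<le> r" "k \<le> r" for i k
  proof (cases "i + k = r")
    case True
    then have "k = r - i" by simp
    then show ?thesis using True by (simp add: c_def)
  next
    case False
    have "(real r - 2 * real i) * b (bmono i) (bmono k) + (real r - 2 * real k) * b (bmono i) (bmono k) = 0"
      using inv(2)[of "bmono i" "bmono k"] that scale[of "bmono i" "bmono k"]
      by (simp add: V_H_bmono bmono_in_V_mod)
    then have "((real r - 2 * real i) + (real r - 2 * real k)) * b (bmono i) (bmono k) = 0"
      by (simp only: distrib_right)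
    moreover have "(real r - 2 * real i) + (real r - 2 * real k) \<noteq> 0"
    proof
      assume "(real r - 2 * real i) + (real r - 2 * real k) = 0"
      then have "real (i + k) = real r" by simp
      then show False using False by (simp only: of_nat_eq_iff)
    qed
    ultimately show ?thesis using False by simp
  qed
  have step: "real (Suc i) * c i + real (r - i) * c (Suc i) = 0" if "Suc i \<le> r" for i
  proof -
    have "b (V_X (bmono (Suc i))) (bmono (r - i)) = real (Suc i) * c i"
      using that scale[of "bmono i" "bmono (r - i)"] by (simp add: V_X_bmono bmono_in_V_mod c)
    moreover have "b (bmono (Suc i)) (V_X (bmono (r - i))) = real (r - i) * c (Suc i)"
      using that scale[of "bmono (Suc i)" "bmono (r - i - 1)"] by (simp add: V_X_bmono bmono_in_V_mod c)
    ultimately show ?thesis using inv(1)[of "bmono (Suc i)" "bmono (r - i)"] that by (simp add: bmono_in_V_mod)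
  qed
  have binom: "c i * real (r choose i) = (-1) ^ i * c 0" if "i \<le> r" for i
    using that
  proof (induction i)
    case (Suc i)
    have ch: "real (Suc i) * real (r choose Suc i) = real (r - i) * real (r choose i)"
    proof -
      have "Suc i * (r choose Suc i) = (r - i) * (r choose i)"
        using binomial_absorb_comp[of r i] binomial_absorption[of i r] Suc.prems
        by (metis Suc_diff_1 Suc_le_lessD binomial_absorption less_nat_zero_code mult.commute neq0_conv)
      then show ?thesis by (metis of_nat_mult)
    qed
    have "real (r - i) * (c (Suc i) * real (r choose Suc i)) = (real (r - i) * c (Suc i)) * real (r choose Suc i)"
      by simp
    also have "real (r - i) * c (Suc i) = - (real (Suc i) * c i)" using step[OF Suc.prems] by linarith
    also have "- (real (Suc i) * c i) * real (r choose Suc i) = - c i * (real (Suc i) * real (r choose Suc i))"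
      by simp
    also have "\<dots> = real (r - i) * (- (c i * real (r choose i)))" unfolding ch by simp
    also have "\<dots> = real (r - i) * ((-1) ^ Suc i * c 0)" using Suc by simp
    finally have eq: "real (r - i) * (c (Suc i) * real (r choose Suc i)) = real (r - i) * ((-1) ^ Suc i * c 0)" .
    have "real (r - i) \<noteq> 0" using Suc.prems by simp
    from mult_left_cancel[OF this, THEN iffD1, OF eq] show ?case .
  qed simp
  have c0: "c 0 \<noteq> 0"
  proof
    assume "c 0 = 0"
    then have c_zero: "c i = 0" if "i \<le> r" for i using binom[OF that] that by (auto simp: binomial_eq_0_iff)
    obtain u v where uv: "u \<in> V_mod r" "v \<in> V_mod r" "b u v \<noteq> 0" using nz by blast
    obtain k where "u = (\<Sum>e\<in>bmono ` {..r}. k e *\<^sub>R e)"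
      using uv(1) span_finite[of "bmono ` {..r}"] by (auto simp: span_bmono)
    then have k: "u = (\<Sum>i\<le>r. k (bmono i) *\<^sub>R bmono i)" by (simp add: sum.reindex inj_bmono)
    obtain l where "v = (\<Sum>e\<in>bmono ` {..r}. l e *\<^sub>R e)"
      using uv(2) span_finite[of "bmono ` {..r}"] by (auto simp: span_bmono)
    then have l: "v = (\<Sum>i\<le>r. l (bmono i) *\<^sub>R bmono i)" by (simp add: sum.reindex inj_bmono)
    have "b u v = (\<Sum>i\<le>r. k (bmono i) * b (bmono i) v)"
      by (subst k, rule bilinear_form_on_sum(1)[OF f subspace_V_mod]) (use uv in \<open>auto simp: bmono_in_V_mod\<close>)
    also have "\<dots> = (\<Sum>i\<le>r. k (bmono i) * (\<Sum>j\<le>r. l (bmono j) * b (bmono i) (bmono j)))"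
      by (subst l, intro sum.cong arg_cong2[where f = "(*)"] refl bilinear_form_on_sum(2)[OF f subspace_V_mod])
        (auto simp: bmono_in_V_mod)
    also have "\<dots> = 0" using c c_zero by (intro sum.neutral ballI) (simp add: sum.neutral)
    finally show False using uv by simp
  qed
  have cnz: "c i \<noteq> 0" if "i \<le> r" for i using binom[OF that] c0 by auto
  moreover have "c r = - c 0" if "odd r" using binom[of r] that by simp
  moreover have "c (r div 2) > 0" if ev: "even r"
  proof (rule ccontr)
    assume "\<not> c (r div 2) > 0"
    then have neg: "c (r div 2) < 0" using cnz[of "r div 2"] by linarith
    let ?A = "bmono ` {..r div 2}"
    have "card ?A \<le> r div 2"
    proof (rule signature_nonpositive_card[OF sig[OF ev]])
      show "independent ?A" by (rule independent_bmono)
      show "?A \<subseteq> V_mod r" by (auto simp: bmono_in_V_mod)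
      fix u assume u: "u \<in> span ?A"
      then obtain k where "u = (\<Sum>e\<in>?A. k e *\<^sub>R e)" using span_finite[of ?A] by auto
      then have k: "u = (\<Sum>i\<le>r div 2. k (bmono i) *\<^sub>R bmono i)" by (simp add: sum.reindex inj_bmono)
      have uV: "u \<in> V_mod r" using u span_minimal[OF \<open>?A \<subseteq> V_mod r\<close> subspace_V_mod] by auto
      have bi: "b (bmono i) u = (if i = r div 2 then k (bmono i) * c i else 0)" if "i \<le> r div 2" for i
      proof -
        have "b (bmono i) u = (\<Sum>j\<le>r div 2. k (bmono j) * b (bmono i) (bmono j))"
          using that by (subst k, intro bilinear_form_on_sum(2)[OF f subspace_V_mod]) (auto simp: bmono_in_V_mod)
        also have "\<dots> = (\<Sum>j\<le>r div 2. if j = r div 2 then if i = r div 2 then k (bmono i) * c i else 0 else 0)"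
        proof (intro sum.cong refl)
          fix j assume "j \<in> {..r div 2}"
          then show "k (bmono j) * b (bmono i) (bmono j) =
              (if j = r div 2 then if i = r div 2 then k (bmono i) * c i else 0 else 0)"
            using that c[of i j] ev by (auto elim!: evenE)
        qed
        finally show ?thesis by simp
      qed
      have "b u u = (\<Sum>i\<le>r div 2. k (bmono i) * b (bmono i) u)"
        by (subst (1) k, rule bilinear_form_on_sum(1)[OF f subspace_V_mod]) (use uV in \<open>auto simp: bmono_in_V_mod\<close>)
      also have "\<dots> = (\<Sum>i\<le>r div 2. if i = r div 2 then k (bmono i) * (k (bmono i) * c i) else 0)"
        using bi by (intro sum.cong) auto
      also have "\<dots> = (k (bmono (r div 2)))\<^sup>2 * c (r div 2)" by (simp add: power2_eq_square)
      also have "\<dots> \<le> 0" using neg by (simp add: mult_nonneg_nonpos)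
      finally show "b u u \<le> 0" .
    qed simp
    then show False by (simp add: card_image inj_bmono)
  qed
  ultimately show thesis using that c by blast
qed

lemma independent_family_scalars:
  assumes "finite I" "inj_on v I" "independent (v ` I)" "(\<Sum>a\<in>I. k a *\<^sub>R v a) = 0" "a \<in> I"
  shows "k a = 0"
proof -
  have "(\<Sum>u\<in>v ` I. k (inv_into I v u) *\<^sub>R u) = (\<Sum>a\<in>I. k a *\<^sub>R v a)"
    using assms(2) by (subst sum.reindex) (auto intro!: sum.cong)
  then have "k (inv_into I v (v a)) = 0"
    using independentD[OF assms(3) _ subset_refl, of "\<lambda>u. k (inv_into I v u)" "v a"] assms by simp
  then show ?thesis using assms by simp
qed

lemma span_family:
  assumes "finite I" "z \<in> span (v ` I)"
  obtains k where "z = (\<Sum>a\<in>I. k a *\<^sub>R v a)"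
proof -
  obtain J where J: "J \<subseteq> I" "v ` I = v ` J" "inj_on v J" by (metis subset_image_inj order_refl)
  obtain l where "z = (\<Sum>u\<in>v ` J. l u *\<^sub>R u)"
    using assms(2) span_finite[of "v ` J"] J finite_subset[OF J(1) assms(1)] by auto
  then have "z = (\<Sum>a\<in>J. l (v a) *\<^sub>R v a)" using J(3) by (simp add: sum.reindex)
  also have "\<dots> = (\<Sum>a\<in>I. (if a \<in> J then l (v a) else 0) *\<^sub>R v a)"
    using J(1) assms(1) by (intro sum.mono_neutral_cong_left) auto
  finally show thesis by (rule that)
qed

lemma signature_nondegenerate:
  assumes sig: "has_signature V f p q" and u: "u \<in> V" "\<And>w. w \<in> V \<Longrightarrow> f u w = 0"
  shows "u = 0"
proof -
  obtain P N where PN: "finite P" "finite N" "span (P \<union> N) = V" "pairwise (\<lambda>u v. f u v = 0) (P \<union> N)"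
      "\<And>v. v \<in> P \<Longrightarrow> f v v > 0" "\<And>v. v \<in> N \<Longrightarrow> f v v < 0" and f: "bilinear_form_on V f" "subspace V"
    using sig unfolding has_signature_def by blast
  have "finite (P \<union> N)" using PN by simp
  then obtain k where k: "u = (\<Sum>v\<in>P \<union> N. k v *\<^sub>R v)" using u(1) span_finite PN(3) by blast
  have V: "v \<in> V" if "v \<in> P \<union> N" for v using that PN(3) span_base by blast
  have "k v = 0" if v: "v \<in> P \<union> N" for v
  proof -
    have "0 = f u v" using u(2) V v by simp
    also have "f u v = (\<Sum>w\<in>P \<union> N. k w * f w v)"
      unfolding k using PN V v by (intro bilinear_form_on_sum(1)[OF f]) auto
    also have "\<dots> = (\<Sum>w\<in>P \<union> N. if w = v then k v * f v v else 0)"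
      using PN(4) v by (intro sum.cong) (auto simp: pairwise_def)
    also have "\<dots> = k v * f v v" using v PN(1,2) by simp
    finally show ?thesis using v PN(5,6)[of v] by auto
  qed
  then show ?thesis by (simp add: k)
qed

text \<open>The index \<open>(r, i, j)\<close> stands for the tensor product of the monomial \<open>t\<^sup>i\<close> of \<open>V_mod r\<close>, of weight
  \<open>r - 2 i\<close>, and the \<open>j\<close>-th basis vector of \<open>W r\<close>.\<close>

definition idx :: "(nat \<Rightarrow> nat) \<Rightarrow> (nat \<times> nat \<times> nat) set" where
  "idx n = {(r, i, j). i \<le> r \<and> j < n r}"

lemma mem_idx [simp]: "(r, i, j) \<in> idx n \<longleftrightarrow> i \<le> r \<and> j < n r"
  by (simp add: idx_def)

text \<open>The common input of both directions. \<open>\<Phi> r\<close> is the Gram matrix of a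
  basis of W_r: for even \<open>r\<close> diagonal and not normalised further, since its signs are
  what enters, for odd \<open>r\<close> the standard symplectic one. At \<open>i = 0\<close> the
  truncated \<open>i - 1\<close> is harmless because of the factor \<open>real i\<close>.\<close>

locale adapted_basis =
  fixes B :: "real^'n \<Rightarrow> real^'n \<Rightarrow> real" and x :: "real^'n^'n" and n :: "nat \<Rightarrow> nat"
    and v :: "nat \<times> nat \<times> nat \<Rightarrow> real^'n" and c :: "nat \<Rightarrow> nat \<Rightarrow> real" and \<Phi> :: "nat \<Rightarrow> nat \<Rightarrow> nat \<Rightarrow> real"
  assumes bil: "bilinear B" and sym: "\<And>u w. B u w = B w u"
    and nondeg: "\<And>u. (\<And>w. B u w = 0) \<Longrightarrow> u = 0"
    and fin_idx: "finite (idx n)" and inj_v: "inj_on v (idx n)" and indep_v: "independent (v ` idx n)"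
    and span_v: "span (v ` idx n) = UNIV"
    and x_v: "\<And>r i j. i \<le> r \<Longrightarrow> j < n r \<Longrightarrow> x *v v (r, i, j) = real i *\<^sub>R v (r, i - 1, j)"
    and B_v: "\<And>r i j r' i' j'. i \<le> r \<Longrightarrow> j < n r \<Longrightarrow> i' \<le> r' \<Longrightarrow> j' < n r' \<Longrightarrow>
       B (v (r, i, j)) (v (r', i', j')) = (if r = r' \<and> i + i' = r then c r i * \<Phi> r j j' else 0)"
    and c_nz: "\<And>r i. i \<le> r \<Longrightarrow> c r i \<noteq> 0" and c_mid: "\<And>r. even r \<Longrightarrow> c r (r div 2) > 0"
    and Phi_even: "\<And>r j j'. even r \<Longrightarrow> j < n r \<Longrightarrow> j' < n r \<Longrightarrow> \<Phi> r j j' = 0 \<longleftrightarrow> j \<noteq> j'"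
    and n_odd: "\<And>r. odd r \<Longrightarrow> even (n r)"
    and Phi_odd: "\<And>r j j'. odd r \<Longrightarrow> j < n r \<Longrightarrow> j' < n r \<Longrightarrow> \<Phi> r j j' = std_symp j j'"

lemma independent_spanning_card:
  assumes "independent A" "span A = V" "independent A'" "span A' = V" "finite A"
  shows "finite A'" "card A' = card A"
  using independent_span_bound[of A A'] independent_span_bound[of A' A] assms span_superset[of A] span_superset[of A']
  by (auto intro: le_antisym)

section \<open>Linear algebra of the multiplicity isomorphism\<close>

context
  fixes B :: "real^'n \<Rightarrow> real^'n \<Rightarrow> real" and x y h :: "real^'n^'n" and b :: "nat \<Rightarrow> bform \<Rightarrow> bform \<Rightarrow> real"
    and W :: "nat \<Rightarrow> 'w::real_vector set" and \<phi> :: "nat \<Rightarrow> 'w \<Rightarrow> 'w \<Rightarrow> real" and T :: "nat \<Rightarrow> bform \<Rightarrow> 'w \<Rightarrow> real^'n"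
    and n :: "nat \<Rightarrow> nat"
  assumes iso: "multiplicity_iso B x y h b W \<phi> T" and W: "\<And>r. subspace (W r)" and n: "\<And>r. n r = dim (W r)"
begin

lemma T_add: "u \<in> V_mod r \<Longrightarrow> u' \<in> V_mod r \<Longrightarrow> w \<in> W r \<Longrightarrow> T r (u + u') w = T r u w + T r u' w"
  and T_add': "u \<in> V_mod r \<Longrightarrow> w \<in> W r \<Longrightarrow> w' \<in> W r \<Longrightarrow> T r u (w + w') = T r u w + T r u w'"
  and T_scale: "u \<in> V_mod r \<Longrightarrow> w \<in> W r \<Longrightarrow> T r (t *\<^sub>R u) w = t *\<^sub>R T r u w"
  and T_scale': "u \<in> V_mod r \<Longrightarrow> w \<in> W r \<Longrightarrow> T r u (t *\<^sub>R w) = t *\<^sub>R T r u w"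
  using iso unfolding multiplicity_iso_def by blast+

lemma T_zero: "w \<in> W r \<Longrightarrow> T r 0 w = 0" and T_zero': "u \<in> V_mod r \<Longrightarrow> T r u 0 = 0"
  using T_scale[of 0 r w 0] subspace_0[OF subspace_V_mod] T_scale'[of u r 0 0] subspace_0[OF W] by auto

lemma T_sum':
  assumes "finite J" "u \<in> V_mod r" "\<And>j. j \<in> J \<Longrightarrow> w j \<in> W r"
  shows "T r u (\<Sum>j\<in>J. k j *\<^sub>R w j) = (\<Sum>j\<in>J. k j *\<^sub>R T r u (w j))"
  using assms(1,3)
proof (induction J rule: finite_induct)
  case (insert a J)
  have "(\<Sum>j\<in>J. k j *\<^sub>R w j) \<in> W r" "k a *\<^sub>R w a \<in> W r" "w a \<in> W r"
    using insert.prems W by (auto intro!: subspace_sum subspace_scale)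
  then show ?case using insert assms(2) by (simp add: T_add' T_scale')
qed (simp add: T_zero' assms(2))

lemma T_mem_span:
  assumes S: "subspace S" and e: "span E = V_mod r" and f: "span F = W r"
    and EF: "\<And>e f. e \<in> E \<Longrightarrow> f \<in> F \<Longrightarrow> T r e f \<in> S" and uw: "u \<in> V_mod r" "w \<in> W r"
  shows "T r u w \<in> S"
proof -
  have FW: "F \<subseteq> W r" and EV: "E \<subseteq> V_mod r" using e f span_superset by blast+
  have 1: "T r e w \<in> S" if "e \<in> E" for e
  proof -
    have "subspace {w \<in> W r. T r e w \<in> S}"
      using W[of r] S EV that T_zero'[of e r]
      by (intro subspaceI) (auto simp: T_add' T_scale' subspace_0 subspace_add subspace_scale)
    moreover have "F \<subseteq> {w \<in> W r. T r e w \<in> S}" using FW EF that by auto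
    ultimately have "span F \<subseteq> {w \<in> W r. T r e w \<in> S}" by (rule span_minimal[rotated])
    then show ?thesis using f uw by auto
  qed
  have "subspace {u \<in> V_mod r. T r u w \<in> S}"
    using S uw(2) T_zero[of w r] subspace_V_mod[of r]
    by (intro subspaceI) (auto simp: T_add T_scale subspace_0 subspace_add subspace_scale)
  moreover have "E \<subseteq> {u \<in> V_mod r. T r u w \<in> S}" using EV 1 by auto
  ultimately have "span E \<subseteq> {u \<in> V_mod r. T r u w \<in> S}" by (rule span_minimal[rotated])
  then show ?thesis using e uw by auto
qed

text \<open>The tensors of basis vectors inject onto a basis of the finite-dimensional space. As
  every \<open>E r\<close> has \<open>r + 1\<close> elements and so is nonempty, each
  \<open>F r\<close> is finite and only finitely many are nonempty.\<close>

lemma multiplicity_finite: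
  shows "finite (idx n)" "card (idx n) = CARD('n)" "\<exists>F. finite F \<and> independent F \<and> span F = W r"
proof -
  obtain E F where EF: "(\<forall>r. independent (E r) \<and> span (E r) = V_mod r) \<and>
            (\<forall>r. independent (F r) \<and> span (F r) = W r) \<and>
            inj_on (\<lambda>(r, e, f). T r e f) (SIGMA r:UNIV. E r \<times> F r) \<and>
            independent ((\<lambda>(r, e, f). T r e f) ` (SIGMA r:UNIV. E r \<times> F r)) \<and>
            span ((\<lambda>(r, e, f). T r e f) ` (SIGMA r:UNIV. E r \<times> F r)) = UNIV"
    using iso[unfolded multiplicity_iso_def, THEN conjunct2, THEN conjunct1] by (elim exE)
  then have E: "\<And>r. independent (E r)" "\<And>r. span (E r) = V_mod r"
    and F: "\<And>r. independent (F r)" "\<And>r. span (F r) = W r"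
    and inj: "inj_on (\<lambda>(r, e, f). T r e f) (SIGMA r:UNIV. E r \<times> F r)"
    and ind: "independent ((\<lambda>(r, e, f). T r e f) ` (SIGMA r:UNIV. E r \<times> F r))"
    and sp: "span ((\<lambda>(r, e, f). T r e f) ` (SIGMA r:UNIV. E r \<times> F r)) = UNIV"
    by simp_all
  let ?I = "SIGMA r:UNIV. E r \<times> F r"
  have finI: "finite ?I" using finiteI_independent[OF ind] inj by (rule finite_imageD)
  have cardI: "card ?I = CARD('n)"
    using card_image[OF inj] dim_span_eq_card_independent[OF ind] unfolding sp by (simp add: dim_UNIV)
  have finE: "finite (E r)" and cardE: "card (E r) = Suc r" for r
    using independent_spanning_card[OF independent_bmono[of r] span_bmono E(1)[of r] E(2)]
    by (auto simp: card_image inj_bmono)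
  have finF: "finite (F r)" for r
  proof -
    have "E r \<noteq> {}" using cardE[of r] by auto
    then obtain e where "e \<in> E r" by blast
    then have "(\<lambda>f. (r, e, f)) ` F r \<subseteq> ?I" by auto
    then have "finite ((\<lambda>f. (r, e, f)) ` F r)" using finI by (rule finite_subset)
    then show ?thesis by (rule finite_imageD) (auto intro: inj_onI)
  qed
  then show "\<exists>F. finite F \<and> independent F \<and> span F = W r" using F by blast
  have nF: "n r = card (F r)" for r
    using n[of r] F dim_span_eq_card_independent by metis
  define R where "R = {r. F r \<noteq> {}}"
  have "R \<subseteq> fst ` ?I"
  proof
    fix r assume "r \<in> R"
    then obtain f where "f \<in> F r" by (auto simp: R_def)
    moreover obtain e where "e \<in> E r" using cardE[of r] by (metis card.empty ex_in_conv nat.distinct(1))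
    ultimately show "r \<in> fst ` ?I" by (intro image_eqI[of _ _ "(r, e, f)"]) auto
  qed
  then have finR: "finite R" using finI finite_subset by blast
  have "?I = (SIGMA r:R. E r \<times> F r)" by (auto simp: R_def)
  then have "card ?I = (\<Sum>r\<in>R. Suc r * n r)"
    using finR finE finF by (simp add: card_SigmaI card_cartesian_product cardE nF)
  moreover have idx: "idx n = (SIGMA r:R. {..r} \<times> {..<n r})"
    using finF by (auto simp: idx_def R_def nF)
  ultimately show "card (idx n) = CARD('n)" using cardI finR by (simp add: card_SigmaI card_cartesian_product)
  show "finite (idx n)" unfolding idx using finR by auto
qed

text \<open>The new tensors span because they generate the old ones, and their index set has
  \<open>CARD('n)\<close> elements, so counting makes them a basis.\<close>

lemma multiplicity_basis:
  assumes w: "\<And>r. span (w r ` {..<n r}) = W r"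
  defines "v \<equiv> \<lambda>(r, i, j). T r (bmono i) (w r j)"
  shows "inj_on v (idx n)" "independent (v ` idx n)" "span (v ` idx n) = UNIV"
proof -
  obtain E F where EF: "(\<forall>r. independent (E r) \<and> span (E r) = V_mod r) \<and>
            (\<forall>r. independent (F r) \<and> span (F r) = W r) \<and>
            inj_on (\<lambda>(r, e, f). T r e f) (SIGMA r:UNIV. E r \<times> F r) \<and>
            independent ((\<lambda>(r, e, f). T r e f) ` (SIGMA r:UNIV. E r \<times> F r)) \<and>
            span ((\<lambda>(r, e, f). T r e f) ` (SIGMA r:UNIV. E r \<times> F r)) = UNIV"
    using iso[unfolded multiplicity_iso_def, THEN conjunct2, THEN conjunct1] by (elim exE)
  then have E: "\<And>r. independent (E r)" "\<And>r. span (E r) = V_mod r"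
    and F: "\<And>r. independent (F r)" "\<And>r. span (F r) = W r"
    and sp: "span ((\<lambda>(r, e, f). T r e f) ` (SIGMA r:UNIV. E r \<times> F r)) = UNIV"
    by simp_all
  have "T r u z \<in> span (v ` idx n)" if "u \<in> V_mod r" "z \<in> W r" for r u z
  proof (rule T_mem_span[OF subspace_span span_bmono w _ that])
    fix e f assume "e \<in> bmono ` {..r}" "f \<in> w r ` {..<n r}"
    then obtain i j where ij: "i \<le> r" "e = bmono i" "j < n r" "f = w r j" by auto
    have "v (r, i, j) \<in> span (v ` idx n)" using ij(1,3) by (intro span_base imageI) simp
    then show "T r e f \<in> span (v ` idx n)" unfolding ij(2,4) by (simp add: v_def)
  qed
  moreover have "e \<in> V_mod r" if "e \<in> E r" for r e using that span_base[of e "E r"] E(2) by simp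
  moreover have "f \<in> W r" if "f \<in> F r" for r f using that span_base[of f "F r"] F(2) by simp
  ultimately have "(\<lambda>(r, e, f). T r e f) ` (SIGMA r:UNIV. E r \<times> F r) \<subseteq> span (v ` idx n)"
    by auto
  from span_minimal[OF this subspace_span] show sv: "span (v ` idx n) = UNIV" unfolding sp by auto
  have "CARD('n) \<le> card (v ` idx n)"
    using span_card_ge_dim[of "v ` idx n" UNIV] sv multiplicity_finite(1) by (simp add: dim_UNIV)
  then have card: "card (v ` idx n) = CARD('n)"
    using card_image_le[OF multiplicity_finite(1), of v] multiplicity_finite(2) by simp
  then show "inj_on v (idx n)" using multiplicity_finite by (intro eq_card_imp_inj_on) auto
  show "independent (v ` idx n)"
    using card_eq_dim[of "v ` idx n" UNIV] card sv multiplicity_finite(1) by (simp add: dim_UNIV)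
qed

end

lemma orthogonal_basis_enumeration:
  assumes sig: "has_signature W f p q" and n: "n = dim W"
  obtains w where "span (w ` {..<n}) = W" "\<And>j k. j < n \<Longrightarrow> k < n \<Longrightarrow> f (w j) (w k) = 0 \<longleftrightarrow> j \<noteq> k"
    "card {j. j < n \<and> f (w j) (w j) > 0} = p" "card {j. j < n \<and> f (w j) (w j) < 0} = q"
proof -
  obtain P N where "finite P \<and> finite N \<and> card P = p \<and> card N = q \<and> P \<inter> N = {} \<and>
      independent (P \<union> N) \<and> span (P \<union> N) = W \<and> pairwise (\<lambda>u v. f u v = 0) (P \<union> N) \<and>
      (\<forall>v\<in>P. f v v > 0) \<and> (\<forall>v\<in>N. f v v < 0)"
    using sig unfolding has_signature_def by (elim exE conjE) blast
  then have PN: "finite P" "finite N" "card P = p" "card N = q" "P \<inter> N = {}"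
      "independent (P \<union> N)" "span (P \<union> N) = W" "pairwise (\<lambda>u v. f u v = 0) (P \<union> N)"
      "\<And>v. v \<in> P \<Longrightarrow> f v v > 0" "\<And>v. v \<in> N \<Longrightarrow> f v v < 0"
    by simp_all
  have fin: "finite (P \<union> N)" using PN by simp
  have "card (P \<union> N) = n" using n PN(7) dim_span_eq_card_independent[OF PN(6)] by simp
  then obtain w where w: "bij_betw w {..<n} (P \<union> N)"
    using ex_bij_betw_nat_finite[OF fin] by (auto simp: atLeast0LessThan)
  have wPN: "w j \<in> P \<union> N" if "j < n" for j using w that by (auto simp: bij_betw_def)
  have inj: "inj_on w {..<n}" and img: "w ` {..<n} = P \<union> N" using w by (auto simp: bij_betw_def)
  have gram: "f (w j) (w k) = 0 \<longleftrightarrow> j \<noteq> k" if "j < n" "k < n" for j k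
  proof (cases "j = k")
    case True
    then show ?thesis using wPN[of j] that PN(9,10)[of "w j"] by auto
  next
    case False
    then have "w j \<noteq> w k" using inj that by (auto simp: inj_on_def)
    then show ?thesis using False PN(8) wPN that by (auto simp: pairwise_def)
  qed
  have imP: "w ` {j. j < n \<and> f (w j) (w j) > 0} = P"
  proof
    show "w ` {j. j < n \<and> f (w j) (w j) > 0} \<subseteq> P" using wPN PN(10) by force
    show "P \<subseteq> w ` {j. j < n \<and> f (w j) (w j) > 0}"
    proof
      fix u assume u: "u \<in> P"
      then obtain j where "j < n" "u = w j" using img by blast
      then show "u \<in> w ` {j. j < n \<and> f (w j) (w j) > 0}" using PN(9) u by auto
    qed
  qed
  have imN: "w ` {j. j < n \<and> f (w j) (w j) < 0} = N"
  proof
    show "w ` {j. j < n \<and> f (w j) (w j) < 0} \<subseteq> N" using wPN PN(9) by force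
    show "N \<subseteq> w ` {j. j < n \<and> f (w j) (w j) < 0}"
    proof
      fix u assume u: "u \<in> N"
      then obtain j where "j < n" "u = w j" using img by blast
      then show "u \<in> w ` {j. j < n \<and> f (w j) (w j) < 0}" using PN(10) u by auto
    qed
  qed
 have injs: "inj_on w {j. j < n \<and> f (w j) (w j) > 0}" "inj_on w {j. j < n \<and> f (w j) (w j) < 0}"
    using inj by (auto intro: inj_on_subset)
  show thesis
  proof (rule that)
    show "span (w ` {..<n}) = W" unfolding img by (rule PN(7))
    show "card {j. j < n \<and> f (w j) (w j) > 0} = p" using card_image[OF injs(1)] imP PN(3) by simp
    show "card {j. j < n \<and> f (w j) (w j) < 0} = q" using card_image[OF injs(2)] imN PN(4) by simp
  qed (rule gram)
qed

text \<open>The properties of \<open>\<phi> r\<close> for odd \<open>r\<close> are recovered from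
  \<open>B\<close>: as \<open>B\<close> is symmetric and \<open>c r r = - c r 0\<close>, the form
  \<open>\<phi> r\<close> is alternating, and it is nondegenerate because \<open>B\<close> is. So
  W_r has a symplectic basis.\<close>

theorem adapted_basis_exists:
  fixes B :: "real^'n \<Rightarrow> real^'n \<Rightarrow> real" and W :: "nat \<Rightarrow> 'w::real_vector set"
  assumes sig: "has_signature UNIV B p q" and b: "\<And>r. normalized_invariant_form r (b r)"
    and mult: "multiplicity_spaces B x y h b W \<phi>" and n: "\<And>r. n r = dim (W r)"
    and even_sig: "\<And>r. even r \<Longrightarrow> has_signature (W r) (\<phi> r) (pos r) (neg r)"
  obtains v c \<Phi> where "adapted_basis B x n v c \<Phi>"
    "\<And>r. even r \<Longrightarrow> card {j. j < n r \<and> \<Phi> r j j > 0} = pos r"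
    "\<And>r. even r \<Longrightarrow> card {j. j < n r \<and> \<Phi> r j j < 0} = neg r"
proof -
  obtain T where W: "\<And>r. subspace (W r)" and \<phi>: "\<And>r. bilinear_form_on (W r) (\<phi> r)"
    and iso: "multiplicity_iso B x y h b W \<phi> T"
    using mult unfolding multiplicity_spaces_def by blast
  have xT: "x *v T r u w = T r (V_X u) w" if "u \<in> V_mod r" "w \<in> W r" for r u w
    using iso that unfolding multiplicity_iso_def by blast
  have BT: "B (T r u w) (T s u' w') = (if r = s then b r u u' * \<phi> r w w' else 0)"
    if "u \<in> V_mod r" "w \<in> W r" "u' \<in> V_mod s" "w' \<in> W s" for r s u w u' w'
    using iso that unfolding multiplicity_iso_def by blast
  have bil: "bilinear B" and sym: "B u w = B w u" for u w
    using sig by (auto simp: has_signature_def bilinear_form_on_UNIV)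
  have nondeg: "u = 0" if "\<And>w. B u w = 0" for u using signature_nondegenerate[OF sig] that by blast
  have "\<exists>c. (\<forall>i k. i \<le> r \<longrightarrow> k \<le> r \<longrightarrow> b r (bmono i) (bmono k) = (if i + k = r then c i else 0)) \<and>
      (\<forall>i\<le>r. c i \<noteq> 0) \<and> (odd r \<longrightarrow> c r = - c 0) \<and> (even r \<longrightarrow> c (r div 2) > 0)" for r
    by (rule normalized_invariant_form_bmono[OF b[of r]]) blast
  then obtain c where c: "\<forall>r. (\<forall>i k. i \<le> r \<longrightarrow> k \<le> r \<longrightarrow> b r (bmono i) (bmono k) = (if i + k = r then c r i else 0)) \<and>
      (\<forall>i\<le>r. c r i \<noteq> 0) \<and> (odd r \<longrightarrow> c r r = - c r 0) \<and> (even r \<longrightarrow> c r (r div 2) > 0)"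
    using choice[of "\<lambda>r c. (\<forall>i k. i \<le> r \<longrightarrow> k \<le> r \<longrightarrow> b r (bmono i) (bmono k) = (if i + k = r then c i else 0)) \<and>
      (\<forall>i\<le>r. c i \<noteq> 0) \<and> (odd r \<longrightarrow> c r = - c 0) \<and> (even r \<longrightarrow> c (r div 2) > 0)"] by blast
  have Bv: "B (T r (bmono i) u) (T r' (bmono i') u') = (if r = r' \<and> i + i' = r then c r i * \<phi> r u u' else 0)"
    if "i \<le> r" "i' \<le> r'" "u \<in> W r" "u' \<in> W r'" for r i u r' i' u'
    using BT[of "bmono i" r u "bmono i'" r' u'] that c by (auto simp: bmono_in_V_mod)
  have alt: "\<phi> r u w = - \<phi> r w u" if "odd r" "u \<in> W r" "w \<in> W r" for r u w
  proof -
    have "c r 0 * \<phi> r u w = B (T r (bmono 0) u) (T r (bmono r) w)" using Bv[of 0 r r r u w] that by simp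
    also have "\<dots> = B (T r (bmono r) w) (T r (bmono 0) u)" by (rule sym)
    also have "\<dots> = - c r 0 * \<phi> r w u" using Bv[of r r 0 r w u] that c by simp
    finally have "c r 0 * (\<phi> r u w + \<phi> r w u) = 0" by (simp add: distrib_left)
    moreover have "c r 0 \<noteq> 0" using c by auto
    ultimately show ?thesis by simp
  qed
  have "\<exists>w. span (w ` {..<n r}) = W r" for r
  proof -
    obtain F where F: "finite F" "independent F" "span F = W r" using multiplicity_finite(3)[OF iso W n] by blast
    have "card F = n r" using n F dim_span_eq_card_independent by metis
    then obtain w where "bij_betw w {..<n r} F"
      using ex_bij_betw_nat_finite[OF F(1)] by (auto simp: atLeast0LessThan)
    then show ?thesis using F by (auto simp: bij_betw_def)
  qed
  then obtain w0 where w0: "\<And>r. span (w0 r ` {..<n r}) = W r" by metis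
  have nondeg_W: "u = 0" if u: "u \<in> W r" "\<And>w. w \<in> W r \<Longrightarrow> \<phi> r u w = 0" for r u
  proof -
    define v0 where "v0 = (\<lambda>(r, i, j). T r (bmono i) (w0 r j))"
    note basis = multiplicity_basis[OF iso W n w0, folded v0_def]
    have w0W: "w0 r j \<in> W r" if "j < n r" for r j
      using span_base[of "w0 r j" "w0 r ` {..<n r}"] that unfolding w0 by simp
    \<comment> \<open>A vector \<open>u\<close> in the radical of \<open>\<phi> r\<close> gives a
      tensor orthogonal to everything, hence zero; independence of the tensors with
      \<open>i = 0\<close> then returns \<open>u = 0\<close>.\<close>
    define z where "z = T r (bmono 0) u"
    have "B z s = 0" for s
    proof -
      have "subspace {s. B z s = 0}"
        by (rule subspaceI) (simp_all add: bilinear_rzero[OF bil] bilinear_radd[OF bil] bilinear_rmul[OF bil])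
      moreover have "v0 ` idx n \<subseteq> {s. B z s = 0}"
        using Bv[of 0 r _ _ u] u w0W by (auto simp: z_def v0_def)
      ultimately have "span (v0 ` idx n) \<subseteq> {s. B z s = 0}" by (rule span_minimal[rotated])
      then show ?thesis using basis(3) by auto
    qed
    then have z: "z = 0" by (rule nondeg)
    obtain k where k: "u = (\<Sum>j<n r. k j *\<^sub>R w0 r j)"
      using span_family[of "{..<n r}" u "w0 r"] u(1) w0 by auto
    let ?I = "{..<n r}" and ?v = "\<lambda>j. v0 (r, 0, j)"
    have sub: "(\<lambda>j. (r, 0, j)) ` ?I \<subseteq> idx n" by auto
    have "inj_on ?v ?I"
    proof (rule inj_onI)
      fix j k assume "j \<in> ?I" "k \<in> ?I" "?v j = ?v k"
      then show "j = k" using inj_onD[OF basis(1), of "(r, 0, j)" "(r, 0, k)"] by simp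
    qed
    moreover have "independent (?v ` ?I)"
      using basis(2) by (rule independent_mono) auto
    moreover have "(\<Sum>j<n r. k j *\<^sub>R ?v j) = 0"
      using z T_sum'[OF iso W n, of ?I "bmono 0" r "w0 r" k] w0W by (simp add: z_def v0_def k bmono_in_V_mod)
    ultimately have "k j = 0" if "j < n r" for j
      using independent_family_scalars[of ?I ?v k j] that by simp
    then show "u = 0" by (simp add: k)
  qed
  have "\<exists>w. span (w ` {..<n r}) = W r \<and>
      (even r \<longrightarrow> (\<forall>j<n r. \<forall>k<n r. \<phi> r (w j) (w k) = 0 \<longleftrightarrow> j \<noteq> k) \<and>
         card {j. j < n r \<and> \<phi> r (w j) (w j) > 0} = pos r \<and> card {j. j < n r \<and> \<phi> r (w j) (w j) < 0} = neg r) \<and>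
      (odd r \<longrightarrow> even (n r) \<and> (\<forall>j<n r. \<forall>k<n r. \<phi> r (w j) (w k) = std_symp j k))" (is "\<exists>w. ?P r w") for r
  proof (cases "even r")
    case True
    obtain w where "span (w ` {..<n r}) = W r" "\<And>j k. j < n r \<Longrightarrow> k < n r \<Longrightarrow> \<phi> r (w j) (w k) = 0 \<longleftrightarrow> j \<noteq> k"
      "card {j. j < n r \<and> \<phi> r (w j) (w j) > 0} = pos r" "card {j. j < n r \<and> \<phi> r (w j) (w j) < 0} = neg r"
      using orthogonal_basis_enumeration[OF even_sig[OF True] n] by blast
    then show ?thesis using True by (intro exI[of _ w]) simp
  next
    case False
    obtain F where F: "finite F" "independent F" "span F = W r" using multiplicity_finite(3)[OF iso W n] by blast
    obtain d w where w: "inj_on w {..<2 * d}" "independent (w ` {..<2 * d})" "span (w ` {..<2 * d}) = W r"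
      "\<And>j k. j < 2 * d \<Longrightarrow> k < 2 * d \<Longrightarrow> \<phi> r (w j) (w k) = std_symp j k"
    proof (rule symplectic_basis[OF \<phi>[of r] W[of r] F(1)])
      show "W r \<subseteq> span F" using F(3) by simp
      show "\<phi> r u v = - \<phi> r v u" if "u \<in> W r" "v \<in> W r" for u v by (rule alt[OF False that])
      show "u = 0" if "u \<in> W r" "\<And>v. v \<in> W r \<Longrightarrow> \<phi> r u v = 0" for u by (rule nondeg_W[OF that])
    qed (rule that)
    have "n r = 2 * d" using n w(1-3) dim_span_eq_card_independent[OF w(2)] by (simp add: card_image)
    then show ?thesis using w False by (intro exI[of _ w]) simp
  qed
  then obtain w where w: "\<And>r. ?P r (w r)" using choice[of ?P] by blast
  have wspan: "span (w r ` {..<n r}) = W r" for r using w by blast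
  have wW: "w r j \<in> W r" if "j < n r" for r j
    using span_base[of "w r j" "w r ` {..<n r}"] that unfolding wspan by simp
  define v where "v = (\<lambda>(r, i, j). T r (bmono i) (w r j))"
  note basis = multiplicity_basis[OF iso W n wspan, folded v_def]
  have "adapted_basis B x n v c (\<lambda>r j k. \<phi> r (w r j) (w r k))"
  proof
    show "finite (idx n)" by (rule multiplicity_finite(1)[OF iso W n])
    show "x *v v (r, i, j) = real i *\<^sub>R v (r, i - 1, j)" if "i \<le> r" "j < n r" for r i j
      using that xT[of "bmono i" r "w r j"] T_scale[OF iso W n, of "bmono (i - 1)" r "w r j" "real i"] wW
      by (simp add: v_def bmono_in_V_mod V_X_bmono)
    show "B (v (r, i, j)) (v (r', i', j')) = (if r = r' \<and> i + i' = r then c r i * \<phi> r (w r j) (w r j') else 0)"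
      if "i \<le> r" "j < n r" "i' \<le> r'" "j' < n r'" for r i j r' i' j'
      using that Bv[of i r i' r' "w r j" "w r' j'"] wW by (auto simp: v_def)
    show "\<phi> r (w r j) (w r j') = 0 \<longleftrightarrow> j \<noteq> j'" if "even r" "j < n r" "j' < n r" for r j j'
      using w[of r] that by blast
    show "even (n r)" if "odd r" for r using w[of r] that by blast
    show "\<phi> r (w r j) (w r j') = std_symp j j'" if "odd r" "j < n r" "j' < n r" for r j j'
      using w[of r] that by blast
  qed (use basis bil sym nondeg c in auto)
  then show thesis
    by (intro that[of v c "\<lambda>r j k. \<phi> r (w r j) (w r k)"]) (use w in blast)+
qed

section \<open>The obstruction to conjugacy\<close>

lemma ldet_identity:
  assumes "finite S" "\<And>a b. a \<in> S \<Longrightarrow> b \<in> S \<Longrightarrow> M a b = (if a = b then 1 else 0)"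
  shows "ldet S M = 1"
proof -
  have "ldet S M = (\<Sum>\<sigma>\<in>{id}. of_int (sign \<sigma>) * (\<Prod>a\<in>S. M a (\<sigma> a)))"
    unfolding ldet_def
  proof (rule sum.mono_neutral_right)
    show "finite {\<sigma>. \<sigma> permutes S}" using assms(1) by (rule finite_permutations)
    show "{id} \<subseteq> {\<sigma>. \<sigma> permutes S}" by (simp add: permutes_id)
    show "\<forall>\<sigma>\<in>{\<sigma>. \<sigma> permutes S} - {id}. of_int (sign \<sigma>) * (\<Prod>a\<in>S. M a (\<sigma> a)) = (0::real)"
    proof
      fix \<sigma> assume "\<sigma> \<in> {\<sigma>. \<sigma> permutes S} - {id}"
      then have s: "\<sigma> permutes S" "\<sigma> \<noteq> id" by auto
      then obtain a where "\<sigma> a \<noteq> a" by (auto simp: fun_eq_iff)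
      then have "a \<in> S" using permutes_not_in[OF s(1)] by metis
      then have "M a (\<sigma> a) = 0" using assms(2)[of a "\<sigma> a"] \<open>\<sigma> a \<noteq> a\<close> permutes_in_image[OF s(1), of a] by simp
      then have "(\<Prod>a\<in>S. M a (\<sigma> a)) = 0" using \<open>a \<in> S\<close> assms(1) by (intro prod_zero) blast+
      then show "of_int (sign \<sigma>) * (\<Prod>a\<in>S. M a (\<sigma> a)) = (0::real)" by simp
    qed
  qed
  then show ?thesis using assms(2) by simp
qed

lemma subspace_sum_direct:
  assumes N: "subspace N" and P: "subspace P" and meet: "\<And>u. u \<in> N \<Longrightarrow> u \<in> P \<Longrightarrow> u = 0"
    and sum: "\<And>u. \<exists>a\<in>N. u - a \<in> P"
  obtains Q :: "real^'n^'n" where "\<And>u. Q *v u \<in> N" "\<And>u. u - Q *v u \<in> P" "\<And>u. u \<in> N \<Longrightarrow> Q *v u = u"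
    "\<And>u. u \<in> P \<Longrightarrow> Q *v u = 0"
proof -
  obtain f where f: "\<And>u. f u \<in> N" "\<And>u. u - f u \<in> P" using sum by metis
  have uniq: "f u = a" if "a \<in> N" "u - a \<in> P" for u a
  proof -
    have "f u - a \<in> N" using f(1) that(1) N by (simp add: subspace_diff)
    moreover have "(u - a) - (u - f u) \<in> P" by (rule subspace_diff[OF P that(2) f(2)])
    ultimately have "f u - a = 0" by (intro meet) simp_all
    then show ?thesis by simp
  qed
  have "linear f"
  proof (rule linearI)
    fix u w :: "real^'n" and t :: real
    have "(u - f u) + (w - f w) \<in> P" using f(2) P by (intro subspace_add)
    then show "f (u + w) = f u + f w" using f(1) N by (intro uniq subspace_add) (simp_all add: algebra_simps)
    have "t *\<^sub>R (u - f u) \<in> P" using f(2) P by (intro subspace_scale)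
    then show "f (t *\<^sub>R u) = t *\<^sub>R f u" using f(1) N by (intro uniq subspace_scale) (simp_all add: algebra_simps)
  qed
  then have Q: "matrix f *v u = f u" for u using matrix_vector_mul(2)[of f] by (simp add: fun_eq_iff)
  show thesis
  proof (rule that[of "matrix f"])
    show "matrix f *v u = u" if "u \<in> N" for u unfolding Q using that subspace_0[OF P] by (intro uniq) simp_all
    show "matrix f *v u = 0" if "u \<in> P" for u unfolding Q using that subspace_0[OF N] by (intro uniq) simp_all
  qed (simp_all add: Q f)
qed

text \<open>The complement is the positive definite \<open>span P\<close>, which meets
  \<open>N\<close> only in 0. A vector orthogonal to \<open>N\<close> and to \<open>span P\<close>
  lies in the negative definite span of the other basis vectors and is nonnegative by
  \<open>perp\<close>; so it vanishes, and the sum is the whole space.\<close>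

lemma semidefinite_projection:
  fixes B :: "real^'n \<Rightarrow> real^'n \<Rightarrow> real"
  assumes sig: "has_signature UNIV B p q" and N: "subspace N"
    and nonpos: "\<And>u. u \<in> N \<Longrightarrow> B u u \<le> 0" and perp: "\<And>u. (\<And>w. w \<in> N \<Longrightarrow> B u w = 0) \<Longrightarrow> B u u \<ge> 0"
  obtains Q :: "real^'n^'n" where "\<And>u. Q *v u \<in> N" "\<And>u. u \<in> N \<Longrightarrow> Q *v u = u"
    "\<And>u. Q *v u = 0 \<Longrightarrow> u \<noteq> 0 \<Longrightarrow> B u u > 0"
proof -
  have "\<exists>P N. finite P \<and> finite N \<and> card P = p \<and> card N = q \<and> P \<inter> N = {} \<and>
        independent (P \<union> N) \<and> span (P \<union> N) = UNIV \<and> pairwise (\<lambda>u v. B u v = 0) (P \<union> N) \<and>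
        (\<forall>v\<in>P. B v v > 0) \<and> (\<forall>v\<in>N. B v v < 0)" 
    using sig unfolding has_signature_def by (elim conjE)
  then obtain P M where "finite P \<and> finite M \<and> card P = p \<and> card M = q \<and> P \<inter> M = {} \<and>
        independent (P \<union> M) \<and> span (P \<union> M) = UNIV \<and> pairwise (\<lambda>u v. B u v = 0) (P \<union> M) \<and>
        (\<forall>v\<in>P. B v v > 0) \<and> (\<forall>v\<in>M. B v v < 0)" by (elim exE)
  then have PM: "finite P" "finite M" "span (P \<union> M) = UNIV" "pairwise (\<lambda>u v. B u v = 0) (P \<union> M)"
      "\<And>v. v \<in> P \<Longrightarrow> B v v > 0" "\<And>v. v \<in> M \<Longrightarrow> B v v < 0" by simp_all
  have f: "bilinear_form_on UNIV B" using sig by (simp add: has_signature_def)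
  have bil: "bilinear B" using f by (simp add: bilinear_form_on_UNIV)
  have P: "u = 0" if "u \<in> span P" "B u u \<le> 0" for u
    by (rule orthogonal_positive_span[OF f subspace_UNIV PM(1) subset_UNIV _ PM(5) that])
      (rule pairwise_subset[OF PM(4)], auto)
  have M: "u = 0" if "u \<in> span M" "B u u \<ge> 0" for u
  proof (rule orthogonal_positive_span[of UNIV "\<lambda>u v. - B u v" M])
    show "bilinear_form_on UNIV (\<lambda>u v. - B u v)" using f by (simp add: bilinear_form_on_def)
    show "pairwise (\<lambda>u v. - B u v = 0) M" using pairwise_subset[OF PM(4), of M] by (simp add: pairwise_def)
  qed (use PM that in auto)
  have Pperp: "u \<in> span M" if "\<And>w. w \<in> P \<Longrightarrow> B u w = 0" for u
  proof -
    have fin: "finite (P \<union> M)" using PM by simp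
    have "u \<in> span (P \<union> M)" using PM(3) by simp
    then obtain k where k: "u = (\<Sum>v\<in>P \<union> M. k v *\<^sub>R v)" using span_finite[OF fin] by auto
    have "k w = 0" if w: "w \<in> P" for w
    proof -
      have "0 = B u w" using that w \<open>\<And>w. w \<in> P \<Longrightarrow> B u w = 0\<close> by simp
      also have "\<dots> = (\<Sum>v\<in>P \<union> M. k v * B v w)"
        unfolding k using fin by (intro bilinear_form_on_sum(1)[OF f]) auto
      also have "\<dots> = (\<Sum>v\<in>P \<union> M. if v = w then k w * B w w else 0)"
        using PM(4) w by (intro sum.cong) (auto simp: pairwise_def)
      also have "\<dots> = k w * B w w" using w fin by simp
      finally show ?thesis using PM(5)[OF w] by simp
    qed
    then have "u = (\<Sum>v\<in>M. k v *\<^sub>R v)"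
      unfolding k using fin by (intro sum.mono_neutral_right) auto
    also have "\<dots> \<in> span M" by (intro span_sum span_scale span_base)
    finally show ?thesis .
  qed
  define S where "S = {a + w | a w. a \<in> N \<and> w \<in> span P}"
  have S: "subspace S" unfolding S_def by (rule subspace_sums[OF N subspace_span])
  have "S = UNIV"
  proof (rule ccontr)
    assume "S \<noteq> UNIV"
    then obtain s where s: "s \<notin> S" by blast
    have "span S = S" using S by (simp add: span_eq_iff)
    then have "span S \<subset> span (UNIV :: (real^'n) set)" using s by (simp only: span_UNIV) blast
    then obtain y where y: "y \<noteq> 0" "\<And>w. w \<in> span S \<Longrightarrow> orthogonal y w"
    proof (rule orthogonal_to_subspace_exists_gen)
      fix y assume "y \<noteq> 0" "\<And>w. w \<in> span S \<Longrightarrow> orthogonal y w"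
      then show thesis by (rule that)
    qed
    \<comment> \<open>\<open>\<gamma>\<close> represents \<open>B\<close> through the Euclidean
      inner product; its bijectivity turns a vector orthogonal to \<open>S\<close> in the Euclidean
      sense into one that is orthogonal with respect to \<open>B\<close>.\<close>
    define \<gamma> where "\<gamma> u = (\<Sum>b\<in>Basis. B u b *\<^sub>R b)" for u
    have g: "\<gamma> u \<bullet> w = B u w" for u w
    proof -
      have "B u w = B u (\<Sum>b\<in>Basis. (w \<bullet> b) *\<^sub>R b)" by (simp add: euclidean_representation)
      also have "\<dots> = (\<Sum>b\<in>Basis. (w \<bullet> b) * B u b)"
        by (rule bilinear_form_on_sum(2)[OF f subspace_UNIV]) auto
      finally show ?thesis by (simp add: \<gamma>_def inner_sum_left inner_sum_right inner_commute mult.commute)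
    qed
    have "linear \<gamma>" unfolding \<gamma>_def
      by (rule linearI) (simp_all add: bilinear_ladd[OF bil] bilinear_lmul[OF bil] scaleR_add_left sum.distrib scaleR_sum_right)
    moreover have "inj \<gamma>"
      unfolding linear_injective_0[OF \<open>linear \<gamma>\<close>]
      using g signature_nondegenerate[OF sig] by (metis UNIV_I inner_zero_left)
    ultimately obtain u where u: "\<gamma> u = y" using linear_injective_imp_surjective by (metis surjD)
    have Bu: "B u w = 0" if "w \<in> S" for w
      using y(2)[OF span_base[OF that]] g[of u w] u by (simp add: orthogonal_def)
    have "B u u \<ge> 0"
    proof (rule perp)
      fix w assume "w \<in> N"
      then have "w + 0 \<in> S" unfolding S_def using span_zero[of P] by blast
      then show "B u w = 0" using Bu by simp
    qed
    moreover have "u \<in> span M"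
    proof (rule Pperp)
      fix w assume "w \<in> P"
      then have "0 + w \<in> S" unfolding S_def using subspace_0[OF N] span_base by blast
      then show "B u w = 0" using Bu by simp
    qed
    ultimately have "u = 0" using M by blast
    then show False using u y(1) \<open>linear \<gamma>\<close> by (simp add: linear_0)
  qed
  then have sum: "\<exists>a\<in>N. u - a \<in> span P" for u
  proof -
    have "u \<in> S" using \<open>S = UNIV\<close> by simp
    then obtain a w where "a \<in> N" "w \<in> span P" "u = a + w" unfolding S_def by blast
    then show ?thesis by (intro bexI[of _ a]) simp_all
  qed
  have meet: "u = 0" if "u \<in> N" "u \<in> span P" for u using nonpos P that by blast
  obtain Q :: "real^'n^'n" where Q: "\<And>u. Q *v u \<in> N" "\<And>u. u - Q *v u \<in> span P" "\<And>u. u \<in> N \<Longrightarrow> Q *v u = u"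
    by (rule subspace_sum_direct[OF N subspace_span meet sum]) blast+
  show thesis
  proof (rule that[OF Q(1,3)])
    fix u assume "Q *v u = 0" "u \<noteq> 0"
    then have "u \<in> span P" using Q(2)[of u] by simp
    then show "B u u > 0" using P[of u] \<open>u \<noteq> 0\<close> by fastforce
  qed
qed

section \<open>Coordinates and determinants in the adapted basis\<close>

context adapted_basis
begin

definition coord :: "real^'n \<Rightarrow> nat \<times> nat \<times> nat \<Rightarrow> real" where
  "coord z a = representation (v ` idx n) z (v a)"

lemma coord_add: "coord (z + z') a = coord z a + coord z' a"
  and coord_scale: "coord (t *\<^sub>R z) a = t * coord z a"
  and coord_minus: "coord (- z) a = - coord z a"
  and coord_zero: "coord 0 a = 0"
  by (simp_all add: coord_def representation_add[OF indep_v] representation_scale[OF indep_v]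
      representation_neg[OF indep_v] representation_zero span_v)

lemma coord_v: "a \<in> idx n \<Longrightarrow> b \<in> idx n \<Longrightarrow> coord (v b) a = (if a = b then 1 else 0)"
  using inj_onD[OF inj_v, of a b] by (auto simp: coord_def representation_basis[OF indep_v])

lemma expand: "(\<Sum>a\<in>idx n. coord z a *\<^sub>R v a) = z"
proof -
  have "(\<Sum>a\<in>idx n. coord z a *\<^sub>R v a) = (\<Sum>u\<in>v ` idx n. representation (v ` idx n) z u *\<^sub>R u)"
    by (simp add: sum.reindex[OF inj_v] coord_def)
  also have "\<dots> = z"
    by (rule sum_representation_eq[OF indep_v]) (simp_all add: span_v fin_idx)
  finally show ?thesis .
qed

lemma linear_coord: "linear (\<lambda>z. coord z a)"
  by (rule linearI) (simp_all add: coord_add coord_scale)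

lemma coord_sum: "coord (\<Sum>s\<in>S. k s *\<^sub>R u s) a = (\<Sum>s\<in>S. k s * coord (u s) a)"
  by (simp add: linear_sum[OF linear_coord] coord_scale)

lemma mult_expand: "A *v z = (\<Sum>a\<in>idx n. coord z a *\<^sub>R (A *v v a))"
proof -
  have "A *v z = A *v (\<Sum>a\<in>idx n. coord z a *\<^sub>R v a)" by (simp add: expand)
  also have "\<dots> = (\<Sum>a\<in>idx n. coord z a *\<^sub>R (A *v v a))"
    by (subst linear_sum[OF matrix_vector_mul_linear]) (simp add: matrix_vector_mult_scaleR)
  finally show ?thesis .
qed

lemma card_idx: "card (idx n) = CARD('n)"
  using dim_span_eq_card_independent[OF indep_v] card_image[OF inj_v] unfolding span_v by (simp add: dim_UNIV)

lemma det_coord: "det A = ldet (idx n) (\<lambda>a b. coord (A *v v a) b)"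
proof -
  obtain f :: "'n \<Rightarrow> nat \<times> nat \<times> nat" where f: "bij_betw f UNIV (idx n)"
    using finite_same_card_bij[of "UNIV :: 'n set" "idx n"] fin_idx card_idx by auto
  have fI: "f k \<in> idx n" for k using f by (auto simp: bij_betw_def)
  define C :: "real^'n^'n" where "C = (\<chi> k i. v (f k) $ i)"
  define M :: "real^'n^'n" where "M = (\<chi> k l. coord (A *v v (f k)) (f l))"
  have rowC: "row k C = v (f k)" for k by (simp add: C_def row_def vec_eq_iff)
  have "rows C = v ` range f" by (auto simp: rows_def rowC)
  then have "rows C = v ` idx n" using f by (simp add: bij_betw_def)
  then have "span (rows C) = UNIV" using span_v by simp
  then have "det C \<noteq> 0"
    by (metis invertible_det_nz invertible_left_inverse matrix_left_invertible_span_rows)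
  \<comment> \<open>The basis vectors are the rows of \<open>C\<close>, so \<open>A\<close> acts on
    them from the right by its transpose; taking determinants cancels \<open>det C\<close>.\<close>
  have "C ** transpose A = M ** C"
  proof -
    have "(C ** transpose A) $ k $ i = (M ** C) $ k $ i" for k i
    proof -
      have "(C ** transpose A) $ k $ i = (A *v v (f k)) $ i"
        by (simp add: matrix_matrix_mult_def matrix_vector_mult_def transpose_def C_def mult.commute)
      also have "A *v v (f k) = (\<Sum>a\<in>idx n. coord (A *v v (f k)) a *\<^sub>R v a)" by (rule expand[symmetric])
      also have "\<dots> = (\<Sum>l\<in>UNIV. coord (A *v v (f k)) (f l) *\<^sub>R v (f l))"
        by (rule sum.reindex_bij_betw[OF f, symmetric])
      also have "\<dots> $ i = (M ** C) $ k $ i"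
        by (simp add: matrix_matrix_mult_def M_def C_def)
      finally show ?thesis .
    qed
    then show ?thesis by (simp add: vec_eq_iff)
  qed
  then have "det C * det A = det M * det C" by (metis det_mul det_transpose)
  then have "det A = det M" using \<open>det C \<noteq> 0\<close> by simp
  also have "\<dots> = ldet UNIV (\<lambda>k l. coord (A *v v (f k)) (f l))" by (simp add: det_eq_ldet M_def)
  also have "\<dots> = ldet (idx n) (\<lambda>a b. coord (A *v v a) b)"
    by (rule ldet_reindex[OF f, symmetric]) simp
  finally show ?thesis .
qed

lemma B_expand: "B z z' = (\<Sum>a\<in>idx n. \<Sum>b\<in>idx n. coord z a * coord z' b * B (v a) (v b))"
proof -
  have "B z z' = B (\<Sum>a\<in>idx n. coord z a *\<^sub>R v a) (\<Sum>b\<in>idx n. coord z' b *\<^sub>R v b)" by (simp add: expand)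
  also have "\<dots> = (\<Sum>b\<in>idx n. \<Sum>a\<in>idx n. coord z a * coord z' b * B (v a) (v b))"
    by (simp add: bilinear_lsum[OF bil] bilinear_rsum[OF bil] bilinear_lmul[OF bil] bilinear_rmul[OF bil]
        sum_distrib_left mult_ac)
  also have "\<dots> = (\<Sum>a\<in>idx n. \<Sum>b\<in>idx n. coord z a * coord z' b * B (v a) (v b))" by (rule sum.swap)
  finally show ?thesis .
qed

text \<open>Only pairs with i + i' = r fail to be orthogonal. With both 2 i and 2 i' at most r, this
  leaves the middle weight, where \<open>\<Phi> r\<close> is diagonal.\<close>

lemma B_self_expand:
  assumes "\<And>r i j. i \<le> r \<Longrightarrow> j < n r \<Longrightarrow> r < 2 * i \<Longrightarrow> coord z (r, i, j) = 0"
  shows "B z z = (\<Sum>(r, i, j)\<in>idx n. if 2 * i = r then (coord z (r, i, j))\<^sup>2 * (c r i * \<Phi> r j j) else 0)"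
  unfolding B_expand[of z z]
proof (rule sum.cong[OF refl])
  fix a assume a0: "a \<in> idx n"
  obtain r i j where a': "a = (r, i, j)" by (cases a)
  have a: "(r, i, j) \<in> idx n" using a0 a' by simp
  have "(\<Sum>b\<in>idx n. coord z (r, i, j) * coord z b * B (v (r, i, j)) (v b)) =
      (\<Sum>b\<in>idx n. if b = (r, i, j) then if 2 * i = r then (coord z (r, i, j))\<^sup>2 * (c r i * \<Phi> r j j) else 0 else 0)"
  proof (rule sum.cong[OF refl])
    fix b assume b: "b \<in> idx n"
    obtain r' i' j' where b': "b = (r', i', j')" by (cases b)
    have Bab: "B (v (r, i, j)) (v b) = (if r = r' \<and> i + i' = r then c r i * \<Phi> r j j' else 0)"
      using B_v a b b' by simp
    show "coord z (r, i, j) * coord z b * B (v (r, i, j)) (v b) =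
        (if b = (r, i, j) then if 2 * i = r then (coord z (r, i, j))\<^sup>2 * (c r i * \<Phi> r j j) else 0 else 0)"
    proof (cases "r = r' \<and> i + i' = r \<and> 2 * i \<le> r \<and> 2 * i' \<le> r")
      case True
      then have "i' = i" "2 * i = r" "r' = r" by auto
      moreover have "\<Phi> r j j' = 0" if "j \<noteq> j'" using Phi_even[of r j j'] that a b b' \<open>r' = r\<close> \<open>2 * i = r\<close> by auto
      ultimately show ?thesis using Bab b' by (auto simp: power2_eq_square)
    next
      case False
      then have "coord z (r, i, j) * coord z b * B (v (r, i, j)) (v b) = 0"
        using Bab assms[of i r j] assms[of i' r' j'] a b b' by auto
      moreover have "\<not> (b = (r, i, j) \<and> 2 * i = r)" using False b' by auto
      ultimately show ?thesis by auto
    qed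
  qed
  also have "\<dots> = (if 2 * i = r then (coord z (r, i, j))\<^sup>2 * (c r i * \<Phi> r j j) else 0)"
    using a fin_idx by simp
  finally show "(\<Sum>b\<in>idx n. coord z a * coord z b * B (v a) (v b)) =
    (case a of (r, i, j) \<Rightarrow> if 2 * i = r then (coord z (r, i, j))\<^sup>2 * (c r i * \<Phi> r j j) else 0)"
    unfolding a' prod.case .
qed

end

text \<open>Replacing \<open>B\<close> by its negative exchanges the two sign conditions without
  changing the group.\<close>

lemma SO_plus_scale:
  assumes "\<delta> \<noteq> (0::real)"
  shows "SO_plus (\<lambda>u w. \<delta> * B u w) = SO_plus B"
  using assms by (simp add: SO_plus_def O_group_def)

lemma SO_plus_isometry: "g \<in> SO_plus B \<Longrightarrow> B (g *v u) (g *v w) = B u w"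
  using subsetD[OF SO_plus_subset, of g B] unfolding O_group_def by blast

context adapted_basis
begin

lemma coord_x:
  assumes "l \<le> r" "j < n r"
  shows "coord (x *v z) (r, l, j) = (if l < r then real (l + 1) * coord z (r, l + 1, j) else 0)"
proof -
  have "coord (x *v z) (r, l, j) = (\<Sum>a\<in>idx n. coord z a * coord (x *v v a) (r, l, j))"
    by (subst mult_expand) (rule coord_sum)
  also have "\<dots> = (\<Sum>a\<in>idx n. if a = (r, l + 1, j) then real (l + 1) * coord z a else 0)"
  proof (rule sum.cong[OF refl])
    fix a assume a: "a \<in> idx n"
    obtain r' i' j' where a': "a = (r', i', j')" by (cases a)
    have "coord (x *v v a) (r, l, j) = real i' * (if (r, l, j) = (r', i' - 1, j') then 1 else 0)"
    proof -
      have "(r', i' - 1, j') \<in> idx n" "(r, l, j) \<in> idx n" using a a' assms by auto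
      then show ?thesis using a a' coord_v[of "(r, l, j)" "(r', i' - 1, j')"] by (simp add: x_v coord_scale)
    qed
    then show "coord z a * coord (x *v v a) (r, l, j) = (if a = (r, l + 1, j) then real (l + 1) * coord z a else 0)"
      using a' by (cases i') auto
  qed
  also have "\<dots> = (if l < r then real (l + 1) * coord z (r, l + 1, j) else 0)"
    using fin_idx assms by (simp add: Suc_le_eq)
  finally show ?thesis .
qed

lemma coord_x_power:
  assumes "l \<le> r" "j < n r"
  shows "\<exists>C>0. \<forall>z. coord (((*v) x ^^ k) z) (r, l, j) = (if l + k \<le> r then C * coord z (r, l + k, j) else 0)"
  using assms(1)
proof (induction k arbitrary: l)
  case 0
  then show ?case by (intro exI[of _ 1]) simp
next
  case (Suc k)
  show ?case
  proof (cases "l < r")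
    case True
    then obtain C where C: "C > 0"
      "\<And>z. coord (((*v) x ^^ k) z) (r, l + 1, j) = (if l + 1 + k \<le> r then C * coord z (r, l + 1 + k, j) else 0)"
      using Suc.IH[of "l + 1"] by auto
    then show ?thesis using True coord_x[OF Suc.prems assms(2)]
      by (intro exI[of _ "real (l + 1) * C"]) auto
  next
    case False
    then show ?thesis using coord_x[OF Suc.prems assms(2)] by (intro exI[of _ 1]) auto
  qed
qed

lemma x_power_v:
  assumes "i \<le> r" "j < n r" "k \<le> i"
  shows "\<exists>C>0. ((*v) x ^^ k) (v (r, i, j)) = C *\<^sub>R v (r, i - k, j)"
  using assms(3)
proof (induction k)
  case 0
  then show ?case by (intro exI[of _ 1]) simp
next
  case (Suc k)
  then obtain C where C: "C > 0" "((*v) x ^^ k) (v (r, i, j)) = C *\<^sub>R v (r, i - k, j)" by auto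
  have "((*v) x ^^ Suc k) (v (r, i, j)) = (C * real (i - k)) *\<^sub>R v (r, i - Suc k, j)"
    using C Suc.prems assms x_v[of "i - k" r j] by (simp add: matrix_vector_mult_scaleR)
  then show ?case using C(1) Suc.prems by (intro exI[of _ "C * real (i - k)"]) simp
qed

lemma x_power_v_zero:
  assumes "i \<le> r" "j < n r"
  shows "((*v) x ^^ Suc i) (v (r, i, j)) = 0"
proof -
  obtain C where "((*v) x ^^ i) (v (r, i, j)) = C *\<^sub>R v (r, 0, j)" using x_power_v[OF assms, of i] by auto
  then show ?thesis using x_v[of 0 r j] assms by (simp add: matrix_vector_mult_scaleR)
qed

lemma mem_span_v:
  assumes "J \<subseteq> idx n"
  shows "z \<in> span (v ` J) \<longleftrightarrow> (\<forall>a\<in>idx n - J. coord z a = 0)"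
proof
  assume "z \<in> span (v ` J)"
  then show "\<forall>a\<in>idx n - J. coord z a = 0"
  proof (induction rule: span_induct_alt)
    case base
    then show ?case by (simp add: coord_zero)
  next
    case (step t u z')
    then obtain b where "b \<in> J" "u = v b" by blast
    have "coord u a = 0" if "a \<in> idx n - J" for a
    proof -
      have "a \<noteq> b" "a \<in> idx n" "b \<in> idx n" using that \<open>b \<in> J\<close> assms by blast+
      then show ?thesis using coord_v[of a b] \<open>u = v b\<close> by simp
    qed
    with step show ?case by (simp add: coord_add coord_scale)
  qed
next
  assume 0: "\<forall>a\<in>idx n - J. coord z a = 0"
  have "z = (\<Sum>a\<in>idx n. coord z a *\<^sub>R v a)" by (rule expand[symmetric])
  also have "\<dots> = (\<Sum>a\<in>J. coord z a *\<^sub>R v a)"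
    using 0 assms fin_idx by (intro sum.mono_neutral_right) auto
  also have "\<dots> \<in> span (v ` J)" by (intro span_sum span_scale span_base) auto
  finally show "z \<in> span (v ` J)" .
qed

section \<open>Block structure of an isometry anticommuting with x\<close>

context
  fixes g assumes g: "g \<in> SO_plus B" and gx: "g ** x = - x ** g"
begin

lemma g_x: "g *v (x *v z) = - (x *v (g *v z))"
proof -
  have "(- A) *v w = - (A *v w)" for A :: "real^'n^'n" and w
    by (simp add: matrix_vector_mult_def vec_eq_iff sum_negf)
  then show ?thesis using gx by (simp add: matrix_vector_mul_assoc matrix_mult_simps)
qed

lemma g_x_power: "g *v (((*v) x ^^ k) z) = (-1) ^ k *\<^sub>R ((*v) x ^^ k) (g *v z)"
  by (induction k) (simp_all add: g_x matrix_vector_mult_scaleR)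

text \<open>\<open>g\<close> preserves kernels and images of powers of \<open>x\<close>. The first
  bound holds because \<open>v (r, i, j)\<close> is killed by the power \<open>i + 1\<close>, the
  second because it lies in the image of the power \<open>r - i\<close>, where coordinates with i' >
  r' - (r - i) vanish.\<close>

lemma g_triangular:
  assumes a: "i \<le> r" "j < n r" "i' \<le> r'" "j' < n r'" and nz: "coord (g *v v (r, i, j)) (r', i', j') \<noteq> 0"
  shows "i' \<le> i" "i' + (r - i) \<le> r'"
proof -
  show "i' \<le> i"
  proof (rule ccontr)
    assume "\<not> i' \<le> i"
    then have i: "Suc i \<le> i'" by simp
    obtain C where C: "C > 0" "\<And>z. coord (((*v) x ^^ Suc i) z) (r', i' - Suc i, j') =
        (if i' - Suc i + Suc i \<le> r' then C * coord z (r', i' - Suc i + Suc i, j') else 0)"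
    proof -
      have "i' - Suc i \<le> r'" using a(3) by simp
      from coord_x_power[OF this a(4), of "Suc i"] show thesis using that by blast
    qed
    have "((*v) x ^^ Suc i) (g *v v (r, i, j)) = (-1) ^ Suc i *\<^sub>R (g *v (((*v) x ^^ Suc i) (v (r, i, j))))"
      unfolding g_x_power scaleR_scaleR by (simp flip: power_mult_distrib)
    then have "((*v) x ^^ Suc i) (g *v v (r, i, j)) = 0" unfolding x_power_v_zero[OF a(1,2)] by simp
    then have "C * coord (g *v v (r, i, j)) (r', i', j') = 0"
      using C(2)[of "g *v v (r, i, j)"] i a(3) by (simp add: coord_zero)
    then show False using C(1) nz by simp
  qed
  show "i' + (r - i) \<le> r'"
  proof (rule ccontr)
    assume "\<not> i' + (r - i) \<le> r'"
    moreover obtain C where C: "C > 0" "\<And>z. coord (((*v) x ^^ (r - i)) z) (r', i', j') =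
        (if i' + (r - i) \<le> r' then C * coord z (r', i' + (r - i), j') else 0)"
      using coord_x_power[OF a(3,4), of "r - i"] by blast
    ultimately have 0: "coord (((*v) x ^^ (r - i)) z) (r', i', j') = 0" for z by simp
    obtain D where D: "D > 0" "((*v) x ^^ (r - i)) (v (r, r, j)) = D *\<^sub>R v (r, r - (r - i), j)"
      using x_power_v[of r r j "r - i"] a by auto
    have "D * coord (g *v v (r, i, j)) (r', i', j') = coord (g *v (D *\<^sub>R v (r, r - (r - i), j))) (r', i', j')"
      using a by (simp add: matrix_vector_mult_scaleR coord_scale)
    also have "\<dots> = 0" unfolding D(2)[symmetric] g_x_power by (simp add: coord_scale 0)
    finally show False using D(1) nz by simp
  qed
qed

text \<open>Comparing coordinates after one application of \<open>x\<close> lowers \<open>i\<close>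
  by one at the cost of one sign.\<close>

lemma g_block_sign:
  assumes "i \<le> r" "j < n r" "k < n r"
  shows "coord (g *v v (r, i, j)) (r, i, k) = (-1) ^ i * coord (g *v v (r, 0, j)) (r, 0, k)"
  using assms(1)
proof (induction i)
  case (Suc i)
  have "real (Suc i) * coord (g *v v (r, Suc i, j)) (r, Suc i, k) = coord (x *v (g *v v (r, Suc i, j))) (r, i, k)"
    using coord_x[of i r k "g *v v (r, Suc i, j)"] Suc.prems assms by simp
  also have "\<dots> = - coord (g *v (x *v v (r, Suc i, j))) (r, i, k)" by (simp add: g_x coord_minus)
  also have "x *v v (r, Suc i, j) = real (Suc i) *\<^sub>R v (r, i, j)"
    using x_v[of "Suc i" r j] Suc.prems assms by simp
  also have "- coord (g *v (real (Suc i) *\<^sub>R v (r, i, j))) (r, i, k) = real (Suc i) * (- coord (g *v v (r, i, j)) (r, i, k))"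
    by (simp only: matrix_vector_mult_scaleR coord_scale mult_minus_right)
  finally have "coord (g *v v (r, Suc i, j)) (r, Suc i, k) = - coord (g *v v (r, i, j)) (r, i, k)"
    by (simp only: mult_cancel_left of_nat_eq_0_iff) simp
  then show ?case using Suc by simp
qed simp

text \<open>\<open>B\<close> pairs the block at \<open>i = 0\<close> with the block at
  \<open>i = r\<close>, and the second is (-1)^r = -1 times the first. So the isometry condition
  says that the block is anti-symplectic.\<close>

lemma g_odd_block_det:
  assumes "odd r"
  shows "ldet {..<n r} (\<lambda>j k. coord (g *v v (r, 0, j)) (r, 0, k)) = (-1) ^ (n r div 2)"
proof -
  define G where "G j k = coord (g *v v (r, 0, j)) (r, 0, k)" for j k
  have nr: "2 * (n r div 2) = n r" using n_odd[OF assms] by simp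
  have "(\<Sum>k<n r. \<Sum>l<n r. G j k * G j' l * std_symp k l) = - std_symp j j'" if j: "j < n r" "j' < n r" for j j'
  proof -
    have "c r 0 * std_symp j j' = B (v (r, 0, j)) (v (r, r, j'))"
      using B_v[of 0 r j r r j'] j Phi_odd[OF assms] by simp
    also have "\<dots> = B (g *v v (r, 0, j)) (g *v v (r, r, j'))"
      using SO_plus_isometry[OF g] by simp
    also have "\<dots> = (\<Sum>a\<in>idx n. \<Sum>b\<in>idx n. coord (g *v v (r, 0, j)) a * coord (g *v v (r, r, j')) b * B (v a) (v b))"
      by (rule B_expand)
    also have "\<dots> = (\<Sum>a\<in>(\<lambda>k. (r, 0::nat, k)) ` {..<n r}. \<Sum>b\<in>(\<lambda>k. (r, r, k)) ` {..<n r}.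
        coord (g *v v (r, 0, j)) a * coord (g *v v (r, r, j')) b * B (v a) (v b))"
    proof -
      have zero: "coord (g *v v (r, 0, j)) a * coord (g *v v (r, r, j')) b * B (v a) (v b) = 0"
        if ab: "a \<in> idx n" "b \<in> idx n" and out: "a \<notin> (\<lambda>k. (r, 0::nat, k)) ` {..<n r} \<or> b \<notin> (\<lambda>k. (r, r, k)) ` {..<n r}" for a b
      proof (rule ccontr)
        obtain s i k where a': "a = (s, i, k)" by (cases a)
        obtain s' i' k' where b': "b = (s', i', k')" by (cases b)
        assume "coord (g *v v (r, 0, j)) a * coord (g *v v (r, r, j')) b * B (v a) (v b) \<noteq> 0"
        then have nz: "coord (g *v v (r, 0, j)) (s, i, k) \<noteq> 0" "coord (g *v v (r, r, j')) (s', i', k') \<noteq> 0"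
          "B (v (s, i, k)) (v (s', i', k')) \<noteq> 0" using a' b' by auto
        \<comment> \<open>Triangularity gives i = 0, s at least r and i' at most r, while a nonzero
          pairing needs i + i' = s; so s = i' = r and only the two extreme blocks survive.\<close>
        have "i = 0" "r \<le> s" using g_triangular[of 0 r j i s k] nz(1) j ab a' by auto
        moreover have "i' \<le> r" using g_triangular[of r r j' i' s' k'] nz(2) j ab b' by auto
        moreover have "s' = s" "i + i' = s" using nz(3) B_v[of i s k i' s' k'] ab a' b' by (auto split: if_splits)
        ultimately show False using out ab a' b' by auto
      qed
      have sub: "(\<lambda>k. (r, 0::nat, k)) ` {..<n r} \<subseteq> idx n" "(\<lambda>k. (r, r, k)) ` {..<n r} \<subseteq> idx n" by auto
      show ?thesis
      proof (rule sum.mono_neutral_cong_right[OF fin_idx sub(1)])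
        show "\<forall>a\<in>idx n - (\<lambda>k. (r, 0::nat, k)) ` {..<n r}.
            (\<Sum>b\<in>idx n. coord (g *v v (r, 0, j)) a * coord (g *v v (r, r, j')) b * B (v a) (v b)) = 0"
          using zero by (intro ballI sum.neutral) blast
        fix a assume "a \<in> (\<lambda>k. (r, 0::nat, k)) ` {..<n r}"
        then have "a \<in> idx n" using sub(1) by blast
        then show "(\<Sum>b\<in>idx n. coord (g *v v (r, 0, j)) a * coord (g *v v (r, r, j')) b * B (v a) (v b)) =
            (\<Sum>b\<in>(\<lambda>k. (r, r, k)) ` {..<n r}. coord (g *v v (r, 0, j)) a * coord (g *v v (r, r, j')) b * B (v a) (v b))"
          using zero by (intro sum.mono_neutral_right[OF fin_idx sub(2)] ballI) blast
      qed
    qed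
    also have "\<dots> = (\<Sum>k<n r. \<Sum>l<n r. G j k * coord (g *v v (r, r, j')) (r, r, l) * (c r 0 * std_symp k l))"
    proof -
      have inj: "inj_on (\<lambda>k. (r, 0::nat, k)) {..<n r}" "inj_on (\<lambda>k. (r, r, k)) {..<n r}" by (auto intro: inj_onI)
      show ?thesis
        unfolding sum.reindex[OF inj(1)] sum.reindex[OF inj(2)] comp_def G_def
        by (intro sum.cong refl) (simp add: B_v Phi_odd[OF assms])
    qed
    also have "\<dots> = (\<Sum>k<n r. \<Sum>l<n r. (- c r 0) * (G j k * G j' l * std_symp k l))"
      using g_block_sign[of r r j'] j assms by (intro sum.cong refl) (simp add: G_def)
    also have "\<dots> = - c r 0 * (\<Sum>k<n r. \<Sum>l<n r. G j k * G j' l * std_symp k l)"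
      by (simp add: sum_distrib_left)
    finally have "c r 0 * ((\<Sum>k<n r. \<Sum>l<n r. G j k * G j' l * std_symp k l) + std_symp j j') = 0"
      by (simp add: distrib_left)
    then show ?thesis using c_nz[of 0 r] by simp
  qed
  then show ?thesis
    using ldet_antisymplectic[of "n r div 2" G] unfolding nr G_def by simp
qed

end

end

text \<open>The exponent of \<open>-1\<close> that \<open>V_r \<otimes> W_r\<close> with \<open>dim W_r = N\<close> contributes to the determinant of the
  compression, see \<open>low_idx_sign\<close>.\<close>

definition parity_weight :: "nat \<Rightarrow> nat \<Rightarrow> nat" where
  "parity_weight r N = (if r mod 8 = 2 \<or> r mod 8 = 4 then N else if r mod 4 = 1 then N div 2 else 0)"

text \<open>On the middle weight space \<open>B\<close> is a positive multiple of
  \<open>\<Phi> r\<close>. Under a sign condition it has one sign for all odd r/2 and the opposite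
  sign for all even r/2; only the former joins the low part.\<close>

definition low_idx :: "nat \<Rightarrow> nat set" where
  "low_idx r = {i. i \<le> r \<and> (2 * i < r \<or> 2 * i = r \<and> odd (r div 2))}"

lemma prod_signs: "(\<Prod>i<4 * q + s. (-1) ^ i) = (if s = 2 \<or> s = 3 then -1 else 1 :: real)" if "s \<le> 4"
proof -
  have e: "(-1 :: real) ^ (4 * q) = 1" by simp
  have step: "(\<Prod>i<Suc k. (-1) ^ i) = (\<Prod>i<k. (-1) ^ i) * (-1 :: real) ^ k" for k
    by (rule prod.lessThan_Suc)
  have 0: "(\<Prod>i<4 * q. (-1) ^ i) = (1 :: real)"
  proof (induction q)
    case (Suc q)
    have "4 * Suc q = Suc (Suc (Suc (Suc (4 * q))))" by simp
    then show ?case by (simp only: step Suc) simp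
  qed simp
  have "s = 0 \<or> s = Suc 0 \<or> s = Suc (Suc 0) \<or> s = Suc (Suc (Suc 0)) \<or> s = Suc (Suc (Suc (Suc 0)))"
    using that by arith
  then show ?thesis by (elim disjE) (simp_all only: add_0_right add_Suc_right step 0 e power_Suc, simp_all)
qed

text \<open>The sign product is -1 when r is 2, 3, 4 or 5 mod 8, but for odd \<open>r\<close> it is
  raised to the even power \<open>N\<close>, which leaves 2 and 4. The number of low indices is odd
  only for r equal to 1 mod 4, and only there does \<open>D\<close> contribute its sign.\<close>

lemma low_idx_sign:
  assumes "(D::real) \<noteq> 0" and "odd r \<Longrightarrow> even N \<and> D = (-1) ^ (N div 2)"
  shows "\<exists>t>0. (\<Prod>i\<in>low_idx r. ((-1) ^ i) ^ N * D) = (-1) ^ parity_weight r N * t"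
proof -
  have P: "(\<Prod>i<k. ((-1) ^ i) ^ N * D) = (\<Prod>i<k. (-1) ^ i) ^ N * D ^ k" for k
    by (simp add: prod.distrib prod_power_distrib)
  define q where "q = r div 8"
  have r: "r = 8 * q + r mod 8" by (simp add: q_def)
  have pos: "D ^ k > 0" if "even k" for k using assms(1) that by (simp add: zero_less_power_eq)
  have "r mod 8 < 8" by simp
  then have "r mod 8 = 0 \<or> r mod 8 = 1 \<or> r mod 8 = 2 \<or> r mod 8 = 3 \<or> r mod 8 = 4 \<or> r mod 8 = 5 \<or>
      r mod 8 = 6 \<or> r mod 8 = 7" by arith
  then show ?thesis
  proof (elim disjE)
    assume 1: "r mod 8 = 0"
    then have r': "r = 8 * q" using r by simp
    then have "low_idx r = {..<4 * q + 0}" by (auto simp: low_idx_def)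
    moreover have "parity_weight r N = 0" unfolding parity_weight_def r' by simp
    ultimately show ?thesis using pos[of "4 * q + 0"] by (simp only: P prod_signs) (auto intro: exI[of _ "D ^ (4 * q)"])
  next
    assume 2: "r mod 8 = 1"
    then have r': "r = 8 * q + 1" using r by simp
    then have "low_idx r = {..<4 * q + 1}" by (auto simp: low_idx_def)
    moreover have "parity_weight r N = N div 2" unfolding parity_weight_def r' by simp presburger
    moreover have "D ^ (4 * q + 1) = D ^ (4 * q) * (-1) ^ (N div 2)" using assms(2) r' by (simp add: power_add)
    ultimately show ?thesis using pos[of "4 * q"]
      by (simp only: P prod_signs) (auto intro: exI[of _ "D ^ (4 * q)"])
  next
    assume 3: "r mod 8 = 2"
    then have r': "r = 8 * q + 2" using r by simp
    then have "r div 2 = 4 * q + 1" by simp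
    then have "low_idx r = {..<4 * q + 2}" unfolding low_idx_def using r' by auto
    moreover have "parity_weight r N = N" unfolding parity_weight_def using 3 by simp
    ultimately show ?thesis using pos[of "4 * q + 2"]
      by (simp only: P prod_signs) (auto intro: exI[of _ "D ^ (4 * q + 2)"])
  next
    assume 4: "r mod 8 = 3"
    then have r': "r = 8 * q + 3" using r by simp
    then have "low_idx r = {..<4 * q + 2}" by (auto simp: low_idx_def)
    moreover have "parity_weight r N = 0" unfolding parity_weight_def r' by simp presburger
    moreover have "even N" using assms(2) r' by simp
    ultimately show ?thesis using pos[of "4 * q + 2"]
      by (simp only: P prod_signs) (auto intro: exI[of _ "D ^ (4 * q + 2)"])
  next
    assume 5: "r mod 8 = 4"
    then have r': "r = 8 * q + 4" using r by simp
    then have "r div 2 = 4 * q + 2" by simp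
    then have "low_idx r = {..<4 * q + 2}" unfolding low_idx_def using r' by auto
    moreover have "parity_weight r N = N" unfolding parity_weight_def using 5 by simp
    ultimately show ?thesis using pos[of "4 * q + 2"]
      by (simp only: P prod_signs) (auto intro: exI[of _ "D ^ (4 * q + 2)"])
  next
    assume 6: "r mod 8 = 5"
    then have r': "r = 8 * q + 5" using r by simp
    then have "low_idx r = {..<4 * q + 3}" by (auto simp: low_idx_def)
    moreover have "parity_weight r N = N div 2" unfolding parity_weight_def r' by simp presburger
    moreover have "D ^ (4 * q + 3) = D ^ (4 * q + 2) * D" by (simp add: eval_nat_numeral)
    then have "D ^ (4 * q + 3) = D ^ (4 * q + 2) * (-1) ^ (N div 2)" using assms(2) r' by simp
    moreover have "even N" using assms(2) r' by simp
    ultimately show ?thesis using pos[of "4 * q + 2"]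
      by (simp only: P prod_signs) (auto intro: exI[of _ "D ^ (4 * q + 2)"])
  next
    assume 7: "r mod 8 = 6"
    then have r': "r = 8 * q + 6" using r by simp
    then have "r div 2 = 4 * q + 3" by simp
    then have "low_idx r = {..<4 * q + 4}" unfolding low_idx_def using r' by auto
    moreover have "parity_weight r N = 0" unfolding parity_weight_def r' by simp presburger
    ultimately show ?thesis using pos[of "4 * q + 4"]
      by (simp only: P prod_signs) (auto intro: exI[of _ "D ^ (4 * q + 4)"])
  next
    assume 8: "r mod 8 = 7"
    then have r': "r = 8 * q + 7" using r by simp
    then have "low_idx r = {..<4 * q + 4}" by (auto simp: low_idx_def)
    moreover have "parity_weight r N = 0" unfolding parity_weight_def r' by simp presburger
    ultimately show ?thesis using pos[of "4 * q + 4"]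
      by (simp only: P prod_signs) (auto intro: exI[of _ "D ^ (4 * q + 4)"])
  qed
qed

lemma prod_sign_rep:
  fixes f :: "'a \<Rightarrow> real"
  assumes "finite R" "\<And>r. r \<in> R \<Longrightarrow> \<exists>t>0. f r = (-1) ^ e r * t"
  shows "\<exists>t>0. prod f R = (-1) ^ sum e R * t"
  using assms(1,2)
proof (induction R rule: finite_induct)
  case empty
  show ?case by (intro exI[of _ 1]) simp
next
  case (insert r R)
  obtain t where t: "t > 0" "prod f R = (-1) ^ sum e R * t" using insert by auto
  obtain s where s: "s > 0" "f r = (-1) ^ e r * s" using insert by auto
  show ?case using insert t s by (intro exI[of _ "t * s"]) (simp add: power_add)
qed

lemma prod_parity_sign:
  fixes f :: "'a \<Rightarrow> real"
  assumes "finite R" "\<And>r. r \<in> R \<Longrightarrow> \<exists>t>0. f r = (-1) ^ e r * t" "prod f R > 0"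
  shows "even (sum e R)"
proof -
  have "\<exists>t>0. prod f R = (-1) ^ sum e R * t" using assms(1,2) by (rule prod_sign_rep)
  then obtain t where t: "t > 0" "prod f R = (-1) ^ sum e R * t" by blast
  then have "(-1) ^ sum e R * t > 0" using assms(3) by simp
  then show ?thesis using t(1) by (cases "even (sum e R)") auto
qed

section \<open>Determinant of the compression to the low subspace\<close>

context adapted_basis
begin

definition supp :: "nat set" where
  "supp = {r. n r > 0}"

lemma finite_supp: "finite supp"
proof -
  have "supp \<subseteq> fst ` idx n"
  proof
    fix r assume "r \<in> supp"
    then show "r \<in> fst ` idx n" by (intro image_eqI[of _ _ "(r, 0, 0)"]) (auto simp: supp_def)
  qed
  then show ?thesis using fin_idx finite_subset by blast
qed

definition low :: "(nat \<times> nat \<times> nat) set" where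
  "low = {(r, i, j). i \<in> low_idx r \<and> j < n r}"

lemma low_subset: "low \<subseteq> idx n"
  by (auto simp: low_def low_idx_def)

lemma low_ldet:
  assumes "\<And>r i j r' i' j'. i \<le> r \<Longrightarrow> j < n r \<Longrightarrow> i' \<le> r' \<Longrightarrow> j' < n r' \<Longrightarrow>
     M (r, i, j) (r', i', j') \<noteq> 0 \<Longrightarrow> i' \<le> i \<and> i' + (r - i) \<le> r'"
  shows "ldet low M = (\<Prod>r\<in>supp. \<Prod>i\<in>low_idx r. ldet {..<n r} (\<lambda>j k. M (r, i, j) (r, i, k)))"
proof -
  obtain K where K: "\<And>r i j. i \<le> r \<Longrightarrow> j < n r \<Longrightarrow> i < K"
  proof (rule that[of "Suc (Max ((\<lambda>(r, i, j). i) ` idx n))"])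
    fix r i j assume "i \<le> r" "j < n r"
    then have "i \<in> (\<lambda>(r, i, j). i) ` idx n" by (intro image_eqI[of _ _ "(r, i, j)"]) auto
    then show "i < Suc (Max ((\<lambda>(r, i, j). i) ` idx n))" using fin_idx by (simp add: less_Suc_eq_le)
  qed
  \<comment> \<open>One integer encodes the lexicographic order by -(r - i) and then i:
    \<open>K\<close> exceeds every \<open>i\<close>, so different (r, i) receive different keys, and
    both inequalities for a nonzero entry can only lower the key.\<close>
  define key2 where "key2 = (\<lambda>(r, i). int i - int (r - i) * int K)"
  define key where "key = (\<lambda>(r, i, j::nat). key2 (r, i))"
  define S where "S = (SIGMA r:supp. low_idx r)"
  have fin: "finite low" using low_subset fin_idx by (rule finite_subset)
  have inj: "inj_on key2 S"
  proof (rule inj_onI)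
    fix a b assume a: "a \<in> S" and b: "b \<in> S" and eq: "key2 a = key2 b"
    obtain r i where a': "a = (r, i)" by (cases a)
    obtain r' i' where b': "b = (r', i')" by (cases b)
    have lt: "i < K" "i' < K" "i \<le> r" "i' \<le> r'"
      using a b a' b' K[of i r 0] K[of i' r' 0] by (auto simp: S_def supp_def low_idx_def)
    have *: False if "m < m'" "int k - int m * int K = int k' - int m' * int K" "k' < K" for m m' k k'
    proof -
      have "int (m + 1) * int K \<le> int m' * int K" using that(1) by (intro mult_right_mono) auto
      then have "int m * int K + int K \<le> int m' * int K" by (simp add: algebra_simps)
      then show False using that(2,3) by linarith
    qed
    have eq': "int i - int (r - i) * int K = int i' - int (r' - i') * int K" using eq a' b' by (simp add: key2_def)
    then have "\<not> r - i < r' - i'" "\<not> r' - i' < r - i" using * lt by metis+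
    then have "r - i = r' - i'" by simp
    then show "a = b" using eq' lt a' b' by simp
  qed
  have "ldet low M = (\<Prod>k\<in>key ` low. ldet {a\<in>low. key a = k} M)"
  proof (rule ldet_key_triangular[OF fin])
    fix a b assume a: "a \<in> low" and b: "b \<in> low" and lt: "key a < key b"
    obtain r i j where a': "a = (r, i, j)" by (cases a)
    obtain r' i' j' where b': "b = (r', i', j')" by (cases b)
    show "M a b = 0"
    proof (rule ccontr)
      assume "M a b \<noteq> 0"
      moreover have "(r, i, j) \<in> idx n" "(r', i', j') \<in> idx n" using a b a' b' low_subset by auto
      ultimately have "i' \<le> i \<and> i' + (r - i) \<le> r'"
        using a' b' by (intro assms[of i r j i' r' j']) simp_all
      then have "i' \<le> i" "r - i \<le> r' - i'" by arith+
      then have "int i' \<le> int i" "int (r - i) * int K \<le> int (r' - i') * int K" by (auto intro: mult_right_mono)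
      then show False using lt a' b' by (simp add: key_def key2_def)
    qed
  qed
  also have "key ` low = key2 ` S"
  proof -
    have "(\<lambda>(r, i, j). (r, i)) ` low = S"
    proof
      show "(\<lambda>(r, i, j). (r, i)) ` low \<subseteq> S" by (auto simp: low_def S_def supp_def)
      show "S \<subseteq> (\<lambda>(r, i, j). (r, i)) ` low"
      proof
        fix a assume "a \<in> S"
        then obtain r i where "a = (r, i)" "n r > 0" "i \<in> low_idx r" by (auto simp: S_def supp_def)
        then show "a \<in> (\<lambda>(r, i, j). (r, i)) ` low" by (intro image_eqI[of _ _ "(r, i, 0)"]) (auto simp: low_def)
      qed
    qed
    moreover have "key = key2 \<circ> (\<lambda>(r, i, j). (r, i))" by (auto simp: key_def fun_eq_iff)
    ultimately show ?thesis by (simp only: image_comp[symmetric])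
  qed
  also have "(\<Prod>k\<in>key2 ` S. ldet {a\<in>low. key a = k} M) = (\<Prod>p\<in>S. ldet {a\<in>low. key a = key2 p} M)"
    by (rule prod.reindex_cong[OF inj refl refl])
  also have "\<dots> = (\<Prod>(r, i)\<in>S. ldet {..<n r} (\<lambda>j k. M (r, i, j) (r, i, k)))"
  proof (rule prod.cong[OF refl])
    fix p assume p: "p \<in> S"
    obtain r i where p': "p = (r, i)" by (cases p)
    have "{a\<in>low. key a = key2 p} = (\<lambda>j. (r, i, j)) ` {..<n r}"
    proof
      show "(\<lambda>j. (r, i, j)) ` {..<n r} \<subseteq> {a\<in>low. key a = key2 p}"
        using p p' by (auto simp: low_def S_def key_def)
      show "{a\<in>low. key a = key2 p} \<subseteq> (\<lambda>j. (r, i, j)) ` {..<n r}"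
      proof
        fix a assume a: "a \<in> {a\<in>low. key a = key2 p}"
        obtain r' i' j' where a': "a = (r', i', j')" by (cases a)
        have "(r', i') \<in> S" "j' < n r'" using a a' by (auto simp: low_def S_def supp_def)
        moreover have "key2 (r', i') = key2 p" using a a' by (simp add: key_def)
        ultimately have "(r', i') = p" using inj p by (auto dest: inj_onD)
        then show "a \<in> (\<lambda>j. (r, i, j)) ` {..<n r}" using a' p' \<open>j' < n r'\<close> by auto
      qed
    qed
    moreover have "bij_betw (\<lambda>j. (r, i, j)) {..<n r} ((\<lambda>j. (r, i, j)) ` {..<n r})"
      by (auto simp: bij_betw_def inj_on_def)
    ultimately have "ldet {a\<in>low. key a = key2 p} M = ldet {..<n r} (\<lambda>j k. M (r, i, j) (r, i, k))"
      using ldet_reindex[of "\<lambda>j. (r, i, j)" "{..<n r}"] by simp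
    then show "ldet {a\<in>low. key a = key2 p} M = (case p of (r, i) \<Rightarrow> ldet {..<n r} (\<lambda>j k. M (r, i, j) (r, i, k)))"
      using p' by simp
  qed
  also have "\<dots> = (\<Prod>r\<in>supp. \<Prod>i\<in>low_idx r. ldet {..<n r} (\<lambda>j k. M (r, i, j) (r, i, k)))"
    unfolding S_def using finite_supp by (subst prod.Sigma) (auto simp: low_idx_def)
  finally show ?thesis .
qed

text \<open>Taken with \<open>\<delta>\<close> = 1 or -1, this is the obstruction under the first or
  the second sign condition. The span of \<open>low\<close> is stable under \<open>g\<close>, so the
  positive determinant of the compression is that of a triangular matrix and can be evaluated block
  by block.\<close>

lemma conjugate_parity:
  assumes g: "g \<in> SO_plus B" and gx: "g ** x = - x ** g"
    and \<delta>: "\<delta> \<noteq> 0" and sig: "has_signature UNIV (\<lambda>u w. \<delta> * B u w) p q"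
    and pure: "\<And>r j. even r \<Longrightarrow> j < n r \<Longrightarrow> \<delta> * (-1) ^ (r div 2) * \<Phi> r j j > 0"
  shows "even (\<Sum>r\<in>supp. parity_weight r (n r))"
proof -
  let ?N = "span (v ` low)"
  have nonpos: "\<delta> * B u u \<le> 0" if "u \<in> ?N" for u
  proof -
    have 0: "coord u a = 0" if "a \<in> idx n - low" for a
      using \<open>u \<in> ?N\<close> that unfolding mem_span_v[OF low_subset] by blast
    have "\<delta> * B u u = (\<Sum>(r, i, j)\<in>idx n. \<delta> * (if 2 * i = r then (coord u (r, i, j))\<^sup>2 * (c r i * \<Phi> r j j) else 0))"
      by (subst B_self_expand) (auto intro!: 0 simp: sum_distrib_left low_def low_idx_def case_prod_beta)
    also have "\<dots> \<le> 0"
    proof (rule sum_nonpos)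
      fix a assume "a \<in> idx n"
      obtain r i j where a': "a = (r, i, j)" by (cases a)
      have "\<delta> * ((coord u (r, i, j))\<^sup>2 * (c r i * \<Phi> r j j)) \<le> 0" if mid: "2 * i = r"
      proof (cases "odd i")
        case True
        have "\<delta> * (-1) ^ (r div 2) * \<Phi> r j j > 0" using pure[of r j] \<open>a \<in> idx n\<close> a' mid by auto
        then have "\<delta> * \<Phi> r j j < 0" using True mid by auto
        moreover have "c r i > 0" using c_mid[of r] mid by auto
        ultimately have "(coord u (r, i, j))\<^sup>2 * c r i * (\<delta> * \<Phi> r j j) \<le> 0"
          by (intro mult_nonneg_nonpos[of "(coord u (r, i, j))\<^sup>2 * c r i"]) simp_all
        then show ?thesis by (simp add: mult_ac)
      next
        case False
        then have "a \<notin> low" using a' mid by (auto simp: low_def low_idx_def)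
        then show ?thesis using 0[of a] a' \<open>a \<in> idx n\<close> by simp
      qed
      then show "(case a of (r, i, j) \<Rightarrow> \<delta> * (if 2 * i = r then (coord u (r, i, j))\<^sup>2 * (c r i * \<Phi> r j j) else 0)) \<le> 0"
        using a' by simp
    qed
    finally show ?thesis .
  qed
  have perp: "\<delta> * B u u \<ge> 0" if u: "\<And>w. w \<in> ?N \<Longrightarrow> \<delta> * B u w = 0" for u
  proof -
    \<comment> \<open>Orthogonality to the low vector \<open>v (r, i, j)\<close> is a condition on
      the coordinates at the opposite index \<open>r - i\<close>; nondegeneracy of
      \<open>\<Phi> r\<close> then makes all of these vanish.\<close>
    have pair: "(\<Sum>k<n r. coord u (r, r - i, k) * \<Phi> r k j) = 0" if i: "i \<in> low_idx r" "j < n r" for r i j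
    proof -
      have ir: "i \<le> r" using i by (simp add: low_idx_def)
      have "v (r, i, j) \<in> ?N" using i by (intro span_base imageI) (simp add: low_def)
      then have "0 = B u (v (r, i, j))" using u \<delta> by auto
      also have "\<dots> = (\<Sum>a\<in>idx n. coord u a * B (v a) (v (r, i, j)))"
        by (subst expand[of u, symmetric]) (simp add: bilinear_lsum[OF bil] bilinear_lmul[OF bil])
      also have "\<dots> = (\<Sum>a\<in>(\<lambda>k. (r, r - i, k)) ` {..<n r}. coord u a * B (v a) (v (r, i, j)))"
      proof (rule sum.mono_neutral_right[OF fin_idx])
        show "(\<lambda>k. (r, r - i, k)) ` {..<n r} \<subseteq> idx n" by auto
        show "\<forall>a\<in>idx n - (\<lambda>k. (r, r - i, k)) ` {..<n r}. coord u a * B (v a) (v (r, i, j)) = 0"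
        proof
          fix a assume a: "a \<in> idx n - (\<lambda>k. (r, r - i, k)) ` {..<n r}"
          obtain r' i' j' where a': "a = (r', i', j')" by (cases a)
          have "\<not> (r' = r \<and> i' + i = r')" using a a' by auto
          then show "coord u a * B (v a) (v (r, i, j)) = 0" using a a' ir i(2) B_v[of i' r' j' i r j] by auto
        qed
      qed
      also have "\<dots> = (\<Sum>k<n r. coord u (r, r - i, k) * (c r (r - i) * \<Phi> r k j))"
        using ir i(2) by (subst sum.reindex) (auto intro!: inj_onI sum.cong simp: B_v)
      also have "\<dots> = c r (r - i) * (\<Sum>k<n r. coord u (r, r - i, k) * \<Phi> r k j)"
        by (simp add: sum_distrib_left mult_ac)
      finally show ?thesis using c_nz[of "r - i" r] by simp
    qed
    have zero: "coord u (r, r - i, j) = 0" if i: "i \<in> low_idx r" "j < n r" for r i j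
    proof (cases "even r")
      case True
      have "(\<Sum>k<n r. coord u (r, r - i, k) * \<Phi> r k j) =
          (\<Sum>k<n r. if k = j then coord u (r, r - i, j) * \<Phi> r j j else 0)"
        using Phi_even[OF True] i(2) by (intro sum.cong) auto
      with pair[OF i] show ?thesis using i(2) Phi_even[OF True i(2) i(2)] by simp
    next
      case False
      have m: "pair_partner j < n r" using n_odd[OF False] i(2) pair_partner_simps(2)[of j "n r div 2"] by simp
      have "(\<Sum>k<n r. coord u (r, r - i, k) * \<Phi> r k (pair_partner j)) =
          (\<Sum>k<n r. if k = j then coord u (r, r - i, j) * std_symp j (pair_partner j) else 0)"
      proof (rule sum.cong[OF refl])
        fix k assume k: "k \<in> {..<n r}"
        have "std_symp k (pair_partner j) = 0" if "k \<noteq> j"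
          using that by (intro std_symp_eq_0) (metis pair_partner_simps(1))
        then show "coord u (r, r - i, k) * \<Phi> r k (pair_partner j) =
            (if k = j then coord u (r, r - i, j) * std_symp j (pair_partner j) else 0)"
          using Phi_odd[OF False _ m, of k] k by auto
      qed
      with pair[OF i(1) m] show ?thesis using i(2) by (simp add: std_symp_partner split: if_splits)
    qed
    have high: "coord u (r, i, j) = 0" if "i \<le> r" "j < n r" "r < 2 * i \<or> 2 * i = r \<and> odd i" for r i j
    proof -
      have "r - i \<in> low_idx r" using that by (auto simp: low_idx_def)
      from zero[OF this that(2)] show ?thesis using that(1) by simp
    qed
    have "\<delta> * B u u = (\<Sum>(r, i, j)\<in>idx n. \<delta> * (if 2 * i = r then (coord u (r, i, j))\<^sup>2 * (c r i * \<Phi> r j j) else 0))"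
      by (subst B_self_expand) (auto intro!: high simp: sum_distrib_left case_prod_beta)
    also have "\<dots> \<ge> 0"
    proof (rule sum_nonneg)
      fix a assume "a \<in> idx n"
      obtain r i j where a': "a = (r, i, j)" by (cases a)
      have "\<delta> * ((coord u (r, i, j))\<^sup>2 * (c r i * \<Phi> r j j)) \<ge> 0" if mid: "2 * i = r"
      proof (cases "odd i")
        case False
        have "\<delta> * (-1) ^ (r div 2) * \<Phi> r j j > 0" using pure[of r j] \<open>a \<in> idx n\<close> a' mid by auto
        then have "\<delta> * \<Phi> r j j > 0" using False mid by auto
        moreover have "c r i > 0" using c_mid[of r] mid by auto
        ultimately have "(coord u (r, i, j))\<^sup>2 * c r i * (\<delta> * \<Phi> r j j) \<ge> 0"
          by (intro mult_nonneg_nonneg[of "(coord u (r, i, j))\<^sup>2 * c r i"]) simp_all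
        then show ?thesis by (simp add: mult_ac)
      next
        case True
        then show ?thesis using high[of i r j] a' mid \<open>a \<in> idx n\<close> by simp
      qed
      then show "(case a of (r, i, j) \<Rightarrow> \<delta> * (if 2 * i = r then (coord u (r, i, j))\<^sup>2 * (c r i * \<Phi> r j j) else 0)) \<ge> 0"
        using a' by simp
    qed
    finally show ?thesis .
  qed
  obtain Q :: "real^'n^'n" where Q: "\<And>u. Q *v u \<in> ?N" "\<And>u. u \<in> ?N \<Longrightarrow> Q *v u = u"
    "\<And>u. Q *v u = 0 \<Longrightarrow> u \<noteq> 0 \<Longrightarrow> \<delta> * B u u > 0"
    by (rule semidefinite_projection[OF sig subspace_span nonpos perp]) blast+
  define L where "L = Q ** g ** Q + (mat 1 - Q)"
  have "det L > 0"
    unfolding L_def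
  proof (rule SO_plus_compression_det_pos[where B = "\<lambda>u w. \<delta> * B u w"])
    show "Q ** Q = Q" using Q(1,2) by (simp add: matrix_eq flip: matrix_vector_mul_assoc)
    show "\<delta> * B u u \<le> 0" if "Q *v u = u" for u using nonpos[of u] Q(1)[of u] that by simp
    show "bilinear (\<lambda>u w. \<delta> * B u w)"
      using sig by (simp add: has_signature_def flip: bilinear_form_on_UNIV)
    show "g \<in> SO_plus (\<lambda>u w. \<delta> * B u w)" using g \<delta> by (simp add: SO_plus_scale)
  qed (use Q in auto)
  define M where "M a b = coord (g *v v a) b" for a b
  have tri: "i' \<le> i \<and> i' + (r - i) \<le> r'" if "i \<le> r" "j < n r" "i' \<le> r'" "j' < n r'" "M (r, i, j) (r', i', j') \<noteq> 0" for r i j r' i' j'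
    using g_triangular[OF g gx that(1-4)] that(5) by (simp add: M_def)
  have gN: "g *v v a \<in> ?N" if a: "a \<in> low" for a
    unfolding mem_span_v[OF low_subset]
  proof
    fix b assume b: "b \<in> idx n - low"
    obtain r i j where a': "a = (r, i, j)" by (cases a)
    obtain r' i' j' where b': "b = (r', i', j')" by (cases b)
    show "coord (g *v v a) b = 0"
    proof (rule ccontr)
      assume "coord (g *v v a) b \<noteq> 0"
      moreover have "(r, i, j) \<in> idx n" "(r', i', j') \<in> idx n" using a b a' b' low_subset by auto
      ultimately have "i' \<le> i \<and> i' + (r - i) \<le> r'"
        using a' b' by (intro tri[of i r j i' r' j']) (simp_all add: M_def)
      then have *: "i' \<le> i" "i' + (r - i) \<le> r'" by simp_all
      have i: "i \<le> r" "2 * i < r \<or> 2 * i = r \<and> odd (r div 2)" using a a' by (auto simp: low_def low_idx_def)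
      \<comment> \<open>The two inequalities give r' - 2 i' \<ge> r - 2 i \<ge> 0. If the left side
        is 0, both are equalities and the block is the same, so the parity condition on r/2 carries
        over.\<close>
      have "i' \<in> low_idx r'"
      proof (cases "2 * i' < r'")
        case True
        then show ?thesis by (simp add: low_idx_def)
      next
        case False
        then have "i' = i" "r' = r" using * i by auto
        then show ?thesis using a a' by (auto simp: low_def)
      qed
      then show False using b b' by (auto simp: low_def)
    qed
  qed
  have Lv: "L *v u = Q *v (g *v (Q *v u)) + (u - Q *v u)" for u
    by (simp add: L_def matrix_vector_mult_add_rdistrib matrix_vector_mult_diff_rdistrib flip: matrix_vector_mul_assoc)
  have "det L = ldet (idx n) (\<lambda>a b. coord (L *v v a) b)" by (rule det_coord)
  also have "idx n = low \<union> (idx n - low)" using low_subset by auto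
  also have "ldet (low \<union> (idx n - low)) (\<lambda>a b. coord (L *v v a) b) =
      ldet low (\<lambda>a b. coord (L *v v a) b) * ldet (idx n - low) (\<lambda>a b. coord (L *v v a) b)"
  proof (rule ldet_block_triangular)
    fix a b assume ab: "a \<in> low" "b \<in> idx n - low"
    have "v a \<in> ?N" using ab by (intro span_base imageI)
    then have "L *v v a = g *v v a" using Lv[of "v a"] Q(2) gN[OF ab(1)] by simp
    then show "coord (L *v v a) b = 0" using gN[OF ab(1)] ab(2) unfolding mem_span_v[OF low_subset] by simp
  qed (use fin_idx low_subset finite_subset in auto)
  \<comment> \<open>Modulo the low subspace \<open>L\<close> is the identity, since \<open>Q\<close>
    takes its values in that subspace.\<close>
  also have "ldet (idx n - low) (\<lambda>a b. coord (L *v v a) b) = 1"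
  proof (rule ldet_identity)
    fix a b assume ab: "a \<in> idx n - low" "b \<in> idx n - low"
    have 0: "coord (Q *v u) b = 0" for u using Q(1)[of u] ab(2) unfolding mem_span_v[OF low_subset] by blast
    have "coord (L *v v a) b = coord (v a) b"
      unfolding Lv using 0 coord_add[of _ "v a - Q *v v a"] coord_add[of "v a - Q *v v a" "Q *v v a" b] by simp
    then show "coord (L *v v a) b = (if a = b then 1 else 0)" using coord_v[of b a] ab by auto
  qed (use fin_idx in simp)
  also have "ldet low (\<lambda>a b. coord (L *v v a) b) = ldet low M"
  proof (rule ldet_cong)
    fix a b assume a: "a \<in> low"
    then have "v a \<in> ?N" by (intro span_base imageI)
    then show "coord (L *v v a) b = M a b" using Lv[of "v a"] Q(2) gN[OF a] by (simp add: M_def)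
  qed
  also have "ldet low M = (\<Prod>r\<in>supp. \<Prod>i\<in>low_idx r. ldet {..<n r} (\<lambda>j k. M (r, i, j) (r, i, k)))"
    by (rule low_ldet) (use tri in blast)
  also have "\<dots> = (\<Prod>r\<in>supp. \<Prod>i\<in>low_idx r. ((-1) ^ i) ^ n r * ldet {..<n r} (\<lambda>j k. M (r, 0, j) (r, 0, k)))"
  proof (intro prod.cong refl)
    fix r i assume i: "i \<in> low_idx r"
    have "ldet {..<n r} (\<lambda>j k. M (r, i, j) (r, i, k)) = ldet {..<n r} (\<lambda>j k. (-1) ^ i * M (r, 0, j) (r, 0, k))"
      using i g_block_sign[OF g gx, of i r] by (intro ldet_cong) (simp add: M_def low_idx_def)
    then show "ldet {..<n r} (\<lambda>j k. M (r, i, j) (r, i, k)) = ((-1) ^ i) ^ n r * ldet {..<n r} (\<lambda>j k. M (r, 0, j) (r, 0, k))"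
      by (simp add: ldet_scale)
  qed
  finally have pos: "0 < (\<Prod>r\<in>supp. \<Prod>i\<in>low_idx r. ((-1) ^ i) ^ n r * ldet {..<n r} (\<lambda>j k. M (r, 0, j) (r, 0, k)))"
    using \<open>det L > 0\<close> by simp
  show ?thesis
  proof (rule prod_parity_sign[OF finite_supp _ pos])
    fix r assume r: "r \<in> supp"
    let ?D = "ldet {..<n r} (\<lambda>j k. M (r, 0, j) (r, 0, k))"
    show "\<exists>t>0. (\<Prod>i\<in>low_idx r. ((-1) ^ i) ^ n r * ?D) = (-1) ^ parity_weight r (n r) * t"
    proof (cases "r = 0")
      case True
      then have "low_idx r = {}" "parity_weight r (n r) = 0" by (auto simp: low_idx_def parity_weight_def)
      then show ?thesis by (intro exI[of _ 1]) simp
    next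
      case False
      \<comment> \<open>For r > 0 the index 0 is low, so \<open>?D\<close> occurs in a positive
        product. For r = 0, treated separately, the product is empty and says nothing about
        \<open>?D\<close>.\<close>
      have "?D \<noteq> 0"
      proof
        assume "?D = 0"
        moreover have "0 \<in> low_idx r" using False by (simp add: low_idx_def)
        ultimately have "(\<Prod>i\<in>low_idx r. ((-1) ^ i) ^ n r * ?D) = 0"
          by (intro prod_zero) (auto simp: low_idx_def)
        then have "(\<Prod>r\<in>supp. \<Prod>i\<in>low_idx r. ((-1) ^ i) ^ n r * ldet {..<n r} (\<lambda>j k. M (r, 0, j) (r, 0, k))) = 0"
          using r finite_supp by (intro prod_zero) blast+
        then show False using pos by simp
      qed
      then show ?thesis
        using g_odd_block_det[OF g gx, of r] n_odd[of r] by (intro low_idx_sign) (auto simp: M_def)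
    qed
  qed
qed

end

section \<open>A conjugating isometry\<close>

lemma prod_minus_one:
  fixes s :: "'a \<Rightarrow> real"
  assumes "finite S" "\<And>a. a \<in> S \<Longrightarrow> s a = 1 \<or> s a = -1"
  shows "prod s S = (-1) ^ card {a\<in>S. s a = -1}"
proof -
  have "prod s S = (\<Prod>a\<in>S. if s a = -1 then -1 else 1)"
    using assms(2) by (intro prod.cong) auto
  also have "\<dots> = (\<Prod>a\<in>{a\<in>S. s a = -1}. -1)" using assms(1) by (rule prod.inter_filter[symmetric])
  finally show ?thesis by simp
qed

context adapted_basis
begin

text \<open>The index of the only basis vector that is not orthogonal to \<open>v a\<close>.\<close>

definition partner :: "nat \<times> nat \<times> nat \<Rightarrow> nat \<times> nat \<times> nat" where
  "partner = (\<lambda>(r, i, j). (r, r - i, if even r then j else pair_partner j))"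

lemma pair_partner_less: "odd r \<Longrightarrow> pair_partner j < n r \<longleftrightarrow> j < n r"
  using n_odd[of r] pair_partner_simps(2)[of j "n r div 2"] by simp

lemma partner_idx: "a \<in> idx n \<Longrightarrow> partner a \<in> idx n"
  by (auto simp: partner_def idx_def pair_partner_less)

lemma partner_partner: "a \<in> idx n \<Longrightarrow> partner (partner a) = a"
  by (auto simp: partner_def idx_def)

lemma B_v_eq_0: 
  assumes "a \<in> idx n" "b \<in> idx n" "b \<noteq> partner a"
  shows "B (v a) (v b) = 0"
proof -
  obtain r i j where a: "a = (r, i, j)" by (cases a)
  obtain r' i' j' where b: "b = (r', i', j')" by (cases b)
  have "\<Phi> r j j' = 0" if "r = r'" "i + i' = r"
  proof (cases "even r")
    case True
    then show ?thesis using Phi_even[OF True, of j j'] assms a b that by (auto simp: partner_def)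
  next
    case False
    then have "j' \<noteq> pair_partner j" using assms a b that by (auto simp: partner_def)
    then show ?thesis using Phi_odd[OF False, of j j'] std_symp_eq_0 assms a b that by auto
  qed
  then show ?thesis using B_v[of i r j i' r' j'] assms a b by auto
qed

lemma B_v_partner: "a \<in> idx n \<Longrightarrow> B (v a) (v (partner a)) \<noteq> 0"
proof -
  assume a: "a \<in> idx n"
  obtain r i j where a': "a = (r, i, j)" by (cases a)
  have "\<Phi> r j (if even r then j else pair_partner j) \<noteq> 0"
    using a a' Phi_even[of r j j] Phi_odd[of r j "pair_partner j"] pair_partner_less[of r j]
    by (auto simp: std_symp_partner)
  then show ?thesis using B_v[of i r j "r - i" r] c_nz[of i r] a a' pair_partner_less[of r j]
    by (auto simp: partner_def)
qed

text \<open>Eigenvalues of a diagonal map: the factor \<open>(-1) ^ i\<close> makes it anticommute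
  with \<open>x\<close>, which shifts \<open>i\<close> by one, and \<open>\<eta>\<close> is the free
  sign of the chain \<open>v (r, _, j)\<close>.\<close>

definition signed :: "(nat \<Rightarrow> nat \<Rightarrow> real) \<Rightarrow> nat \<times> nat \<times> nat \<Rightarrow> real" where
  "signed \<eta> = (\<lambda>(r, i, j). (-1) ^ i * \<eta> r j)"

definition half :: "nat \<times> nat \<times> nat \<Rightarrow> bool" where
  "half = (\<lambda>(r, i, j). 2 * i < r)"

definition mid :: "nat \<times> nat \<times> nat \<Rightarrow> bool" where
  "mid = (\<lambda>(r, i, j). 2 * i = r)"

text \<open>An orthogonal basis: the hyperbolic planes spanned by \<open>v a\<close> and \<open>v (partner a)\<close> are split into a
  positive and a negative line.\<close>

definition frame :: "(nat \<times> nat \<times> nat) \<times> bool \<Rightarrow> real^'n" where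
  "frame = (\<lambda>(a, t). if half a then (if t then v a + v (partner a) else v a - v (partner a)) else v a)"

text \<open>One index for each frame vector in the eigenspace of -1. A plane is listed under its
  \<open>half\<close> member and carries both Booleans; a middle vector is listed once, under
  \<open>True\<close>.\<close>

definition frame_idx :: "(nat \<Rightarrow> nat \<Rightarrow> real) \<Rightarrow> ((nat \<times> nat \<times> nat) \<times> bool) set" where
  "frame_idx \<eta> = {(a, t). a \<in> idx n \<and> signed \<eta> a = -1 \<and> (half a \<or> mid a \<and> t)}"

lemma half_partner: "half a \<Longrightarrow> a \<in> idx n \<Longrightarrow> \<not> half (partner a) \<and> \<not> mid (partner a) \<and> partner a \<noteq> a"
  by (auto simp: half_def mid_def partner_def idx_def)

lemma mid_partner: "mid a \<Longrightarrow> partner a = a"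
  by (auto simp: mid_def partner_def)

lemma half_mid_trichotomy: "a \<in> idx n \<Longrightarrow> half a \<or> mid a \<or> half (partner a)"
  by (auto simp: half_def mid_def partner_def idx_def)

lemma finite_frame_idx: "finite (frame_idx \<eta>)"
  by (rule finite_subset[of _ "idx n \<times> UNIV"]) (auto simp: frame_idx_def fin_idx)

lemma B_v_frame_eq_0:
  assumes "b \<in> idx n" "a \<in> idx n" "half a \<or> mid a" "b \<noteq> a" "b \<noteq> partner a"
  shows "B (v b) (frame (a, t)) = 0"
proof -
  have "a \<noteq> partner b" "partner a \<noteq> partner b"
    using assms partner_partner by metis+
  then have "B (v b) (v a) = 0" "B (v b) (v (partner a)) = 0"
    using B_v_eq_0 assms partner_idx by auto
  then show ?thesis by (simp add: frame_def bilinear_radd[OF bil] bilinear_rsub[OF bil])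
qed

lemma half_B:
  assumes "half a" "a \<in> idx n"
  shows "B (v a) (v a) = 0" "B (v (partner a)) (v (partner a)) = 0" "B (v (partner a)) (v a) = B (v a) (v (partner a))"
  using B_v_eq_0[of a a] B_v_eq_0[of "partner a" "partner a"] half_partner[OF assms] partner_idx[OF assms(2)]
    partner_partner[OF assms(2)] assms sym by auto

lemma B_frame_self:
  assumes "a \<in> idx n"
  shows "half a \<Longrightarrow> B (frame (a, t)) (frame (a, t)) = (if t then 2 else -2) * B (v a) (v (partner a))"
    and "mid a \<Longrightarrow> B (frame (a, t)) (frame (a, t)) = B (v a) (v (partner a))"
  using assms half_B[of a] mid_partner[of a]
  by (auto simp: frame_def bilinear_radd[OF bil] bilinear_rsub[OF bil] bilinear_ladd[OF bil] bilinear_lsub[OF bil]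
      half_def mid_def)

lemma frame_orthogonal: "pairwise (\<lambda>p q. B (frame p) (frame q) = 0) (frame_idx \<eta>)"
proof (rule pairwiseI)
  fix p q assume p: "p \<in> frame_idx \<eta>" and q: "q \<in> frame_idx \<eta>" and ne: "p \<noteq> q"
  obtain a t where p': "p = (a, t)" by (cases p)
  obtain b s where q': "q = (b, s)" by (cases q)
  have a: "a \<in> idx n" "half a \<or> mid a" and b: "b \<in> idx n" "half b \<or> mid b"
    using p q p' q' by (auto simp: frame_idx_def)
  show "B (frame p) (frame q) = 0"
  proof (cases "a = b")
    case True
    then have "half a" "t \<noteq> s" using p q p' q' ne by (auto simp: frame_idx_def half_def mid_def)
    then show ?thesis using half_B[OF _ a(1)] True unfolding p' q'
      by (cases t; cases s) (simp_all add: frame_def bilinear_radd[OF bil] bilinear_rsub[OF bil]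
          bilinear_ladd[OF bil] bilinear_lsub[OF bil])
  next
    case False
    have ab: "a \<noteq> partner b"
    proof
      assume "a = partner b"
      then show False using a b half_partner[of b] mid_partner[of b] False by auto
    qed
    have "B (v a) (frame q) = 0" unfolding q' by (rule B_v_frame_eq_0[OF a(1) b False ab])
    moreover have "B (v (partner a)) (frame q) = 0"
      unfolding q'
    proof (rule B_v_frame_eq_0[OF partner_idx[OF a(1)] b])
      show "partner a \<noteq> b" using ab partner_partner[OF a(1)] by auto
      show "partner a \<noteq> partner b" using False partner_partner[OF a(1)] partner_partner[OF b(1)] by auto
    qed
    ultimately show ?thesis unfolding p'
      by (auto simp: frame_def bilinear_ladd[OF bil] bilinear_lsub[OF bil])
  qed
qed

text \<open>Partners have equal signs, so a hyperbolic plane lies in one eigenspace. If the sign is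
  -1, the reflections in its two frame vectors together act as -1 on it; if it is 1, no frame vector
  of the plane occurs.\<close>

lemma refl_prod_frame:
  assumes b: "b \<in> idx n" and s: "signed \<eta> b = 1 \<or> signed \<eta> b = -1" and sp: "signed \<eta> (partner b) = signed \<eta> b"
  shows "refl_prod B (frame_idx \<eta>) frame (v b) = signed \<eta> b *\<^sub>R v b"
proof -
  \<comment> \<open>The representative under which the plane or line containing \<open>v b\<close>
    is listed.\<close>
  define a where "a = (if half b \<or> mid b then b else partner b)"
  have a: "a \<in> idx n" "half a \<or> mid a" "b = a \<or> b = partner a" "signed \<eta> a = signed \<eta> b"
    using b half_mid_trichotomy[OF b] partner_idx[OF b] partner_partner[OF b] sp by (auto simp: a_def)
  let ?f = "\<lambda>p. (2 * B (v b) (frame p) / B (frame p) (frame p)) *\<^sub>R frame p"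
  have zero: "?f p = 0" if p: "p \<in> frame_idx \<eta>" "fst p \<noteq> a" for p
  proof -
    obtain a' t where p': "p = (a', t)" by (cases p)
    have a': "a' \<in> idx n" "half a' \<or> mid a'" "a' \<noteq> a" using p p' by (auto simp: frame_idx_def)
    have ne: "a' \<noteq> partner a" "partner a' \<noteq> partner a"
      using a a' half_partner[of a] mid_partner[of a] partner_partner[of a] partner_partner[of a'] by metis+
    have "b \<noteq> a'" "b \<noteq> partner a'"
      using a(3) a'(3) ne partner_partner[OF a(1)] partner_partner[OF a'(1)] by metis+
    then show ?thesis using B_v_frame_eq_0[OF b a'(1,2)] p' by simp
  qed
  have eq: "(\<Sum>p\<in>frame_idx \<eta>. ?f p) = (\<Sum>p\<in>{p\<in>frame_idx \<eta>. fst p = a}. ?f p)"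
    using zero finite_frame_idx by (intro sum.mono_neutral_right) auto
  have k: "B (v a) (v (partner a)) \<noteq> 0" using B_v_partner a(1) .
  have "(\<Sum>p\<in>{p\<in>frame_idx \<eta>. fst p = a}. ?f p) = (if signed \<eta> b = -1 then 2 else 0) *\<^sub>R v b"
  proof (cases "signed \<eta> b = -1")
    case False
    then have "{p\<in>frame_idx \<eta>. fst p = a} = {}" using a(4) by (auto simp: frame_idx_def)
    then show ?thesis using False by (simp only: sum.empty) simp
  next
    case True
    show ?thesis
    proof (cases "mid a")
      case True
      then have "{p\<in>frame_idx \<eta>. fst p = a} = {(a, True)}"
        using a(1,4) \<open>signed \<eta> b = -1\<close> by (auto simp: frame_idx_def half_def mid_def)
      moreover have "b = a" using a(3) mid_partner[OF True] by auto
      moreover have "frame (a, True) = v a" using True by (auto simp: frame_def half_def mid_def)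
      ultimately show ?thesis using k mid_partner[OF True] \<open>signed \<eta> b = -1\<close> by simp
    next
      case False
      then have h: "half a" using a(2) by simp
      then have "{p\<in>frame_idx \<eta>. fst p = a} = {(a, True), (a, False)}"
        using a(1,4) \<open>signed \<eta> b = -1\<close> by (auto simp: frame_idx_def)
      then have "(\<Sum>p\<in>{p\<in>frame_idx \<eta>. fst p = a}. ?f p) = ?f (a, True) + ?f (a, False)" by simp
      also have "\<dots> = 2 *\<^sub>R v b"
        using a(3)
      proof
        assume "b = a"
        then have "?f (a, True) = v a + v (partner a)" "?f (a, False) = v a - v (partner a)"
          using k half_B[OF h a(1)] unfolding B_frame_self(1)[OF a(1) h]
          by (simp_all add: frame_def h bilinear_radd[OF bil] bilinear_rsub[OF bil])
        then show ?thesis using \<open>b = a\<close> by (simp add: scaleR_2)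
      next
        assume "b = partner a"
        then have "?f (a, True) = v a + v (partner a)" "?f (a, False) = - (v a - v (partner a))"
          using k half_B[OF h a(1)] unfolding B_frame_self(1)[OF a(1) h]
          by (simp_all add: frame_def h bilinear_radd[OF bil] bilinear_rsub[OF bil])
        then show ?thesis using \<open>b = partner a\<close> by (simp add: scaleR_2)
      qed
      finally show ?thesis using \<open>signed \<eta> b = -1\<close> by simp
    qed
  qed
  then show ?thesis unfolding refl_prod_def eq using s by (auto simp: scaleR_2)
qed

text \<open>The \<open>i\<close> at which the chain \<open>v (r, _, j)\<close> offers a frame vector
  of type \<open>\<sigma>\<close>: each hyperbolic plane offers one of either type, the middle
  vector only the type given by the sign of \<open>\<Phi> r j j\<close>.\<close>

definition sign_set :: "bool \<Rightarrow> nat \<Rightarrow> nat \<Rightarrow> nat set" where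
  "sign_set \<sigma> r j = {i. i \<le> r \<and> (2 * i < r \<or> 2 * i = r \<and> (if \<sigma> then \<Phi> r j j > 0 else \<Phi> r j j < 0))}"

text \<open>Changing the sign of a diagonal isometry on \<open>v (r, _, j)\<close>, \<open>(r, j) \<in> flips \<sigma>\<close>, changes the parity of the
  number of its reflections in positive (\<open>\<sigma>\<close>) or negative (\<open>\<not> \<sigma>\<close>) vectors and of no other number.\<close>

definition flips :: "bool \<Rightarrow> (nat \<times> nat) set" where
  "flips \<sigma> = {(r, j). even r \<and> j < n r \<and>
     (if \<sigma> then (-1) ^ (r div 2) * \<Phi> r j j > 0 else (-1) ^ (r div 2) * \<Phi> r j j < 0)}"

definition total_sign :: "bool \<Rightarrow> (nat \<Rightarrow> nat \<Rightarrow> real) \<Rightarrow> real" where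
  "total_sign \<sigma> \<eta> = (\<Prod>r\<in>supp. \<Prod>j<n r. \<Prod>i\<in>sign_set \<sigma> r j. (-1) ^ i * \<eta> r j)"

text \<open>A hyperbolic plane has exactly one frame vector of each sign, so dropping the Boolean
  identifies the reflections of type \<open>\<sigma>\<close> with those indices from
  \<open>sign_set\<close> whose sign is -1.\<close>

lemma frame_sign_card:
  assumes "\<And>r j. \<eta> r j = 1 \<or> \<eta> r j = -1"
  shows "(-1) ^ card {p\<in>frame_idx \<eta>. if \<sigma> then B (frame p) (frame p) > 0 else B (frame p) (frame p) < 0} =
     total_sign \<sigma> \<eta>"
proof -
  let ?A = "{p\<in>frame_idx \<eta>. if \<sigma> then B (frame p) (frame p) > 0 else B (frame p) (frame p) < 0}"
  let ?S = "SIGMA r:supp. SIGMA j:{..<n r}. sign_set \<sigma> r j"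
  let ?T = "{a\<in>?S. (case a of (r, j, i) \<Rightarrow> (-1) ^ i * \<eta> r j) = -1}"
  have finS: "finite ?S" using finite_supp by (auto simp: sign_set_def intro!: finite_SigmaI)
  have midB: "B (v (r, i, j)) (v (partner (r, i, j))) = c r i * \<Phi> r j j \<and> c r i > 0" if "2 * i = r" "j < n r" for r i j
    using that B_v[of i r j i r j] c_mid[of r] by (auto simp: partner_def)
  have mem: "(\<exists>t. ((r, i, j), t) \<in> ?A) \<longleftrightarrow> (r, j, i) \<in> ?T" for r i j
  proof (cases "i \<le> r \<and> j < n r")
    case False
    then show ?thesis by (auto simp: frame_idx_def sign_set_def)
  next
    case True
    then have a: "(r, i, j) \<in> idx n" by simp
    have r: "r \<in> supp" using True by (auto simp: supp_def)
    have sg: "signed \<eta> (r, i, j) = (-1) ^ i * \<eta> r j" by (simp add: signed_def)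
    consider "half (r, i, j)" | "mid (r, i, j)" | "r < 2 * i" by (auto simp: half_def mid_def; linarith)
    then show ?thesis
    proof cases
      case 1
      have k: "B (v (r, i, j)) (v (partner (r, i, j))) \<noteq> 0" using B_v_partner[OF a] .
      define t where "t = (if \<sigma> then B (v (r, i, j)) (v (partner (r, i, j))) > 0 else B (v (r, i, j)) (v (partner (r, i, j))) < 0)"
      have "if \<sigma> then B (frame ((r, i, j), t)) (frame ((r, i, j), t)) > 0 else B (frame ((r, i, j), t)) (frame ((r, i, j), t)) < 0"
        unfolding B_frame_self(1)[OF a 1] t_def using k by auto
      then show ?thesis using 1 a sg r True by (auto simp: frame_idx_def half_def sign_set_def)
    next
      case 2
      then have i: "2 * i = r" by (simp add: mid_def)
      have "\<not> half (r, i, j)" using i by (simp add: half_def)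
      then show ?thesis using 2 a sg r True midB[OF i] unfolding frame_idx_def
        by (auto simp: B_frame_self(2)[OF a 2] sign_set_def i zero_less_mult_iff mult_less_0_iff)
    next
      case 3
      then show ?thesis by (auto simp: frame_idx_def half_def mid_def sign_set_def)
    qed
  qed
  have inj: "inj_on fst ?A"
  proof (rule inj_onI)
    fix p q assume p: "p \<in> ?A" and q: "q \<in> ?A" and eq: "fst p = fst q"
    obtain a t where p': "p = (a, t)" by (cases p)
    obtain s where q': "q = (a, s)" using eq p' by (cases q) auto
    have a: "a \<in> idx n" "half a \<or> mid a" using p p' by (auto simp: frame_idx_def)
    have "t = s"
    proof (cases "half a")
      case True
      then show ?thesis using p q unfolding p' q'
        by (cases \<sigma>; cases t; cases s) (auto simp: B_frame_self(1)[OF a(1) True])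
    next
      case False
      then show ?thesis using p q p' q' by (auto simp: frame_idx_def)
    qed
    then show "p = q" using p' q' by simp
  qed
  have "card ?A = card (fst ` ?A)" using card_image[OF inj] by simp
  also have "fst ` ?A = (\<lambda>(r, j, i). (r, i, j)) ` ?T"
  proof (intro set_eqI iffI)
    fix a assume "a \<in> fst ` ?A"
    moreover obtain r i j where a: "a = (r, i, j)" by (cases a)
    ultimately have "\<exists>t. ((r, i, j), t) \<in> ?A" by force
    then have "(r, j, i) \<in> ?T" using mem by blast
    then show "a \<in> (\<lambda>(r, j, i). (r, i, j)) ` ?T" unfolding a by (intro image_eqI[of _ _ "(r, j, i)"]) simp_all
  next
    fix a assume "a \<in> (\<lambda>(r, j, i). (r, i, j)) ` ?T"
    then obtain r i j where a: "a = (r, i, j)" "(r, j, i) \<in> ?T" by auto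
    then have "\<exists>t. ((r, i, j), t) \<in> ?A" using mem by blast
    then show "a \<in> fst ` ?A" unfolding a by force
  qed
  also have "card ((\<lambda>(r, j, i). (r, i, j)) ` ?T) = card ?T"
    by (rule card_image) (auto intro!: inj_onI)
  finally have "(-1) ^ card ?A = ((-1) ^ card ?T :: real)" by simp
  also have "\<dots> = (\<Prod>(r, j, i)\<in>?S. (-1) ^ i * \<eta> r j)"
  proof (rule prod_minus_one[OF finS, symmetric])
    fix a assume "a \<in> ?S"
    obtain r j i where a: "a = (r, j, i)" by (cases a)
    show "(case a of (r, j, i) \<Rightarrow> (-1) ^ i * \<eta> r j) = 1 \<or> (case a of (r, j, i) \<Rightarrow> (-1) ^ i * \<eta> r j) = -1"
      using assms[of r j] unfolding a by (cases "even i") auto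
  qed
  also have "\<dots> = total_sign \<sigma> \<eta>"
    unfolding total_sign_def
    using finite_supp by (simp add: prod.Sigma sign_set_def case_prod_beta)
  finally show ?thesis .
qed

end

section \<open>Parities of the numbers of reflections\<close>

context adapted_basis
begin

text \<open>Outside \<open>flips \<sigma>\<close> the sign of the middle entry is tied to the parity
  of r/2 just as in \<open>low_idx\<close>. Hence the count of reflections and the determinant of
  the compression are governed by the same sign product.\<close>

lemma sign_set_low:
  assumes "j < n r" "(r, j) \<notin> flips \<sigma>"
  shows "sign_set \<sigma> r j = low_idx r"
proof (cases "even r")
  case False
  then have "2 * i \<noteq> r" for i by auto
  then show ?thesis by (auto simp: sign_set_def low_idx_def)
next
  case True
  have "\<Phi> r j j \<noteq> 0" using Phi_even[OF True, of j j] assms by simp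
  then have "(if \<sigma> then \<Phi> r j j > 0 else \<Phi> r j j < 0) \<longleftrightarrow> odd (r div 2)"
    using assms True by (cases "even (r div 2)") (auto simp: flips_def split: if_splits)
  then show ?thesis by (auto simp: sign_set_def low_idx_def)
qed

text \<open>The set has r/2 or r/2 + 1 elements, depending on the sign of the middle entry; a change
  of \<open>\<eta> r j\<close> is felt in \<open>total_sign\<close> only if this number is
  odd.\<close>

lemma odd_card_sign_set:
  assumes "even r" "j < n r"
  shows "odd (card (sign_set \<sigma> r j)) \<longleftrightarrow> (r, j) \<in> flips \<sigma>"
proof -
  have nz: "\<Phi> r j j \<noteq> 0" using Phi_even[OF assms(1), of j j] assms by simp
  obtain m where m: "r = 2 * m" using assms(1) by (rule evenE)
  define P where "P \<longleftrightarrow> (if \<sigma> then \<Phi> r j j > 0 else \<Phi> r j j < 0)"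
  have "sign_set \<sigma> r j = (if P then {..m} else {..<m})"
    unfolding sign_set_def P_def[symmetric] using m by auto
  then have "odd (card (sign_set \<sigma> r j)) \<longleftrightarrow> (P \<longleftrightarrow> even m)" by auto
  also have "\<dots> \<longleftrightarrow> (r, j) \<in> flips \<sigma>"
    using assms nz m by (cases "even m"; cases \<sigma>) (auto simp: flips_def P_def)
  finally show ?thesis .
qed

lemma finite_flips: "finite (flips \<sigma>)"
  by (rule finite_subset[of _ "SIGMA r:supp. {..<n r}"]) (auto simp: flips_def supp_def finite_supp[unfolded supp_def])

lemma total_sign_flip:
  assumes \<eta>: "\<And>r j. \<eta> r j = 1 \<or> \<eta> r j = -1" and odd: "\<And>r j. odd r \<Longrightarrow> \<eta> r j = \<eta>' r j"
    and even: "\<And>r j. even r \<Longrightarrow> \<eta>' r j = 1"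
  shows "total_sign \<sigma> \<eta> = total_sign \<sigma> \<eta>' * (\<Prod>(r, j)\<in>flips \<sigma>. \<eta> r j)"
proof -
  have "(\<Prod>(r, j)\<in>flips \<sigma>. \<eta> r j) = (\<Prod>a\<in>(SIGMA r:supp. {..<n r}). if a \<in> flips \<sigma> then case a of (r, j) \<Rightarrow> \<eta> r j else 1)"
  proof (rule prod.mono_neutral_cong_left)
    show "finite (SIGMA r:supp. {..<n r})" using finite_supp by auto
  qed (auto simp: flips_def supp_def)
  also have "\<dots> = (\<Prod>r\<in>supp. \<Prod>j<n r. if (r, j) \<in> flips \<sigma> then \<eta> r j else 1)"
    using finite_supp by (subst prod.Sigma) (auto intro: prod.cong)
  finally have flips: "(\<Prod>(r, j)\<in>flips \<sigma>. \<eta> r j) = (\<Prod>r\<in>supp. \<Prod>j<n r. if (r, j) \<in> flips \<sigma> then \<eta> r j else 1)" .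
  have "(\<Prod>i\<in>sign_set \<sigma> r j. (-1) ^ i * \<eta> r j) =
      (\<Prod>i\<in>sign_set \<sigma> r j. (-1) ^ i * \<eta>' r j) * (if (r, j) \<in> flips \<sigma> then \<eta> r j else 1)" if j: "j < n r" for r j
  proof (cases "even r")
    case False
    then have "(r, j) \<notin> flips \<sigma>" by (simp add: flips_def)
    then show ?thesis using odd False by simp
  next
    case True
    have "\<eta> r j ^ card (sign_set \<sigma> r j) = (if (r, j) \<in> flips \<sigma> then \<eta> r j else 1)"
      using odd_card_sign_set[OF True j, of \<sigma>] \<eta>[of r j] by (cases "odd (card (sign_set \<sigma> r j))") auto
    then show ?thesis using even[OF True] by (simp add: prod.distrib)
  qed
  then show ?thesis unfolding total_sign_def flips prod.distrib[symmetric] by (auto intro!: prod.cong)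
qed

text \<open>\<open>low_idx_sign\<close> applies with \<open>D\<close> the product of the
  \<open>\<eta> r j\<close>: for odd \<open>r\<close> the alternating signs multiply to
  \<open>(-1) ^ (n r div 2)\<close>, the determinant of an anti-symplectic block.\<close>

lemma total_sign_base:
  assumes "flips \<sigma> = {}" and \<eta>: "\<And>r j. \<eta> r j = (if odd r then (-1) ^ j else 1)"
  shows "\<exists>t>0. total_sign \<sigma> \<eta> = (-1) ^ (\<Sum>r\<in>supp. parity_weight r (n r)) * t"
proof -
  have "\<exists>t>0. (\<Prod>j<n r. \<Prod>i\<in>sign_set \<sigma> r j. (-1) ^ i * \<eta> r j) = (-1) ^ parity_weight r (n r) * t" for r
  proof (cases "r = 0")
    case True
    then have "low_idx r = {}" "parity_weight r (n r) = 0" by (auto simp: low_idx_def parity_weight_def)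
    then show ?thesis using sign_set_low[where \<sigma> = \<sigma>] assms(1) by (intro exI[of _ 1]) simp
  next
    case False
    have "(\<Prod>j<n r. \<Prod>i\<in>sign_set \<sigma> r j. (-1) ^ i * \<eta> r j) = (\<Prod>j<n r. \<Prod>i\<in>low_idx r. (-1) ^ i * \<eta> r j)"
      using sign_set_low[where \<sigma> = \<sigma>] assms(1) by (intro prod.cong) auto
    also have "\<dots> = (\<Prod>i\<in>low_idx r. \<Prod>j<n r. (-1) ^ i * \<eta> r j)" by (rule prod.swap)
    also have "\<dots> = (\<Prod>i\<in>low_idx r. ((-1) ^ i) ^ n r * (\<Prod>j<n r. \<eta> r j))"
      by (simp add: prod.distrib)
    finally have eq: "(\<Prod>j<n r. \<Prod>i\<in>sign_set \<sigma> r j. (-1) ^ i * \<eta> r j) =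
        (\<Prod>i\<in>low_idx r. ((-1) ^ i) ^ n r * (\<Prod>j<n r. \<eta> r j))" .
    have pairs: "(\<Prod>j<2 * d. (-1) ^ j) = ((-1) ^ d :: real)" for d
      by (induction d) simp_all
    have "(\<Prod>j<n r. \<eta> r j) \<noteq> 0" by (simp add: \<eta>)
    moreover have "even (n r) \<and> (\<Prod>j<n r. \<eta> r j) = (-1) ^ (n r div 2)" if "odd r"
      using n_odd[OF that] pairs[of "n r div 2"] that by (simp add: \<eta>)
    ultimately show ?thesis unfolding eq by (rule low_idx_sign)
  qed
  then show ?thesis unfolding total_sign_def
    by (intro prod_sign_rep finite_supp) blast
qed

text \<open>\<open>flips True\<close> and \<open>flips False\<close> are disjoint, so the two
  parities can be corrected independently, each by one sign change. Where no correction is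
  available, the parity hypothesis makes the total sign 1 from the start.\<close>

theorem conjugate_exists:
  assumes par: "\<And>\<sigma>. flips \<sigma> = {} \<Longrightarrow> even (\<Sum>r\<in>supp. parity_weight r (n r))"
  shows "\<exists>g\<in>SO_plus B. g ** x = - x ** g"
proof -
  \<comment> \<open>For odd \<open>r\<close> partners sit at \<open>i\<close> and
    \<open>r - i\<close> of opposite parity, so \<open>\<eta>\<close> must be opposite on the two
    members of a pair of \<open>j\<close>; alternating in \<open>j\<close> achieves this.\<close>
  define \<eta>\<^sub>1 where "\<eta>\<^sub>1 r j = (if odd r then (-1) ^ j else 1 :: real)" for r j :: nat
  have \<eta>1: "\<eta>\<^sub>1 r j = 1 \<or> \<eta>\<^sub>1 r j = -1" for r j by (cases "even j") (auto simp: \<eta>\<^sub>1_def)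
  define K where "K \<sigma> = total_sign \<sigma> \<eta>\<^sub>1" for \<sigma>
  have K: "K \<sigma> = 1 \<or> K \<sigma> = -1" for \<sigma>
    unfolding K_def frame_sign_card[of "\<eta>\<^sub>1" \<sigma>, OF \<eta>1, symmetric] minus_one_power_iff by simp
  have K1: "K \<sigma> = 1" if fl: "flips \<sigma> = {}" for \<sigma>
  proof -
    obtain t where "t > 0" "K \<sigma> = (-1) ^ (\<Sum>r\<in>supp. parity_weight r (n r)) * t"
      unfolding K_def using total_sign_base[of \<sigma> "\<eta>\<^sub>1", OF fl \<eta>\<^sub>1_def] by blast
    then show ?thesis using par[OF fl] K[of \<sigma>] by auto
  qed
  define f where "f \<sigma> = (SOME p. p \<in> flips \<sigma>)" for \<sigma>
  have f: "f \<sigma> \<in> flips \<sigma>" if "flips \<sigma> \<noteq> {}" for \<sigma> unfolding f_def using that by (auto intro: someI_ex)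
  have disj: "flips True \<inter> flips False = {}" by (auto simp: flips_def)
  \<comment> \<open>If the total sign \<open>K \<sigma>\<close> is -1, the chosen element of
    \<open>flips \<sigma>\<close> carries -1 as well and the two cancel.\<close>
  define \<eta> where "\<eta> r j = (if odd r then (-1) ^ j else if flips True \<noteq> {} \<and> (r, j) = f True then K True
     else if flips False \<noteq> {} \<and> (r, j) = f False then K False else 1)" for r j
  have \<eta>: "\<eta> r j = 1 \<or> \<eta> r j = -1" for r j using K by (cases "even j") (auto simp: \<eta>_def)
  have total: "total_sign \<sigma> \<eta> = 1" for \<sigma>
  proof -
    have t: "total_sign \<sigma> \<eta> = K \<sigma> * (\<Prod>(r, j)\<in>flips \<sigma>. \<eta> r j)"
      unfolding K_def by (rule total_sign_flip[OF \<eta>]) (auto simp: \<eta>_def \<eta>\<^sub>1_def)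
    show ?thesis
    proof (cases "flips \<sigma> = {}")
      case True
      then show ?thesis using t K1 by simp
    next
      case False
      have "(case p of (r, j) \<Rightarrow> \<eta> r j) = (if p = f \<sigma> then K \<sigma> else 1)" if p: "p \<in> flips \<sigma>" for p
      proof -
        obtain r j where p': "p = (r, j)" by (cases p)
        have "even r" using p p' by (simp add: flips_def)
        moreover have "flips (\<not> \<sigma>) \<noteq> {} \<Longrightarrow> p \<noteq> f (\<not> \<sigma>)" using f[of "\<not> \<sigma>"] p disj by (cases \<sigma>) auto
        ultimately show ?thesis using p' False by (cases \<sigma>) (auto simp: \<eta>_def)
      qed
      then have "(\<Prod>p\<in>flips \<sigma>. case p of (r, j) \<Rightarrow> \<eta> r j) = (\<Prod>p\<in>flips \<sigma>. if p = f \<sigma> then K \<sigma> else 1)"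
        by (rule prod.cong[OF refl])
      also have "\<dots> = K \<sigma>" using f[OF False] finite_flips by simp
      finally show ?thesis using t K[of \<sigma>] by auto
    qed
  qed
  let ?g = "matrix (refl_prod B (frame_idx \<eta>) frame)"
  have noniso: "B (frame p) (frame p) \<noteq> 0" if "p \<in> frame_idx \<eta>" for p
  proof -
    obtain a t where p: "p = (a, t)" by (cases p)
    have a: "a \<in> idx n" "half a \<or> mid a" using that p by (auto simp: frame_idx_def)
    show ?thesis
      using B_v_partner[OF a(1)] a(2) B_frame_self(1)[OF a(1), of t] B_frame_self(2)[OF a(1), of t] unfolding p by (cases t) auto
  qed
  have "?g \<in> SO_plus B"
  proof (rule refl_prod_SO_plus[OF bil sym finite_frame_idx frame_orthogonal noniso])
    show "even (card {p \<in> frame_idx \<eta>. 0 < B (frame p) (frame p)})"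
      using frame_sign_card[of \<eta> True, OF \<eta>] unfolding total by (simp add: minus_one_power_iff split: if_splits)
    show "even (card {p \<in> frame_idx \<eta>. B (frame p) (frame p) < 0})"
      using frame_sign_card[of \<eta> False, OF \<eta>] unfolding total by (simp add: minus_one_power_iff split: if_splits)
  qed
  moreover have "?g ** x = - x ** ?g"
  proof -
    have sp: "signed \<eta> (partner b) = signed \<eta> b" if b: "b \<in> idx n" for b
    proof -
      obtain r i j where b': "b = (r, i, j)" by (cases b)
      show ?thesis
      proof (cases "even r")
        case True
        then show ?thesis using b b' by (simp add: signed_def partner_def minus_one_power_iff)
      next
        case False
        then have "\<eta> r (pair_partner j) = - \<eta> r j" by (simp add: \<eta>_def minus_one_power_iff)
        then show ?thesis using b b' False by (simp add: signed_def partner_def minus_one_power_iff)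
      qed
    qed
    have s1: "signed \<eta> b = 1 \<or> signed \<eta> b = -1" for b
    proof -
      obtain r i j where b': "b = (r, i, j)" by (cases b)
      show ?thesis using \<eta>[of r j] by (cases "even i") (auto simp: signed_def b')
    qed
    have gv: "?g *v v b = signed \<eta> b *\<^sub>R v b" if "b \<in> idx n" for b
      using refl_prod_frame[OF that s1 sp[OF that]]
      by (simp add: fun_cong[OF matrix_vector_mul(2)[OF linear_refl_prod[OF bil sym]]])
    have "(?g ** x) *v z = (- x ** ?g) *v z" for z
    proof (rule linear_eq_on_span[OF matrix_vector_mul_linear matrix_vector_mul_linear])
      show "z \<in> span (v ` idx n)" using span_v by simp
      fix u assume "u \<in> v ` idx n"
      then obtain b where b: "b \<in> idx n" "u = v b" by blast
      obtain r i j where b': "b = (r, i, j)" by (cases b)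
      have m: "(r, i - 1, j) \<in> idx n" using b b' by auto
      have "(?g ** x) *v u = real i *\<^sub>R (signed \<eta> (r, i - 1, j) *\<^sub>R v (r, i - 1, j))"
        using b b' x_v[of i r j] gv[OF m] by (simp add: matrix_vector_mult_scaleR flip: matrix_vector_mul_assoc)
      also have "\<dots> = - (signed \<eta> b *\<^sub>R (real i *\<^sub>R v (r, i - 1, j)))"
        by (cases i) (simp_all add: b' signed_def)
      also have "\<dots> = - ((x ** ?g) *v u)"
        using b b' x_v[of i r j] gv[OF b(1)] by (simp add: matrix_vector_mult_scaleR flip: matrix_vector_mul_assoc)
      also have "\<dots> = (- x ** ?g) *v u"
        by (simp add: matrix_mult_simps matrix_vector_mult_def vec_eq_iff sum_negf)
      finally show "(?g ** x) *v u = (- x ** ?g) *v u" .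
    qed
    then show ?thesis by (simp add: matrix_eq)
  qed
  ultimately show ?thesis by blast
qed

end

section \<open>The Killing form\<close>

text \<open>The projection \<open>P\<close> removes the choice of a basis of \<open>V\<close>: the
  trace on \<open>V\<close> is the trace of \<open>f\<close> after \<open>P\<close> on the whole
  space, which can be computed in the standard basis.\<close>

lemma trace_on_eq:
  fixes V :: "'a::euclidean_space set" and f P :: "'a \<Rightarrow> 'a"
  assumes V: "subspace V" and f: "linear f" "\<And>z. z \<in> V \<Longrightarrow> f z \<in> V"
    and P: "linear P" "\<And>z. P z \<in> V" "\<And>z. z \<in> V \<Longrightarrow> P z = z"
  shows "trace_on V f = (\<Sum>b\<in>Basis. f (P b) \<bullet> b)"
proof -
  define E where "E = (SOME E. independent E \<and> span E = V)"
  have "\<exists>E. independent E \<and> span E = V"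
    using basis_exists[of V] span_subspace[OF _ _ V] by metis
  then have E: "independent E" "span E = V" unfolding E_def by (rule someI2_ex, blast)+
  have fin: "finite E" using finiteI_independent[OF E(1)] .
  have rep: "z = (\<Sum>e\<in>E. representation E z e *\<^sub>R e)" if "z \<in> V" for z
    using sum_representation_eq[OF E(1) _ fin subset_refl, of z] that E(2) by simp
  have lin: "representation E (\<Sum>b\<in>Basis. k b *\<^sub>R P b) e = (\<Sum>b\<in>Basis. k b * representation E (P b) e)" for k e
  proof -
    have "representation E (\<Sum>b\<in>Basis. k b *\<^sub>R P b) = (\<lambda>e. \<Sum>b\<in>Basis. representation E (k b *\<^sub>R P b) e)"
      by (rule representation_sum[OF E(1)]) (simp add: E(2) P(2) subspace_scale[OF V])
    then show ?thesis by (simp add: representation_scale[OF E(1)] E(2) P(2))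
  qed
  have "(\<Sum>b\<in>Basis. f (P b) \<bullet> b) = (\<Sum>b\<in>Basis. \<Sum>e\<in>E. representation E (P b) e * (f e \<bullet> b))"
  proof (rule sum.cong[OF refl])
    fix b :: 'a assume "b \<in> Basis"
    have "f (P b) = (\<Sum>e\<in>E. representation E (P b) e *\<^sub>R f e)"
      by (subst rep[OF P(2)[of b]]) (simp add: linear_sum[OF f(1)] linear_scale[OF f(1)])
    then show "f (P b) \<bullet> b = (\<Sum>e\<in>E. representation E (P b) e * (f e \<bullet> b))"
      by (simp add: inner_sum_left)
  qed
  also have "\<dots> = (\<Sum>e\<in>E. \<Sum>b\<in>Basis. (f e \<bullet> b) * representation E (P b) e)"
    by (subst sum.swap) (simp add: mult.commute)
  also have "\<dots> = (\<Sum>e\<in>E. representation E (\<Sum>b\<in>Basis. (f e \<bullet> b) *\<^sub>R P b) e)"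
    by (simp only: lin)
  also have "\<dots> = (\<Sum>e\<in>E. representation E (f e) e)"
  proof (rule sum.cong[OF refl])
    fix e assume e: "e \<in> E"
    have "(\<Sum>b\<in>Basis. (f e \<bullet> b) *\<^sub>R P b) = P (\<Sum>b\<in>Basis. (f e \<bullet> b) *\<^sub>R b)"
      by (simp add: linear_sum[OF P(1)] linear_scale[OF P(1)])
    also have "\<dots> = f e"
      using P(3)[OF f(2)[of e]] span_base[OF e] E(2) by (simp add: euclidean_representation)
    finally show "representation E (\<Sum>b\<in>Basis. (f e \<bullet> b) *\<^sub>R P b) e = representation E (f e) e" by simp
  qed
  finally show ?thesis unfolding trace_on_def E_def[symmetric] Let_def by simp
qed

lemma sum_Basis_matrix:
  fixes F :: "real^'n^'n \<Rightarrow> real"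
  shows "(\<Sum>b\<in>Basis. F b) = (\<Sum>k\<in>UNIV. \<Sum>l\<in>UNIV. F (axis k (axis l 1)))"
proof -
  have B: "(Basis :: (real^'n^'n) set) = (\<lambda>(k, l). axis k (axis l 1)) ` (UNIV \<times> UNIV)"
    by (auto simp: Basis_vec_def)
  have inj: "inj (\<lambda>(k, l). axis k (axis l (1::real)) :: real^'n^'n)"
    by (auto simp: inj_on_def axis_eq_axis)
  show ?thesis unfolding B by (subst sum.reindex) (use inj in \<open>auto simp: sum.cartesian_product case_prod_beta\<close>)
qed

lemma matrix_sandwich_entry:
  fixes L R :: "real^'n^'n"
  shows "(L ** axis k (axis l 1) ** R) $ i $ j = L $ i $ k * R $ l $ j"
proof -
  have "(L ** axis k (axis l 1)) $ i $ m = (if m = l then L $ i $ k else 0)" for m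
  proof -
    have "(L ** axis k (axis l 1)) $ i $ m = (\<Sum>s\<in>UNIV. L $ i $ s * axis k (axis l 1) $ s $ m)"
      by (simp add: matrix_matrix_mult_def)
    also have "\<dots> = (\<Sum>s\<in>UNIV. if s = k then (if m = l then L $ i $ k else 0) else 0)"
      by (rule sum.cong) (auto simp: axis_def)
    finally show ?thesis by simp
  qed
  moreover have "(L ** axis k (axis l 1) ** R) $ i $ j = (\<Sum>m\<in>UNIV. (L ** axis k (axis l 1)) $ i $ m * R $ m $ j)"
    by (simp add: matrix_matrix_mult_def[of "L ** axis k (axis l 1)"])
  moreover have "(\<Sum>m\<in>UNIV. (if m = l then L $ i $ k else 0) * R $ m $ j) =
      (\<Sum>m\<in>UNIV. if m = l then L $ i $ k * R $ l $ j else 0)"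
    by (rule sum.cong) auto
  ultimately show ?thesis by simp
qed

lemma transpose_axis: "transpose (axis k (axis l 1) :: real^'n^'n) = axis l (axis k 1)"
  by (auto simp: transpose_def axis_def vec_eq_iff)

lemma inner_matrix_axis: "M \<bullet> axis k (axis l 1) = M $ k $ l" for M :: "real^'n^'n"
  by (simp add: inner_axis)

text \<open>These evaluate the trace of a product of two ad maps, a sum of four sandwiches. The
  transposed version enters through the adjoint in the projection onto the Lie algebra.\<close>

lemma sum_Basis_sandwich:
  fixes L R :: "real^'n^'n"
  shows "(\<Sum>b\<in>Basis. (L ** b ** R) \<bullet> b) = trace L * trace R"
    and "(\<Sum>b\<in>Basis. (L ** transpose b ** R) \<bullet> b) = trace (L ** transpose R)"
proof -
  show "(\<Sum>b\<in>Basis. (L ** b ** R) \<bullet> b) = trace L * trace R"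
    by (simp add: sum_Basis_matrix inner_matrix_axis matrix_sandwich_entry trace_def sum_product)
  show "(\<Sum>b\<in>Basis. (L ** transpose b ** R) \<bullet> b) = trace (L ** transpose R)"
    by (simp add: sum_Basis_matrix inner_matrix_axis transpose_axis matrix_sandwich_entry trace_def)
      (simp add: matrix_matrix_mult_def transpose_def)
qed

text \<open>The Gram matrix \<open>G\<close> turns the adjoint with respect to the form into a conjugated transpose.\<close>

locale gram_form =
  fixes B :: "real^'n \<Rightarrow> real^'n \<Rightarrow> real" and G G' :: "real^'n^'n"
  assumes B_G: "B u w = u \<bullet> (G *v w)" and G_sym: "transpose G = G" and G': "G ** G' = mat 1" "G' ** G = mat 1"
begin

definition adj :: "real^'n^'n \<Rightarrow> real^'n^'n" where
  "adj M = G' ** transpose M ** G"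

lemma G'_sym: "transpose G' = G'"
proof -
  have "transpose G' ** G = mat 1" using arg_cong[OF G'(1), of transpose] by (simp add: matrix_transpose_mul G_sym)
  then have "transpose G' ** (G ** G') = mat 1 ** G'" by (simp add: matrix_mul_assoc)
  then show ?thesis by (simp add: G')
qed

lemma adj_adjoint: "B (M *v u) w = B u (adj M *v w)"
proof -
  have "G ** adj M = transpose M ** G" unfolding adj_def by (simp add: matrix_mul_assoc G')
  then have "B u (adj M *v w) = u \<bullet> ((transpose M ** G) *v w)"
    by (simp add: B_G matrix_vector_mul_assoc)
  also have "\<dots> = (M *v u) \<bullet> (G *v w)"
    by (simp only: matrix_vector_mul_assoc[symmetric] dot_lmul_matrix[symmetric] vector_transpose_matrix)
  finally show ?thesis by (simp add: B_G)
qed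

lemma adj_mult: "adj (M ** N) = adj N ** adj M"
proof -
  have "adj N ** adj M = G' ** transpose N ** (G ** G') ** transpose M ** G" by (simp add: adj_def matrix_mul_assoc)
  then show ?thesis by (simp add: adj_def G' matrix_transpose_mul matrix_mul_assoc)
qed

lemma adj_adj: "adj (adj M) = M"
proof -
  have "adj (adj M) = G' ** (G ** M ** G') ** G"
    by (simp add: adj_def matrix_transpose_mul G_sym G'_sym matrix_mul_assoc)
  also have "\<dots> = (G' ** G) ** M ** (G' ** G)" by (simp add: matrix_mul_assoc)
  finally show ?thesis by (simp add: G')
qed

lemma linear_adj: "linear adj"
  unfolding adj_def
  by (rule linearI) (simp_all add: matrix_mult_simps transpose_def vec_eq_iff matrix_matrix_mult_def
     distrib_left distrib_right sum.distrib sum_distrib_left mult_ac)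

lemma trace_adj: "trace (adj M) = trace M"
proof -
  have "trace (adj M) = trace (G ** (G' ** transpose M))" unfolding adj_def by (rule trace_mul_sym)
  then show ?thesis by (simp add: matrix_mul_assoc G' trace_def transpose_def)
qed

lemma B_nondeg: "(\<And>w. B u w = B u' w) \<Longrightarrow> u = u'"
proof -
  assume *: "\<And>w. B u w = B u' w"
  have "u \<bullet> w = u' \<bullet> w" for w
    using *[of "G' *v w"] by (simp add: B_G matrix_vector_mul_assoc G')
  then show ?thesis by (metis inner_commute vector_eq_ldot)
qed

lemma so_algebra_iff: "a \<in> so_algebra B \<longleftrightarrow> adj a = - a"
proof -
  have m: "(- a) *v w = - (a *v w)" for w by (simp add: matrix_vector_mult_def vec_eq_iff sum_negf)
  have neg: "B v (- w) = - B v w" for v w by (simp add: B_G linear_neg[OF matrix_vector_mul_linear])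
  have sym: "B v w = B w v" for v w
    by (simp add: B_G) (metis G_sym dot_lmul_matrix inner_commute transpose_matrix_vector)
  have "a \<in> so_algebra B \<longleftrightarrow> (\<forall>v w. B v (adj a *v w) + B v (a *v w) = 0)"
    by (simp add: so_algebra_def adj_adjoint)
  also have "\<dots> \<longleftrightarrow> (\<forall>w v. B (adj a *v w) v = B ((- a) *v w) v)"
    unfolding m sym[of "adj a *v _"] sym[of "- _"] neg by (simp add: add_eq_0_iff2) blast
  also have "\<dots> \<longleftrightarrow> (\<forall>w. adj a *v w = (- a) *v w)" using B_nondeg by metis
  finally show ?thesis by (simp add: matrix_eq)
qed

lemma subspace_so: "subspace (so_algebra B)"
  by (rule subspaceI) (auto simp: so_algebra_iff linear_0[OF linear_adj] linear_add[OF linear_adj] linear_scale[OF linear_adj])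

lemma bracket_so: "a \<in> so_algebra B \<Longrightarrow> c \<in> so_algebra B \<Longrightarrow> bracket a c \<in> so_algebra B"
  by (simp add: so_algebra_iff bracket_def linear_diff[OF linear_adj] adj_mult matrix_mult_simps)

text \<open>The projection is half of z - \<open>adj z\<close>. With N = \<open>CARD('n)\<close>,
  the first part gives 2 N trace (a c), because a is traceless, and the adjoint part gives 4 trace
  (a c); half the difference yields the factor N - 2.\<close>

lemma killing_form_eq:
  assumes a: "a \<in> so_algebra B" and c: "c \<in> so_algebra B"
  shows "killing_form B a c = (real CARD('n) - 2) * trace (a ** c)"
proof -
  define f where "f z = bracket a (bracket c z)" for z
  define P where "P z = (1/2) *\<^sub>R (z - adj z)" for z
  have f: "f z = a ** c ** z ** mat 1 - a ** z ** c - c ** z ** a + mat 1 ** z ** (c ** a)" for z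
    by (simp add: f_def bracket_def matrix_mult_simps matrix_mul_assoc)
  have linf: "linear f"
    by (rule linearI) (simp_all add: f matrix_mult_simps algebra_simps)
  have linP: "linear P"
    by (rule linearI) (simp_all add: P_def linear_add[OF linear_adj] linear_scale[OF linear_adj] algebra_simps)
  have "killing_form B a c = (\<Sum>b\<in>Basis. f (P b) \<bullet> b)"
    unfolding killing_form_def f_def[symmetric]
  proof (rule trace_on_eq[OF subspace_so linf _ linP])
    show "f z \<in> so_algebra B" if "z \<in> so_algebra B" for z
      unfolding f_def using a c that by (intro bracket_so)
    show "P z \<in> so_algebra B" for z
      by (simp add: so_algebra_iff P_def linear_scale[OF linear_adj] linear_diff[OF linear_adj] adj_adj scaleR_right_diff_distrib)
    show "P z = z" if "z \<in> so_algebra B" for z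
      using that by (simp add: so_algebra_iff P_def flip: scaleR_2)
  qed
  also have "\<dots> = (\<Sum>b\<in>Basis. (1/2) * (f b \<bullet> b - f (adj b) \<bullet> b))"
    by (simp add: P_def linear_scale[OF linf] linear_diff[OF linf] inner_diff_left)
  also have "\<dots> = (1/2) * ((\<Sum>b\<in>Basis. f b \<bullet> b) - (\<Sum>b\<in>Basis. f (adj b) \<bullet> b))"
    by (simp add: sum_distrib_left sum_subtractf right_diff_distrib)
  also have "(\<Sum>b\<in>Basis. f b \<bullet> b) = 2 * real CARD('n) * trace (a ** c)"
  proof -
    have tr0: "trace a = 0" using trace_adj[of a] a by (simp add: so_algebra_iff trace_def sum_negf)
    have "(\<Sum>b\<in>Basis. f b \<bullet> b) = (\<Sum>b\<in>Basis. (a ** c ** b ** (mat 1 :: real^'n^'n)) \<bullet> b) - (\<Sum>b\<in>Basis. (a ** b ** c) \<bullet> b)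
        - (\<Sum>b\<in>Basis. (c ** b ** a) \<bullet> b) + (\<Sum>b\<in>Basis. ((mat 1 :: real^'n^'n) ** b ** (c ** a)) \<bullet> b)"
      unfolding f inner_add_left inner_diff_left sum.distrib sum_subtractf ..
    also have "\<dots> = trace (a ** c) * trace (mat 1 :: real^'n^'n) - trace a * trace c - trace c * trace a
        + trace (mat 1 :: real^'n^'n) * trace (c ** a)"
      unfolding sum_Basis_sandwich ..
    finally show ?thesis using tr0 trace_mul_sym[of a c] by (simp add: trace_I)
  qed
  also have "(\<Sum>b\<in>Basis. f (adj b) \<bullet> b) = 4 * trace (a ** c)"
  proof -
    have sand: "(\<Sum>b\<in>Basis. (L ** adj b ** R) \<bullet> b) = trace (L ** adj R)" for L R
    proof -
      have "(\<Sum>b\<in>Basis. (L ** adj b ** R) \<bullet> b) = (\<Sum>b\<in>Basis. ((L ** G') ** transpose b ** (G ** R)) \<bullet> b)"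
        by (simp add: adj_def matrix_mul_assoc)
      also have "\<dots> = trace (L ** G' ** transpose (G ** R))" by (rule sum_Basis_sandwich)
      also have "\<dots> = trace (L ** adj R)" by (simp add: adj_def matrix_transpose_mul G_sym matrix_mul_assoc)
      finally show ?thesis .
    qed
    have adj1: "adj (mat 1) = mat 1" by (simp add: adj_def G')
    have ad: "adj a = - a" "adj c = - c" using a c by (simp_all add: so_algebra_iff)
    have "(\<Sum>b\<in>Basis. f (adj b) \<bullet> b) = (\<Sum>b\<in>Basis. (a ** c ** adj b ** (mat 1 :: real^'n^'n)) \<bullet> b) - (\<Sum>b\<in>Basis. (a ** adj b ** c) \<bullet> b)
        - (\<Sum>b\<in>Basis. (c ** adj b ** a) \<bullet> b) + (\<Sum>b\<in>Basis. ((mat 1 :: real^'n^'n) ** adj b ** (c ** a)) \<bullet> b)"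
      unfolding f inner_add_left inner_diff_left sum.distrib sum_subtractf ..
    also have "\<dots> = trace (a ** c) + trace (a ** c) + trace (c ** a) + trace (a ** c)"
      unfolding sand adj1 adj_mult ad by (simp add: matrix_mult_simps trace_def sum_negf)
    finally show ?thesis using trace_mul_sym[of a c] by simp
  qed
  finally show ?thesis by (simp add: algebra_simps)
qed

text \<open>For \<open>a\<close> in the Lie algebra, trace (a M) = - trace (a \<open>adj M\<close>),
  while pairing with M - \<open>adj M\<close> gives equality; so \<open>a\<close> is orthogonal to
  all matrices.\<close>

lemma trace_form_nondeg:
  assumes a: "a \<in> so_algebra B" and 0: "\<And>c. c \<in> so_algebra B \<Longrightarrow> trace (a ** c) = 0"
  shows "a = 0"
proof -
  have "trace (a ** M) = 0" for M
  proof -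
    have "M - adj M \<in> so_algebra B"
      by (simp add: so_algebra_iff linear_diff[OF linear_adj] adj_adj)
    then have "trace (a ** (M - adj M)) = 0" by (rule 0)
    then have 1: "trace (a ** M) = trace (a ** adj M)" by (simp add: matrix_mult_simps trace_sub)
    have "trace (a ** M) = trace (adj (a ** M))" by (simp add: trace_adj)
    also have "\<dots> = trace (adj M ** (- a))" using a by (simp add: adj_mult so_algebra_iff)
    also have "\<dots> = - trace (a ** adj M)"
      by (subst trace_mul_sym) (simp add: matrix_mult_simps trace_def sum_negf)
    finally show ?thesis using 1 by simp
  qed
  then have "trace (a ** axis l (axis k 1)) = 0" for k l by blast
  moreover have "trace (a ** axis l (axis k 1)) = a $ k $ l" for k l
  proof -
    have "trace (a ** axis l (axis k 1) ** mat 1) = (\<Sum>i\<in>UNIV. a $ i $ l * (mat 1 :: real^'n^'n) $ k $ i)"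
      unfolding trace_def matrix_sandwich_entry ..
    also have "\<dots> = a $ k $ l" by (simp add: mat_def if_distrib cong: if_cong)
    finally show ?thesis by simp
  qed
  ultimately show ?thesis by (simp add: vec_eq_iff)
qed

end

lemma gram_form_exists:
  fixes B :: "real^'n \<Rightarrow> real^'n \<Rightarrow> real"
  assumes "has_signature UNIV B p q"
  shows "\<exists>G G'. gram_form B G G'"
proof -
  have bil: "bilinear B" and sym: "\<And>u w. B u w = B w u"
    using assms by (simp_all add: has_signature_def bilinear_form_on_UNIV)
  have f: "bilinear_form_on UNIV B" using bil by (simp add: bilinear_form_on_UNIV)
  define G :: "real^'n^'n" where "G = (\<chi> k l. B (axis k 1) (axis l 1))"
  have ax: "u = (\<Sum>k\<in>UNIV. u $ k *\<^sub>R axis k 1)" for u :: "real^'n"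
    by (simp add: vec_eq_iff axis_def if_distrib cong: if_cong)
  have BG: "B u w = u \<bullet> (G *v w)" for u w
  proof -
    have "B u w = (\<Sum>k\<in>UNIV. u $ k * B (axis k 1) w)"
      by (subst ax[of u], rule bilinear_form_on_sum(1)[OF f subspace_UNIV]) auto
    also have "\<dots> = (\<Sum>k\<in>UNIV. u $ k * (\<Sum>l\<in>UNIV. w $ l * B (axis k 1) (axis l 1)))"
      by (subst ax[of w], subst bilinear_form_on_sum(2)[OF f subspace_UNIV]) auto
    finally show ?thesis by (simp add: inner_vec_def matrix_vector_mult_def G_def mult.commute)
  qed
  have "invertible G"
  proof -
    have "u = 0" if "G *v u = 0" for u
      using signature_nondegenerate[OF assms, of u] BG[of _ u] sym that by simp
    then show ?thesis using matrix_left_invertible_ker[of G] invertible_left_inverse by blast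
  qed
  then obtain G' where "G ** G' = mat 1" "G' ** G = mat 1" unfolding invertible_def by blast
  moreover have "transpose G = G" unfolding G_def transpose_def by (simp add: vec_eq_iff) (blast intro: sym)
  ultimately have "gram_form B G G'" using BG by (intro gram_form.intro)
  then show ?thesis by blast
qed

section \<open>The Cayley chart of an orbit\<close>

text \<open>By Cramer's rule the entries are quotients of polynomials in the entries of the
  matrix.\<close>

lemma continuous_on_matrix_inv: "continuous_on {M. det M \<noteq> 0} (matrix_inv :: real^'n^'n \<Rightarrow> _)"
proof -
  have entry: "matrix_inv M $ i $ j = det (\<chi> k l. if l = i then axis j 1 $ k else M $ k $ l) / det M"
    if M: "det M \<noteq> 0" for M :: "real^'n^'n" and i j
  proof -
    have inv: "invertible M" using M invertible_det_nz by blast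
    have "M *v (matrix_inv M *v axis j 1) = axis j 1"
      by (simp add: matrix_vector_mul_assoc matrix_inv_inverses(1)[OF inv])
    then have "matrix_inv M *v axis j 1 = (\<chi> i. det (\<chi> k l. if l = i then axis j 1 $ k else M $ k $ l) / det M)"
      using cramer[OF M] by blast
    moreover have "(matrix_inv M *v axis j 1) $ i = matrix_inv M $ i $ j"
      by (simp add: matrix_vector_mult_basis column_def)
    ultimately show ?thesis by simp
  qed
  have entry_cont: "continuous_on S (\<lambda>M :: real^'n^'n. if l = i then axis j 1 $ k else M $ k $ l)" for S i j k l
    by (cases "l = i") (auto intro!: continuous_intros)
  have "continuous_on {M. det M \<noteq> 0} (\<lambda>M :: real^'n^'n. \<chi> i j. det (\<chi> k l. if l = i then axis j 1 $ k else M $ k $ l) / det M)"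
    unfolding det_def vec_lambda_beta
    by (intro continuous_on_vec_lambda continuous_on_divide continuous_on_sum continuous_on_mult continuous_on_prod
        continuous_on_const entry_cont) (auto intro!: continuous_intros)
  then show ?thesis
    by (rule continuous_on_cong[THEN iffD1, rotated -1]) (auto simp: vec_eq_iff entry)
qed

text \<open>Continuity of a derivative in operator norm is thereby checked on finitely many
  vectors.\<close>

lemma onorm_le_sum_Basis:
  fixes F :: "'a::euclidean_space \<Rightarrow> 'b::real_normed_vector"
  assumes "linear F"
  shows "onorm F \<le> (\<Sum>b\<in>Basis. norm (F b))"
proof (rule onorm_le)
  fix v :: 'a
  have "F v = (\<Sum>b\<in>Basis. (v \<bullet> b) *\<^sub>R F b)"
    by (subst euclidean_representation[of v, symmetric]) (simp add: linear_sum[OF assms] linear_scale[OF assms])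
  then have "norm (F v) \<le> (\<Sum>b\<in>Basis. \<bar>v \<bullet> b\<bar> * norm (F b))" by (simp add: order_trans[OF norm_sum])
  also have "\<dots> \<le> (\<Sum>b\<in>Basis. norm v * norm (F b))"
    by (intro sum_mono mult_right_mono) (auto simp: Basis_le_norm)
  finally show "norm (F v) \<le> (\<Sum>b\<in>Basis. norm (F b)) * norm v" by (simp add: mult.commute flip: sum_distrib_left)
qed

definition resolvent :: "real^'n^'n \<Rightarrow> real^'n^'n" where
  "resolvent A = matrix_inv (mat 1 - A)"

definition cayley_domain :: "(real^'n^'n) set" where
  "cayley_domain = {A. det (mat 1 - A) \<noteq> 0 \<and> det (mat 1 + A) \<noteq> 0}"

text \<open>This is (1 + A) / (1 - A), written so that it is affine in the resolvent. In place of
  the exponential map it takes small elements of the Lie algebra to isometries, by rational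
  functions.\<close>

definition cayley :: "real^'n^'n \<Rightarrow> real^'n^'n" where
  "cayley A = 2 *\<^sub>R resolvent A - mat 1"

lemma uminus_cayley_domain: "A \<in> cayley_domain \<Longrightarrow> - A \<in> cayley_domain"
  by (simp add: cayley_domain_def)

lemma resolvent_inverse:
  assumes "A \<in> cayley_domain"
  shows "(mat 1 - A) ** resolvent A = mat 1" "resolvent A ** (mat 1 - A) = mat 1"
    "(mat 1 + A) ** resolvent (- A) = mat 1" "resolvent (- A) ** (mat 1 + A) = mat 1"
  using assms by (simp_all add: cayley_domain_def resolvent_def matrix_inv_inverses invertible_det_nz)

lemma open_cayley_domain: "open (cayley_domain :: (real^'n^'n) set)"
proof -
  have "continuous_on UNIV (\<lambda>A :: real^'n^'n. det (mat 1 - A) * det (mat 1 + A))"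
    unfolding det_def by (intro continuous_intros)
  then have "open {A :: real^'n^'n. det (mat 1 - A) * det (mat 1 + A) \<noteq> 0}"
    by (rule open_Collect_neq) (rule continuous_on_const)
  then show ?thesis by (simp add: cayley_domain_def)
qed

lemma zero_cayley_domain: "0 \<in> cayley_domain"
  by (simp add: cayley_domain_def)

lemma resolvent_0: "resolvent 0 = mat 1"
  using resolvent_inverse(1)[OF zero_cayley_domain] by simp

lemma cayley_0: "cayley 0 = mat 1"
  by (simp add: cayley_def resolvent_0 scaleR_2)

lemma continuous_on_resolvent: "continuous_on cayley_domain resolvent"
proof -
  have "continuous_on cayley_domain (\<lambda>A. matrix_inv (mat 1 - A))"
    by (rule continuous_on_compose2[OF continuous_on_matrix_inv])
      (auto simp: cayley_domain_def intro!: continuous_intros)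
  then show ?thesis by (simp add: resolvent_def[abs_def])
qed

text \<open>By the resolvent identity R' - R = R' (A' - A) R the remainder is (R' - R) (A' - A) R,
  and continuity of the resolvent makes it small compared with A' - A.\<close>

lemma has_derivative_resolvent:
  fixes A :: "real^'n^'n"
  assumes A: "A \<in> cayley_domain"
  shows "(resolvent has_derivative (\<lambda>E. resolvent A ** E ** resolvent A)) (at A)"
proof -
  have bl: "bounded_linear (\<lambda>E. resolvent A ** E ** resolvent A)"
    by (intro linear_conv_bounded_linear[THEN iffD1] linearI) (simp_all add: matrix_mult_simps)
  have bb: "bounded_bilinear ((**) :: real^'n^'n \<Rightarrow> real^'n^'n \<Rightarrow> real^'n^'n)"
    by (rule bounded_bilinear_matrix_mult)
  obtain K where "K > 0 \<and> (\<forall>(M :: real^'n^'n) (N :: real^'n^'n). norm (M ** N) \<le> norm M * norm N * K)"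
    using bounded_bilinear.pos_bounded[OF bb] by (elim exE)
  then have K: "K > 0" "norm (M ** N) \<le> norm M * norm N * K" for M N :: "real^'n^'n" by simp_all
  have res: "resolvent A' - resolvent A = resolvent A' ** (A' - A) ** resolvent A" if "A' \<in> cayley_domain" for A'
  proof -
    have "resolvent A' ** ((mat 1 - A) - (mat 1 - A')) ** resolvent A =
        resolvent A' ** ((mat 1 - A) ** resolvent A) - (resolvent A' ** (mat 1 - A')) ** resolvent A"
      by (simp only: matrix_mult_simps matrix_mul_assoc)
    then show ?thesis using resolvent_inverse(1)[OF A] resolvent_inverse(2)[OF that] by simp
  qed
  have "((\<lambda>A'. norm (resolvent A' - resolvent A - resolvent A ** (A' - A) ** resolvent A) / norm (A' - A)) \<longlongrightarrow> 0) (at A)"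
  proof (rule Lim_null_comparison)
    have "\<forall>\<^sub>F A' in at A. A' \<in> cayley_domain"
      using open_cayley_domain A eventually_at_topological by blast
    then show "\<forall>\<^sub>F A' in at A. norm (norm (resolvent A' - resolvent A - resolvent A ** (A' - A) ** resolvent A) / norm (A' - A))
        \<le> norm (resolvent A' - resolvent A) * (K * (norm (resolvent A) * K))"
    proof (rule eventually_mono)
      fix A' :: "real^'n^'n" assume A': "A' \<in> cayley_domain"
      have "resolvent A' - resolvent A - resolvent A ** (A' - A) ** resolvent A =
          (resolvent A' - resolvent A) ** (A' - A) ** resolvent A"
        by (subst res[OF A']) (simp add: matrix_mult_simps algebra_simps)
      then have "norm (resolvent A' - resolvent A - resolvent A ** (A' - A) ** resolvent A) \<le>
          norm ((resolvent A' - resolvent A) ** (A' - A)) * norm (resolvent A) * K"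
        using K(2) by metis
      also have "\<dots> \<le> norm (resolvent A' - resolvent A) * norm (A' - A) * K * norm (resolvent A) * K"
        using K by (intro mult_right_mono) auto
      finally have "norm (resolvent A' - resolvent A - resolvent A ** (A' - A) ** resolvent A) \<le>
          norm (resolvent A' - resolvent A) * (K * (norm (resolvent A) * K)) * norm (A' - A)"
        by (simp add: mult_ac)
      then show "norm (norm (resolvent A' - resolvent A - resolvent A ** (A' - A) ** resolvent A) / norm (A' - A))
        \<le> norm (resolvent A' - resolvent A) * (K * (norm (resolvent A) * K))"
        using K(1) by (cases "A' = A") (auto simp: divide_le_eq)
    qed
    have "continuous (at A) resolvent"
      using continuous_on_resolvent open_cayley_domain A continuous_on_eq_continuous_at by blast
    then have "((\<lambda>A'. norm (resolvent A' - resolvent A) * (K * (norm (resolvent A) * K))) \<longlongrightarrow>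
        norm (resolvent A - resolvent A) * (K * (norm (resolvent A) * K))) (at A)"
      unfolding continuous_at by (intro tendsto_intros)
    then show "((\<lambda>A'. norm (resolvent A' - resolvent A) * (K * (norm (resolvent A) * K))) \<longlongrightarrow> 0) (at A)" by simp
  qed
  then show ?thesis using bl by (simp add: has_derivative_iff_norm)
qed

lemma cayley_eq:
  assumes "A \<in> cayley_domain"
  shows "cayley A = (mat 1 + A) ** resolvent A" "cayley (- A) = (mat 1 - A) ** resolvent (- A)"
proof -
  have "(mat 1 + A) ** resolvent A = (2 *\<^sub>R mat 1 - (mat 1 - A)) ** resolvent A" by (simp add: scaleR_2)
  also have "\<dots> = 2 *\<^sub>R resolvent A - (mat 1 - A) ** resolvent A" by (simp only: matrix_mult_simps matrix_mul_lid)
  finally show "cayley A = (mat 1 + A) ** resolvent A" by (simp add: cayley_def resolvent_inverse[OF assms])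
  have "(mat 1 - A) ** resolvent (- A) = (2 *\<^sub>R mat 1 - (mat 1 + A)) ** resolvent (- A)" by (simp add: scaleR_2)
  also have "\<dots> = 2 *\<^sub>R resolvent (- A) - (mat 1 + A) ** resolvent (- A)" by (simp only: matrix_mult_simps matrix_mul_lid)
  finally show "cayley (- A) = (mat 1 - A) ** resolvent (- A)" by (simp add: cayley_def resolvent_inverse[OF assms])
qed

lemma resolvent_commute:
  assumes "A \<in> cayley_domain"
  shows "(mat 1 + A) ** resolvent A = resolvent A ** (mat 1 + A)"
proof -
  have c: "(mat 1 - A) ** (mat 1 + A) = (mat 1 + A) ** (mat 1 - A)" by (simp add: matrix_mult_simps)
  have "(mat 1 + A) ** resolvent A = (resolvent A ** (mat 1 - A)) ** (mat 1 + A) ** resolvent A"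
    by (simp add: resolvent_inverse[OF assms])
  also have "\<dots> = resolvent A ** ((mat 1 - A) ** (mat 1 + A)) ** resolvent A" by (simp only: matrix_mul_assoc)
  also have "\<dots> = resolvent A ** (mat 1 + A) ** ((mat 1 - A) ** resolvent A)" unfolding c by (simp only: matrix_mul_assoc)
  finally show ?thesis by (simp add: resolvent_inverse[OF assms])
qed

lemma cayley_inverse:
  assumes "A \<in> cayley_domain"
  shows "cayley A ** cayley (- A) = mat 1" "cayley (- A) ** cayley A = mat 1"
proof -
  have *: "cayley A ** cayley (- A) = mat 1" if A: "A \<in> cayley_domain" for A :: "real^'n^'n"
  proof -
    have "cayley A ** cayley (- A) = (mat 1 + A) ** (resolvent A ** (mat 1 - A)) ** resolvent (- A)"
      by (simp only: cayley_eq[OF A] matrix_mul_assoc)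
    then show ?thesis by (simp add: resolvent_inverse[OF A])
  qed
  show "cayley A ** cayley (- A) = mat 1" by (rule *[OF assms])
  show "cayley (- A) ** cayley A = mat 1" using *[OF uminus_cayley_domain[OF assms]] by simp
qed

lemma resolvent_cayley:
  assumes "A \<in> cayley_domain"
  shows "resolvent (- A) ** cayley A = resolvent A" "cayley (- A) ** resolvent A = resolvent (- A)"
proof -
  show "resolvent (- A) ** cayley A = resolvent A"
    by (simp add: cayley_eq[OF assms] matrix_mul_assoc resolvent_inverse[OF assms])
  have m: "- A \<in> cayley_domain" using assms by (rule uminus_cayley_domain)
  have "cayley (- A) = resolvent (- A) ** (mat 1 - A)"
    using cayley_eq(1)[OF m] resolvent_commute[OF m] by simp
  then show "cayley (- A) ** resolvent A = resolvent (- A)"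
    by (simp add: resolvent_inverse[OF assms] flip: matrix_mul_assoc)
qed

context gram_form
begin

lemma adj_mat_1: "adj (mat 1) = mat 1"
  by (simp add: adj_def G')

lemma adj_resolvent:
  assumes "A \<in> cayley_domain" "A \<in> so_algebra B"
  shows "adj (resolvent A) = resolvent (- A)"
proof -
  have "adj (resolvent A) ** (mat 1 + A) = mat 1"
    using arg_cong[OF resolvent_inverse(1)[OF assms(1)], of adj] assms(2)
    by (simp add: adj_mult adj_mat_1 so_algebra_iff linear_diff[OF linear_adj])
  then have "adj (resolvent A) ** ((mat 1 + A) ** resolvent (- A)) = resolvent (- A)"
    by (simp add: matrix_mul_assoc)
  then show ?thesis by (simp add: resolvent_inverse[OF assms(1)])
qed

lemma cayley_O_group:
  assumes "A \<in> cayley_domain" "A \<in> so_algebra B"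
  shows "cayley A \<in> O_group B"
proof -
  have "adj (cayley A) = cayley (- A)"
    using adj_resolvent[OF assms] by (simp add: cayley_def linear_diff[OF linear_adj] linear_scale[OF linear_adj] adj_mat_1)
  then have "B (cayley A *v u) (cayley A *v w) = B u w" for u w
    by (simp add: adj_adjoint matrix_vector_mul_assoc cayley_inverse[OF assms(1)])
  moreover have "invertible (cayley A)" unfolding invertible_def using cayley_inverse[OF assms(1)] by blast
  ultimately show ?thesis by (simp add: O_group_def)
qed

lemma continuous_on_cayley: "continuous_on cayley_domain cayley"
  unfolding cayley_def[abs_def] by (intro continuous_intros continuous_on_resolvent)

lemma cayley_SO_plus:
  assumes "ball 0 \<rho> \<subseteq> (cayley_domain :: (real^'n^'n) set)" "A \<in> ball 0 \<rho>" "A \<in> so_algebra B"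
  shows "cayley A \<in> SO_plus B"
proof -
  have dom: "t *\<^sub>R A \<in> cayley_domain" if "0 \<le> t" "t \<le> 1" for t
  proof -
    have "t * norm A \<le> 1 * norm A" using that by (intro mult_right_mono) auto
    then have "t *\<^sub>R A \<in> ball 0 \<rho>" using assms(2) that by simp
    then show ?thesis using assms(1) by blast
  qed
  have "cayley (1 *\<^sub>R A) \<in> SO_plus B"
  proof (rule SO_plus_path[of "\<lambda>t. cayley (t *\<^sub>R A)"])
    show "continuous_on {0..1} (\<lambda>t. cayley (t *\<^sub>R A))"
      by (rule continuous_on_compose2[OF continuous_on_cayley]) (auto intro!: continuous_intros dom)
    show "cayley (t *\<^sub>R A) \<in> O_group B" if "0 \<le> t" "t \<le> 1" for t
      using dom[OF that] assms(3) subspace_so by (intro cayley_O_group) (auto intro: subspace_scale)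
    show "cayley (0 *\<^sub>R A) \<in> SO_plus B" by (simp add: cayley_0 mat_1_SO_plus)
  qed
  then show ?thesis by simp
qed

end

section \<open>The orbit map and the symplectic form on the orbit\<close>

definition orbit_map :: "real^'n^'n \<Rightarrow> real^'n^'n \<Rightarrow> real^'n^'n" where
  "orbit_map x A = cayley A ** x ** cayley (- A)"

text \<open>The derivative of \<open>cayley\<close> at \<open>A\<close> along \<open>E\<close>,
  multiplied on the right by the inverse \<open>cayley (- A)\<close>: the Lie algebra element by
  which the point of the orbit moves.\<close>

definition velocity :: "real^'n^'n \<Rightarrow> real^'n^'n \<Rightarrow> real^'n^'n" where
  "velocity A E = 2 *\<^sub>R (resolvent A ** E ** resolvent (- A))"

lemma has_derivative_orbit_map:
  fixes A :: "real^'n^'n"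
  assumes A: "A \<in> cayley_domain"
  shows "(orbit_map x has_derivative (\<lambda>E. bracket (velocity A E) (orbit_map x A))) (at A)"
proof -
  have c1: "(cayley has_derivative (\<lambda>E. 2 *\<^sub>R (resolvent A ** E ** resolvent A))) (at A)"
    unfolding cayley_def[abs_def] by (rule derivative_eq_intros has_derivative_resolvent[OF A] refl | simp)+
  have m: "(cayley has_derivative (\<lambda>E. 2 *\<^sub>R (resolvent (- A) ** E ** resolvent (- A)))) (at (- A))"
    unfolding cayley_def[abs_def]
    by (rule derivative_eq_intros has_derivative_resolvent[OF uminus_cayley_domain[OF A]] refl | simp)+
  have "((\<lambda>A. - A) has_derivative (\<lambda>E. - E)) (at A)" by (rule derivative_eq_intros refl)+
  from has_derivative_compose[OF this m]
  have c2: "((\<lambda>A. cayley (- A)) has_derivative (\<lambda>E. 2 *\<^sub>R (resolvent (- A) ** (- E) ** resolvent (- A)))) (at A)" .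
  have c3: "((\<lambda>A. cayley A ** x) has_derivative (\<lambda>E. 2 *\<^sub>R (resolvent A ** E ** resolvent A) ** x)) (at A)"
    by (rule bounded_linear.has_derivative[OF bounded_bilinear.bounded_linear_left[OF bounded_bilinear_matrix_mult] c1])
  have "(orbit_map x has_derivative (\<lambda>E. cayley A ** x ** (2 *\<^sub>R (resolvent (- A) ** (- E) ** resolvent (- A))) +
      2 *\<^sub>R (resolvent A ** E ** resolvent A) ** x ** cayley (- A))) (at A)"
    unfolding orbit_map_def[abs_def] by (rule bounded_bilinear.FDERIV[OF bounded_bilinear_matrix_mult c3 c2])
  moreover have "bracket (velocity A E) (orbit_map x A) =
      cayley A ** x ** (2 *\<^sub>R (resolvent (- A) ** (- E) ** resolvent (- A))) +
      2 *\<^sub>R (resolvent A ** E ** resolvent A) ** x ** cayley (- A)" for E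
  proof -
    \<comment> \<open>Factors are grouped so that \<open>resolvent_cayley\<close> contracts a
      resolvent with the adjacent Cayley transform.\<close>
    have "velocity A E ** orbit_map x A = 2 *\<^sub>R (resolvent A ** E ** (resolvent (- A) ** cayley A) ** x ** cayley (- A))"
      by (simp only: velocity_def orbit_map_def matrix_mult_simps matrix_mul_assoc)
    moreover have "orbit_map x A ** velocity A E = 2 *\<^sub>R (cayley A ** x ** (cayley (- A) ** resolvent A) ** E ** resolvent (- A))"
      by (simp only: velocity_def orbit_map_def matrix_mult_simps matrix_mul_assoc)
    ultimately show ?thesis
      unfolding bracket_def resolvent_cayley[OF A] by (simp add: matrix_mult_simps matrix_mul_assoc)
  qed
  ultimately show ?thesis by simp
qed

lemma bracket_scale: "bracket (t *\<^sub>R a) c = t *\<^sub>R bracket a c" "bracket a (t *\<^sub>R c) = t *\<^sub>R bracket a c"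
  and bracket_add: "bracket (a + a') c = bracket a c + bracket a' c" "bracket a (c + c') = bracket a c + bracket a c'"
  by (simp_all add: bracket_def matrix_mult_simps scaleR_right_diff_distrib)

lemma linear_bracket: "linear (\<lambda>a. bracket a c)"
  by (rule linearI) (simp_all add: bracket_scale bracket_add)

lemma trace_scale: "trace (t *\<^sub>R M) = t * trace M" for M :: "real^'n^'n"
  by (simp add: trace_def sum_distrib_left)

lemma trace_bracket:
  fixes a c y :: "real^'n^'n"
  shows "trace (y ** bracket a c) = - trace (bracket a y ** c)" "trace (y ** bracket a c) = trace (bracket c y ** a)"
proof -
  have 1: "trace (y ** a ** c) = trace (c ** y ** a)" by (metis matrix_mul_assoc trace_mul_sym)
  have 2: "trace (y ** c ** a) = trace (a ** y ** c)" by (metis matrix_mul_assoc trace_mul_sym)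
  show "trace (y ** bracket a c) = - trace (bracket a y ** c)" "trace (y ** bracket a c) = trace (bracket c y ** a)"
    using 1 2 by (simp_all add: bracket_def matrix_mult_simps trace_sub matrix_mul_assoc)
qed

context gram_form
begin

text \<open>Cyclicity of the trace moves \<open>y\<close> into the bracket with either argument, so
  the value depends on \<open>a\<close> and \<open>c\<close> only through the tangent vectors; this
  is the uniqueness that the definite description requires.\<close>

lemma orbit_form_eq:
  assumes y: "y \<in> so_algebra B" and a: "a \<in> so_algebra B" and c: "c \<in> so_algebra B"
  shows "orbit_form B y (bracket a y) (bracket c y) = (real CARD('n) - 2) * trace (y ** bracket a c)"
  unfolding orbit_form_def
proof (rule the_equality)
  show "\<exists>a'\<in>so_algebra B. \<exists>c'\<in>so_algebra B. bracket a y = bracket a' y \<and> bracket c y = bracket c' y \<and>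
      (real CARD('n) - 2) * trace (y ** bracket a c) = killing_form B y (bracket a' c')"
    by (intro bexI[OF _ a] bexI[OF _ c] conjI refl killing_form_eq[OF y bracket_so[OF a c], symmetric])
next
  fix k assume "\<exists>a'\<in>so_algebra B. \<exists>c'\<in>so_algebra B. bracket a y = bracket a' y \<and> bracket c y = bracket c' y \<and>
      k = killing_form B y (bracket a' c')"
  then obtain a' c' where *: "a' \<in> so_algebra B" "c' \<in> so_algebra B" "bracket a y = bracket a' y"
    "bracket c y = bracket c' y" "k = killing_form B y (bracket a' c')" by blast
  have "trace (y ** bracket a c) = trace (y ** bracket a' c)" by (simp only: trace_bracket(1) *(3))
  also have "\<dots> = trace (y ** bracket a' c')" by (simp only: trace_bracket(2) *(4))
  finally show "k = (real CARD('n) - 2) * trace (y ** bracket a c)"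
    using killing_form_eq[OF y bracket_so[OF *(1,2)]] *(5) by simp
qed

text \<open>The orbit form is nondegenerate on the tangent space: a vector of its radical is
  orthogonal to the Lie algebra for the trace form, as the factor N - 2 is nonzero. A symplectic
  basis is then lifted to Lie algebra elements \<open>e i\<close>.\<close>

lemma tangent_symplectic_basis:
  assumes x: "x \<in> so_algebra B" and N: "CARD('n) > 2"
  obtains d e where "\<And>i. i < 2 * d \<Longrightarrow> e i \<in> so_algebra B"
    "inj_on (\<lambda>i. bracket (e i) x) {..<2 * d}" "independent ((\<lambda>i. bracket (e i) x) ` {..<2 * d})"
    "span ((\<lambda>i. bracket (e i) x) ` {..<2 * d}) = tangent_space B x"
    "\<And>i j. i < 2 * d \<Longrightarrow> j < 2 * d \<Longrightarrow> (real CARD('n) - 2) * trace (x ** bracket (e i) (e j)) = std_symp i j"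
proof -
  let ?T = "tangent_space B x" and ?f = "orbit_form B x"
  have T: "?T = (\<lambda>a. bracket a x) ` so_algebra B" by (auto simp: tangent_space_def)
  have sT: "subspace ?T" unfolding T by (rule linear_subspace_image[OF linear_bracket subspace_so])
  have bil: "bilinear_form_on ?T ?f"
    unfolding bilinear_form_on_def
  proof (intro conjI ballI allI)
    fix u v w assume "u \<in> ?T" "v \<in> ?T" "w \<in> ?T"
    then obtain a b c where abc: "a \<in> so_algebra B" "b \<in> so_algebra B" "c \<in> so_algebra B"
      "u = bracket a x" "v = bracket b x" "w = bracket c x" unfolding T by blast
    have ab: "a + b \<in> so_algebra B" using abc subspace_so by (auto intro: subspace_add)
    show "?f (u + v) w = ?f u w + ?f v w" "?f w (u + v) = ?f w u + ?f w v"
      unfolding abc(4-6) bracket_add[symmetric] orbit_form_eq[OF x ab abc(3)] orbit_form_eq[OF x abc(3) ab]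
        orbit_form_eq[OF x abc(1,3)] orbit_form_eq[OF x abc(2,3)] orbit_form_eq[OF x abc(3,1)] orbit_form_eq[OF x abc(3,2)]
      by (simp_all add: bracket_add matrix_mult_simps trace_add distrib_left)
  next
    fix u v :: "real^'n^'n" and t :: real assume "u \<in> ?T" "v \<in> ?T"
    then obtain a b where ab: "a \<in> so_algebra B" "b \<in> so_algebra B" "u = bracket a x" "v = bracket b x" unfolding T by blast
    have t: "t *\<^sub>R a \<in> so_algebra B" "t *\<^sub>R b \<in> so_algebra B" using ab subspace_so by (auto intro: subspace_scale)
    show "?f (t *\<^sub>R u) v = t * ?f u v" "?f u (t *\<^sub>R v) = t * ?f u v"
      unfolding ab(3,4) bracket_scale[symmetric] orbit_form_eq[OF x t(1) ab(2)] orbit_form_eq[OF x ab(1) t(2)]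
        orbit_form_eq[OF x ab(1,2)]
      by (simp_all add: bracket_scale matrix_mult_simps trace_scale)
  qed
  obtain F where F: "finite F" "span F = ?T"
    using basis_exists[of ?T] span_subspace[OF _ _ sT] finiteI_independent by metis
  obtain d w where w: "inj_on w {..<2 * d}" "independent (w ` {..<2 * d})" "span (w ` {..<2 * d}) = ?T"
    "\<And>i j. i < 2 * d \<Longrightarrow> j < 2 * d \<Longrightarrow> ?f (w i) (w j) = std_symp i j"
  proof (rule symplectic_basis[OF bil sT F(1)])
    show "?T \<subseteq> span F" using F by simp
    show "?f u v = - ?f v u" if uv: "u \<in> ?T" "v \<in> ?T" for u v
    proof -
      obtain a b where ab: "a \<in> so_algebra B" "b \<in> so_algebra B" "u = bracket a x" "v = bracket b x"
        using uv unfolding T by blast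
      have "bracket a b = - bracket b a" by (simp add: bracket_def)
      then show ?thesis
        unfolding ab(3,4) orbit_form_eq[OF x ab(1,2)] orbit_form_eq[OF x ab(2,1)]
        by (simp add: matrix_mult_simps trace_def sum_negf)
    qed
    show "u = 0" if u: "u \<in> ?T" "\<And>v. v \<in> ?T \<Longrightarrow> ?f u v = 0" for u
    proof -
      obtain a where a: "a \<in> so_algebra B" "u = bracket a x" using u(1) unfolding T by blast
      show "u = 0"
      proof (rule trace_form_nondeg)
        show "u \<in> so_algebra B" using a x bracket_so by simp
        fix c assume c: "c \<in> so_algebra B"
        have "(real CARD('n) - 2) * trace (x ** bracket a c) = 0"
          using u(2)[of "bracket c x"] c orbit_form_eq[OF x a(1) c] a(2) unfolding T by auto
        then have "trace (x ** bracket a c) = 0" using N by simp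
        then show "trace (u ** c) = 0" using trace_bracket(1)[of x a c] a(2) by simp
      qed
    qed
  qed (rule that)
  have "\<exists>a. a \<in> so_algebra B \<and> bracket a x = w i" if i: "i < 2 * d" for i
  proof -
    have "w i \<in> ?T" using span_base[of "w i" "w ` {..<2 * d}"] i unfolding w(3) by simp
    then show ?thesis unfolding T by auto
  qed
  then obtain e where e: "\<And>i. i < 2 * d \<Longrightarrow> e i \<in> so_algebra B" "\<And>i. i < 2 * d \<Longrightarrow> bracket (e i) x = w i" by metis
  have inj: "inj_on (\<lambda>i. bracket (e i) x) {..<2 * d}" using w(1) e(2) by (simp add: inj_on_def)
  have img: "(\<lambda>i. bracket (e i) x) ` {..<2 * d} = w ` {..<2 * d}" using e(2) by (intro image_cong) auto
  show thesis
  proof (rule that[OF e(1) inj])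
    show "(real CARD('n) - 2) * trace (x ** bracket (e i) (e j)) = std_symp i j" if "i < 2 * d" "j < 2 * d" for i j
      using w(4)[OF that] orbit_form_eq[OF x e(1)[OF that(1)] e(1)[OF that(2)]] e(2) that by simp
  qed (use w img in auto)
qed

lemma velocity_so:
  assumes A: "A \<in> cayley_domain" "A \<in> so_algebra B" and E: "E \<in> so_algebra B"
  shows "velocity A E \<in> so_algebra B"
proof -
  have "adj (resolvent (- A)) = resolvent A"
    using adj_resolvent[OF A] adj_adj by metis
  then show ?thesis
    using E adj_resolvent[OF A]
    by (simp add: so_algebra_iff velocity_def linear_scale[OF linear_adj] adj_mult matrix_mult_simps matrix_mul_assoc)
qed

lemma orbit_map_so:
  assumes A: "A \<in> cayley_domain" "A \<in> so_algebra B" and x: "x \<in> so_algebra B"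
  shows "orbit_map x A \<in> so_algebra B"
proof -
  have c: "adj (cayley A) = cayley (- A)"
    using adj_resolvent[OF A] by (simp add: cayley_def linear_diff[OF linear_adj] linear_scale[OF linear_adj] adj_mat_1)
  then have "adj (cayley (- A)) = cayley A" using adj_adj by metis
  then show ?thesis using c x
    by (simp add: so_algebra_iff orbit_map_def adj_mult matrix_mult_simps matrix_mul_assoc)
qed

lemma conjugate_so:
  assumes A: "A \<in> cayley_domain" "A \<in> so_algebra B" and a: "a \<in> so_algebra B"
  shows "cayley (- A) ** a ** cayley A \<in> so_algebra B"
  using orbit_map_so[OF uminus_cayley_domain[OF A(1)] _ a] A(2) subspace_so
  by (simp add: orbit_map_def subspace_neg)

text \<open>Conjugation by \<open>cayley A\<close> maps the tangent space at \<open>x\<close> onto a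
  space containing the one at the image point. The bound complements the independent tangent vectors
  that the chart supplies.\<close>

lemma dim_tangent_space_le:
  assumes A: "A \<in> cayley_domain" "A \<in> so_algebra B"
  shows "dim (tangent_space B (orbit_map x A)) \<le> dim (tangent_space B x)"
proof -
  have "linear (\<lambda>u. cayley A ** u ** cayley (- A))"
    by (rule linearI) (simp_all add: matrix_mult_simps)
  moreover have "tangent_space B (orbit_map x A) \<subseteq> (\<lambda>u. cayley A ** u ** cayley (- A)) ` tangent_space B x"
  proof
    fix u assume "u \<in> tangent_space B (orbit_map x A)"
    then obtain a where a: "a \<in> so_algebra B" "u = bracket a (orbit_map x A)" by (auto simp: tangent_space_def)
    let ?a = "cayley (- A) ** a ** cayley A"
    have "cayley A ** bracket ?a x ** cayley (- A) =
        (cayley A ** cayley (- A)) ** a ** cayley A ** x ** cayley (- A) - cayley A ** x ** cayley (- A) ** a ** (cayley A ** cayley (- A))"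
      by (simp only: bracket_def matrix_mult_simps matrix_mul_assoc)
    also have "\<dots> = u" by (simp add: cayley_inverse[OF A(1)] a(2) bracket_def orbit_map_def matrix_mul_assoc)
    finally show "u \<in> (\<lambda>u. cayley A ** u ** cayley (- A)) ` tangent_space B x"
      using conjugate_so[OF A a(1)] by (auto simp: tangent_space_def intro!: image_eqI[of _ _ "bracket ?a x"])
  qed
  ultimately show ?thesis by (meson dim_image_le dim_subset order_trans)
qed

end

context gram_form
begin

text \<open>A relation between the tangent vectors is one between the rows and between the columns
  of the Gram matrix, so \<open>wedge_power_degenerate\<close> would make the power vanish. Thus a
  nonzero density also makes the chart regular.\<close>

lemma orbit_gram_nonsingular:
  assumes nz: "wedge_power d (\<lambda>i j. (real CARD('n) - 2) * trace (y ** bracket (a i) (a j))) id \<noteq> 0"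
  shows "inj_on (\<lambda>i. bracket (a i) y) {..<2 * d}" "independent ((\<lambda>i. bracket (a i) y) ` {..<2 * d})"
proof -
  have indep: "k i = 0" if k: "(\<Sum>i<2 * d. k i *\<^sub>R bracket (a i) y) = 0" and i: "i < 2 * d" for k i
  proof (rule ccontr)
    assume "k i \<noteq> 0"
    define s where "s = (\<Sum>i<2 * d. k i *\<^sub>R a i)"
    have lin: "(\<Sum>i<2 * d. k i * trace (bracket (a i) y ** c)) = 0" for c
    proof -
      have "linear (\<lambda>u. trace (u ** c))" by (rule linearI) (simp_all add: matrix_mult_simps trace_add trace_scale)
      from linear_sum[OF this, of "\<lambda>i. k i *\<^sub>R bracket (a i) y" "{..<2 * d}"]
      have "trace ((\<Sum>i<2 * d. k i *\<^sub>R bracket (a i) y) ** c) = (\<Sum>i<2 * d. k i * trace (bracket (a i) y ** c))"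
        by (simp add: matrix_mult_simps trace_scale)
      then show ?thesis unfolding k by (simp add: matrix_mult_simps trace_def)
    qed
    have "wedge_power d (\<lambda>i j. (real CARD('n) - 2) * trace (y ** bracket (a i) (a j))) id = 0"
    proof (rule wedge_power_degenerate[of i d k])
      fix j
      have "(\<Sum>i<2 * d. k i * ((real CARD('n) - 2) * trace (y ** bracket (a i) (a j)))) =
          - (real CARD('n) - 2) * (\<Sum>i<2 * d. k i * trace (bracket (a i) y ** a j))"
        unfolding trace_bracket(1) sum_distrib_left by (intro sum.cong refl) (simp add: algebra_simps)
      then show "(\<Sum>i<2 * d. k i * ((real CARD('n) - 2) * trace (y ** bracket (a i) (a j)))) = 0"
        unfolding lin by simp
      have "(\<Sum>i<2 * d. k i * ((real CARD('n) - 2) * trace (y ** bracket (a j) (a i)))) =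
          (real CARD('n) - 2) * (\<Sum>i<2 * d. k i * trace (bracket (a i) y ** a j))"
        unfolding trace_bracket(2) sum_distrib_left by (intro sum.cong refl) simp
      then show "(\<Sum>i<2 * d. k i * ((real CARD('n) - 2) * trace (y ** bracket (a j) (a i)))) = 0"
        unfolding lin by simp
    qed (use i \<open>k i \<noteq> 0\<close> in auto)
    then show False using nz by contradiction
  qed
  show inj: "inj_on (\<lambda>i. bracket (a i) y) {..<2 * d}"
  proof (rule inj_onI, rule ccontr)
    fix i j assume ij: "i \<in> {..<2 * d}" "j \<in> {..<2 * d}" "bracket (a i) y = bracket (a j) y" "i \<noteq> j"
    have "(\<Sum>l<2 * d. ((if l = i then 1 else 0) - (if l = j then 1 else 0)) *\<^sub>R bracket (a l) y) = 0"
      using ij by (simp add: scaleR_left_diff_distrib sum_subtractf if_distrib[of "\<lambda>t. t *\<^sub>R _"] cong: if_cong)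
    from indep[OF this, of i] show False using ij by simp
  qed
  show "independent ((\<lambda>i. bracket (a i) y) ` {..<2 * d})"
  proof (rule independent_if_scalars_zero)
    fix f u assume f: "(\<Sum>u\<in>(\<lambda>i. bracket (a i) y) ` {..<2 * d}. f u *\<^sub>R u) = 0" and u: "u \<in> (\<lambda>i. bracket (a i) y) ` {..<2 * d}"
    obtain i where i: "i < 2 * d" "u = bracket (a i) y" using u by auto
    have "(\<Sum>i<2 * d. f (bracket (a i) y) *\<^sub>R bracket (a i) y) = 0" using f by (simp add: sum.reindex[OF inj])
    from indep[OF this i(1)] show "f u = 0" using i by simp
  qed simp
qed

lemma continuous_on_velocity:
  fixes E :: "real^'n^'n"
  shows "continuous_on cayley_domain (\<lambda>A. velocity A E)"
proof -
  have "continuous_on cayley_domain (\<lambda>A :: real^'n^'n. resolvent (- A))"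
    by (rule continuous_on_compose2[OF continuous_on_resolvent])
      (auto intro!: continuous_intros uminus_cayley_domain)
  then show ?thesis unfolding velocity_def[abs_def]
    by (intro continuous_intros bounded_bilinear.continuous_on[OF bounded_bilinear_matrix_mult] continuous_on_resolvent)
qed

lemma continuous_on_orbit_map:
  fixes x :: "real^'n^'n"
  shows "continuous_on cayley_domain (orbit_map x)"
proof -
  have "continuous_on cayley_domain (\<lambda>A :: real^'n^'n. cayley (- A))"
    by (rule continuous_on_compose2[OF continuous_on_cayley])
      (auto intro!: continuous_intros uminus_cayley_domain)
  then show ?thesis unfolding orbit_map_def[abs_def]
    by (intro continuous_intros bounded_bilinear.continuous_on[OF bounded_bilinear_matrix_mult] continuous_on_cayley)
qed

lemma continuous_on_bracket:
  "continuous_on S f \<Longrightarrow> continuous_on S g \<Longrightarrow> continuous_on S (\<lambda>A. bracket (f A) (g A :: real^'n^'n))"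
  unfolding bracket_def
  by (intro continuous_intros bounded_bilinear.continuous_on[OF bounded_bilinear_matrix_mult])

text \<open>The map corrected by \<open>A - pr A\<close> has derivative the identity at the origin, so it is
  locally injective, and on the range of \<open>pr\<close> it is a function of \<open>orbit_map x\<close>.\<close>

lemma orbit_map_locally_injective:
  fixes x :: "real^'n^'n" and L :: "real^'n^'n \<Rightarrow> real^'n^'n"
  assumes L: "linear L" and pr: "pr = (\<lambda>E. L (bracket (2 *\<^sub>R E) x))"
  obtains r where "r > 0" "inj_on (orbit_map x) (ball 0 r \<inter> {A. pr A = A})"
proof -
  have linpr: "linear pr" unfolding pr
    by (rule linear_compose[of "\<lambda>E. bracket (2 *\<^sub>R E) x" L, unfolded comp_def])
      (auto intro!: linearI L simp: bracket_scale bracket_add scaleR_add_right)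
  define h where "h A = L (orbit_map x A) + (A - pr A)" for A
  define h' where "h' A E = L (bracket (velocity A E) (orbit_map x A)) + (E - pr E)" for A E
  have blL: "bounded_linear L" and blpr: "bounded_linear pr" using L linpr by (simp_all add: linear_conv_bounded_linear)
  have linv: "linear (velocity A)" for A :: "real^'n^'n"
    by (rule linearI) (simp_all add: velocity_def matrix_mult_simps scaleR_add_right)
  have lin': "linear (\<lambda>v. h' A v - h' 0 v)" for A
    unfolding h'_def
    by (rule linearI) (simp_all add: linear_add[OF linv] linear_scale[OF linv] bracket_add bracket_scale
        linear_add[OF L] linear_scale[OF L] algebra_simps)
  \<comment> \<open>At the origin \<open>velocity 0 E\<close> is \<open>2 *\<^sub>R E\<close>, so
    the first term is \<open>pr E\<close> and cancels.\<close>
  have at0: "h' 0 E = E" for E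
    by (simp add: h'_def velocity_def resolvent_0 orbit_map_def cayley_0 pr)
  obtain r where r: "r > 0" "ball 0 r \<subseteq> (cayley_domain :: (real^'n^'n) set)" "inj_on h (ball 0 r)"
  proof (rule has_derivative_locally_injective[of 0 cayley_domain id h' h])
    show "id \<circ> h' 0 = id" by (simp add: fun_eq_iff at0)
    show "(h has_derivative h' A) (at A)" if "A \<in> cayley_domain" for A
      unfolding h_def[abs_def] h'_def
      by (intro has_derivative_add has_derivative_diff has_derivative_ident
          bounded_linear.has_derivative[OF blL has_derivative_orbit_map[OF that]]
          bounded_linear.has_derivative[OF blpr])
    show "\<exists>d>0. \<forall>A. dist 0 A < d \<longrightarrow> onorm (\<lambda>v. h' A v - h' 0 v) < \<epsilon>" if e: "\<epsilon> > 0" for \<epsilon>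
    proof -
    have "continuous_on cayley_domain (\<lambda>A. \<Sum>b\<in>Basis. norm (h' A b - h' 0 b))"
      unfolding h'_def
      by (intro continuous_intros bounded_linear.continuous_on[OF blL] continuous_on_bracket
          continuous_on_velocity continuous_on_orbit_map)
    then have "continuous (at 0) (\<lambda>A. \<Sum>b\<in>Basis. norm (h' A b - h' 0 b))"
      using open_cayley_domain zero_cayley_domain continuous_on_eq_continuous_at by blast
    then obtain d where d: "d > 0" "\<And>A. dist A 0 < d \<Longrightarrow>
        dist (\<Sum>b\<in>Basis. norm (h' A b - h' 0 b)) (\<Sum>b\<in>Basis. norm (h' 0 b - h' 0 b)) < \<epsilon>"
      using e unfolding continuous_at_eps_delta by meson
    show ?thesis
    proof (intro exI conjI allI impI)
      fix A :: "real^'n^'n" assume "dist 0 A < d"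
      then have "dist (\<Sum>b\<in>Basis. norm (h' A b - h' 0 b)) (\<Sum>b\<in>Basis. norm (h' 0 b - h' 0 b)) < \<epsilon>"
        using d(2)[of A] by (simp only: dist_commute)
      then have "(\<Sum>b\<in>Basis. norm (h' A b - h' 0 b)) < \<epsilon>" by (simp add: dist_real_def)
      then show "onorm (\<lambda>v. h' A v - h' 0 v) < \<epsilon>" using onorm_le_sum_Basis[OF lin'] by (rule le_less_trans[rotated])
    qed (rule d(1))
    qed
    show "bounded_linear (id :: real^'n^'n \<Rightarrow> _)" unfolding id_def by (rule bounded_linear_ident)
    fix r assume "r > 0" "ball 0 r \<subseteq> (cayley_domain :: (real^'n^'n) set)" "inj_on h (ball 0 r)"
    then show thesis by (rule that)
  qed (rule zero_cayley_domain open_cayley_domain)+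
  have "inj_on (orbit_map x) (ball 0 r \<inter> {A. pr A = A})"
    using r(3) by (auto simp: inj_on_def h_def)
  then show thesis using that r(1) by blast
qed

end

section \<open>Divergence of the partition function\<close>

lemma wedge_power_scale: "wedge_power d (\<lambda>a b. t * \<Omega> a b) v = t ^ d * wedge_power d \<Omega> v"
  by (simp add: wedge_power_def prod.distrib sum_distrib_left mult.left_commute)

lemma continuous_on_wedge_power:
  assumes "\<And>i j. continuous_on S (\<lambda>A. \<Omega> A i j)"
  shows "continuous_on S (\<lambda>A. wedge_power d (\<Omega> A) id)"
  unfolding wedge_power_def by (intro continuous_intros assms) simp_all

context gram_form
begin

lemma continuous_on_gram:
  fixes x :: "real^'n^'n"
  shows "continuous_on cayley_domain
    (\<lambda>A. wedge_power d (\<lambda>i j. (real CARD('n) - 2) * trace (orbit_map x A ** bracket (velocity A (f i)) (velocity A (f j)))) id)"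
proof (rule continuous_on_wedge_power)
  fix i j
  have "continuous_on cayley_domain (\<lambda>A. orbit_map x A ** bracket (velocity A (f i)) (velocity A (f j)))"
    by (intro bounded_bilinear.continuous_on[OF bounded_bilinear_matrix_mult] continuous_on_orbit_map
        continuous_on_bracket continuous_on_velocity)
  then show "continuous_on cayley_domain
      (\<lambda>A. (real CARD('n) - 2) * trace (orbit_map x A ** bracket (velocity A (f i)) (velocity A (f j))))"
    unfolding trace_def by (intro continuous_intros)
qed

text \<open>A hypothetical finite value \<open>z\<close> is exceeded by the mass of one scaled
  patch. The nonzero tangent space gives \<open>d \<ge> 1\<close>, without which the mass would not
  grow.\<close>

theorem no_gibbs_state:
  assumes x: "x \<in> so_algebra B" and N: "CARD('n) > 2" and nz: "tangent_space B x \<noteq> {0}"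
    and scal: "\<And>t y. t \<noteq> 0 \<Longrightarrow> y \<in> adjoint_orbit B x \<Longrightarrow> t *\<^sub>R y \<in> adjoint_orbit B x"
  shows "\<not> admits_gibbs_state B (adjoint_orbit B x)"
proof
  assume "admits_gibbs_state B (adjoint_orbit B x)"
  then obtain \<mu> \<beta> where \<mu>: "liouville_measure B (adjoint_orbit B x) \<mu>" and \<beta>: "linear \<beta>"
    and fin: "partition_function \<mu> \<beta> < \<infinity>" unfolding admits_gibbs_state_def by blast
  let ?Q = "adjoint_orbit B x"
  obtain d e where e: "\<And>i. i < 2 * d \<Longrightarrow> e i \<in> so_algebra B"
    "inj_on (\<lambda>i. bracket (e i) x) {..<2 * d}" "independent ((\<lambda>i. bracket (e i) x) ` {..<2 * d})"
    "span ((\<lambda>i. bracket (e i) x) ` {..<2 * d}) = tangent_space B x"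
    "\<And>i j. i < 2 * d \<Longrightarrow> j < 2 * d \<Longrightarrow> (real CARD('n) - 2) * trace (x ** bracket (e i) (e j)) = std_symp i j"
    using tangent_symplectic_basis[OF x N] by metis
  define m where "m = 2 * d"
  have d: "d \<ge> 1" using e(4) nz by (cases d) auto
  have dimT: "dim (tangent_space B x) = m"
    using dim_span_eq_card_independent[OF e(3)] card_image[OF e(2)] unfolding e(4) m_def by simp
  \<comment> \<open>The factor 1/2 cancels the 2 in \<open>velocity\<close>, so that
    \<open>velocity 0 (f i) = e i\<close>.\<close>
  define f where "f i = (1/2) *\<^sub>R e i" for i
  have f: "f i \<in> so_algebra B" if "i < m" for i
    unfolding f_def using e(1)[of i] that subspace_so by (auto simp: m_def intro: subspace_scale)
  have vel0: "velocity 0 (f i) = e i" for i by (simp add: velocity_def resolvent_0 f_def)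
  have orb0: "orbit_map x 0 = x" by (simp add: orbit_map_def cayley_0)
  \<comment> \<open>\<open>L\<close> sends the tangent vectors of the symplectic basis back to the
    \<open>f i\<close>. Hence \<open>pr\<close> fixes every \<open>Af u\<close>, and local
    injectivity applies to these points.\<close>
  have "\<exists>L. linear L \<and> (\<forall>u\<in>(\<lambda>i. bracket (e i) x) ` {..<m}. L u = f (inv_into {..<m} (\<lambda>i. bracket (e i) x) u))"
    using linear_independent_extend[OF e(3)] unfolding m_def .
  then obtain L where L: "linear L" "\<And>i. i < m \<Longrightarrow> L (bracket (e i) x) = f i"
    using inv_into_f_f[OF e(2)] unfolding m_def by auto
  define pr where "pr = (\<lambda>E. L (bracket (2 *\<^sub>R E) x))"
  have linpr: "linear pr" unfolding pr_def
    by (rule linear_compose[of "\<lambda>E. bracket (2 *\<^sub>R E) x" L, unfolded comp_def])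
      (auto intro!: linearI L(1) simp: bracket_scale bracket_add scaleR_add_right)
  have pr_f: "pr (f i) = f i" if "i < m" for i using L(2)[OF that] by (simp add: pr_def f_def)
  define Af where "Af u = (\<Sum>i<m. u i *\<^sub>R f i)" for u :: "nat \<Rightarrow> real"
  have prA: "pr (Af u) = Af u" for u
    by (simp add: Af_def linear_sum[OF linpr] linear_scale[OF linpr] pr_f)
  have Aso: "Af u \<in> so_algebra B" for u
    unfolding Af_def using f subspace_so by (intro subspace_sum subspace_scale) auto
  obtain r where r: "r > 0" "inj_on (orbit_map x) (ball 0 r \<inter> {A. pr A = A})"
    using orbit_map_locally_injective[OF L(1) pr_def] by blast
  define Pf where "Pf A = wedge_power d (\<lambda>i j. (real CARD('n) - 2) * trace (orbit_map x A ** bracket (velocity A (f i)) (velocity A (f j)))) id" for A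
  have Pf0: "Pf 0 > 0"
  proof -
    have "Pf 0 = wedge_power d std_symp id"
      unfolding Pf_def orb0 vel0 using e(5) by (rule wedge_power_cong)
    then show ?thesis using wedge_power_std_symp by simp
  qed
  \<comment> \<open>By continuity, half the value at the origin bounds the density from below on a
    small ball.\<close>
  define C where "C = Pf 0 / 2"
  have "\<exists>\<rho>>0. \<rho> \<le> r \<and> ball 0 \<rho> \<subseteq> (cayley_domain :: (real^'n^'n) set) \<and> (\<forall>A\<in>ball 0 \<rho>. Pf A > C)"
  proof -
    have "continuous_on cayley_domain Pf" unfolding Pf_def[abs_def] by (rule continuous_on_gram)
    then have "open (cayley_domain \<inter> Pf -` {C<..})"
      using open_cayley_domain by (intro continuous_open_preimage) auto
    moreover have "0 \<in> cayley_domain \<inter> Pf -` {C<..}" using Pf0 zero_cayley_domain by (simp add: C_def)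
    ultimately obtain s where s: "s > 0" "ball 0 s \<subseteq> cayley_domain \<inter> Pf -` {C<..}"
      using open_contains_ball by blast
    have "ball 0 (min s r) \<subseteq> ball (0 :: real^'n^'n) s" by (rule subset_ball) simp
    then show ?thesis using s r(1) by (intro exI[of _ "min s r"]) auto
  qed
  then obtain \<rho> where \<rho>: "\<rho> > 0" "\<rho> \<le> r" "ball 0 \<rho> \<subseteq> (cayley_domain :: (real^'n^'n) set)"
    "\<And>A. A \<in> ball 0 \<rho> \<Longrightarrow> Pf A > C" by blast
  have C: "C > 0" using Pf0 by (simp add: C_def)
  let ?X = "product_topology (\<lambda>_. euclideanreal) {..<m}"
  define U where "U = {u \<in> topspace ?X. Af u \<in> ball 0 \<rho>}"
  have UA: "Af u \<in> ball 0 \<rho>" "Af u \<in> cayley_domain" "u \<in> {..<m} \<rightarrow>\<^sub>E UNIV" if "u \<in> U" for u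
    using that \<rho>(3) by (auto simp: U_def)
  have contA: "continuous_map ?X euclidean Af"
    unfolding Af_def
  proof (intro continuous_map_sum)
    fix i assume i: "i \<in> {..<m}"
    have "continuous_map euclideanreal euclidean (\<lambda>t. t *\<^sub>R f i)" by (auto intro!: continuous_intros)
    from continuous_map_compose[OF continuous_map_product_projection[OF i] this]
    show "continuous_map ?X euclidean (\<lambda>u. u i *\<^sub>R f i)" by (simp add: comp_def)
  qed simp
  have openU: "openin ?X U"
    unfolding U_def by (rule openin_continuous_map_preimage[OF contA]) simp
  define D where "D i u = bracket (velocity (Af u) (f i)) (orbit_map x (Af u))" for i u
  have velso: "velocity (Af u) (f i) \<in> so_algebra B" if "u \<in> U" "i < m" for u i
    using UA[OF that(1)] Aso f[OF that(2)] by (intro velocity_so)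
  have orbso: "orbit_map x (Af u) \<in> so_algebra B" if "u \<in> U" for u
    using UA[OF that] Aso x by (intro orbit_map_so)
  have orbQ: "orbit_map x (Af u) \<in> ?Q" if "u \<in> U" for u
    unfolding mem_adjoint_orbit_iff
  proof (rule bexI[of _ "cayley (Af u)"])
    show "cayley (Af u) \<in> SO_plus B" using \<rho>(3) UA(1)[OF that] Aso by (rule cayley_SO_plus)
    show "cayley (Af u) ** x = orbit_map x (Af u) ** cayley (Af u)"
      by (simp add: orbit_map_def cayley_inverse[OF UA(2)[OF that]] flip: matrix_mul_assoc)
  qed
  have Pfnz: "Pf (Af u) \<noteq> 0" if "u \<in> U" for u using \<rho>(4)[OF UA(1)[OF that]] C by simp
  have indepD: "inj_on (\<lambda>i. D i u) {..<m}" "independent ((\<lambda>i. D i u) ` {..<m})" if "u \<in> U" for u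
    unfolding D_def m_def using orbit_gram_nonsingular[of d "orbit_map x (Af u)" "\<lambda>i. velocity (Af u) (f i)"] Pfnz[OF that]
    by (simp_all only: Pf_def not_False_eq_True)
  have tangent_scale: "tangent_space B (t *\<^sub>R y) = tangent_space B y" if "t \<noteq> 0" for t y
  proof -
    have "bracket a (t *\<^sub>R y) = bracket (t *\<^sub>R a) y" for a by (simp add: bracket_scale)
    moreover have "bracket a y = bracket ((1/t) *\<^sub>R a) (t *\<^sub>R y)" for a using that by (simp add: bracket_scale)
    ultimately show ?thesis
      unfolding tangent_space_def using subspace_scale[OF subspace_so] by blast
  qed
  \<comment> \<open>One domain \<open>U\<close> serves every \<open>t\<close>: scaling preserves the
    orbit by \<open>scal\<close> and the tangent spaces by \<open>tangent_scale\<close>.\<close>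
  have chart: "orbit_chart B ?Q m U (\<lambda>u. t *\<^sub>R orbit_map x (Af u)) (\<lambda>i u. t *\<^sub>R D i u)" if t: "t \<noteq> 0" for t
    unfolding orbit_chart_def
  proof (intro conjI ballI allI impI)
    show "openin ?X U" by (rule openU)
    show "inj_on (\<lambda>u. t *\<^sub>R orbit_map x (Af u)) U"
    proof (rule inj_onI)
      fix u w assume u: "u \<in> U" and w: "w \<in> U" and eq: "t *\<^sub>R orbit_map x (Af u) = t *\<^sub>R orbit_map x (Af w)"
      have "Af u \<in> ball 0 r \<inter> {A. pr A = A}" "Af w \<in> ball 0 r \<inter> {A. pr A = A}"
        using UA(1)[OF u] UA(1)[OF w] \<rho>(2) prA by auto
      then have AA: "Af u = Af w" using inj_onD[OF r(2), of "Af u" "Af w"] eq t by simp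
      have "u i = w i" if i: "i < m" for i
      proof -
        have "(\<Sum>i<m. (u i - w i) *\<^sub>R f i) = 0" using AA by (simp add: Af_def scaleR_left_diff_distrib sum_subtractf)
        then have "bracket (2 *\<^sub>R (\<Sum>i<m. (u i - w i) *\<^sub>R f i)) x = 0" by (simp add: bracket_def matrix_mult_simps)
        moreover have "bracket (2 *\<^sub>R (\<Sum>i<m. (u i - w i) *\<^sub>R f i)) x = (\<Sum>i<m. (u i - w i) *\<^sub>R bracket (e i) x)"
          by (simp add: linear_sum[OF linear_bracket] bracket_scale scaleR_sum_right f_def diff_divide_distrib)
        ultimately show ?thesis
          using independent_family_scalars[of "{..<m}" "\<lambda>i. bracket (e i) x" "\<lambda>i. u i - w i" i] e(2,3) i by (simp add: m_def)
      qed
      then show "u = w" using UA(3)[OF u] UA(3)[OF w] by (intro PiE_ext) auto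
    qed
    show "(\<lambda>u. t *\<^sub>R orbit_map x (Af u)) ` U \<subseteq> ?Q" using orbQ scal[OF t] by auto
    show "continuous_map (subtopology ?X U) euclidean (\<lambda>u. t *\<^sub>R D i u)" for i
    proof -
      have "continuous_map (subtopology ?X U) (top_of_set (ball 0 \<rho>)) Af"
        using contA by (intro continuous_map_into_subtopology continuous_map_from_subtopology) (auto simp: U_def)
      moreover have "continuous_on (ball 0 \<rho>) (\<lambda>A. t *\<^sub>R bracket (velocity A (f i)) (orbit_map x A))"
        by (rule continuous_on_subset[OF _ \<rho>(3)])
          (intro continuous_intros continuous_on_bracket continuous_on_velocity continuous_on_orbit_map)
      then have "continuous_map (top_of_set (ball 0 \<rho>)) euclidean (\<lambda>A. t *\<^sub>R bracket (velocity A (f i)) (orbit_map x A))"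
        by simp
      ultimately have "continuous_map (subtopology ?X U) euclidean
          ((\<lambda>A. t *\<^sub>R bracket (velocity A (f i)) (orbit_map x A)) \<circ> Af)"
        by (rule continuous_map_compose)
      then show ?thesis by (simp add: comp_def D_def)
    qed
  next
    fix u i assume u: "u \<in> U" and i: "i < m"
    have upd: "Af (u(i := s)) = Af u + (s - u i) *\<^sub>R f i" for s
    proof -
      have "Af (u(i := s)) = (\<Sum>k<m. u k *\<^sub>R f k + (if k = i then (s - u i) *\<^sub>R f i else 0))"
        unfolding Af_def by (rule sum.cong) (auto simp: scaleR_left_diff_distrib)
      then show ?thesis using i by (simp add: sum.distrib Af_def)
    qed
    have "((\<lambda>s. Af u + (s - u i) *\<^sub>R f i) has_derivative (\<lambda>s. s *\<^sub>R f i)) (at (u i))"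
      by (auto intro!: derivative_eq_intros)
    moreover have "(orbit_map x has_derivative (\<lambda>E. bracket (velocity (Af u) E) (orbit_map x (Af u))))
        (at (Af u + (u i - u i) *\<^sub>R f i))"
      using has_derivative_orbit_map[OF UA(2)[OF u]] by simp
    ultimately have "((\<lambda>s. orbit_map x (Af u + (s - u i) *\<^sub>R f i)) has_derivative
        (\<lambda>s. bracket (velocity (Af u) (s *\<^sub>R f i)) (orbit_map x (Af u)))) (at (u i))"
      by (rule has_derivative_compose)
    moreover have "bracket (velocity (Af u) (s *\<^sub>R f i)) (orbit_map x (Af u)) = s *\<^sub>R D i u" for s
      by (simp add: D_def velocity_def matrix_mult_simps bracket_scale)
    ultimately have "((\<lambda>s. orbit_map x (Af (u(i := s)))) has_vector_derivative D i u) (at (u i))"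
      by (simp add: has_vector_derivative_def upd)
    then show "((\<lambda>s. t *\<^sub>R orbit_map x (Af (u(i := s)))) has_vector_derivative t *\<^sub>R D i u) (at (u i))"
      by (rule bounded_linear.has_vector_derivative[OF bounded_linear_scaleR_right])
  next
    fix u assume u: "u \<in> U"
    show inj: "inj_on (\<lambda>i. t *\<^sub>R D i u) {..<m}" using indepD(1)[OF u] t by (simp add: inj_on_def)
    have im: "(\<lambda>i. t *\<^sub>R D i u) ` {..<m} = (\<lambda>z. t *\<^sub>R z) ` ((\<lambda>i. D i u) ` {..<m})" by (simp add: image_image)
    show ind: "independent ((\<lambda>i. t *\<^sub>R D i u) ` {..<m})"
      unfolding im using indepD(2)[OF u] t
      by (intro linear_independent_injective_image linear_scale_self) (auto simp: inj_on_def)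
    let ?T = "tangent_space B (orbit_map x (Af u))"
    have sT: "subspace ?T"
    proof -
      have "?T = (\<lambda>a. bracket a (orbit_map x (Af u))) ` so_algebra B" by (auto simp: tangent_space_def)
      then show ?thesis using linear_subspace_image[OF linear_bracket subspace_so] by simp
    qed
    have sub: "(\<lambda>i. t *\<^sub>R D i u) ` {..<m} \<subseteq> ?T"
    proof
      fix z assume "z \<in> (\<lambda>i. t *\<^sub>R D i u) ` {..<m}"
      then obtain i where i: "i < m" "z = t *\<^sub>R D i u" by auto
      have "D i u \<in> ?T" using velso[OF u i(1)] by (auto simp: D_def tangent_space_def)
      then show "z \<in> ?T" using i(2) sT by (simp add: subspace_scale)
    qed
    have "dim ?T \<le> card ((\<lambda>i. t *\<^sub>R D i u) ` {..<m})"
      using dim_tangent_space_le[OF UA(2)[OF u] Aso, of x] dimT card_image[OF inj] by simp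
    then have "?T \<subseteq> span ((\<lambda>i. t *\<^sub>R D i u) ` {..<m})" by (rule card_ge_dim_independent[OF sub ind])
    moreover have "span ((\<lambda>i. t *\<^sub>R D i u) ` {..<m}) \<subseteq> ?T" using sub sT by (rule span_minimal)
    ultimately show "span ((\<lambda>i. t *\<^sub>R D i u) ` {..<m}) = tangent_space B (t *\<^sub>R orbit_map x (Af u))"
      using tangent_scale[OF t] by simp
  qed
  \<comment> \<open>The scaled tangent vector is the bracket of the same Lie algebra element with
    the scaled base point. So each value of the form gains one factor \<open>t\<close>, and the
    power gains \<open>d\<close> of them.\<close>
  have density: "\<bar>wedge_power (m div 2) (orbit_form B (t *\<^sub>R orbit_map x (Af u))) (\<lambda>i. t *\<^sub>R D i u)\<bar> = \<bar>t\<bar> ^ d * \<bar>Pf (Af u)\<bar>"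
    if u: "u \<in> U" for t u
  proof -
    let ?y = "orbit_map x (Af u)"
    have ty: "t *\<^sub>R ?y \<in> so_algebra B" using orbso[OF u] subspace_so by (rule subspace_scale[rotated])
    have "wedge_power (m div 2) (orbit_form B (t *\<^sub>R ?y)) (\<lambda>i. t *\<^sub>R D i u) =
        wedge_power d (\<lambda>i j. orbit_form B (t *\<^sub>R ?y) (t *\<^sub>R D i u) (t *\<^sub>R D j u)) id"
      by (subst wedge_power_gram) (simp add: m_def)
    also have "\<dots> = wedge_power d (\<lambda>i j. t * ((real CARD('n) - 2) * trace (?y ** bracket (velocity (Af u) (f i)) (velocity (Af u) (f j))))) id"
    proof (rule wedge_power_cong)
      fix i j assume ij: "i < 2 * d" "j < 2 * d"
      have "orbit_form B (t *\<^sub>R ?y) (t *\<^sub>R D i u) (t *\<^sub>R D j u) =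
          (real CARD('n) - 2) * trace ((t *\<^sub>R ?y) ** bracket (velocity (Af u) (f i)) (velocity (Af u) (f j)))"
        using orbit_form_eq[OF ty velso[OF u] velso[OF u], of i j] ij by (simp add: D_def bracket_scale m_def)
      then show "orbit_form B (t *\<^sub>R ?y) (t *\<^sub>R D i u) (t *\<^sub>R D j u) =
          t * ((real CARD('n) - 2) * trace (?y ** bracket (velocity (Af u) (f i)) (velocity (Af u) (f j))))"
        by (simp add: matrix_mult_simps trace_scale)
    qed
    also have "\<dots> = t ^ d * Pf (Af u)" unfolding wedge_power_scale Pf_def ..
    finally show ?thesis by (simp add: abs_mult power_abs)
  qed
  let ?g = "\<lambda>A. \<beta> (orbit_map x A)"
  have contg: "continuous_on (ball 0 \<rho>) ?g"
    by (rule continuous_on_subset[OF _ \<rho>(3)])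
      (intro linear_continuous_on_compose[OF _ \<beta>] continuous_on_orbit_map)
  \<comment> \<open>If \<open>\<beta>\<close> vanishes on the whole patch, the neighbourhood of the
    origin with sign 1 will do; otherwise continuity fixes the sign of \<open>\<beta>\<close> near
    some \<open>u0\<close>.\<close>
  have "\<exists>u0\<in>U. \<exists>\<eta>>0. \<exists>\<sigma>\<in>{1,-1::real}. \<forall>u\<in>{..<m} \<rightarrow>\<^sub>E UNIV. norm (Af u - Af u0) < \<eta> \<longrightarrow> u \<in> U \<and> \<sigma> * ?g (Af u) \<le> 0"
  proof (cases "\<exists>u0\<in>U. ?g (Af u0) \<noteq> 0")
    case True
    then obtain u0 where u0: "u0 \<in> U" "?g (Af u0) \<noteq> 0" by blast
    define \<sigma> :: real where "\<sigma> = (if ?g (Af u0) > 0 then -1 else 1)"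
    have "open (ball 0 \<rho> \<inter> (\<lambda>A. \<sigma> * ?g A) -` {..<0})"
      by (intro continuous_open_preimage continuous_intros contg) auto
    moreover have "Af u0 \<in> ball 0 \<rho> \<inter> (\<lambda>A. \<sigma> * ?g A) -` {..<0}" using UA(1)[OF u0(1)] u0(2) by (auto simp: \<sigma>_def)
    ultimately obtain \<eta> where \<eta>: "\<eta> > 0" "ball (Af u0) \<eta> \<subseteq> ball 0 \<rho> \<inter> (\<lambda>A. \<sigma> * ?g A) -` {..<0}"
      using open_contains_ball by blast
    have "u \<in> U \<and> \<sigma> * ?g (Af u) \<le> 0" if "u \<in> {..<m} \<rightarrow>\<^sub>E UNIV" "norm (Af u - Af u0) < \<eta>" for u
    proof -
      have "Af u \<in> ball (Af u0) \<eta>" using that(2) by (simp add: dist_norm norm_minus_commute)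
      then have "Af u \<in> ball 0 \<rho>" "\<sigma> * ?g (Af u) < 0" using \<eta>(2) by auto
      then show ?thesis using that(1) by (simp add: U_def)
    qed
    then show ?thesis using u0(1) \<eta>(1) by (intro bexI[of _ u0] exI[of _ \<eta>] conjI bexI[of _ \<sigma>]) (auto simp: \<sigma>_def)
  next
    case False
    define u0 :: "nat \<Rightarrow> real" where "u0 = (\<lambda>i\<in>{..<m}. 0)"
    have A0: "Af u0 = 0" by (simp add: Af_def u0_def)
    have "u0 \<in> U" using \<rho>(1) A0 by (simp add: U_def u0_def)
    moreover have "u \<in> U \<and> 1 * ?g (Af u) \<le> 0" if "u \<in> {..<m} \<rightarrow>\<^sub>E UNIV" "norm (Af u - Af u0) < \<rho>" for u
    proof -
      have "u \<in> U" using that by (simp add: U_def A0)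
      then show ?thesis using False by auto
    qed
    ultimately show ?thesis using \<rho>(1) by blast
  qed
  then obtain u0 \<eta> \<sigma> where u0: "u0 \<in> U" and \<eta>: "\<eta> > 0" and \<sigma>: "\<sigma> = 1 \<or> \<sigma> = (-1::real)"
    and near: "\<And>u. u \<in> {..<m} \<rightarrow>\<^sub>E UNIV \<Longrightarrow> norm (Af u - Af u0) < \<eta> \<Longrightarrow> u \<in> U \<and> \<sigma> * ?g (Af u) \<le> 0"
    by blast
  define S where "S = (\<Sum>i<m. norm (f i))"
  \<comment> \<open>A point of the box of half-width \<open>\<delta>\<close> around
    \<open>u0\<close> is displaced under \<open>Af\<close> by at most \<open>\<delta> * S\<close>,
    which is less than \<open>\<eta>\<close>.\<close>
  define \<delta> where "\<delta> = \<eta> / (2 * (1 + S))"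
  have S: "S \<ge> 0" by (simp add: S_def sum_nonneg)
  have \<delta>: "\<delta> > 0" using \<eta> S by (simp add: \<delta>_def)
  define K where "K = (\<Pi>\<^sub>E i\<in>{..<m}. {u0 i - \<delta>..u0 i + \<delta>})"
  have KU: "u \<in> U" "\<sigma> * ?g (Af u) \<le> 0" if u: "u \<in> K" for u
  proof -
    have "Af u - Af u0 = (\<Sum>i<m. (u i - u0 i) *\<^sub>R f i)" by (simp add: Af_def scaleR_left_diff_distrib sum_subtractf)
    then have "norm (Af u - Af u0) \<le> (\<Sum>i<m. \<bar>u i - u0 i\<bar> * norm (f i))" by (simp add: order_trans[OF norm_sum])
    also have "\<dots> \<le> (\<Sum>i<m. \<delta> * norm (f i))"
    proof (intro sum_mono mult_right_mono)
      fix i assume "i \<in> {..<m}"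
      then have "u i \<in> {u0 i - \<delta>..u0 i + \<delta>}" using u unfolding K_def by (rule PiE_mem[rotated])
      then show "\<bar>u i - u0 i\<bar> \<le> \<delta>" by auto
    qed simp
    also have "\<dots> = \<delta> * S" by (simp add: S_def sum_distrib_left)
    also have "\<dots> < \<eta>"
    proof -
      have "\<delta> * S < \<delta> * (2 * (1 + S))" using \<delta> S by (intro mult_strict_left_mono) auto
      also have "\<dots> = \<eta>" using S by (simp add: \<delta>_def)
      finally show ?thesis .
    qed
    finally have "norm (Af u - Af u0) < \<eta>" .
    moreover have "u \<in> {..<m} \<rightarrow>\<^sub>E UNIV" using u by (auto simp: K_def PiE_def)
    ultimately show "u \<in> U" "\<sigma> * ?g (Af u) \<le> 0" using near by blast+
  qed
  have compK: "compact (Af ` K)"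
  proof -
    have "compactin ?X K" unfolding K_def by (simp add: compactin_PiE)
    then have "compactin euclidean (Af ` K)" using contA by (rule image_compactin)
    then show ?thesis by simp
  qed
  let ?P = "Pi\<^sub>M {..<m} (\<lambda>_. lborel :: real measure)"
  interpret ps: product_sigma_finite "\<lambda>_::nat. lborel :: real measure"
    by (simp add: product_sigma_finite_def sigma_finite_lborel)
  have measK: "emeasure ?P K = ennreal ((2 * \<delta>) ^ m)"
  proof -
    have "emeasure ?P K = (\<Prod>i\<in>{..<m}. emeasure lborel {u0 i - \<delta>..u0 i + \<delta>})"
      unfolding K_def by (rule ps.emeasure_PiM) auto
    also have "\<dots> = (\<Prod>i\<in>{..<m}. ennreal (2 * \<delta>))" using \<delta> by (intro prod.cong) auto
    also have "\<dots> = ennreal ((2 * \<delta>) ^ m)" using \<delta> by (simp add: ennreal_power)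
    finally show ?thesis .
  qed
  have setsK: "K \<in> sets ?P" unfolding K_def by (intro sets_PiM_I_finite) auto
  have lower: "ennreal (s ^ d * C * (2 * \<delta>) ^ m) \<le> partition_function \<mu> \<beta>" if s: "s > 0" for s
  proof -
    \<comment> \<open>The value of \<open>\<beta>\<close> at the scaled point is \<open>s\<close>
      times \<open>\<sigma> * ?g (Af u)\<close>, hence nonpositive, and the integrand is at least 1
      on the scaled patch.\<close>
    define t where "t = \<sigma> * s"
    have t: "t \<noteq> 0" "\<bar>t\<bar> = s" using s \<sigma> by (auto simp: t_def)
    let ?\<psi> = "\<lambda>u. t *\<^sub>R orbit_map x (Af u)"
    define Z where "Z = ?\<psi> ` K"
    have ZQ: "Z \<subseteq> ?Q" using KU orbQ scal[OF t(1)] by (auto simp: Z_def)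
    have "compact ((\<lambda>A. t *\<^sub>R orbit_map x A) ` (Af ` K))"
    proof (rule compact_continuous_image[OF _ compK])
      show "continuous_on (Af ` K) (\<lambda>A. t *\<^sub>R orbit_map x A)"
        by (rule continuous_on_subset[of cayley_domain])
          (use KU UA in \<open>auto intro!: continuous_intros continuous_on_orbit_map\<close>)
    qed
    then have "closed Z" by (simp add: Z_def image_image compact_imp_closed)
    then have "Z \<in> sets borel" by (rule borel_closed)
    then have "Z \<in> sets (restrict_space borel ?Q)" using ZQ by (simp add: sets_restrict_space_iff image_iff sets_restrict_space) blast
    then have Zsets: "Z \<in> sets \<mu>" using \<mu> by (simp add: liouville_measure_def)
    have "ennreal (s ^ d * C * (2 * \<delta>) ^ m) = ennreal (s ^ d * C) * emeasure ?P K"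
      using s C \<delta> by (simp add: measK ennreal_mult)
    also have "\<dots> = (\<integral>\<^sup>+u. ennreal (s ^ d * C) * indicator K u \<partial>?P)"
      using setsK by (simp add: nn_integral_cmult_indicator)
    also have "\<dots> \<le> (\<integral>\<^sup>+u. ennreal \<bar>wedge_power (m div 2) (orbit_form B (?\<psi> u)) (\<lambda>i. t *\<^sub>R D i u)\<bar>
                    * indicator {u \<in> U. ?\<psi> u \<in> Z} u \<partial>?P)"
    proof (rule nn_integral_mono)
      fix u
      show "ennreal (s ^ d * C) * indicator K u \<le>
          ennreal \<bar>wedge_power (m div 2) (orbit_form B (?\<psi> u)) (\<lambda>i. t *\<^sub>R D i u)\<bar> * indicator {u \<in> U. ?\<psi> u \<in> Z} u"
      proof (cases "u \<in> K")
        case True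
        have u: "u \<in> U" using KU True by blast
        have "C \<le> \<bar>Pf (Af u)\<bar>" using \<rho>(4)[OF UA(1)[OF u]] by simp
        then have "s ^ d * C \<le> \<bar>t\<bar> ^ d * \<bar>Pf (Af u)\<bar>" using s t(2) by (simp add: mult_left_mono)
        then have "s ^ d * C \<le> \<bar>wedge_power (m div 2) (orbit_form B (?\<psi> u)) (\<lambda>i. t *\<^sub>R D i u)\<bar>"
          unfolding density[OF u] .
        then have "ennreal (s ^ d * C) \<le> ennreal \<bar>wedge_power (m div 2) (orbit_form B (?\<psi> u)) (\<lambda>i. t *\<^sub>R D i u)\<bar>"
          by (rule ennreal_leI)
        moreover have "u \<in> {u \<in> U. ?\<psi> u \<in> Z}" using True u by (auto simp: Z_def)
        ultimately show ?thesis using True by (simp only: indicator_simps(1) mult_1_right)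
      qed simp
    qed
    also have "\<dots> = emeasure \<mu> Z"
    proof -
      have "Z \<subseteq> ?\<psi> ` U" using KU by (auto simp: Z_def)
      then show ?thesis
        using \<mu> chart[OF t(1)] Zsets unfolding liouville_measure_def by simp
    qed
    also have "\<dots> = (\<integral>\<^sup>+y. indicator Z y \<partial>\<mu>)" using Zsets by simp
    also have "\<dots> \<le> partition_function \<mu> \<beta>"
      unfolding partition_function_def
    proof (rule nn_integral_mono)
      fix y
      show "indicator Z y \<le> ennreal (exp (- \<beta> y))"
      proof (cases "y \<in> Z")
        case True
        then obtain u where u: "u \<in> K" "y = t *\<^sub>R orbit_map x (Af u)" by (auto simp: Z_def)
        have "\<beta> y = s * (\<sigma> * ?g (Af u))" by (simp add: u(2) linear_scale[OF \<beta>] t_def)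
        also have "\<dots> \<le> 0" using KU(2)[OF u(1)] s by (simp add: mult_nonneg_nonpos)
        finally have "1 \<le> exp (- \<beta> y)" by simp
        then have "ennreal 1 \<le> ennreal (exp (- \<beta> y))" by (rule ennreal_leI)
        then show ?thesis using True by simp
      qed simp
    qed
    finally show ?thesis .
  qed
  obtain z where z: "z \<ge> 0" "partition_function \<mu> \<beta> = ennreal z"
    using fin by (metis ennreal_cases infinity_ennreal_def less_irrefl)
  define c where "c = C * (2 * \<delta>) ^ m"
  have c: "c > 0" using C \<delta> by (simp add: c_def)
  \<comment> \<open>Chosen so that \<open>s * c\<close> exceeds \<open>z\<close>; since
    \<open>s \<ge> 1\<close> and \<open>d \<ge> 1\<close>, the power \<open>s ^ d\<close> is no
    smaller than \<open>s\<close>.\<close>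
  define s where "s = 1 + (z + 1) / c"
  have s1: "s \<ge> 1" using c z by (simp add: s_def)
  have "s ^ d * C * (2 * \<delta>) ^ m \<le> z" using lower[of s] s1 z by (simp add: ennreal_le_iff)
  moreover have "s * c \<le> s ^ d * c" using s1 d c by (intro mult_right_mono) (auto simp: self_le_power)
  moreover have "s * c > z" using c z by (simp add: s_def distrib_right add_divide_distrib)
  ultimately show False by (simp add: c_def mult.assoc)
qed

end

section \<open>Conjugacy of the multiples of the nilpotent element\<close>

lemma parity_weight_residues:
  "parity_weight (8 * K) N = 0" "parity_weight (8 * K + 1) N = N div 2" "parity_weight (8 * K + 2) N = N"
  "parity_weight (8 * K + 3) N = 0" "parity_weight (8 * K + 4) N = N" "parity_weight (8 * K + 5) N = N div 2"
  "parity_weight (8 * K + 6) N = 0" "parity_weight (8 * K + 7) N = 0"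
proof -
  have "(8 * K + i) mod 4 = i mod 4" for i
    using mod_mult_self2[of i 4 "2 * K"] by (simp add: add.commute)
  moreover have "(8 * K + i) mod 8 = i mod 8" for i using mod_mult_self2[of i 8 K] by (simp add: add.commute)
  ultimately have r: "parity_weight (8 * K + i) N = parity_weight i N" for i by (simp only: parity_weight_def)
  have w: "parity_weight 0 N = 0" "parity_weight 1 N = N div 2" "parity_weight 2 N = N" "parity_weight 3 N = 0"
    "parity_weight 4 N = N" "parity_weight 5 N = N div 2" "parity_weight 6 N = 0" "parity_weight 7 N = 0"
    by (simp_all add: parity_weight_def)
  show "parity_weight (8 * K) N = 0" using r[of 0] w(1) by (simp only: add_0_right)
  show "parity_weight (8 * K + 1) N = N div 2" "parity_weight (8 * K + 2) N = N"
    "parity_weight (8 * K + 3) N = 0" "parity_weight (8 * K + 4) N = N" "parity_weight (8 * K + 5) N = N div 2"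
    "parity_weight (8 * K + 6) N = 0" "parity_weight (8 * K + 7) N = 0"
    by (simp_all only: r w)
qed

text \<open>A block of eight consecutive \<open>r\<close> contains one index of each of the forms 8
  k + 2 and 8 k + 4 but two of the form 4 k + 1, whence the different ranges.\<close>

lemma sum_parity_weight:
  "(\<Sum>r<8 * K. parity_weight r (n r)) = (\<Sum>k<K. n (8 * k + 4) + n (8 * k + 2)) + (\<Sum>k<2 * K. n (4 * k + 1) div 2)"
proof (induction K)
  case (Suc K)
  have "(\<Sum>r<8 * Suc K. f r) = (\<Sum>r<8 * K. f r) + f (8 * K) + f (8 * K + 1) + f (8 * K + 2) + f (8 * K + 3) +
      f (8 * K + 4) + f (8 * K + 5) + f (8 * K + 6) + f (8 * K + 7)" for f :: "nat \<Rightarrow> nat"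
    by (simp add: numeral_eq_Suc)
  then have "(\<Sum>r<8 * Suc K. parity_weight r (n r)) = (\<Sum>r<8 * K. parity_weight r (n r)) +
      n (8 * K + 1) div 2 + n (8 * K + 2) + n (8 * K + 4) + n (8 * K + 5) div 2"
    by (simp only: parity_weight_residues add_0_right)
  moreover have "(\<Sum>k<2 * Suc K. n (4 * k + 1) div 2) =
      (\<Sum>k<2 * K. n (4 * k + 1) div 2) + n (8 * K + 1) div 2 + n (8 * K + 5) div 2"
  proof -
    have "4 * (2 * K) + 1 = 8 * K + 1" "4 * Suc (2 * K) + 1 = 8 * K + 5" "2 * Suc K = Suc (Suc (2 * K))" by simp_all
    then show ?thesis by (simp only: sum.lessThan_Suc)
  qed
  ultimately show ?case using Suc.IH by (simp only: sum.lessThan_Suc)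
qed simp

lemma Sum_any_parity_weight:
  assumes "finite S" "\<And>r. r \<notin> S \<Longrightarrow> n r = 0"
  shows "Sum_any (\<lambda>k. n (8 * k + 4) + n (8 * k + 2) + n (4 * k + 1) div 2) = (\<Sum>r\<in>S. parity_weight r (n r))"
proof -
  obtain K where K: "\<And>r. r \<in> S \<Longrightarrow> r < K" using assms(1) unfolding finite_nat_set_iff_bounded by blast
  have zero: "n r = 0" if "r \<ge> K" for r
  proof (rule assms(2))
    show "r \<notin> S" using K[of r] that by linarith
  qed
  have "Sum_any (\<lambda>k. n (8 * k + 4) + n (8 * k + 2) + n (4 * k + 1) div 2) =
      (\<Sum>k<2 * K. n (8 * k + 4) + n (8 * k + 2) + n (4 * k + 1) div 2)"
  proof (rule Sum_any.expand_superset)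
    show "{k. n (8 * k + 4) + n (8 * k + 2) + n (4 * k + 1) div 2 \<noteq> 0} \<subseteq> {..<2 * K}"
    proof
      fix k assume k: "k \<in> {k. n (8 * k + 4) + n (8 * k + 2) + n (4 * k + 1) div 2 \<noteq> 0}"
      show "k \<in> {..<2 * K}"
      proof (rule ccontr)
        assume "k \<notin> {..<2 * K}"
        then have "8 * k + 4 \<ge> K" "8 * k + 2 \<ge> K" "4 * k + 1 \<ge> K" by auto
        then show False using k by (simp add: zero)
      qed
    qed
  qed simp
  also have "\<dots> = (\<Sum>k<2 * K. n (8 * k + 4) + n (8 * k + 2)) + (\<Sum>k<2 * K. n (4 * k + 1) div 2)"
    by (simp add: sum.distrib)
  also have "(\<Sum>k<2 * K. n (8 * k + 4) + n (8 * k + 2)) = (\<Sum>k<K. n (8 * k + 4) + n (8 * k + 2))"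
    by (rule sum.mono_neutral_right) (auto simp: zero)
  also have "\<dots> + (\<Sum>k<2 * K. n (4 * k + 1) div 2) = (\<Sum>r<8 * K. parity_weight r (n r))"
    by (rule sum_parity_weight[symmetric])
  also have "\<dots> = (\<Sum>r\<in>S. parity_weight r (n r))"
  proof (rule sum.mono_neutral_right)
    show "S \<subseteq> {..<8 * K}"
    proof
      fix r assume "r \<in> S"
      then show "r \<in> {..<8 * K}" using K[of r] by simp
    qed
    show "\<forall>r\<in>{..<8 * K} - S. parity_weight r (n r) = 0" using assms(2) by (simp add: parity_weight_def)
  qed simp
  finally show ?thesis .
qed

lemma has_signature_minus:
  assumes "has_signature V f p q"
  shows "has_signature V (\<lambda>u w. - f u w) q p"
proof -
  obtain P N where "finite P" "finite N" "card P = p" "card N = q" "P \<inter> N = {}"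
        "independent (P \<union> N)" "span (P \<union> N) = V"
        "pairwise (\<lambda>u v. f u v = 0) (P \<union> N)"
        "\<forall>v\<in>P. f v v > 0" "\<forall>v\<in>N. f v v < 0"
    using assms unfolding has_signature_def by auto
  then have "\<exists>P N. finite P \<and> finite N \<and> card P = q \<and> card N = p \<and> P \<inter> N = {} \<and>
        independent (P \<union> N) \<and> span (P \<union> N) = V \<and>
        pairwise (\<lambda>u v. - f u v = 0) (P \<union> N) \<and>
        (\<forall>v\<in>P. - f v v > 0) \<and> (\<forall>v\<in>N. - f v v < 0)"
    by (intro exI[of _ N] exI[of _ P]) (simp add: Un_commute Int_commute)
  then show ?thesis using assms unfolding has_signature_def bilinear_form_on_def by simp
qed

section \<open>Positive multiples of x and the dimension bound\<close>

context adapted_basis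
begin

lemma matrix_eqI_basis:
  assumes "\<And>a. a \<in> idx n \<Longrightarrow> A *v v a = C *v v a"
  shows "A = C"
  unfolding matrix_eq
proof
  fix z
  have "A *v z = (\<Sum>a\<in>idx n. coord z a *\<^sub>R (A *v v a))" by (rule mult_expand)
  also have "\<dots> = (\<Sum>a\<in>idx n. coord z a *\<^sub>R (C *v v a))" by (rule sum.cong) (simp_all add: assms)
  also have "\<dots> = C *v z" by (rule mult_expand[symmetric])
  finally show "A *v z = C *v z" .
qed

text \<open>The one-parameter group of \<open>h\<close> multiplies \<open>v (r, i, j)\<close> by the
  exponential of \<tau> times the weight r - 2 i. Paired vectors have opposite weights, so it
  consists of isometries. As \<open>x\<close> raises weights by 2, conjugation multiplies it by the
  exponential of 2 \<tau>, which is \<open>t\<close> for \<tau> = ln t / 2.\<close>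

lemma scaling_conjugation:
  assumes t: "t > 0"
  shows "\<exists>g\<in>SO_plus B. g ** x = (t *\<^sub>R x) ** g"
proof -
  define wt where "wt = (\<lambda>(r, i, j :: nat). real r - 2 * real i)"
  define E where "E a = matrix (\<lambda>z. coord z a *\<^sub>R v a)" for a
  have E: "E a *v z = coord z a *\<^sub>R v a" for a z
    unfolding E_def by (rule matrix_works, unfold linear_matrix_vector_mul_eq) (auto intro!: linearI simp: coord_add coord_scale scaleR_add_left)
  define L where "L \<tau> = (\<Sum>a\<in>idx n. exp (\<tau> * wt a) *\<^sub>R E a)" for \<tau>
  have L: "L \<tau> *v z = (\<Sum>a\<in>idx n. (exp (\<tau> * wt a) * coord z a) *\<^sub>R v a)" for \<tau> z
  proof -
    have "linear (\<lambda>A. A *v z)"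
      by (auto intro!: linearI simp: matrix_vector_mult_add_rdistrib scaleR_matrix_vector_assoc)
    then have "L \<tau> *v z = (\<Sum>a\<in>idx n. (exp (\<tau> * wt a) *\<^sub>R E a) *v z)" unfolding L_def by (rule linear_sum)
    then show ?thesis by (simp add: E flip: scaleR_matrix_vector_assoc)
  qed
  have cL: "coord (L \<tau> *v z) a = exp (\<tau> * wt a) * coord z a" if a: "a \<in> idx n" for \<tau> z a
  proof -
    have "coord (L \<tau> *v z) a = (\<Sum>b\<in>idx n. if a = b then exp (\<tau> * wt b) * coord z b else 0)"
      unfolding L coord_sum by (rule sum.cong) (auto simp: coord_v[OF a])
    then show ?thesis using a fin_idx by simp
  qed
  have iso: "B (L \<tau> *v z) (L \<tau> *v z') = B z z'" for \<tau> z z'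
    unfolding B_expand[of "L \<tau> *v z"] B_expand[of z]
  proof (intro sum.cong refl)
    fix a a' assume a: "a \<in> idx n" "a' \<in> idx n"
    obtain r i j r' i' j' where e: "a = (r, i, j)" "a' = (r', i', j')" by (cases a, cases a')
    show "coord (L \<tau> *v z) a * coord (L \<tau> *v z') a' * B (v a) (v a') = coord z a * coord z' a' * B (v a) (v a')"
    proof (cases "r = r' \<and> i + i' = r")
      case True
      then have w: "wt a' = - wt a" by (auto simp: e wt_def)
      have "coord (L \<tau> *v z) a * coord (L \<tau> *v z') a' = (exp (\<tau> * wt a) * exp (\<tau> * wt a')) * (coord z a * coord z' a')"
        using a by (simp add: cL mult_ac)
      also have "exp (\<tau> * wt a) * exp (\<tau> * wt a') = 1" by (simp add: w flip: exp_add)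
      finally show ?thesis by simp
    next
      case False
      then have "B (v a) (v a') = 0" using a by (auto simp: e idx_def B_v)
      then show ?thesis by simp
    qed
  qed
  have "L \<tau> \<in> O_group B" for \<tau>
  proof -
    have "z = 0" if "L \<tau> *v z = 0" for z
    proof (rule nondeg)
      fix w show "B z w = 0" using iso[of \<tau> z w] that bil by (simp add: bilinear_lzero)
    qed
    then have "invertible (L \<tau>)" by (simp add: invertible_left_inverse matrix_left_invertible_ker)
    then show ?thesis using iso by (simp add: O_group_def)
  qed
  moreover have "L 0 = mat 1" by (rule matrix_eqI_basis) (simp add: L expand)
  moreover define \<tau> where "\<tau> = ln t / 2"
  moreover have "continuous_on {0..1} (\<lambda>s. L (s * \<tau>))" unfolding L_def by (intro continuous_intros)
  ultimately have "L \<tau> \<in> SO_plus B"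
    using SO_plus_path[of "\<lambda>s. L (s * \<tau>)" B] mat_1_SO_plus[of B] by simp
  moreover have "L \<tau> ** x = (t *\<^sub>R x) ** L \<tau>"
  proof (rule matrix_eqI_basis)
    fix a assume a: "a \<in> idx n"
    obtain r i j where e: "a = (r, i, j)" by (cases a)
    have ij: "i \<le> r" "j < n r" using a by (auto simp: e idx_def)
    have Lv: "L \<tau> *v v b = exp (\<tau> * wt b) *\<^sub>R v b" if b: "b \<in> idx n" for b
    proof -
      have "L \<tau> *v v b = (\<Sum>a\<in>idx n. if a = b then exp (\<tau> * wt b) *\<^sub>R v b else 0)"
        unfolding L by (rule sum.cong) (auto simp: coord_v b)
      then show ?thesis using b fin_idx by simp
    qed
    have "L \<tau> *v (x *v v a) = t *\<^sub>R (x *v (L \<tau> *v v a))"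
    proof (cases i)
      case 0
      then show ?thesis using ij a x_v[of 0 r j] by (simp add: e Lv matrix_vector_mult_scaleR)
    next
      case (Suc k)
      have k: "(r, k, j) \<in> idx n" using ij Suc by (simp add: idx_def)
      have "exp (\<tau> * wt (r, k, j)) = t * exp (\<tau> * wt a)"
      proof -
        have "\<tau> * wt (r, k, j) = ln t + \<tau> * wt a" by (simp add: wt_def e Suc \<tau>_def algebra_simps)
        then show ?thesis using t by (simp add: exp_add)
      qed
      then show ?thesis
        using x_v[OF ij] k a by (simp add: e Suc Lv matrix_vector_mult_scaleR)
    qed
    then show "(L \<tau> ** x) *v v a = ((t *\<^sub>R x) ** L \<tau>) *v v a"
      by (simp add: scaleR_matrix_vector_assoc flip: matrix_vector_mul_assoc)
  qed
  ultimately show ?thesis by blast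
qed

text \<open>This keeps the factor N - 2 of the Killing form positive. If r = 1 occurs, its
  multiplicity is even, so V_1 occurs at least twice; for larger r a single copy of V_r already has
  three weights.\<close>

lemma card_gt_2:
  assumes "x \<noteq> 0"
  shows "CARD('n) > 2"
proof -
  have "\<exists>r j. r \<ge> 1 \<and> j < n r"
  proof (rule ccontr)
    assume no: "\<nexists>r j. r \<ge> 1 \<and> j < n r"
    have "x = 0"
    proof (rule matrix_eqI_basis)
      fix a assume a: "a \<in> idx n"
      obtain r i j where e: "a = (r, i, j)" by (cases a)
      then have ij: "i \<le> r" "j < n r" using a by (auto simp: idx_def)
      have "r = 0" using no ij(2) by (cases r) auto
      then have "a = (0, 0, j)" "j < n 0" using e ij by auto
      then show "x *v v a = 0 *v v a" using x_v[of 0 0 j] by simp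
    qed
    then show False using assms by simp
  qed
  then obtain r j where r: "r \<ge> 1" "j < n r" by blast
  obtain A where A: "A \<subseteq> idx n" "card A = 3"
  proof (cases "r = 1")
    case True
    then have "n 1 \<ge> 2" using n_odd[of 1] r by presburger
    then have "{(1, 0, 0), (1, 1, 0), (1, 0, 1)} \<subseteq> idx n" by (simp add: idx_def)
    then show ?thesis using that[of "{(1, 0, 0), (1, 1, 0), (1, 0, 1)}"] by simp
  next
    case False
    then have "{(r, 0, j), (r, 1, j), (r, 2, j)} \<subseteq> idx n" using r by (simp add: idx_def)
    then show ?thesis using that[of "{(r, 0, j), (r, 1, j), (r, 2, j)}"] by simp
  qed
  then show ?thesis using card_mono[OF fin_idx A(1)] by (simp add: card_idx)
qed

end

section \<open>The criterion\<close>

context adapted_basis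
begin

lemma flips_empty_iff:
  assumes "\<And>r. even r \<Longrightarrow> card {j. j < n r \<and> \<Phi> r j j > 0} = pos r"
    and "\<And>r. even r \<Longrightarrow> card {j. j < n r \<and> \<Phi> r j j < 0} = neg r"
  shows "flips False = {} \<longleftrightarrow> (\<forall>k. neg (4 * k) = 0 \<and> pos (4 * k + 2) = 0)"
    and "flips True = {} \<longleftrightarrow> (\<forall>k. pos (4 * k) = 0 \<and> neg (4 * k + 2) = 0)"
proof -
  have all_even: "(\<forall>r. even r \<longrightarrow> P r) \<longleftrightarrow> (\<forall>k. P (4 * k) \<and> P (4 * k + 2))" for P :: "nat \<Rightarrow> bool"
  proof (intro iffI allI impI)
    fix r :: nat assume *: "\<forall>k. P (4 * k) \<and> P (4 * k + 2)" and "even r"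
    then have "r = 4 * (r div 4) \<or> r = 4 * (r div 4) + 2" by presburger
    then show "P r" using * by metis
  qed auto
  have pos: "pos r = 0 \<longleftrightarrow> (\<forall>j<n r. \<not> \<Phi> r j j > 0)" and neg: "neg r = 0 \<longleftrightarrow> (\<forall>j<n r. \<not> \<Phi> r j j < 0)" if "even r" for r
    by (auto simp: card_eq_0_iff simp flip: assms(1)[OF that] assms(2)[OF that])
  have sg: "(-1 :: real) ^ (4 * k div 2) = 1" "(-1 :: real) ^ ((4 * k + 2) div 2) = -1" for k
  proof -
    have "4 * k div 2 = 2 * k" "(4 * k + 2) div 2 = Suc (2 * k)" by simp_all
    then show "(-1 :: real) ^ (4 * k div 2) = 1" "(-1 :: real) ^ ((4 * k + 2) div 2) = -1" by simp_all
  qed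
  have "flips False = {} \<longleftrightarrow> (\<forall>r. even r \<longrightarrow> (\<forall>j<n r. \<not> (-1) ^ (r div 2) * \<Phi> r j j < 0))"
    unfolding flips_def by auto
  then show "flips False = {} \<longleftrightarrow> (\<forall>k. neg (4 * k) = 0 \<and> pos (4 * k + 2) = 0)"
    unfolding all_even sg by (simp add: pos neg)
  have "flips True = {} \<longleftrightarrow> (\<forall>r. even r \<longrightarrow> (\<forall>j<n r. \<not> (-1) ^ (r div 2) * \<Phi> r j j > 0))"
    unfolding flips_def by auto
  then show "flips True = {} \<longleftrightarrow> (\<forall>k. pos (4 * k) = 0 \<and> neg (4 * k + 2) = 0)"
    unfolding all_even sg by (simp add: pos neg)
qed

text \<open>Necessity uses the compression for \<open>B\<close> if \<open>flips False\<close> is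
  empty and for its negative if \<open>flips True\<close> is empty.\<close>

lemma conjugate_iff:
  assumes sig: "has_signature UNIV B p q"
  shows "(\<exists>g\<in>SO_plus B. g ** x = - x ** g) \<longleftrightarrow>
     even (\<Sum>r\<in>supp. parity_weight r (n r)) \<or> flips False \<noteq> {} \<and> flips True \<noteq> {}"
proof
  assume "\<exists>g\<in>SO_plus B. g ** x = - x ** g"
  then obtain g where g: "g \<in> SO_plus B" "g ** x = - x ** g" by blast
  have nz: "\<Phi> r j j \<noteq> 0" if "even r" "j < n r" for r j using Phi_even[of r j j] that by simp
  have "even (\<Sum>r\<in>supp. parity_weight r (n r))" if "flips False = {}"
  proof (rule conjugate_parity[OF g, of 1])
    show "has_signature UNIV (\<lambda>u w. 1 * B u w) p q" using sig by simp
    fix r j assume *: "even r" "j < n r"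
    have "(r, j) \<notin> flips False" using that by simp
    then show "1 * (-1) ^ (r div 2) * \<Phi> r j j > 0"
      using * nz[OF *] by (auto simp: flips_def not_less le_less)
  qed simp
  moreover have "even (\<Sum>r\<in>supp. parity_weight r (n r))" if "flips True = {}"
  proof (rule conjugate_parity[OF g, of "-1"])
    show "has_signature UNIV (\<lambda>u w. -1 * B u w) q p" using has_signature_minus[OF sig] by simp
    fix r j assume *: "even r" "j < n r"
    have "(r, j) \<notin> flips True" using that by simp
    then show "-1 * (-1) ^ (r div 2) * \<Phi> r j j > 0"
      using * nz[OF *] by (auto simp: flips_def not_less le_less)
  qed simp
  ultimately show "even (\<Sum>r\<in>supp. parity_weight r (n r)) \<or> flips False \<noteq> {} \<and> flips True \<noteq> {}" by blast
next
  assume *: "even (\<Sum>r\<in>supp. parity_weight r (n r)) \<or> flips False \<noteq> {} \<and> flips True \<noteq> {}"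
  show "\<exists>g\<in>SO_plus B. g ** x = - x ** g"
  proof (rule conjugate_exists)
    fix \<sigma> assume "flips \<sigma> = {}"
    then show "even (\<Sum>r\<in>supp. parity_weight r (n r))" using * by (cases \<sigma>) auto
  qed
qed

text \<open>The absolute value of \<open>t\<close> is absorbed by the weight grading and its sign by
  the assumed conjugation; scalars commute with the conjugation that takes \<open>x\<close> to
  \<open>y\<close>.\<close>

lemma adjoint_orbit_scaling:
  assumes conj: "\<exists>g\<in>SO_plus B. g ** x = - x ** g" and t: "t \<noteq> 0" and y: "y \<in> adjoint_orbit B x"
  shows "t *\<^sub>R y \<in> adjoint_orbit B x"
proof -
  obtain k where k: "k \<in> SO_plus B" "k ** x = y ** k" using y by (auto simp: mem_adjoint_orbit_iff)
  obtain l where l: "l \<in> SO_plus B" "l ** x = (\<bar>t\<bar> *\<^sub>R x) ** l" using scaling_conjugation[of "\<bar>t\<bar>"] t by auto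
  have "\<exists>m\<in>SO_plus B. m ** x = (t *\<^sub>R x) ** m"
  proof (cases "t > 0")
    case True
    then show ?thesis using l by auto
  next
    case False
    obtain g where g: "g \<in> SO_plus B" "g ** x = - x ** g" using conj by blast
    have "(g ** l) ** x = \<bar>t\<bar> *\<^sub>R ((g ** x) ** l)"
      using l(2) by (simp add: matrix_mult_simps flip: matrix_mul_assoc)
    also have "\<dots> = (t *\<^sub>R x) ** (g ** l)" using False by (simp add: g(2) matrix_mult_simps matrix_mul_assoc)
    finally show ?thesis using SO_plus_mult[OF g(1) l(1)] by blast
  qed
  then obtain m where m: "m \<in> SO_plus B" "m ** x = (t *\<^sub>R x) ** m" by blast
  have "(k ** m) ** x = k ** ((t *\<^sub>R x) ** m)" by (simp add: m(2) flip: matrix_mul_assoc)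
  also have "\<dots> = t *\<^sub>R ((k ** x) ** m)" by (simp add: matrix_mult_simps matrix_mul_assoc)
  also have "\<dots> = (t *\<^sub>R y) ** (k ** m)" by (simp add: k(2) matrix_mult_simps matrix_mul_assoc)
  finally show ?thesis using SO_plus_mult[OF k(1) m(1)] by (auto simp: mem_adjoint_orbit_iff)
qed

end

theorem theorem4p17:
  fixes B :: "real^'n \<Rightarrow> real^'n \<Rightarrow> real"
    and p q :: nat
    and x y h :: "real^'n^'n"
    and b :: "nat \<Rightarrow> bform \<Rightarrow> bform \<Rightarrow> real"
    and W :: "nat \<Rightarrow> 'w::real_vector set"
    and \<phi> :: "nat \<Rightarrow> 'w \<Rightarrow> 'w \<Rightarrow> real"
    and n pos neg :: "nat \<Rightarrow> nat"
  assumes "p \<ge> 1" and "q \<ge> 1"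
    and "has_signature UNIV B p q"
    and "standard_triple B x y h"
    and "\<And>r. normalized_invariant_form r (b r)"
    and "multiplicity_spaces B x y h b W \<phi>"
    and "\<And>r. n r = dim (W r)"
    and "\<And>r. even r \<Longrightarrow> has_signature (W r) (\<phi> r) (pos r) (neg r)"
  shows "(adjoint_orbit B x \<noteq> adjoint_orbit B (- x) \<longleftrightarrow>
            Sum_any (\<lambda>k. n (8 * k + 4) + n (8 * k + 2) + n (4 * k + 1) div 2) mod 2 = 1 \<and>
            ((\<forall>k. neg (4 * k) = 0 \<and> pos (4 * k + 2) = 0) \<or>
             (\<forall>k. pos (4 * k) = 0 \<and> neg (4 * k + 2) = 0))) \<and>
         (adjoint_orbit B x = adjoint_orbit B (- x) \<longrightarrow>
            \<not> admits_gibbs_state B (adjoint_orbit B x))"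
proof -
  obtain v c \<Phi> where ab: "adapted_basis B x n v c \<Phi>"
    and pos: "\<And>r. even r \<Longrightarrow> card {j. j < n r \<and> \<Phi> r j j > 0} = pos r"
    and neg: "\<And>r. even r \<Longrightarrow> card {j. j < n r \<and> \<Phi> r j j < 0} = neg r"
  proof (rule adapted_basis_exists[OF assms(3,5,6,7,8)])
    fix v c \<Phi> assume "adapted_basis B x n v c \<Phi>"
      "\<And>r. even r \<Longrightarrow> card {j. j < n r \<and> \<Phi> r j j > 0} = pos r"
      "\<And>r. even r \<Longrightarrow> card {j. j < n r \<and> \<Phi> r j j < 0} = neg r"
    then show thesis by (rule that)
  qed
  interpret adapted_basis B x n v c \<Phi> by (rule ab)
  have "Sum_any (\<lambda>k. n (8 * k + 4) + n (8 * k + 2) + n (4 * k + 1) div 2) = (\<Sum>r\<in>supp. parity_weight r (n r))"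
    by (rule Sum_any_parity_weight[OF finite_supp]) (simp add: supp_def)
  then have S: "Sum_any (\<lambda>k. n (8 * k + 4) + n (8 * k + 2) + n (4 * k + 1) div 2) mod 2 = 1 \<longleftrightarrow>
      odd (\<Sum>r\<in>supp. parity_weight r (n r))"
    by (simp only: odd_iff_mod_2_eq_one)
  have F: "flips False = {} \<longleftrightarrow> (\<forall>k. neg (4 * k) = 0 \<and> pos (4 * k + 2) = 0)"
    "flips True = {} \<longleftrightarrow> (\<forall>k. pos (4 * k) = 0 \<and> neg (4 * k + 2) = 0)"
    by (rule flips_empty_iff; simp add: pos neg)+
  have "adjoint_orbit B x \<noteq> adjoint_orbit B (- x) \<longleftrightarrow>
            Sum_any (\<lambda>k. n (8 * k + 4) + n (8 * k + 2) + n (4 * k + 1) div 2) mod 2 = 1 \<and>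
            ((\<forall>k. neg (4 * k) = 0 \<and> pos (4 * k + 2) = 0) \<or>
             (\<forall>k. pos (4 * k) = 0 \<and> neg (4 * k + 2) = 0))"
    unfolding adjoint_orbit_eq_minus_iff conjugate_iff[OF assms(3)] S F
    by (simp only: de_Morgan_disj de_Morgan_conj not_not)
  moreover have "\<not> admits_gibbs_state B (adjoint_orbit B x)" if "adjoint_orbit B x = adjoint_orbit B (- x)"
  proof -
    obtain G G' where "gram_form B G G'" using gram_form_exists[OF assms(3)] by (elim exE)
    then interpret gram_form B G G' .
    have t: "x \<in> so_algebra B" "h \<in> so_algebra B" "x \<noteq> 0" "bracket h x = 2 *\<^sub>R x"
      using assms(4) by (auto simp: standard_triple_def)
    show ?thesis
    proof (rule no_gibbs_state[OF t(1) card_gt_2[OF t(3)]])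
      \<comment> \<open>The relation [h, x] = 2 x exhibits \<open>x\<close> itself, up to the factor
        2, as a nonzero tangent vector.\<close>
      have "bracket h x \<in> tangent_space B x" using t(2) by (auto simp only: tangent_space_def)
      moreover have "bracket h x \<noteq> 0" using t(3,4) by simp
      ultimately show "tangent_space B x \<noteq> {0}" by (metis singletonD)
      show "t *\<^sub>R z \<in> adjoint_orbit B x" if "t \<noteq> 0" "z \<in> adjoint_orbit B x" for t z
        using \<open>adjoint_orbit B x = adjoint_orbit B (- x)\<close>[unfolded adjoint_orbit_eq_minus_iff] that
        by (rule adjoint_orbit_scaling)
    qed
  qed
  ultimately show ?thesis by blast
qed

end
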